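(* Assume the hypotheses [Convexity], [Dynamics], [Running cost], [Terminal cost] and [Inner ball] stated in the context, that $g$ is locally semiconcave, that $V$ is (real-valued and) continuous, and that $H^0$ is $C^{1,1}$ on $\mathbb{R}^d\times(\mathbb{R}^d\setminus\{0\})$. For every $x\in\partial\mathcal S^*_1$ let $\mathbf n(x)$ be the unit proximal normal vector to $\overline{\mathcal S^c}$ at $x$. If the set $$\partial\mathcal S^{*,0}_{1}=\left\{x\in\partial\mathcal S^*_1:\max_{\omega\in U}\{\mathbf n(x)\cdot f(x,\omega)\}=0\right\}$$ is countably $\mathcal H^{d-2}$-rectifiable and $\mathbf n$ is locally Lipschitz on $\partial\mathcal S^{*,0}_1$, then $V$ is a function of special bounded variation in $\mathcal S^c$, i.e. $V\in SBV_{loc}(\mathcal S^c)$.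
   Context: Setting. $U\subset\mathbb{R}^m$ is nonempty and compact, $\mathcal S\subseteq\mathbb{R}^d$ is nonempty and closed (the target), $\mathcal S^c=\mathbb{R}^d\setminus\mathcal S$, and $f:\mathbb{R}^d\times U\to\mathbb{R}^d$, $r:\mathbb{R}^d\times U\to\mathbb{R}$, $g:\mathbb{R}^d\to\mathbb{R}$ are given. For $x\in\mathbb{R}^d$ and a measurable control $u:[0,\infty)\to U$, $y^{x,u}$ is the Carath\'eodory solution of $y'(s)=f(y(s),u(s))$, $y(0)=x$, and $\tau^{x,u}=\min\{t\ge 0:y^{x,u}(t)\in\mathcal S\}$ ($+\infty$ if $\mathcal S$ is never reached). The value function is $V(x)=\inf_u\big(\int_0^{\tau^{x,u}}r(y^{x,u}(s),u(s))\,ds+g(y^{x,u}(\tau^{x,u}))\big)$, the infimum being over measurable controls with $\tau^{x,u}<\infty$. Here $V$ is understood to be finite and continuous on $\mathbb{R}^d$ (so every point can be steered to $\mathcal S$). $H^0(x,p)=\max_{\omega\in U}\{-p\cdot f(x,\omega)\}$. $C^{1,1}$ means differentiable with locally Lipschitz gradient. Hypotheses (with constants $N,L,r_0,\rho_0>0$). [Convexity] For every $x$ the set $\{(v,\lambda)\in\mathbb{R}^d\times\mathbb{R}:\exists\omega\in U,\ v=f(x,\omega),\ \lambda\ge r(x,\omega)\}$ is convex. [Dynamics] $f$ is continuous, $|f|<N$; $D_xf$ exists everywhere and is continuous in $(x,u)$; $|f(y,\omega)-f(x,\omega)|\le L|y-x|$ and $|D_xf(y,\omega)-D_xf(x,\omega)|\le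 L|y-x|$ for all $x,y\in\mathbb{R}^d$, $\omega\in U$. [Running cost] $r$ is continuous and differentiable in $x$, $D_xr$ is continuous, $|r(y,\omega)-r(x,\omega)|+|D_xr(y,\omega)-D_xr(x,\omega)|\le L|y-x|$ for all $x,y,\omega$, and $r(x,\omega)\ge r_0$ for all $x,\omega$. [Terminal cost] There are a neighborhood $\mathcal N$ of $\partial\mathcal S$ and $0\le G<r_0/N$ with $|g(y)-g(x)|\le G|y-x|$ for $x,y\in\mathcal N$. [Inner ball] For every $x\in\partial\mathcal S$ there is a unit $\xi_x\in N^P_{\overline{\mathcal S^c}}(x)$ with $\xi_x\cdot(y-x)\le\frac1{2\rho_0}|y-x|^2$ for all $y\in\overline{\mathcal S^c}$. Notions. For a closed set $Q$ and $x\in Q$, $v\in N^P_Q(x)$ (proximal normal) iff there is $\sigma\ge0$ with $v\cdot(y-x)\le\sigma|y-x|^2$ for all $y\in Q$. $g$ is locally semiconcave if every point has a ball $B$ and $c>0$ with $(1-\lambda)g(x_0)+\lambda g(x_1)-g((1-\lambda)x_0+\lambda x_1)\le c\lambda(1-\lambda)|x_0-x_1|^2$ for $x_0,x_1\in B$, $\lambda\in[0,1]$. The reachable boundary $\partial\mathcal S^*$ is the set of $x^*\in\partial\mathcal S$ for which there are $\delta>0$ and points $x_n^*\in\partial\mathcal S$ with $x_n^*\to x^*$ such that each $x_n^*=y^{x_n,u_n}(\tau^{x_n,u_n})$ for some $x_n$ and control $u_n$ with $\delta\le\tau^{x_n,u_n}<\infty$. $\partial\mathcal S_1^*=\{x\in\partial\mathcal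 S^*:\dim N^P_{\overline{\mathcal S^c}}(x)=1\}$; at such points the normal cone is the half line $\{s\,\mathbf n(x):s\ge0\}$. A set is countably $\mathcal H^{k}$-rectifiable if, up to an $\mathcal H^k$-null set, it is contained in a countable union of Lipschitz images of subsets of $\mathbb{R}^k$. $SBV_{loc}(\Omega)$ is the set of functions in $BV_{loc}(\Omega)$ whose distributional derivative has zero Cantor part. *)

theory Defs
  imports "HOL-Analysis.Analysis"
begin

definition control :: "'b::euclidean_space set \<Rightarrow> (real \<Rightarrow> 'b) \<Rightarrow> bool" where
  "control U u \<longleftrightarrow> u \<in> borel_measurable (lebesgue_on {0..}) \<and> (\<forall>s\<ge>0. u s \<in> U)"

text \<open>Caratheodory solution on \<open>[0,\<infinity>)\<close> of \<open>y' = f(y,u)\<close>, \<open>y(0) = x\<close>, in integral form.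
  The values of \<open>y\<close> at negative times are irrelevant.\<close>

definition trajectory ::
  "('a::euclidean_space \<Rightarrow> 'b \<Rightarrow> 'a) \<Rightarrow> 'a \<Rightarrow> (real \<Rightarrow> 'b) \<Rightarrow> (real \<Rightarrow> 'a) \<Rightarrow> bool" where
  "trajectory f x u y \<longleftrightarrow>
     (\<forall>t\<ge>0. (\<lambda>s. f (y s) (u s)) absolutely_integrable_on {0..t} \<and>
            y t = x + (LINT s:{0..t}|lebesgue. f (y s) (u s)))"

text \<open>\<open>T = min {t \<ge> 0. y t \<in> S}\<close>; there is no such \<open>T\<close> iff \<open>y\<close> never reaches \<open>S\<close>
  (\<open>S\<close> closed, \<open>y\<close> continuous), which is the case of an infinite hitting time.\<close>

definition hitting_time :: "'a set \<Rightarrow> (real \<Rightarrow> 'a) \<Rightarrow> real \<Rightarrow> bool" where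
  "hitting_time S y T \<longleftrightarrow> 0 \<le> T \<and> y T \<in> S \<and> (\<forall>t. 0 \<le> t \<and> t < T \<longrightarrow> y t \<notin> S)"

definition attainable_costs ::
  "'b::euclidean_space set \<Rightarrow> ('a::euclidean_space \<Rightarrow> 'b \<Rightarrow> 'a) \<Rightarrow> ('a \<Rightarrow> 'b \<Rightarrow> real) \<Rightarrow>
   ('a \<Rightarrow> real) \<Rightarrow> 'a set \<Rightarrow> 'a \<Rightarrow> real set" where
  "attainable_costs U f r g S x =
     {(LINT s:{0..T}|lebesgue. r (y s) (u s)) + g (y T) | u y T.
        control U u \<and> trajectory f x u y \<and> hitting_time S y T}"

definition value_function ::
  "'b::euclidean_space set \<Rightarrow> ('a::euclidean_space \<Rightarrow> 'b \<Rightarrow> 'a) \<Rightarrow> ('a \<Rightarrow> 'b \<Rightarrow> real) \<Rightarrow>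
   ('a \<Rightarrow> real) \<Rightarrow> 'a set \<Rightarrow> 'a \<Rightarrow> ereal" where
  "value_function U f r g S x = (INF J\<in>attainable_costs U f r g S x. ereal J)"

definition H0 ::
  "'b set \<Rightarrow> ('a::euclidean_space \<Rightarrow> 'b \<Rightarrow> 'a) \<Rightarrow> 'a \<Rightarrow> 'a \<Rightarrow> real" where
  "H0 U f x p = (SUP \<omega>\<in>U. - (p \<bullet> f x \<omega>))"

definition reachable_boundary ::
  "'b::euclidean_space set \<Rightarrow> ('a::euclidean_space \<Rightarrow> 'b \<Rightarrow> 'a) \<Rightarrow> 'a set \<Rightarrow> 'a set" where
  "reachable_boundary U f S =
     {x \<in> frontier S. \<exists>\<delta>>0. \<exists>X. X \<longlonglongrightarrow> x \<and>
        (\<forall>k::nat. X k \<in> frontier S \<and>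
           (\<exists>x0 u y T. control U u \<and> trajectory f x0 u y \<and> hitting_time S y T \<and>
                       \<delta> \<le> T \<and> X k = y T))}"

definition proximal_normals :: "'a::euclidean_space set \<Rightarrow> 'a \<Rightarrow> 'a set" where
  "proximal_normals Q x = {v. \<exists>\<sigma>\<ge>0. \<forall>y\<in>Q. v \<bullet> (y - x) \<le> \<sigma> * (norm (y - x))\<^sup>2}"

definition reachable_boundary1 ::
  "'b::euclidean_space set \<Rightarrow> ('a::euclidean_space \<Rightarrow> 'b \<Rightarrow> 'a) \<Rightarrow> 'a set \<Rightarrow> 'a set" where
  "reachable_boundary1 U f S =
     {x \<in> reachable_boundary U f S. dim (proximal_normals (closure (- S)) x) = 1}"

definition locally_semiconcave :: "('a::euclidean_space \<Rightarrow> real) \<Rightarrow> bool" where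
  "locally_semiconcave g \<longleftrightarrow>
     (\<forall>z. \<exists>e>0. \<exists>c>0. \<forall>x0\<in>ball z e. \<forall>x1\<in>ball z e. \<forall>t\<in>{0..1}.
        (1 - t) * g x0 + t * g x1 - g ((1 - t) *\<^sub>R x0 + t *\<^sub>R x1)
          \<le> c * t * (1 - t) * (norm (x0 - x1))\<^sup>2)"

definition locally_lipschitz_on ::
  "'a::metric_space set \<Rightarrow> ('a \<Rightarrow> 'b::metric_space) \<Rightarrow> bool" where
  "locally_lipschitz_on A h \<longleftrightarrow> (\<forall>x\<in>A. \<exists>e>0. \<exists>C. C-lipschitz_on (ball x e \<inter> A) h)"

definition C11_on :: "'a::euclidean_space set \<Rightarrow> ('a \<Rightarrow> real) \<Rightarrow> bool" where
  "C11_on W h \<longleftrightarrow> (\<exists>Dh. (\<forall>z\<in>W. GDERIV h z :> Dh z) \<and> locally_lipschitz_on W Dh)"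

text \<open>Empty covering sets contribute nothing, also for \<open>k = 0\<close>; boundedness is required
  because \<open>diameter\<close> carries no information on unbounded sets.\<close>

definition hausdorff_premeasure :: "nat \<Rightarrow> real \<Rightarrow> 'a::metric_space set \<Rightarrow> ennreal" where
  "hausdorff_premeasure k \<delta> A =
     (INF C\<in>{C :: nat \<Rightarrow> 'a set. A \<subseteq> (\<Union>i. C i) \<and> (\<forall>i. bounded (C i) \<and> diameter (C i) \<le> \<delta>)}.
        \<Sum>i. if C i = {} then 0
            else ennreal (unit_ball_vol (real k) * (diameter (C i) / 2) ^ k))"

definition hausdorff_measure :: "nat \<Rightarrow> 'a::metric_space set \<Rightarrow> ennreal" where
  "hausdorff_measure k A = (SUP \<delta>\<in>{0<..}. hausdorff_premeasure k \<delta> A)"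

text \<open>A point of \<open>R\<^sup>k\<close> is represented by a sequence of which only the entries with index below
  \<open>k\<close> count: the Lipschitz condition with respect to the Euclidean distance of these
  entries forces \<open>h\<close> to ignore the others.\<close>

definition lipschitz_image_of_Rk :: "nat \<Rightarrow> 'a::metric_space set \<Rightarrow> bool" where
  "lipschitz_image_of_Rk k E \<longleftrightarrow>
     (\<exists>A :: (nat \<Rightarrow> real) set. \<exists>h C. E = h ` A \<and>
        (\<forall>a\<in>A. \<forall>b\<in>A. dist (h a) (h b) \<le> C * L2_set (\<lambda>i. a i - b i) {..<k}))"

definition countably_rectifiable :: "nat \<Rightarrow> 'a::metric_space set \<Rightarrow> bool" where
  "countably_rectifiable k A \<longleftrightarrow>
     (\<exists>E :: nat \<Rightarrow> 'a set. (\<forall>i. lipschitz_image_of_Rk k (E i)) \<and>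
        hausdorff_measure k (A - (\<Union>i. E i)) = 0)"

primrec times_cont_differentiable :: "nat \<Rightarrow> ('a::euclidean_space \<Rightarrow> real) \<Rightarrow> bool" where
  "times_cont_differentiable 0 \<phi> \<longleftrightarrow> continuous_on UNIV \<phi>"
| "times_cont_differentiable (Suc k) \<phi> \<longleftrightarrow>
     \<phi> differentiable_on UNIV \<and>
     (\<forall>b\<in>Basis. times_cont_differentiable k (\<lambda>x. frechet_derivative \<phi> (at x) b))"

definition test_function :: "'a::euclidean_space set \<Rightarrow> ('a \<Rightarrow> real) \<Rightarrow> bool" where
  "test_function \<Omega> \<phi> \<longleftrightarrow> (\<forall>k. times_cont_differentiable k \<phi>) \<and>
     compact (closure {x. \<phi> x \<noteq> 0}) \<and> closure {x. \<phi> x \<noteq> 0} \<subseteq> \<Omega>"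

definition radon_measure_on :: "'a::euclidean_space set \<Rightarrow> 'a measure \<Rightarrow> bool" where
  "radon_measure_on \<Omega> \<mu> \<longleftrightarrow> sets \<mu> = sets (restrict_space borel \<Omega>) \<and>
     (\<forall>K. compact K \<and> K \<subseteq> \<Omega> \<longrightarrow> emeasure \<mu> K < \<infinity>)"

text \<open>A vector-valued Radon measure on the open set \<open>\<Omega>\<close> is given by its polar
  decomposition \<open>\<sigma> \<mu>\<close>: \<open>\<mu>\<close> is its total variation and \<open>\<bar>\<sigma>\<bar> = 1\<close> holds
  \<open>\<mu>\<close>-almost everywhere. The predicate says that the distributional derivative \<open>Du\<close> of
  \<open>u\<close> on \<open>\<Omega>\<close> is the measure \<open>\<sigma> \<mu>\<close>, so that \<open>\<mu> = \<bar>Du\<bar>\<close>.\<close>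

definition distributional_derivative ::
  "'a::euclidean_space set \<Rightarrow> ('a \<Rightarrow> real) \<Rightarrow> 'a measure \<Rightarrow> ('a \<Rightarrow> 'a) \<Rightarrow> bool" where
  "distributional_derivative \<Omega> u \<mu> \<sigma> \<longleftrightarrow>
     radon_measure_on \<Omega> \<mu> \<and> \<sigma> \<in> borel_measurable \<mu> \<and> (AE x in \<mu>. norm (\<sigma> x) = 1) \<and>
     (\<forall>\<phi> b. test_function \<Omega> \<phi> \<and> b \<in> Basis \<longrightarrow>
        (LINT x:\<Omega>|lebesgue. u x * frechet_derivative \<phi> (at x) b)
          = - (\<integral>x. \<phi> x * (\<sigma> x \<bullet> b) \<partial>\<mu>))"

definition BV_loc :: "'a::euclidean_space set \<Rightarrow> ('a \<Rightarrow> real) set" where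
  "BV_loc \<Omega> = {u. (\<forall>K. compact K \<and> K \<subseteq> \<Omega> \<longrightarrow> u absolutely_integrable_on K) \<and>
     (\<exists>\<mu> \<sigma>. distributional_derivative \<Omega> u \<mu> \<sigma>)}"

text \<open>The complement in \<open>\<Omega>\<close> of the approximate discontinuity set \<open>S\<^sub>u\<close>.\<close>

definition approx_continuity_set :: "'a::euclidean_space set \<Rightarrow> ('a \<Rightarrow> real) \<Rightarrow> 'a set" where
  "approx_continuity_set \<Omega> u =
     {x \<in> \<Omega>. \<exists>z. ((\<lambda>\<rho>. (LINT y:ball x \<rho>|lebesgue. \<bar>u y - z\<bar>) / measure lebesgue (ball x \<rho>))
                    \<longlongrightarrow> 0) (at_right 0)}"

definition lebesgue_decomposition ::
  "'a::euclidean_space set \<Rightarrow> 'a measure \<Rightarrow> 'a measure \<Rightarrow> 'a measure \<Rightarrow> bool" where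
  "lebesgue_decomposition \<Omega> \<mu> \<mu>a \<mu>s \<longleftrightarrow>
     sets \<mu>a = sets \<mu> \<and> sets \<mu>s = sets \<mu> \<and>
     (\<forall>B\<in>sets \<mu>. emeasure \<mu> B = emeasure \<mu>a B + emeasure \<mu>s B) \<and>
     absolutely_continuous (restrict_space lborel \<Omega>) \<mu>a \<and>
     (\<exists>Z\<in>null_sets (restrict_space lborel \<Omega>). emeasure \<mu>s (\<Omega> - Z) = 0)"

text \<open>With \<open>\<mu>s = \<bar>D\<^sup>su\<bar>\<close> the singular part of \<open>\<bar>Du\<bar>\<close>, the Cantor part \<open>D\<^sup>cu\<close> is
  the restriction of \<open>D\<^sup>su\<close> to \<open>\<Omega> - S\<^sub>u\<close>. It vanishes iff \<open>\<mu>s\<close> does not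
  charge \<open>\<Omega> - S\<^sub>u\<close>. The objects \<open>\<mu>, \<mu>a, \<mu>s\<close> are uniquely determined by \<open>u\<close>.\<close>

definition SBV_loc :: "'a::euclidean_space set \<Rightarrow> ('a \<Rightarrow> real) set" where
  "SBV_loc \<Omega> = {u \<in> BV_loc \<Omega>. \<exists>\<mu> \<sigma> \<mu>a \<mu>s.
     distributional_derivative \<Omega> u \<mu> \<sigma> \<and> lebesgue_decomposition \<Omega> \<mu> \<mu>a \<mu>s \<and>
     approx_continuity_set \<Omega> u \<in> null_sets \<mu>s}"

end

theory Submission
  imports Defs
begin

text \<open>Since \<open>V\<close> is continuous, it has no jump part, and the claim is that \<open>DV\<close> is absolutely
  continuous. The inner ball condition gives, at every point, a half space (up to a quadratic error)
  in which \<open>V\<close> grows at most linearly; hence locally \<open>V\<close> is enclosed by finitely many cone-monotone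
  functions and its difference quotients are bounded in \<open>L\<^sup>1\<close>. It remains to show that
  the closed set \<open>\<Sigma>\<close> where \<open>V\<close> is not locally Lipschitz is negligible for the gauge
  \<open>r\<^sup>d\<^sup>-\<^sup>1\<close> times the modulus of continuity of \<open>V\<close>: then \<open>V\<close> minus a constant on each ball of a
  fine cover of \<open>\<Sigma>\<close> contributes nothing to the integration by parts.

  If \<open>V\<close> is not Lipschitz near \<open>x\<close>, nearly optimal trajectories from \<open>x\<close> accumulate at an end point
  \<open>z\<close> with a unit normal \<open>\<xi>\<close> such that \<open>max \<xi> \<bullet> f(z, U) = 0\<close>. A needle variation shows that they
  nearly maximize the Hamiltonian along the adjoint arc ending at \<open>\<xi>\<close>, so that by the \<open>C\<^sup>1\<^sup>,\<^sup>1\<close>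
  regularity they follow the Hamiltonian flow and \<open>x\<close> is a Lipschitz function of \<open>(z, \<xi>)\<close> and the
  arrival time. The pairs \<open>(z, \<xi>)\<close> have dimension \<open>d - 2\<close>: by assumption if the normal cone at \<open>z\<close>
  is a half line, and by hypomonotonicity of the normals otherwise, as a second normal provides an
  equation which is transversal to the normal cone.\<close>

text \<open>Optimality is only ever used up to \<open>eps\<close>; starting points, end points,
  arrival times and normals are what passes to the limit. The maximum principle and the
  transversality of the velocity are therefore won by comparison with explicit competitors, and in
  both the contradiction comes from \<open>G * N < r0\<close>: reaching the target a time s earlier
  saves at least (r0 - G N) s, up to the displacement of the trajectory.

  Why this gauge: an L^1 bound on difference quotients yields only a measure as derivative, which
  might concentrate on \<Sigma>. A bump of radius r enters the integration by parts with at most the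
  oscillation of \<open>V\<close> times 1/r times the volume r^d. So if a cover of \<Sigma> has a
  small sum of oscillation times r^(d-1), cutting it out changes little. Off \<Sigma> the quotients
  are locally bounded, and a density can be extracted from them. The exponent is d - 1 = (d - 2) +
  1: the pairs of end point and normal contribute d - 2, the arrival time contributes 1.\<close>

lemmas hk_integrable_diff = Henstock_Kurzweil_Integration.integrable_diff
lemmas hk_integral_diff = Henstock_Kurzweil_Integration.integral_diff

section \<open>Primitives of bounded functions\<close>

text \<open>The bound on the velocity makes \<open>y\<close> Lipschitz, so the product rule and
  Gronwall's inequality below stay elementary although \<open>v\<close> is merely
  integrable.\<close>

definition primitive_on :: "(real => 'a::euclidean_space) => (real => 'a) => real => bool" where
 "primitive_on y v T \<longleftrightarrow> v integrable_on {0..T} & bounded (v ` {0..T}) &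
   (\<forall>t\<in>{0..T}. y t = y 0 + integral {0..t} v)"

lemma integrable_on_bounded_measurable:
 fixes v :: "real => 'a::euclidean_space"
 assumes "v \<in> borel_measurable (lebesgue_on {a..b})" "!!s. s \<in> {a..b} ==> norm (v s) <= B"
 shows "v integrable_on {a..b}"
 by (rule measurable_bounded_by_integrable_imp_integrable[of v "{a..b}" "%_. B"]) (use assms in auto)

lemma integrable_on_compose:
 fixes v :: "real => 'a::euclidean_space" and w :: "real => 'b::euclidean_space"
  and h :: "'a => 'b => 'c::euclidean_space"
 assumes v: "v integrable_on {a..b}" "bounded (v ` {a..b})"
  and w: "w integrable_on {a..b}" "bounded (w ` {a..b})"
  and h: "continuous_on UNIV (%(x, y). h x y)"
 shows "(%s. h (v s) (w s)) integrable_on {a..b} & bounded ((%s. h (v s) (w s)) ` {a..b})"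
proof -
 let ?K = "closure (v ` {a..b}) \<times> closure (w ` {a..b})"
 have "compact ?K" using v w by (intro compact_Times) (auto simp: compact_closure)
 hence "compact ((%(x, y). h x y) ` ?K)" by (intro compact_continuous_image continuous_on_subset[OF h]) auto
 hence "bounded ((%(x, y). h x y) ` ?K)" by (rule compact_imp_bounded)
 moreover have "(%s. h (v s) (w s)) ` {a..b} \<subseteq> (%(x, y). h x y) ` ?K"
 proof (rule image_subsetI)
  fix s assume "s \<in> {a..b}"
  thus "h (v s) (w s) \<in> (%(x, y). h x y) ` ?K"
   by (intro image_eqI[of _ _ "(v s, w s)"]) (auto intro!: subsetD[OF closure_subset])
 qed
 ultimately have bd: "bounded ((%s. h (v s) (w s)) ` {a..b})" by (rule bounded_subset)
 then obtain B where B: "!!s. s \<in> {a..b} ==> norm (h (v s) (w s)) <= B" unfolding bounded_iff by blast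
 have mv: "v \<in> borel_measurable (lebesgue_on {a..b})" "w \<in> borel_measurable (lebesgue_on {a..b})"
  using v w by (auto intro: integrable_imp_measurable)
 have hm: "(%(x, y). h x y) \<in> borel_measurable borel" using h by (rule borel_measurable_continuous_onI)
 have "(%s. (v s, w s)) \<in> borel_measurable (lebesgue_on {a..b})" using mv by (rule borel_measurable_Pair)
 from measurable_compose[OF this hm]
 have "(%s. h (v s) (w s)) \<in> borel_measurable (lebesgue_on {a..b})" by simp
 thus ?thesis using bd B integrable_on_bounded_measurable by blast
qed

lemma primitive_onD:
 "primitive_on y v T ==> t \<in> {0..T} ==> y t = y 0 + integral {0..t} v" unfolding primitive_on_def by blast

lemma primitive_onI:
 assumes "v integrable_on {0..T}" "bounded (v ` {0..T})"
  "!!t. t \<in> {0..T} ==> y t = y 0 + integral {0..t} v"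
 shows "primitive_on y v T" unfolding primitive_on_def by (intro conjI ballI assms)

lemma primitive_on_diff_eq:
 assumes "primitive_on y v T" "0 <= s" "s <= t" "t <= T"
 shows "y t - y s = integral {s..t} v" "v integrable_on {s..t}"
proof -
 have i: "v integrable_on {0..T}" using assms by (auto simp: primitive_on_def)
 thus "v integrable_on {s..t}" by (rule integrable_on_subinterval) (use assms in auto)
 have "v integrable_on {0..t}" using i by (rule integrable_on_subinterval) (use assms in auto)
 hence "integral {0..s} v + integral {s..t} v = integral {0..t} v"
  by (intro Henstock_Kurzweil_Integration.integral_combine) (use assms in auto)
 moreover have "y t = y 0 + integral {0..t} v" "y s = y 0 + integral {0..s} v" using assms by (auto intro: primitive_onD)
 ultimately show "y t - y s = integral {s..t} v" by (metis add.commute add_diff_cancel_left add_diff_cancel_right')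
qed

lemma primitive_on_norm_diff_le:
 assumes "primitive_on y v T" "0 <= s" "s <= t" "t <= T"
  and "e integrable_on {s..t}" "!!r. r \<in> {s..t} ==> norm (v r) <= e r"
 shows "norm (y t - y s) <= integral {s..t} e" unfolding primitive_on_diff_eq(1)[OF assms(1-4)]
 by (rule integral_norm_bound_integral[OF primitive_on_diff_eq(2)[OF assms(1-4)] assms(5,6)])

lemma primitive_on_lipschitz:
 assumes "primitive_on y v T" "0 <= s" "s <= t" "t <= T"
  and "!!r. r \<in> {s..t} ==> norm (v r) <= B"
 shows "norm (y t - y s) <= B*(t - s)"
 using primitive_on_norm_diff_le[OF assms(1-4), of "%_. B"] assms(3,5) by (auto simp: mult.commute)

lemma primitive_on_continuous:
 assumes "primitive_on y v T" shows "continuous_on {0..T} y"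
proof -
 obtain B where B: "!!s. s \<in> {0..T} ==> norm (v s) <= B" using assms unfolding primitive_on_def bounded_iff by blast
 have "(max B 0)-lipschitz_on {0..T} y"
 proof (rule lipschitz_onI)
  fix s t assume st: "s \<in> {0..T}" "t \<in> {0..T}"
  have *: "norm (y b - y a) <= B*(b - a)" if "a <= b" "0 <= a" "b <= T" for a b
   using primitive_on_lipschitz[OF assms, of a b B] B that by auto
  have "norm (y t - y s) <= B*\<bar>t - s\<bar>"
  proof (cases "s <= t")
   case True with *[of s t] st show ?thesis by auto
  next
   case False with *[of t s] st show ?thesis by (auto simp: norm_minus_commute)
  qed
  also have "... <= max B 0*\<bar>t - s\<bar>" by (intro mult_right_mono) auto
  finally show "dist (y s) (y t) <= max B 0*dist s t" by (simp add: dist_norm norm_minus_commute abs_minus_commute)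
 qed simp
 thus ?thesis by (rule lipschitz_on_continuous_on)
qed

lemma primitive_on_diff:
 assumes "primitive_on y v T" "primitive_on z w T"
 shows "primitive_on (%s. y s - z s) (%s. v s - w s) T"
proof -
 have i: "v integrable_on {0..T}" "w integrable_on {0..T}" "bounded (v ` {0..T})" "bounded (w ` {0..T})"
  using assms by (auto simp: primitive_on_def)
 have *: "integral {0..t} (%s. v s - w s) = integral {0..t} v - integral {0..t} w" if "t \<in> {0..T}" for t
  by (rule hk_integral_diff)
   (use i that in \<open>auto intro: integrable_on_subinterval\<close>)
 have "y t - z t = y 0 - z 0 + integral {0..t} (%s. v s - w s)" if "t \<in> {0..T}" for t
  unfolding *[OF that] primitive_onD[OF assms(1) that] primitive_onD[OF assms(2) that] by simp
 note 1 = this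
 have 2: "(%s. v s - w s) integrable_on {0..T}" using i(1,2) by (rule hk_integrable_diff)
 have 3: "bounded ((%s. v s - w s) ` {0..T})" using i(3,4) by (rule bounded_minus_comp)
 show ?thesis using 2 3 1 by (rule primitive_onI)
qed

lemma primitive_on_Pair:
 assumes "primitive_on y v T" "primitive_on z w T"
 shows "primitive_on (%s. (y s, z s)) (%s. (v s, w s)) T"
proof -
 have i: "v integrable_on {0..T}" "w integrable_on {0..T}" "bounded (v ` {0..T})" "bounded (w ` {0..T})"
  using assms by (auto simp: primitive_on_def)
 have *: "((%s. (v s, w s)) has_integral (integral {0..t} v, integral {0..t} w)) {0..t}"
  if "t \<in> {0..T}" for t
 proof -
  have "(v has_integral integral {0..t} v) {0..t}" "(w has_integral integral {0..t} w) {0..t}"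
   using i that by (auto intro!: integrable_integral intro: integrable_on_subinterval)
  from has_integral_add[OF has_integral_linear[OF this(1), of "%x. (x, 0)"]
    has_integral_linear[OF this(2), of "%x. (0, x)"]]
  show ?thesis by (simp add: o_def bounded_linear_intros bounded_linear_Pair)
 qed
 have 1: "(y t, z t) = (y 0, z 0) + integral {0..t} (%s. (v s, w s))" if "t \<in> {0..T}" for t
  unfolding integral_unique[OF *[OF that]] primitive_onD[OF assms(1) that] primitive_onD[OF assms(2) that] by simp
 have 2: "(%s. (v s, w s)) integrable_on {0..T}" using *[of T] by (cases "0 <= T") (auto simp: integrable_on_def)
 have 3: "bounded ((%s. (v s, w s)) ` {0..T})" by (rule bounded_subset[OF bounded_Times[OF i(3,4)]]) auto
 show ?thesis using 2 3 1 by (rule primitive_onI)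
qed

lemma integrable_on_reflect_interval:
 fixes v :: "real => 'a::euclidean_space"
 assumes "v integrable_on {T - b..T - a}"
 shows "(%s. v (T - s)) integrable_on {a..b}"
  "integral {a..b} (%s. v (T - s)) = integral {T - b..T - a} v"
proof -
 have "((%s. v ((-1) *\<^sub>R s + T)) has_integral (1/\<bar>-1\<bar> ^ DIM(real)) *\<^sub>R integral {T - b..T - a} v)
   ((%x. (1/(-1)) *\<^sub>R x + - ((1/(-1)) *\<^sub>R T)) ` cbox (T - b) (T - a))"
  by (rule has_integral_affinity) (use assms in \<open>auto intro: integrable_integral\<close>)
 moreover have "(%x. (1/(-1)) *\<^sub>R x + - ((1/(-1)) *\<^sub>R T)) ` cbox (T - b) (T - a) = {a..b}"
 proof -
  have "x \<in> (%x. T - x) ` {T - b..T - a}" if "x \<in> {a..b}" for x using that by (intro image_eqI[of _ _ "T - x"]) auto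
  thus ?thesis by auto
 qed
 ultimately have "((%s. v (T - s)) has_integral integral {T - b..T - a} v) {a..b}" by simp
 thus "(%s. v (T - s)) integrable_on {a..b}"
  "integral {a..b} (%s. v (T - s)) = integral {T - b..T - a} v" by auto
qed

lemma primitive_on_reflect:
 assumes "primitive_on y v T" "\<tau> <= T"
 shows "primitive_on (%s. y (T - s)) (%s. - v (T - s)) \<tau>"
proof -
 have i: "v integrable_on {0..T}" "bounded (v ` {0..T})" using assms by (auto simp: primitive_on_def)
 have "v integrable_on {T - t..T - 0}" if "t \<in> {0..\<tau>}" for t
  by (rule integrable_on_subinterval[OF i(1)]) (use that assms in auto)
 note r = integrable_on_reflect_interval[OF this]
 have "(%s. v (T - s)) integrable_on {0..\<tau>}" using r(1)[of \<tau>] by (cases "0 <= \<tau>") auto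
 hence 2: "(%s. - v (T - s)) integrable_on {0..\<tau>}" by (rule integrable_neg)
 have "(%s. - v (T - s)) ` {0..\<tau>} \<subseteq> uminus ` v ` {0..T}" using assms(2) by (auto simp: image_image)
 hence 3: "bounded ((%s. - v (T - s)) ` {0..\<tau>})" using i(2) bounded_subset bounded_uminus by metis
 have 1: "y (T - t) = y (T - 0) + integral {0..t} (%s. - v (T - s))" if t: "t \<in> {0..\<tau>}" for t
 proof -
  have "y T - y (T - t) = integral {T - t..T} v" by (rule primitive_on_diff_eq(1)[OF assms(1)]) (use assms(2) t in auto)
  thus ?thesis using r(2)[OF t] by (simp add: algebra_simps)
 qed
 show ?thesis using 2 3 1 by (rule primitive_onI)
qed

text \<open>The integrating factor \<open>exp (- A * s)\<close> turns the right-hand side of the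
  assumption into \<open>?G\<close>, whose derivative is nonpositive by \<open>le\<close>.\<close>

lemma gronwall_real:
 fixes \<phi> e :: "real => real"
 assumes c: "continuous_on {0..T} \<phi>" and A: "0 <= A" and t: "t \<in> {0..T}"
  and le: "!!s. s \<in> {0..T} ==> \<phi> s <= a + A*integral {0..s} \<phi>"
 shows "\<phi> t <= a*exp (A*t)"
proof -
 let ?G = "%s. (a + A*integral {0..s} \<phi>)*exp (- A * s)"
 have d: "(?G has_real_derivative (A*\<phi> s*exp (- A * s) - (a + A*integral {0..s} \<phi>)*A*exp (- A * s)))
   (at s within {0..T})" if "s \<in> {0..T}" for s
 proof -
  have "((%s. integral {0..s} \<phi>) has_real_derivative \<phi> s) (at s within {0..T})"
   using integral_has_real_derivative[OF c that] .
  thus ?thesis by (auto intro!: derivative_eq_intros simp: algebra_simps)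
 qed
 have "?G t <= ?G 0"
 proof (cases "t = 0")
  case False
  hence t0: "0 < t" using t by auto
  have dG: "(?G has_real_derivative (A*\<phi> s*exp (- A * s) - (a + A*integral {0..s} \<phi>)*A*exp (- A * s))) (at s)"
   if "0 < s" "s < t" for s
  proof -
   have sT: "s \<in> {0..T}" "s \<in> interior {0..T}" using that t by auto
   show ?thesis using d[OF sT(1)] unfolding at_within_interior[OF sT(2)] .
  qed
  have "continuous_on {0..T} ?G" using d by (rule DERIV_continuous_on)
  hence cG: "continuous_on {0..t} ?G" by (rule continuous_on_subset) (use t in auto)
  have df: "?G differentiable (at s)" if "0 < s" "s < t" for s
   unfolding real_differentiable_def by (rule exI, rule dG[OF that])
  from MVT[OF t0 cG df]
  obtain l s where s: "0 < s" "s < t" "(?G has_real_derivative l) (at s)" "?G t - ?G 0 = (t - 0)*l" by blast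
  have "l = A*\<phi> s*exp (- A * s) - (a + A*integral {0..s} \<phi>)*A*exp (- A * s)"
   using DERIV_unique[OF s(3) dG[OF s(1,2)]] .
  moreover have "A*\<phi> s*exp (- A * s) <= A*(a + A*integral {0..s} \<phi>)*exp (- A * s)"
   using le[of s] A s t by (intro mult_right_mono mult_left_mono) auto
  ultimately have "l <= 0" by (simp add: algebra_simps)
  hence "(t - 0)*l <= 0" using t0 by (simp add: mult_nonneg_nonpos)
  thus ?thesis using s(4) by linarith
 qed simp
 hence "(a + A*integral {0..t} \<phi>)*exp (- A*t) <= a" by simp
 hence "(a + A*integral {0..t} \<phi>) <= a*exp (A*t)" by (simp add: exp_minus field_simps)
 with le[OF t] show ?thesis by linarith
qed

text \<open>Only the integral of the error \<open>e\<close> enters the bound. This matters for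
  nearly optimal arcs, whose errors are small in mean but not pointwise.\<close>

lemma primitive_on_gronwall:
 assumes p: "primitive_on y v T" and A: "0 <= A" and t: "t \<in> {0..T}"
  and e: "e integrable_on {0..T}" "!!s. s \<in> {0..T} ==> 0 <= e s"
  and v: "!!s. s \<in> {0..T} ==> norm (v s) <= A*norm (y s) + e s"
 shows "norm (y t) <= (norm (y 0) + integral {0..T} e)*exp (A*t)"
proof -
 have c: "continuous_on {0..T} (%s. norm (y s))" using primitive_on_continuous[OF p] by (rule continuous_on_norm)
 show ?thesis
 proof (rule gronwall_real[OF c A t])
  fix s assume s: "s \<in> {0..T}"
  have i: "(%r. norm (y r)) integrable_on {0..s}"
   by (rule integrable_continuous_real, rule continuous_on_subset[OF c]) (use s in auto)
  have ie: "e integrable_on {0..s}" by (rule integrable_on_subinterval[OF e(1)]) (use s in auto)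
  note i = i ie
  have "norm (y s - y 0) <= integral {0..s} (%r. A*norm (y r) + e r)"
  proof (rule primitive_on_norm_diff_le[OF p])
   show "(%r. A*norm (y r) + e r) integrable_on {0..s}" by (intro integrable_add integrable_on_mult_right i)
   show "norm (v r) <= A*norm (y r) + e r" if "r \<in> {0..s}" for r by (rule v) (use s that in auto)
  qed (use s in auto)
  also have "... = A*integral {0..s} (%r. norm (y r)) + integral {0..s} e"
   by (subst integral_add) (use i in \<open>auto intro!: integrable_on_mult_right\<close>)
  also have "integral {0..s} e <= integral {0..T} e" by (rule integral_subset_le) (use s e i in auto)
  finally show "norm (y s) <= norm (y 0) + integral {0..T} e + A*integral {0..s} (%r. norm (y r))"
   using norm_triangle_ineq2[of "y s" "y 0"] by linarith
 qed
qed

lemma primitive_on_gronwall_backward: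
 assumes p: "primitive_on y v T" and A: "0 <= A" and t: "t \<in> {0..T}"
  and e: "e integrable_on {0..T}" "!!s. s \<in> {0..T} ==> 0 <= e s"
  and v: "!!s. s \<in> {0..T} ==> norm (v s) <= A*norm (y s) + e s"
 shows "norm (y t) <= (norm (y T) + integral {0..T} e)*exp (A*(T - t))"
proof -
 have e': "e integrable_on {T - T..T - 0}" using e by simp
 note r = integrable_on_reflect_interval[OF e']
 have "norm (y (T - (T - t))) <= (norm (y (T - 0)) + integral {0..T} (%s. e (T - s)))*exp (A*(T - t))"
 proof (rule primitive_on_gronwall[OF primitive_on_reflect[OF p order.refl] A _ r(1)])
  show "T - t \<in> {0..T}" using t by auto
  show "0 <= e (T - s)" if "s \<in> {0..T}" for s by (rule e(2)) (use that in auto)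
  show "norm (- v (T - s)) <= A*norm (y (T - s)) + e (T - s)" if "s \<in> {0..T}" for s
   unfolding norm_minus_cancel by (rule v) (use that in auto)
 qed
 thus ?thesis using r(2) by simp
qed

text \<open>Increments of second order force the derivative to vanish at every point. This yields
  the product rule for primitives, whose velocities are only known under the integral.\<close>

lemma constant_if_quadratic_increments:
 fixes D :: "real => 'a::real_normed_vector"
 assumes "!!s t. 0 <= s ==> s <= t ==> t <= T ==> norm (D t - D s) <= C*(t - s)^2"
  and t: "t \<in> {0..T}"
 shows "D t = D 0"
proof -
 have sym: "norm (D t - D s) <= C*(t - s)^2" if "s \<in> {0..T}" "t \<in> {0..T}" for s t
  using assms(1)[of s t] assms(1)[of t s] that by (cases "s <= t") (auto simp: norm_minus_commute power2_commute)
 have "(D has_derivative (%h. 0)) (at s within {0..T})" if s: "s \<in> {0..T}" for s unfolding has_derivative_within_alt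
 proof (intro conjI bounded_linear_zero allI impI)
  fix e :: real assume e: "e > 0"
  show "\<exists>d>0. \<forall>y\<in>{0..T}. norm (y - s) < d --> norm (D y - D s - 0) <= e*norm (y - s)"
  proof (intro exI[of _ "e/(\<bar>C\<bar> + 1)"] conjI ballI impI)
   show "0 < e/(\<bar>C\<bar> + 1)" using e by simp
   fix y assume y: "y \<in> {0..T}" "norm (y - s) < e/(\<bar>C\<bar> + 1)"
   have "norm (D y - D s) <= C*(y - s)^2" by (rule sym[OF s y(1)])
   also have "... <= (\<bar>C\<bar> + 1)*(y - s)^2" by (intro mult_right_mono) auto
   also have "... = (\<bar>C\<bar> + 1)*\<bar>y - s\<bar>*\<bar>y - s\<bar>" by (simp add: power2_eq_square)
   also have "... <= e*\<bar>y - s\<bar>" using y(2) by (intro mult_right_mono) (auto simp: field_simps)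
   finally show "norm (D y - D s - 0) <= e*norm (y - s)" by simp
  qed
 qed
 then obtain c where "!!x. x \<in> {0..T} ==> D x = c" using has_derivative_zero_constant[of "{0..T}" D] by auto
 thus ?thesis using t by auto
qed

lemma primitive_on_inner:
 fixes y p :: "real => 'a::euclidean_space"
 assumes y: "primitive_on y v T" and p: "primitive_on p q T" and T: "0 <= T"
 shows "(%s. v s \<bullet> p s + y s \<bullet> q s) integrable_on {0..T}"
  "y T \<bullet> p T - y 0 \<bullet> p 0 = integral {0..T} (%s. v s \<bullet> p s + y s \<bullet> q s)"
proof -
 let ?w = "%s. v s \<bullet> p s + y s \<bullet> q s"
 have cy: "continuous_on {0..T} y" and cp: "continuous_on {0..T} p" using y p primitive_on_continuous by auto
 have by': "bounded (y ` {0..T})" and bp: "bounded (p ` {0..T})"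
  using cy cp compact_continuous_image compact_imp_bounded by blast+
 have iy: "y integrable_on {0..T}" "p integrable_on {0..T}" using cy cp by (auto intro: integrable_continuous_real)
 have i: "v integrable_on {0..T}" "bounded (v ` {0..T})" "q integrable_on {0..T}" "bounded (q ` {0..T})"
  using y p by (auto simp: primitive_on_def)
 have ci: "continuous_on UNIV (%(x, z). x \<bullet> (z :: 'a))" by (auto simp: case_prod_unfold intro!: continuous_intros)
 have w: "?w integrable_on {0..T}"
  using integrable_on_compose[OF i(1,2) iy(2) bp ci] integrable_on_compose[OF iy(1) by' i(3,4) ci]
  by (auto intro: integrable_add)
 thus "?w integrable_on {0..T}" .
 obtain Bv where Bv: "!!s. s \<in> {0..T} ==> norm (v s) <= Bv" using i(2) unfolding bounded_iff by blast
 obtain Bq where Bq: "!!s. s \<in> {0..T} ==> norm (q s) <= Bq" using i(4) unfolding bounded_iff by blast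
 have B0: "0 <= Bv" "0 <= Bq" using order_trans[OF norm_ge_zero Bv[of 0]] order_trans[OF norm_ge_zero Bq[of 0]] T by auto
 define D where "D t = y t \<bullet> p t - integral {0..t} ?w" for t
 have "D T = D 0"
 proof (rule constant_if_quadratic_increments[of T D "3*Bv * Bq"])
  fix s t assume st: "0 <= s" "s <= t" "t <= T"
  have wst: "?w integrable_on {s..t}" "?w integrable_on {0..t}" by (rule integrable_on_subinterval[OF w], use st in simp)+
  have Dd: "D t - D s = y t \<bullet> p t - y s \<bullet> p s - integral {s..t} ?w"
   using Henstock_Kurzweil_Integration.integral_combine[OF st(1,2) wst(2)] by (simp add: D_def)
  have ivp: "v integrable_on {s..t}" "q integrable_on {s..t}" by (rule integrable_on_subinterval[OF i(1)], use st in simp)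
     (rule integrable_on_subinterval[OF i(3)], use st in simp)
  \<comment> \<open>\<open>p\<close> is frozen at the right end and \<open>y\<close> at the left end
    of the interval: the two integrals then add up exactly to the increment of the inner product,
    and freezing costs an error quadratic in t - s.\<close>
  have hv: "((%r. v r \<bullet> p t) has_integral (y t - y s) \<bullet> p t) {s..t}"
   using has_integral_linear[OF integrable_integral[OF ivp(1)] bounded_linear_inner_left[of "p t"]]
   unfolding primitive_on_diff_eq(1)[OF y st] by (simp add: o_def)
  have hq: "((%r. y s \<bullet> q r) has_integral y s \<bullet> (p t - p s)) {s..t}"
   using has_integral_linear[OF integrable_integral[OF ivp(2)] bounded_linear_inner_right[of "y s"]]
   unfolding primitive_on_diff_eq(1)[OF p st] by (simp add: o_def)
  note ip = has_integral_integrable[OF hv] has_integral_integrable[OF hq]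
  note e1 = integral_unique[OF hv] and e2 = integral_unique[OF hq]
  have "D t - D s = integral {s..t} (%r. v r \<bullet> p t + y s \<bullet> q r) - integral {s..t} ?w"
   unfolding Dd integral_add[OF ip] e1 e2 by (simp add: algebra_simps)
  also have "... = integral {s..t} (%r. (v r \<bullet> p t + y s \<bullet> q r) - ?w r)"
   by (rule hk_integral_diff[symmetric]) (use ip wst in \<open>auto intro: integrable_add\<close>)
  finally have Dt: "D t - D s = integral {s..t} (%r. (v r \<bullet> p t + y s \<bullet> q r) - ?w r)" .
  have "norm (integral {s..t} (%r. (v r \<bullet> p t + y s \<bullet> q r) - ?w r)) <= integral {s..t} (%r. 2*Bv * Bq*(t - s))"
  proof (rule integral_norm_bound_integral)
   show "(%r. (v r \<bullet> p t + y s \<bullet> q r) - ?w r) integrable_on {s..t}"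
    using ip wst by (auto intro!: hk_integrable_diff integrable_add)
   fix r assume r: "r \<in> {s..t}"
   have "norm (p t - p r) <= Bq*(t - r)" by (rule primitive_on_lipschitz[OF p]) (use r st Bq in auto)
   also have "... <= Bq*(t - s)" using r B0 by (intro mult_left_mono) auto
   finally have 1: "norm (p t - p r) <= Bq*(t - s)" .
   have "norm (y r - y s) <= Bv * (r - s)" by (rule primitive_on_lipschitz[OF y]) (use r st Bv in auto)
   also have "... <= Bv * (t - s)" using r B0 by (intro mult_left_mono) auto
   finally have 2: "norm (y r - y s) <= Bv * (t - s)" .
   have "(v r \<bullet> p t + y s \<bullet> q r) - ?w r = v r \<bullet> (p t - p r) - (y r - y s) \<bullet> q r"
    by (simp add: algebra_simps)
   also have "norm ... <= norm (v r)*norm (p t - p r) + norm (y r - y s)*norm (q r)"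
    using Cauchy_Schwarz_ineq2[of "v r" "p t - p r"] Cauchy_Schwarz_ineq2[of "y r - y s" "q r"]
    unfolding real_norm_def by linarith
   also have "... <= Bv * (Bq*(t - s)) + (Bv * (t - s))*Bq"
    using Bv[of r] Bq[of r] r st 1 2 B0 by (intro add_mono mult_mono) auto
   finally show "norm ((v r \<bullet> p t + y s \<bullet> q r) - ?w r) <= 2*Bv * Bq*(t - s)" by (simp add: algebra_simps)
  qed auto
  also have "... = 2*Bv * Bq*(t - s)^2" using st by (simp add: power2_eq_square)
  also have "... <= 3*Bv * Bq*(t - s)^2" using B0 by (intro mult_right_mono) auto
  finally show "norm (D t - D s) <= 3*Bv * Bq*(t - s)^2" unfolding Dt .
 qed (use T in auto)
 thus "y T \<bullet> p T - y 0 \<bullet> p 0 = integral {0..T} ?w" by (simp add: D_def)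
qed

section \<open>Trajectories and costs\<close>

text \<open>Picard iteration measured with the weight exp(2 A' t): there each step contracts by 1/2,
  so one series converges on every bounded interval and no continuation of local solutions is
  needed. \<open>F\<close> is not assumed continuous in time, which is why integrability along
  continuous curves is a hypothesis.\<close>

lemma caratheodory_exists:
 fixes F :: "real => 'a::euclidean_space => 'a"
 assumes A0: "0 <= A"
  and lip: "!!s x y. 0 <= s ==> norm (F s x - F s y) <= A*norm (x - y)"
  and bnd: "!!s. 0 <= s ==> norm (F s x0) <= B"
  and int: "!!y t. continuous_on {0..t} y ==> (%s. F s (y s)) integrable_on {0..t}"
 shows "\<exists>y. y 0 = x0 & (\<forall>t. primitive_on y (%s. F s (y s)) t)"
proof -
 define Y where "Y = rec_nat (%_. x0) (%n z t. x0 + integral {0..t} (%s. F s (z s)))"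
 have Y0: "Y 0 = (%_. x0)" and YS: "Y (Suc n) t = x0 + integral {0..t} (%s. F s (Y n s))" for n t by (simp_all add: Y_def)
 have cY: "continuous_on {0..t} (Y n)" for n t
 proof (induction n)
  case (Suc n)
  show ?case unfolding YS by (intro continuous_intros indefinite_integral_continuous_1 int Suc)
 qed (simp add: Y0)
 \<comment> \<open>The maximum with 1 covers \<open>A = 0\<close>: below, \<open>2*A'\<close> is a
   divisor, and \<open>t <= exp (2*A'*t)\<close> starts the induction.\<close>
 define A' where "A' = max A 1"
 have A': "A <= A'" "1 <= A'" by (auto simp: A'_def)
 have B0: "0 <= B" using order_trans[OF norm_ge_zero bnd[of 0]] by simp
 have expint: "((%s. exp (2*A' * s)) has_integral (exp (2*A'*t) - 1)/(2*A')) {0..t}" if "0 <= t" for t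
 proof -
  have "((%s. exp (2*A' * s)) has_integral exp (2*A'*t)/(2*A') - exp (2*A'*0)/(2*A')) {0..t}"
   by (rule fundamental_theorem_of_calculus[OF that])
    (use A' in \<open>auto intro!: derivative_eq_intros simp flip: has_real_derivative_iff_has_vector_derivative\<close>)
  thus ?thesis by (simp add: diff_divide_distrib)
 qed
 have step: "norm (Y (Suc n) t - Y n t) <= B*(1/2) ^ n*exp (2*A'*t)" if "0 <= t" for n t using that
 proof (induction n arbitrary: t)
  case 0
  have "norm (Y (Suc 0) t - Y 0 t) = norm (integral {0..t} (%s. F s x0))" by (simp add: YS Y0)
  also have "... <= integral {0..t} (%s. B)" by (rule integral_norm_bound_integral) (use int[of t "%_. x0"] bnd in auto)
  also have "... = B*t" using 0 by simp
  also have "... <= B*exp (2*A'*t)"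
  proof (rule mult_left_mono[OF _ B0])
   have "t <= 1 + 2*A'*t" using A'(2) 0 by (smt (verit) mult_le_cancel_right1)
   also have "... <= exp (2*A'*t)" by (rule exp_ge_add_one_self)
   finally show "t <= exp (2*A'*t)" .
  qed
  finally show ?case by simp
 next
  case (Suc n)
  have i: "(%s. F s (Y n s)) integrable_on {0..t}" "(%s. F s (Y (Suc n) s)) integrable_on {0..t}" by (intro int cY)+
  let ?c = "A'*(B*(1/2) ^ n)"
  have "Y (Suc (Suc n)) t - Y (Suc n) t = integral {0..t} (%s. F s (Y (Suc n) s) - F s (Y n s))"
   unfolding hk_integral_diff[OF i(2,1)] YS[of "Suc n" t] YS[of n t] by simp
  also have "norm ... <= integral {0..t} (%s. ?c*exp (2*A' * s))"
  proof (rule integral_norm_bound_integral)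
   show "(%s. F s (Y (Suc n) s) - F s (Y n s)) integrable_on {0..t}" using i by (intro hk_integrable_diff)
   show "(%s. ?c*exp (2*A' * s)) integrable_on {0..t}" by (intro integrable_continuous_real continuous_intros)
   fix s assume s: "s \<in> {0..t}"
   have "norm (F s (Y (Suc n) s) - F s (Y n s)) <= A*norm (Y (Suc n) s - Y n s)" using s by (intro lip) auto
   also have "... <= A'*(B*(1/2) ^ n*exp (2*A' * s))" using A' A0 s by (intro mult_mono Suc.IH) auto
   finally show "norm (F s (Y (Suc n) s) - F s (Y n s)) <= ?c*exp (2*A' * s)" by (simp add: mult.assoc)
  qed
  also have "... = ?c*((exp (2*A'*t) - 1)/(2*A'))" using integral_unique[OF expint[OF Suc.prems]] by simp
  also have "... = B*(1/2) ^ Suc n*(exp (2*A'*t) - 1)" using A' by simp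
  also have "... <= B*(1/2) ^ Suc n*exp (2*A'*t)" using B0 by (intro mult_left_mono) auto
  finally show ?case .
 qed
 define y where "y t = x0 + (\<Sum>i. Y (Suc i) t - Y i t)" for t
 have tele: "Y n t = x0 + (\<Sum>i<n. Y (Suc i) t - Y i t)" for n t
  using sum_lessThan_telescope[of "%i. Y i t" n] by (simp add: Y0)
 have unif: "uniform_limit {0..T} Y y sequentially" for T
 proof -
  have "uniform_limit {0..T} (%n t. \<Sum>i<n. Y (Suc i) t - Y i t) (%t. \<Sum>i. Y (Suc i) t - Y i t) sequentially"
  proof (rule Weierstrass_m_test)
   fix n t assume t: "t \<in> {0..T}"
   have "norm (Y (Suc n) t - Y n t) <= B*(1/2) ^ n*exp (2*A'*t)" using t by (intro step) auto
   also have "... <= B*(1/2) ^ n*exp (2*A'*T)" using t B0 A' by (intro mult_left_mono) auto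
   finally show "norm (Y (Suc n) t - Y n t) <= B*(1/2) ^ n*exp (2*A'*T)" .
  next
   show "summable (%n. B*(1/2) ^ n*exp (2*A'*T))" by (intro summable_mult summable_mult2 summable_geometric) auto
  qed
  from uniform_limit_add[OF uniform_limit_const[where c = "%_. x0"] this]
  have "uniform_limit {0..T} (%n t. x0 + (\<Sum>i<n. Y (Suc i) t - Y i t))
    (%t. x0 + (\<Sum>i. Y (Suc i) t - Y i t)) sequentially" .
  moreover have "(%n t. x0 + (\<Sum>i<n. Y (Suc i) t - Y i t)) = Y" by (intro ext tele[symmetric])
  moreover have "(%t. x0 + (\<Sum>i. Y (Suc i) t - Y i t)) = y" by (intro ext y_def[symmetric])
  ultimately show ?thesis by (simp only:)
 qed
 have cy: "continuous_on {0..T} y" for T by (rule uniform_limit_theorem[OF _ unif]) (auto simp: cY)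
 have eq: "y t = x0 + integral {0..t} (%s. F s (y s))" if t: "0 <= t" for t
 proof -
  have "(%n. Y (Suc n) t) \<longlonglongrightarrow> x0 + integral {0..t} (%s. F s (y s))" unfolding YS
  proof (intro tendsto_intros tendstoI)
   fix e :: real assume e: "0 < e"
   define d where "d = e/(2*(A*t + 1))"
   have At: "0 <= A*t" using A0 t by simp
   have d: "0 < d" using e At by (simp add: d_def add_nonneg_pos)
   have "\<forall>\<^sub>F n in sequentially. \<forall>s\<in>{0..t}. dist (Y n s) (y s) < d"
    using unif d unfolding uniform_limit_iff by blast
   thus "\<forall>\<^sub>F n in sequentially. dist (integral {0..t} (%s. F s (Y n s))) (integral {0..t} (%s. F s (y s))) < e"
   proof eventually_elim
    case (elim n)
    have i: "(%s. F s (Y n s)) integrable_on {0..t}" "(%s. F s (y s)) integrable_on {0..t}" by (intro int cY cy)+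
    have "norm (integral {0..t} (%s. F s (Y n s) - F s (y s))) <= integral {0..t} (%s. A*d)"
    proof (rule integral_norm_bound_integral)
     fix s assume s: "s \<in> {0..t}"
     have "norm (F s (Y n s) - F s (y s)) <= A*norm (Y n s - y s)" using s by (intro lip) auto
     also have "... <= A*d" using elim s A0 by (intro mult_left_mono) (auto simp: dist_norm less_imp_le)
     finally show "norm (F s (Y n s) - F s (y s)) <= A*d" .
    qed (use i in \<open>auto intro: hk_integrable_diff\<close>)
    also have "... = (A*t)*d" using t by simp
    also have "... <= (A*t + 1)*d" using d by (intro mult_right_mono) auto
    also have "... = e/2"
    proof -
     have "A*t + 1 ~= 0" using At by linarith
     thus ?thesis unfolding d_def by (simp add: field_simps)
    qed
    also have "... < e" using e by simp
    finally show ?case by (simp add: dist_norm hk_integral_diff[OF i])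
   qed
  qed
  moreover have "(%n. Y n t) \<longlonglongrightarrow> y t" using tendsto_uniform_limitI[OF unif[of t]] t by auto
  hence "(%n. Y (Suc n) t) \<longlonglongrightarrow> y t" by (rule LIMSEQ_Suc)
  ultimately show ?thesis by (rule LIMSEQ_unique[rotated])
 qed
 have y0: "y 0 = x0" using eq[of 0] by simp
 show ?thesis
 proof (intro exI[of _ y] conjI allI y0 primitive_onI)
  fix t
  show "(%s. F s (y s)) integrable_on {0..t}" by (intro int cy)
  have "bounded (y ` {0..t})" using cy compact_continuous_image compact_imp_bounded by blast
  then obtain C where C: "!!s. s \<in> {0..t} ==> norm (y s) <= C" unfolding bounded_iff by blast
  have "norm (F s (y s)) <= B + A*(C + norm x0)" if s: "s \<in> {0..t}" for s
  proof -
   have "norm (F s (y s)) <= norm (F s x0) + norm (F s (y s) - F s x0)" by (metis norm_triangle_sub)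
   also have "... <= B + A*norm (y s - x0)" using s by (intro add_mono bnd lip) auto
   also have "... <= B + A*(C + norm x0)"
    using C[OF s] A0 norm_triangle_ineq4[of "y s" x0] by (intro add_left_mono mult_left_mono) auto
   finally show ?thesis .
  qed
  thus "bounded ((%s. F s (y s)) ` {0..t})" unfolding bounded_iff by blast
 next
  fix t s :: real assume "s \<in> {0..t}"
  thus "y s = y 0 + integral {0..s} (%s. F s (y s))" unfolding y0 by (intro eq) auto
 qed
qed

lemma control_compose_integrable:
 fixes h :: "'a::euclidean_space => 'b::euclidean_space => 'c::euclidean_space"
 assumes h: "continuous_on (UNIV \<times> U) (%(x, om). h x om)" and U: "compact U"
  and u: "control U u" and y: "continuous_on {0..t} y"
 shows "(%s. h (y s) (u s)) integrable_on {0..t}" "bounded ((%s. h (y s) (u s)) ` {0..t})"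
proof -
 have um: "u \<in> borel_measurable (lebesgue_on {0..t})"
  using u unfolding control_def by (auto intro: measurable_restrict_mono[of u lebesgue "{0..}"])
 have ym: "y \<in> borel_measurable (lebesgue_on {0..t})" using y by (auto intro: continuous_imp_measurable_on_sets_lebesgue)
 \<comment> \<open>\<open>h\<close> is continuous only on \<open>UNIV \<times> U\<close>, so the
   pair has to be measurable as a map into that subspace.\<close>
 have "(%s. (y s, u s)) \<in> measurable (lebesgue_on {0..t}) (restrict_space borel (UNIV \<times> U))"
 proof (rule measurable_restrict_space2)
  show "(%s. (y s, u s)) \<in> space (lebesgue_on {0..t}) \<rightarrow> UNIV \<times> U"
   using u unfolding control_def by (auto simp: space_restrict_space)
  show "(%s. (y s, u s)) \<in> borel_measurable (lebesgue_on {0..t})" using ym um by (rule borel_measurable_Pair)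
 qed
 from measurable_compose[OF this borel_measurable_continuous_on_restrict[OF h]]
 have m: "(%s. h (y s) (u s)) \<in> borel_measurable (lebesgue_on {0..t})" by simp
 have "compact (y ` {0..t} \<times> U)" using y U by (intro compact_Times compact_continuous_image) auto
 hence "compact ((%(x, om). h x om) ` (y ` {0..t} \<times> U))"
  by (intro compact_continuous_image continuous_on_subset[OF h]) auto
 hence "bounded ((%(x, om). h x om) ` (y ` {0..t} \<times> U))" by (rule compact_imp_bounded)
 moreover have "(%s. h (y s) (u s)) ` {0..t} \<subseteq> (%(x, om). h x om) ` (y ` {0..t} \<times> U)"
 proof (rule image_subsetI)
  fix s assume "s \<in> {0..t}"
  thus "h (y s) (u s) \<in> (%(x, om). h x om) ` (y ` {0..t} \<times> U)"
   using u unfolding control_def by (intro image_eqI[of _ _ "(y s, u s)"]) auto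
 qed
 ultimately show b: "bounded ((%s. h (y s) (u s)) ` {0..t})" by (rule bounded_subset)
 then obtain B where B: "!!s. s \<in> {0..t} ==> norm (h (y s) (u s)) <= B" unfolding bounded_iff by blast
 show "(%s. h (y s) (u s)) integrable_on {0..t}" by (rule integrable_on_bounded_measurable[OF m B])
qed

locale exit_problem =
 fixes U :: "'b::euclidean_space set" and S Nbd :: "'a::euclidean_space set"
  and f :: "'a => 'b => 'a" and Df :: "'a => 'b => 'a \<Rightarrow>\<^sub>L 'a"
  and r :: "'a => 'b => real" and g V :: "'a => real" and N L r0 \<rho>0 G :: real
 assumes U: "compact U" "U ~= {}"
  and S: "closed S" "S ~= {}"
  and constants: "N > 0" "L > 0" "r0 > 0" "\<rho>0 > 0"
  and f_continuous: "continuous_on (UNIV \<times> U) (%(x, om). f x om)"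
  and f_bound: "!!x om. om \<in> U ==> norm (f x om) <= N"
  and f_derivative: "!!x om. om \<in> U ==> ((%y. f y om) has_derivative blinfun_apply (Df x om)) (at x)"
  and Df_continuous: "continuous_on (UNIV \<times> U) (%(x, om). Df x om)"
  and f_lipschitz: "!!x y om. om \<in> U ==> norm (f y om - f x om) <= L*norm (y - x)"
  and Df_lipschitz: "!!x y om. om \<in> U ==> norm (Df y om - Df x om) <= L*norm (y - x)"
  and r_continuous: "continuous_on (UNIV \<times> U) (%(x, om). r x om)"
  and r_lipschitz: "!!x y om. om \<in> U ==> \<bar>r y om - r x om\<bar> <= L*norm (y - x)"
  and r_ge: "!!x om. om \<in> U ==> r0 <= r x om"
  and Nbd: "open Nbd" "frontier S \<subseteq> Nbd"
  and G: "0 <= G" "G*N < r0"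
  and g_lipschitz: "!!x y. x \<in> Nbd ==> y \<in> Nbd ==> \<bar>g y - g x\<bar> <= G*norm (y - x)"
  and inner_ball:
   "!!x. x \<in> frontier S ==> \<exists>\<xi>. norm \<xi> = 1 &
      (\<forall>y\<in>closure (- S). \<xi> \<bullet> (y - x) <= 1/(2*\<rho>0)*(norm (y - x))^2)"
  and V_value: "!!x. value_function U f r g S x = ereal (V x)"
begin

definition cost :: "(real => 'b) => (real => 'a) => real => real" where
 "cost u y t = integral {0..t} (%s. r (y s) (u s))"

lemma control_in: "control U u ==> 0 <= s ==> u s \<in> U" unfolding control_def by blast

lemma f_bound_control: "control U u ==> 0 <= s ==> norm (f x (u s)) <= N" by (intro f_bound control_in)

lemma trajectory_primitive:
 assumes u: "control U u" and y: "trajectory f x u y"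
 shows "y 0 = x" "primitive_on y (%s. f (y s) (u s)) T"
proof -
 have ai: "(%s. f (y s) (u s)) absolutely_integrable_on {0..t}" 
  and eq: "y t = x + integral {0..t} (%s. f (y s) (u s))" if "0 <= t" for t
  using y that unfolding trajectory_def by (auto simp: set_lebesgue_integral_eq_integral(2))
 show y0: "y 0 = x" using eq[of 0] by simp
 show "primitive_on y (%s. f (y s) (u s)) T"
 proof (rule primitive_onI)
  show "(%s. f (y s) (u s)) integrable_on {0..T}"
   using ai[of T] set_lebesgue_integral_eq_integral(1) by (cases "0 <= T") auto
  show "bounded ((%s. f (y s) (u s)) ` {0..T})" unfolding bounded_iff using f_bound_control[OF u] by (intro exI[of _ N]) auto
  show "y t = y 0 + integral {0..t} (%s. f (y s) (u s))" if "t \<in> {0..T}" for t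
   unfolding y0 by (rule eq) (use that in auto)
 qed
qed

lemma trajectory_continuous:
 "control U u ==> trajectory f x u y ==> continuous_on {0..T} y"
 using trajectory_primitive(2) primitive_on_continuous by blast

lemma trajectory_lipschitz:
 assumes "control U u" "trajectory f x u y" "0 <= s" "s <= t"
 shows "norm (y t - y s) <= N*(t - s)"
 by (rule primitive_on_lipschitz[OF trajectory_primitive(2)[OF assms(1,2)] assms(3,4) order.refl])
  (use assms in \<open>auto intro!: f_bound_control\<close>)

lemma trajectory_exists:
 assumes u: "control U u" shows "\<exists>y. trajectory f x u y"
proof -
 have "\<exists>y. y 0 = x & (\<forall>t. primitive_on y (%s. f (y s) (u s)) t)"
 proof (rule caratheodory_exists[where A = L and B = N])
  show "(%s. f (y s) (u s)) integrable_on {0..t}" if "continuous_on {0..t} y" for y t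
   by (rule control_compose_integrable[OF f_continuous U(1) u that])
 qed (use constants f_lipschitz f_bound control_in[OF u] in auto)
 then obtain y where y: "y 0 = x" "!!t. primitive_on y (%s. f (y s) (u s)) t" by blast
 have "(%s. f (y s) (u s)) absolutely_integrable_on {0..t} &
   y t = x + (LINT s:{0..t}|lebesgue. f (y s) (u s))" if t: "0 <= t" for t
 proof -
  have i: "(%s. f (y s) (u s)) integrable_on {0..t}" using y(2)[of t] unfolding primitive_on_def by blast
  have ai: "(%s. f (y s) (u s)) absolutely_integrable_on {0..t}"
   by (rule absolutely_integrable_integrable_bound[OF _ i, of "%_. N"])
    (use f_bound control_in[OF u] in auto)
  have "y t = y 0 + integral {0..t} (%s. f (y s) (u s))" by (rule primitive_onD[OF y(2)[of t]]) (use t in auto)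
  thus ?thesis using ai set_lebesgue_integral_eq_integral(2)[OF ai] y(1) by simp
 qed
 thus ?thesis unfolding trajectory_def by blast
qed

lemma cost_integrable:
 assumes "control U u" "trajectory f x u y" "0 <= a"
 shows "(%s. r (y s) (u s)) integrable_on {a..b}"
 by (rule integrable_on_subinterval[OF control_compose_integrable(1)[OF r_continuous U(1) assms(1)
    trajectory_continuous[OF assms(1,2), of b]]]) (use assms in auto)

lemma cost_eq:
 assumes u: "control U u" "trajectory f x u y"
 shows "(LINT s:{0..T}|lebesgue. r (y s) (u s)) = cost u y T"
proof -
 have "(%s. r (y s) (u s)) absolutely_integrable_on {0..T}"
 proof (rule nonnegative_absolutely_integrable_1[OF cost_integrable[OF u order.refl]])
  fix s assume "s \<in> {0..T}"
  hence "r0 <= r (y s) (u s)" by (intro r_ge control_in[OF u(1)]) auto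
  thus "0 <= r (y s) (u s)" using constants by simp
 qed
 thus ?thesis unfolding cost_def by (rule set_lebesgue_integral_eq_integral(2))
qed

lemma cost_split:
 assumes "control U u" "trajectory f x u y" "0 <= s" "s <= t"
 shows "cost u y t = cost u y s + integral {s..t} (%s. r (y s) (u s))" unfolding cost_def
 by (rule Henstock_Kurzweil_Integration.integral_combine[symmetric, OF assms(3,4) cost_integrable[OF assms(1,2) order.refl]])

lemma cost_diff_ge:
 assumes "control U u" "trajectory f x u y" "0 <= s" "s <= t"
 shows "cost u y s + r0*(t - s) <= cost u y t"
proof -
 have "integral {s..t} (%_. r0) <= integral {s..t} (%s. r (y s) (u s))"
  by (rule integral_le[OF _ cost_integrable[OF assms(1-3)]])
   (use assms in \<open>auto intro!: r_ge control_in[OF assms(1)]\<close>)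
 thus ?thesis using cost_split[OF assms] assms(4) by (simp add: mult.commute)
qed

lemma V_le_attained:
 assumes "control U u" "trajectory f x u y" "hitting_time S y T"
 shows "V x <= cost u y T + g (y T)"
proof -
 have "cost u y T + g (y T) \<in> attainable_costs U f r g S x" unfolding attainable_costs_def mem_Collect_eq
  by (intro exI[of _ u] exI[of _ y] exI[of _ T]) (simp add: assms cost_eq[OF assms(1,2)])
 hence "value_function U f r g S x <= ereal (cost u y T + g (y T))" unfolding value_function_def by (rule INF_lower)
 thus ?thesis by (simp add: V_value)
qed

lemma near_optimal:
 assumes "0 < eps"
 shows "\<exists>u y T. control U u & trajectory f x u y & hitting_time S y T & cost u y T + g (y T) < V x + eps"
proof -
 have "value_function U f r g S x < ereal (V x + eps)" using assms by (simp add: V_value)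
 then obtain J where J: "J \<in> attainable_costs U f r g S x" "J < V x + eps"
  unfolding value_function_def INF_less_iff by auto
 then obtain u y T where "control U u" "trajectory f x u y" "hitting_time S y T"
  "J = (LINT s:{0..T}|lebesgue. r (y s) (u s)) + g (y T)" unfolding attainable_costs_def by auto
 with J(2) cost_eq show ?thesis by metis
qed

lemma hitting_exists:
 assumes u: "control U u" "trajectory f x u y" and t: "0 <= t" "y t \<in> S"
 shows "\<exists>T\<le>t. hitting_time S y T"
proof -
 let ?K = "{s \<in> {0..t}. y s \<in> S}"
 have "closed ?K" using continuous_closed_preimage[OF trajectory_continuous[OF u, of t] _ S(1)]
  by (simp add: vimage_def Int_def)
 moreover have "{0..t} \<inter> ?K = ?K" by auto
 ultimately have "compact ?K" using compact_Int_closed[OF compact_Icc[of 0 t], of ?K] by simp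
 moreover have "?K ~= {}" using t by auto
 ultimately obtain T where T: "T \<in> ?K" "!!s. s \<in> ?K ==> T <= s" using compact_attains_inf[of ?K] by auto
 have "y s \<notin> S" if "0 <= s" "s < T" for s
 proof
  assume "y s \<in> S"
  hence "s \<in> ?K" using that T(1) by auto
  from T(2)[OF this] that show False by simp
 qed
 hence "hitting_time S y T" unfolding hitting_time_def using T(1) by auto
 with T show ?thesis by auto
qed

lemma hitting_frontier:
 assumes u: "control U u" "trajectory f x u y" and T: "hitting_time S y T" and x: "x \<notin> S"
 shows "0 < T" "y T \<in> frontier S"
proof -
 have T': "0 <= T" "y T \<in> S" "!!t. 0 <= t ==> t < T ==> y t \<notin> S" using T unfolding hitting_time_def by auto
 show T0: "0 < T" using T' x trajectory_primitive(1)[OF u] by (cases "T = 0") auto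
 have "y T \<in> closure (- S)" unfolding closure_approachable
 proof (intro allI impI)
  fix e :: real assume e: "0 < e"
  define t where "t = max 0 (T - e/(2*N))"
  have t: "0 <= t" "t < T" "T - t <= e/(2*N)" using T0 e constants by (auto simp: t_def)
  have "norm (y T - y t) <= N*(T - t)" by (rule trajectory_lipschitz[OF u]) (use t in auto)
  also have "... <= N*(e/(2*N))" using t constants by (intro mult_left_mono) auto
  also have "... < e" using e constants by simp
  finally show "\<exists>z\<in>- S. dist z (y T) < e"
   using T'(3)[OF t(1,2)] by (intro bexI[of _ "y t"]) (auto simp: dist_norm norm_minus_commute)
 qed
 thus "y T \<in> frontier S" using T'(2) S(1) by (auto simp: frontier_closures)
qed

text \<open>Passing through the target and stopping later never pays, because \<open>G N < r\<^sub>0\<close>.\<close>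

lemma V_le_arrival:
 assumes u: "control U u" "trajectory f x u y" and t: "0 <= t" "y t \<in> S" "y t \<in> Nbd" and x: "x \<notin> S"
 shows "V x <= cost u y t + g (y t)"
proof -
 obtain T where T: "T <= t" "hitting_time S y T" using hitting_exists[OF u t(1,2)] by blast
 have T0: "0 < T" and fr: "y T \<in> frontier S" using hitting_frontier[OF u T(2) x] by auto
 have "\<bar>g (y t) - g (y T)\<bar> <= G*norm (y t - y T)" using t(3) fr Nbd by (intro g_lipschitz) auto
 also have "... <= G*(N*(t - T))" using T T0 G by (intro mult_left_mono trajectory_lipschitz[OF u]) auto
 also have "... <= r0*(t - T)" using T G by (simp add: mult_right_mono flip: mult.assoc)
 finally have "g (y T) <= g (y t) + r0*(t - T)" by linarith
 moreover have "cost u y T + r0*(t - T) <= cost u y t" using cost_diff_ge[OF u, of T t] T T0 by auto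
 ultimately show ?thesis using V_le_attained[OF u T(2)] by linarith
qed

end

section \<open>Adjoint arcs and variations of trajectories\<close>

definition adj :: "('a::euclidean_space \<Rightarrow>\<^sub>L 'a) => 'a => 'a" where
 "adj D p = (\<Sum>b\<in>Basis. (p \<bullet> blinfun_apply D b) *\<^sub>R b)"

lemma adj_inner: "adj D p \<bullet> v = p \<bullet> blinfun_apply D v"
proof -
 have "p \<bullet> blinfun_apply D v = p \<bullet> blinfun_apply D (\<Sum>b\<in>Basis. (v \<bullet> b) *\<^sub>R b)"
  by (simp add: euclidean_representation)
 also have "... = (\<Sum>b\<in>Basis. (v \<bullet> b)*(p \<bullet> blinfun_apply D b))"
  by (simp add: blinfun.sum_right blinfun.scaleR_right inner_sum_right)
 also have "... = adj D p \<bullet> v"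
  unfolding adj_def inner_sum_left inner_scaleR_left by (simp add: inner_commute mult.commute)
 finally show ?thesis by simp
qed

lemma norm_adj_le: "norm (adj D p) <= norm D*norm p"
proof -
 have "norm (adj D p) ^ 2 = p \<bullet> blinfun_apply D (adj D p)" by (simp add: power2_norm_eq_inner adj_inner)
 also have "... <= norm p*norm (blinfun_apply D (adj D p))" using Cauchy_Schwarz_ineq2 abs_le_D1 by blast
 also have "... <= norm p*(norm D*norm (adj D p))" by (intro mult_left_mono norm_blinfun) auto
 finally have "norm (adj D p)*norm (adj D p) <= (norm D*norm p)*norm (adj D p)" by (simp add: power2_eq_square algebra_simps)
 thus ?thesis by (cases "adj D p = 0") auto
qed

lemma adj_diff_right: "adj D (p - q) = adj D p - adj D q"
 unfolding adj_def by (simp add: inner_diff_left algebra_simps sum_subtractf)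

lemma adj_diff_left: "adj (D - E) p = adj D p - adj E p"
 unfolding adj_def by (simp add: blinfun.diff_left inner_diff_right algebra_simps sum_subtractf)

lemma primitive_on_cong:
 assumes "primitive_on y v T" "!!s. s \<in> {0..T} ==> v s = w s"
 shows "primitive_on y w T"
proof (rule primitive_onI)
 have i: "v integrable_on {0..T}" "bounded (v ` {0..T})" using assms(1) unfolding primitive_on_def by auto
 show "w integrable_on {0..T}" using i(1) assms(2) integrable_cong by blast
 have "w ` {0..T} = v ` {0..T}" using assms(2) by (intro image_cong) auto
 thus "bounded (w ` {0..T})" using i(2) by simp
 show "y t = y 0 + integral {0..t} w" if t: "t \<in> {0..T}" for t
 proof -
  have "integral {0..t} v = integral {0..t} w" by (rule Henstock_Kurzweil_Integration.integral_cong) (use t assms(2) in auto)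
  thus ?thesis using primitive_onD[OF assms(1) t] by simp
 qed
qed

lemma has_derivative_norm_le_lipschitz:
 fixes h :: "'a::real_normed_vector => 'c::real_normed_vector"
 assumes d: "(h has_derivative D) (at x)" and l: "!!y. norm (h y - h x) <= K*norm (y - x)"
 shows "norm (D v) <= K*norm v"
proof (cases "v = 0")
 case True
 thus ?thesis using linear_0[OF has_derivative_linear[OF d]] by simp
next
 case v: False
 show ?thesis
 proof (rule field_le_epsilon)
  fix e :: real assume e: "0 < e"
  hence "0 < e/norm v" using v by simp
  then obtain dlt where dlt: "0 < dlt"
   "!!y. norm (y - x) < dlt ==> norm (h y - h x - D (y - x)) <= e/norm v * norm (y - x)"
   using d unfolding has_derivative_at_alt by blast
  define t where "t = dlt/(2*norm v)"
  have t: "0 < t" "norm (t *\<^sub>R v) < dlt" using dlt(1) v by (auto simp: t_def)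
  have "norm (D (t *\<^sub>R v)) <= norm (h (x + t *\<^sub>R v) - h x) + norm (h (x + t *\<^sub>R v) - h x - D (t *\<^sub>R v))"
   by (metis norm_minus_commute norm_triangle_sub)
  also have "... <= K*norm (t *\<^sub>R v) + e/norm v * norm (t *\<^sub>R v)"
   using l[of "x + t *\<^sub>R v"] dlt(2)[of "x + t *\<^sub>R v"] t by (intro add_mono) auto
  also have "... = t*(K*norm v + e)" using t v by (simp add: field_simps)
  finally have "t*norm (D v) <= t*(K*norm v + e)" using t linear_scale[OF has_derivative_linear[OF d], of t v] by simp
  thus "norm (D v) <= K*norm v + e" using t by simp
 qed
qed

lemma integral_if_interval:
 fixes v :: "real => 'c::banach"
 assumes "0 <= a" "b <= T" "v integrable_on {a..b}"
 shows "(%s. if s \<in> {a..b} then v s else 0) integrable_on {0..T}"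
  "integral {0..T} (%s. if s \<in> {a..b} then v s else 0) = integral {a..b} v"
proof -
 have e: "{a..b} \<inter> {0..T} = {a..b}" using assms by auto
 show "(%s. if s \<in> {a..b} then v s else 0) integrable_on {0..T}" unfolding integrable_restrict_Int e by (rule assms(3))
 show "integral {0..T} (%s. if s \<in> {a..b} then v s else 0) = integral {a..b} v" unfolding integral_restrict_Int e ..
qed

context exit_problem
begin

lemma Df_norm: assumes "om \<in> U" shows "norm (Df x om) <= L" by (rule norm_blinfun_bound)
  (use constants has_derivative_norm_le_lipschitz[OF f_derivative f_lipschitz] assms in auto)

lemma f_taylor:
 assumes w: "om \<in> U"
 shows "norm (f y om - f x om - blinfun_apply (Df x om) (y - x)) <= L*(norm (y - x))^2"
proof -
 have "norm (f y om - f x om - blinfun_apply (Df x om) (y - x)) <= norm (y - x)*(L*norm (y - x))"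
 proof (rule differentiable_bound_linearization[where S = "closed_segment x y" and f' = "%z. blinfun_apply (Df z om)"])
  show "x + t *\<^sub>R (y - x) \<in> closed_segment x y" if "t \<in> {0..1}" for t
   using that unfolding closed_segment_def by (auto intro!: exI[of _ t] simp: algebra_simps)
  show "((%y. f y om) has_derivative blinfun_apply (Df z om)) (at z within closed_segment x y)" for z
   using f_derivative[OF w] by (rule has_derivative_at_withinI)
  fix z assume z: "z \<in> closed_segment x y"
  have "blinfun_apply (Df z om) - blinfun_apply (Df x om) = blinfun_apply (Df z om - Df x om)"
   by (auto simp: fun_eq_iff blinfun.diff_left)
  hence "onorm (blinfun_apply (Df z om) - blinfun_apply (Df x om)) = norm (Df z om - Df x om)"
   by (simp add: norm_blinfun.rep_eq)
  also have "... <= L*norm (z - x)" by (rule Df_lipschitz[OF w])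
  also have "... <= L*norm (y - x)" using segment_bound(1)[OF z] constants by (intro mult_left_mono) auto
  finally show "onorm (blinfun_apply (Df z om) - blinfun_apply (Df x om)) <= L*norm (y - x)" .
 qed simp
 thus ?thesis by (simp add: power2_eq_square algebra_simps)
qed

lemma adj_integrable:
 assumes u: "control U u" and y: "continuous_on {0..T} y" and p: "continuous_on {0..T} p"
 shows "(%s. adj (Df (y s) (u s)) (p s)) integrable_on {0..T}"
proof -
 let ?h = "%x om. adj (Df (fst x) om) (snd x)"
 have "continuous_on ((UNIV :: ('a \<times> 'a) set) \<times> U) (%z. Df (fst (fst z)) (snd z))"
 proof -
  have "continuous_on ((UNIV :: ('a \<times> 'a) set) \<times> U) (%z. (fst (fst z), snd z))" by (intro continuous_intros)
  moreover have "(%z. (fst (fst z), snd z)) ` ((UNIV :: ('a \<times> 'a) set) \<times> U) \<subseteq> UNIV \<times> U" by auto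
  ultimately show ?thesis using continuous_on_compose2[OF Df_continuous] by fastforce
 qed
 hence "continuous_on ((UNIV :: ('a \<times> 'a) set) \<times> U) (%(x, om). ?h x om)"
  unfolding adj_def case_prod_unfold by (intro continuous_intros) auto
 from control_compose_integrable(1)[OF this U(1) u continuous_on_Pair[OF y p]]
 show ?thesis by simp
qed

text \<open>The terminal value problem is solved forward in the reversed time, with the field set to
  zero beyond \<open>T\<close> so that the existence theorem on the half line applies. The lower
  bound on \<open>p\<close> keeps the costate away from 0, where no smoothness of the Hamiltonian is
  assumed.\<close>

lemma adjoint_exists:
 assumes u: "control U u" "trajectory f x u y" and T: "0 <= T"
 obtains p where "p T = \<xi>" "primitive_on p (%s. - adj (Df (y s) (u s)) (p s)) T"
  "!!s. s \<in> {0..T} ==> norm (p s) <= norm \<xi>*exp (L*T)"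
  "!!s. s \<in> {0..T} ==> norm \<xi> <= norm (p s)*exp (L*T)"
proof -
 define F where "F s q = (if s \<in> {..T} then adj (Df (y (T - s)) (u (T - s))) q else 0)" for s q
 have adjle: "norm (adj (Df (y s) (u s)) q) <= L*norm q" if "0 <= s" for s q
  using norm_adj_le[of "Df (y s) (u s)" q] mult_right_mono[OF Df_norm[OF control_in[OF u(1) that], of "y s"] norm_ge_zero[of q]]
  by linarith
 have "\<exists>q. q 0 = \<xi> & (\<forall>t. primitive_on q (%s. F s (q s)) t)"
 proof (rule caratheodory_exists[where A = L and B = "L*norm \<xi>"])
  show "norm (F s q - F s q') <= L*norm (q - q')" if "0 <= s" for s q q'
   using adjle[of "T - s" "q - q'"] constants unfolding F_def by (auto simp: adj_diff_right)
  show "norm (F s \<xi>) <= L*norm \<xi>" if "0 <= s" for s using adjle[of "T - s" \<xi>] constants unfolding F_def by auto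
  fix z :: "real => 'a" and t assume z: "continuous_on {0..t} z"
  show "(%s. F s (z s)) integrable_on {0..t}"
  proof (cases "0 <= t")
   case t: True
   \<comment> \<open>\<open>z\<close> is known to be continuous only on \<open>{0..t}\<close>.
     Clamping the argument gives a function that is continuous on all of \<open>{0..T}\<close> and
     agrees with the reflected \<open>z\<close> where the two intervals overlap.\<close>
   let ?w = "%s. z (min t (max 0 (T - s)))"
   have "continuous_on {0..T} ?w"
    by (rule continuous_on_compose2[OF z]) (use t in \<open>auto intro!: continuous_intros\<close>)
   hence "(%s. adj (Df (y s) (u s)) (?w s)) integrable_on {T - T..T - 0}"
    using adj_integrable[OF u(1) trajectory_continuous[OF u]] by simp
   from integrable_on_reflect_interval(1)[OF this]
   have "(%s. adj (Df (y (T - s)) (u (T - s))) (?w (T - s))) integrable_on {0..min T t}"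
    by (rule integrable_on_subinterval) auto
   hence "(%s. adj (Df (y (T - s)) (u (T - s))) (z s)) integrable_on {0..min T t}" by (rule integrable_eq) auto
   moreover have "{..T} \<inter> {0..t} = {0..min T t}" by auto
   ultimately show ?thesis unfolding F_def integrable_restrict_Int by (simp only:)
  qed (simp add: integrable_on_empty)
 qed (use constants in auto)
 then obtain q where q: "q 0 = \<xi>" "!!t. primitive_on q (%s. F s (q s)) t" by blast
 define p where "p s = q (T - s)" for s
 have "primitive_on p (%s. - F (T - s) (q (T - s))) T" unfolding p_def using primitive_on_reflect[OF q(2)[of T] order.refl] .
 hence pr: "primitive_on p (%s. - adj (Df (y s) (u s)) (p s)) T" by (rule primitive_on_cong) (auto simp: F_def p_def)
 have pT: "p T = \<xi>" by (simp add: p_def q(1))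
 have b: "norm (- adj (Df (y s) (u s)) (p s)) <= L*norm (p s) + 0" if "s \<in> {0..T}" for s
  using adjle[of s "p s"] that by simp
 have e1: "exp (L*(T - s)) <= exp (L*T)" if "s \<in> {0..T}" for s using that constants by simp
 have up: "norm (p s) <= norm \<xi>*exp (L*T)" if s: "s \<in> {0..T}" for s
 proof -
  have "norm (p s) <= (norm (p T) + integral {0..T} (%_. 0))*exp (L*(T - s))"
   by (rule primitive_on_gronwall_backward[OF pr _ s]) (use constants b in auto)
  also have "... <= norm \<xi>*exp (L*T)" using e1[OF s] by (simp add: pT mult_left_mono)
  finally show ?thesis .
 qed
 have lo: "norm \<xi> <= norm (p s)*exp (L*T)" if s: "s \<in> {0..T}" for s
 proof -
  \<comment> \<open>The reflected arc has the value \<xi> at time 0 and \<open>p s\<close> at time T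
    - s, so the backward estimate for it bounds \<xi> by \<open>p s\<close>.\<close>
  let ?p = "%r. p (T - r)"
  have pr': "primitive_on ?p (%r. - (- adj (Df (y (T - r)) (u (T - r))) (p (T - r)))) (T - s)"
   by (rule primitive_on_reflect[OF pr]) (use s in auto)
  have "norm (?p 0) <= (norm (?p (T - s)) + integral {0..T - s} (%_. 0))*exp (L*((T - s) - 0))"
   by (rule primitive_on_gronwall_backward[OF pr']) (use constants s b in auto)
  hence "norm \<xi> <= norm (p s)*exp (L*(T - s))" by (simp add: pT)
  also have "... <= norm (p s)*exp (L*T)" using e1[OF s] by (intro mult_left_mono) auto
  finally show ?thesis .
 qed
 from that[OF pT pr up lo] show ?thesis .
qed

text \<open>On \<open>{a..b}\<close> the velocities differ by at most 2 N, whatever the controls;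
  elsewhere the controls agree and the Lipschitz bound feeds Gronwall.\<close>

lemma trajectory_compare:
 assumes u: "control U u" "trajectory f x u y" and u': "control U u'" "trajectory f x' u' y'"
  and ab: "0 <= a" "a <= b" "b <= T" and same: "!!s. s \<in> {0..T} ==> s \<notin> {a..b} ==> u' s = u s"
  and t: "t \<in> {0..T}"
 shows "norm (y' t - y t) <= (norm (x' - x) + 2*N*(b - a))*exp (L*T)"
proof -
 let ?e = "%s. if s \<in> {a..b} then 2*N else 0"
 have e: "?e integrable_on {0..T}" "integral {0..T} ?e = 2*N*(b - a)"
  using integral_if_interval[OF ab(1,3) integrable_const_ivl, of "2*N"] ab by (simp_all add: algebra_simps)
 have pd: "primitive_on (%s. y' s - y s) (%s. f (y' s) (u' s) - f (y s) (u s)) T"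
  by (rule primitive_on_diff[OF trajectory_primitive(2)[OF u'] trajectory_primitive(2)[OF u]])
 have "norm (y' t - y t) <= (norm (y' 0 - y 0) + integral {0..T} ?e)*exp (L*t)"
 proof (rule primitive_on_gronwall[OF pd _ t e(1)])
  fix s assume s: "s \<in> {0..T}"
  show "norm (f (y' s) (u' s) - f (y s) (u s)) <= L*norm (y' s - y s) + ?e s"
  proof (cases "s \<in> {a..b}")
   case True
   have "norm (f (y' s) (u' s) - f (y s) (u s)) <= N + N"
    using f_bound_control[OF u(1), of s "y s"] f_bound_control[OF u'(1), of s "y' s"] s
     norm_triangle_ineq4[of "f (y' s) (u' s)" "f (y s) (u s)"] by auto
   thus ?thesis using True constants by (simp add: add_increasing)
  next
   case False
   thus ?thesis using same[OF s] f_lipschitz[OF control_in[OF u(1)], of s "y' s" "y s"] s by auto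
  qed
 qed (use constants in auto)
 also have "... <= (norm (x' - x) + 2*N*(b - a))*exp (L*T)"
  unfolding e(2) trajectory_primitive(1)[OF u] trajectory_primitive(1)[OF u']
  using t constants ab by (intro mult_left_mono) auto
 finally show ?thesis .
qed

text \<open>The increment of p . (y' - y) is computed by the product rule. Off the needle the
  adjoint equation cancels the linear part and leaves the Taylor remainder P L D^2. On the needle
  the gain is evaluated along the old trajectory, and the two discrepancies caused by this are at
  most P L D each.\<close>

lemma variation:
 assumes u: "control U u" "trajectory f x u y" and u': "control U u'" "trajectory f x' u' y'"
  and ab: "0 <= a" "a <= b" "b <= T" and same: "!!s. s \<in> {0..T} ==> s \<notin> {a..b} ==> u' s = u s"
  and p: "primitive_on p (%s. - adj (Df (y s) (u s)) (p s)) T" "!!s. s \<in> {0..T} ==> norm (p s) <= P"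
  and D: "!!s. s \<in> {0..T} ==> norm (y' s - y s) <= D"
 shows "p 0 \<bullet> (x' - x) + integral {a..b} (%s. p s \<bullet> (f (y s) (u' s) - f (y s) (u s)))
   - P*L*D^2*T - 2*P*L*D*(b - a) <= p T \<bullet> (y' T - y T)"
proof -
 have T0: "0 <= T" using ab by simp
 define \<phi> where "\<phi> s = p s \<bullet> (f (y s) (u' s) - f (y s) (u s))" for s
 have P0: "0 <= P" "0 <= D" using order_trans[OF norm_ge_zero p(2)[of 0]] order_trans[OF norm_ge_zero D[of 0]] T0 by auto
 have cp: "continuous_on {0..T} p" and cy: "continuous_on {0..T} y"
  using primitive_on_continuous[OF p(1)] trajectory_continuous[OF u] by auto
 have fi: "(%s. f (y s) (v s)) integrable_on {0..T} & bounded ((%s. f (y s) (v s)) ` {0..T})"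
  if "control U v" for v using control_compose_integrable[OF f_continuous U(1) that cy] by auto
 have "(%s. p s \<bullet> f (y s) (v s)) integrable_on {0..T}" if "control U v" for v
 proof -
  have "continuous_on UNIV (%(x :: 'a, y). x \<bullet> y)" unfolding case_prod_unfold by (intro continuous_intros)
  thus ?thesis using integrable_on_compose[of p 0 T "%s. f (y s) (v s)" "%x y. x \<bullet> y"] fi[OF that]
    integrable_continuous_real[OF cp] compact_imp_bounded[OF compact_continuous_image[OF cp]] by auto
 qed
 hence "(%s. p s \<bullet> f (y s) (u' s) - p s \<bullet> f (y s) (u s)) integrable_on {0..T}"
  using u(1) u'(1) by (intro hk_integrable_diff)
 hence i\<phi>: "\<phi> integrable_on {0..T}" unfolding \<phi>_def[abs_def] by (simp add: inner_diff_right)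
 have i\<phi>': "\<phi> integrable_on {a..b}" by (rule integrable_on_subinterval[OF i\<phi>]) (use ab in auto)
 have ic: "(%s. \<phi> s - 2*P*L*D) integrable_on {a..b}" using i\<phi>' by (intro hk_integrable_diff) auto
 note ifi = integral_if_interval[OF ab(1,3) ic]
 let ?l = "%s. (if s \<in> {a..b} then \<phi> s - 2*P*L*D else 0) - P*L*D^2"
 have "integral {0..T} ?l = integral {a..b} (%s. \<phi> s - 2*P*L*D) - integral {0..T} (%_. P*L*D^2)"
  unfolding ifi(2)[symmetric] by (rule hk_integral_diff[OF ifi(1)]) auto
 also have "integral {a..b} (%s. \<phi> s - 2*P*L*D) = integral {a..b} \<phi> - 2*P*L*D*(b - a)"
  by (subst hk_integral_diff[OF i\<phi>']) (use ab in auto)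
 finally have il: "integral {0..T} ?l = integral {a..b} \<phi> - 2*P*L*D*(b - a) - P*L*D^2*T" using T0 by simp
 have pd: "primitive_on (%s. y' s - y s) (%s. f (y' s) (u' s) - f (y s) (u s)) T"
  by (rule primitive_on_diff[OF trajectory_primitive(2)[OF u'] trajectory_primitive(2)[OF u]])
 let ?w = "%s. (f (y' s) (u' s) - f (y s) (u s)) \<bullet> p s + (y' s - y s) \<bullet> (- adj (Df (y s) (u s)) (p s))"
 note pi = primitive_on_inner[OF pd p(1) T0]
 have "integral {0..T} ?l <= integral {0..T} ?w"
 proof (rule integral_le[OF _ pi(1)])
  show "?l integrable_on {0..T}" using ifi(1) by (intro hk_integrable_diff) auto
  fix s assume s: "s \<in> {0..T}"
  have us: "u s \<in> U" "u' s \<in> U" using control_in u(1) u'(1) s by auto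
  let ?\<Delta> = "y' s - y s"
  have weq: "?w s = p s \<bullet> (f (y' s) (u' s) - f (y s) (u s) - blinfun_apply (Df (y s) (u s)) ?\<Delta>)"
  proof -
   have "?\<Delta> \<bullet> (- adj (Df (y s) (u s)) (p s)) = - (p s \<bullet> blinfun_apply (Df (y s) (u s)) ?\<Delta>)"
    by (simp only: inner_minus_right inner_commute[of ?\<Delta>] adj_inner)
   thus ?thesis by (simp only: inner_diff_right[of "p s"] inner_commute[of _ "p s"])
  qed
  have cs: "- (P*k) <= p s \<bullet> v" if "norm v <= k" for v k
  proof -
   have "\<bar>p s \<bullet> v\<bar> <= norm (p s)*norm v" by (rule Cauchy_Schwarz_ineq2)
   also have "... <= P*k" using p(2)[OF s] that P0 by (intro mult_mono) auto
   finally show ?thesis by linarith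
  qed
  have PL: "0 <= P*(L*D^2)" using P0 constants by simp
  show "?l s <= ?w s"
  proof (cases "s \<in> {a..b}")
   case True
   have "norm (f (y' s) (u' s) - f (y s) (u' s)) <= L*D"
    using order_trans[OF f_lipschitz[OF us(2)] mult_left_mono[OF D[OF s]]] constants by simp
   note 1 = cs[OF this]
   have "norm (- blinfun_apply (Df (y s) (u s)) ?\<Delta>) <= L*D"
    using order_trans[OF norm_blinfun mult_mono[OF Df_norm[OF us(1)] D[OF s]]] constants by simp
   note 2 = cs[OF this]
   have "?w s = p s \<bullet> (f (y' s) (u' s) - f (y s) (u' s)) + \<phi> s + p s \<bullet> (- blinfun_apply (Df (y s) (u s)) ?\<Delta>)"
    unfolding weq \<phi>_def by (simp add: algebra_simps)
   with 1 2 PL True show ?thesis by (simp add: algebra_simps)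
  next
   case False
   have "norm (f (y' s) (u' s) - f (y s) (u s) - blinfun_apply (Df (y s) (u s)) ?\<Delta>) <= L*(norm ?\<Delta>)^2"
    unfolding same[OF s False] by (rule f_taylor[OF us(1)])
   also have "... <= L*D^2" using D[OF s] constants by (intro mult_left_mono power_mono) auto
   finally have "- (P*(L*D^2)) <= ?w s" unfolding weq by (rule cs)
   moreover have "?l s = - (P*(L*D^2))" using False by (simp only: if_False)
   ultimately show ?thesis by linarith
  qed
 qed
 also have "integral {0..T} ?w = (y' T - y T) \<bullet> p T - (y' 0 - y 0) \<bullet> p 0" by (rule pi(2)[symmetric])
 finally show ?thesis unfolding il
  trajectory_primitive(1)[OF u] trajectory_primitive(1)[OF u'] \<phi>_def[symmetric]
  by (simp add: inner_commute algebra_simps)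
qed

lemma cost_compare:
 assumes u: "control U u" "trajectory f x u y" and u': "control U u'" "trajectory f x' u' y'"
  and ab: "0 <= a" "a <= b" "b <= T" and same: "!!s. s \<in> {0..T} ==> s \<notin> {a..b} ==> u' s = u s"
  and D: "!!s. s \<in> {0..T} ==> norm (y' s - y s) <= D"
  and R: "!!s. s \<in> {a..b} ==> \<bar>r (y s) (u' s) - r (y s) (u s)\<bar> <= R"
 shows "\<bar>cost u' y' T - cost u y T\<bar> <= L*D*T + R*(b - a)"
proof -
 have T0: "0 <= T" using ab by simp
 let ?e = "%s. L*D + (if s \<in> {a..b} then R else 0)"
 have i: "(%s. if s \<in> {a..b} then R else 0) integrable_on {0..T}"
  "integral {0..T} (%s. if s \<in> {a..b} then R else 0) = R*(b - a)"
  using integral_if_interval[OF ab(1,3) integrable_const_ivl, of R] ab by (simp_all add: algebra_simps)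
 have "norm (integral {0..T} (%s. r (y' s) (u' s) - r (y s) (u s))) <= integral {0..T} ?e"
 proof (rule integral_norm_bound_integral)
  show "(%s. r (y' s) (u' s) - r (y s) (u s)) integrable_on {0..T}"
   by (intro hk_integrable_diff cost_integrable[OF u] cost_integrable[OF u']) auto
  show "?e integrable_on {0..T}" using i(1) by (intro integrable_add) auto
  fix s assume s: "s \<in> {0..T}"
  have us: "u s \<in> U" "u' s \<in> U" using control_in u(1) u'(1) s by auto
  have "\<bar>r (y' s) (u' s) - r (y s) (u' s)\<bar> <= L*D"
   using order_trans[OF r_lipschitz[OF us(2)] mult_left_mono[OF D[OF s]]] constants by simp
  moreover have "\<bar>r (y s) (u' s) - r (y s) (u s)\<bar> <= (if s \<in> {a..b} then R else 0)"
   using R[of s] same[OF s] by auto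
  ultimately show "norm (r (y' s) (u' s) - r (y s) (u s)) <= ?e s" unfolding real_norm_def by linarith
 qed
 also have "integral {0..T} ?e = L*D*T + R*(b - a)" by (subst integral_add[OF _ i(1)]) (use T0 i(2) in auto)
 also have "integral {0..T} (%s. r (y' s) (u' s) - r (y s) (u s)) = cost u' y' T - cost u y T" unfolding cost_def
  by (intro hk_integral_diff cost_integrable[OF u] cost_integrable[OF u']) auto
 finally show ?thesis by simp
qed

lemma control_splice:
 assumes u: "control U u" and w: "om \<in> U"
 shows "control U (%s. if s \<in> {a..b} then om else u s)" unfolding control_def
proof (intro conjI allI impI)
 show "(%s. if s \<in> {a..b} then om else u s) \<in> borel_measurable (lebesgue_on {0..})" using u unfolding control_def
  by (intro measurable_If_set) (auto simp: sets_restrict_space space_restrict_space image_iff intro!: bexI[of _ "{a..b}"])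
qed (use w control_in[OF u] in auto)

lemma trajectory_straight:
 assumes u: "control U u" "trajectory f x u y" and t: "0 <= t" "0 <= \<theta>"
  and w: "om \<in> U" "!!s. s \<in> {t..t + \<theta>} ==> u s = om"
 shows "norm (y (t + \<theta>) - y t - \<theta> *\<^sub>R f z om) <= \<theta>*L*(norm (y t - z) + N*\<theta>)"
proof -
 have pr: "primitive_on y (%s. f (y s) (u s)) (t + \<theta>)" by (rule trajectory_primitive(2)[OF u])
 note d = primitive_on_diff_eq[OF pr t(1), of "t + \<theta>"]
 have i: "(%s. f (y s) (u s)) integrable_on {t..t + \<theta>}" by (rule d(2)) (use t in auto)
 have "y (t + \<theta>) - y t - \<theta> *\<^sub>R f z om = integral {t..t + \<theta>} (%s. f (y s) (u s) - f z om)"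
  by (subst hk_integral_diff[OF i]) (use d(1) t in auto)
 also have "norm ... <= integral {t..t + \<theta>} (%_. L*(norm (y t - z) + N*\<theta>))"
 proof (rule integral_norm_bound_integral)
  fix s assume s: "s \<in> {t..t + \<theta>}"
  have "norm (f (y s) om - f z om) <= L*norm (y s - z)" by (rule f_lipschitz[OF w(1)])
  also have "norm (y s - z) <= norm (y t - z) + norm (y s - y t)" using norm_triangle_ineq[of "y t - z" "y s - y t"] by simp
  also have "norm (y s - y t) <= N*(s - t)" using s t by (intro trajectory_lipschitz[OF u]) auto
  also have "N*(s - t) <= N*\<theta>" using s constants by (intro mult_left_mono) auto
  finally show "norm (f (y s) (u s) - f z om) <= L*(norm (y t - z) + N*\<theta>)" using w(2)[OF s] constants by simp
 qed (use i in \<open>auto intro: hk_integrable_diff\<close>)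
 also have "... = \<theta>*L*(norm (y t - z) + N*\<theta>)" using t by simp
 finally show ?thesis .
qed

section \<open>Nearly optimal controls and uniform bounds\<close>

definition near_opt :: "'a => real => (real => 'b) => (real => 'a) => real => bool" where
 "near_opt x eps u y T \<longleftrightarrow> control U u & trajectory f x u y & hitting_time S y T & cost u y T + g (y T) < V x + eps"

text \<open>A trajectory that arrives at time T pays at least r0 T. Comparison of \<open>g\<close>
  at its end point with \<open>g\<close> at one fixed frontier point shows that the terminal cost
  gives back at most G N T plus a constant, and G N < r0.\<close>

lemma time_bound:
 assumes K: "compact K" and V: "continuous_on K V"
 shows "\<exists>\<tau>>0. \<forall>x\<in>K. \<forall>eps u y T. x \<notin> S & eps <= 1 & near_opt x eps u y T --> T <= \<tau>"
proof (cases "frontier S = {}")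
 case True
 hence "\<not> near_opt x eps u y T" if "x \<notin> S" for x eps u y T
  using hitting_frontier(2)[of u x y T] that unfolding near_opt_def by auto
 thus ?thesis by (intro exI[of _ 1]) auto
next
 case False
 then obtain z0 where z0: "z0 \<in> frontier S" by blast
 obtain M where M: "!!x. x \<in> K ==> V x <= M"
  using compact_imp_bounded[OF compact_continuous_image[OF V K]] unfolding bounded_iff by (force simp: abs_le_iff)
 obtain \<rho> where \<rho>: "!!x. x \<in> K ==> norm x <= \<rho>" using compact_imp_bounded[OF K] unfolding bounded_iff by blast
 define \<tau> where "\<tau> = max 1 ((M + 1 - g z0 + G*(\<rho> + norm z0))/(r0 - G*N))"
 show ?thesis
 proof (intro exI[of _ \<tau>] conjI ballI allI impI)
  show "0 < \<tau>" unfolding \<tau>_def by simp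
  fix x eps u y T assume x: "x \<in> K" and h: "x \<notin> S & eps <= 1 & near_opt x eps u y T"
  hence u: "control U u" "trajectory f x u y" and T: "hitting_time S y T"
   and c: "cost u y T + g (y T) < V x + 1" unfolding near_opt_def by auto
  note fr = hitting_frontier[OF u T]
  have T0: "0 <= T" using fr h by auto
  have "cost u y 0 + r0*(T - 0) <= cost u y T" by (rule cost_diff_ge[OF u _ T0]) auto
  hence c2: "r0*T <= cost u y T" by (simp add: cost_def)
  have "norm (y T - z0) <= norm (y T - y 0) + norm (y 0 - z0)" using norm_triangle_ineq[of "y T - y 0" "y 0 - z0"] by simp
  also have "... <= N*(T - 0) + (\<rho> + norm z0)"
   using trajectory_lipschitz[OF u order.refl T0] trajectory_primitive(1)[OF u] \<rho>[OF x]
    norm_triangle_ineq4[of x z0] by (intro add_mono) auto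
  finally have "norm (y T - z0) <= N*T + (\<rho> + norm z0)" by simp
  hence "G*norm (y T - z0) <= G*(N*T + (\<rho> + norm z0))" using G by (intro mult_left_mono)
  moreover have "\<bar>g (y T) - g z0\<bar> <= G*norm (y T - z0)" using fr h z0 Nbd by (intro g_lipschitz) auto
  ultimately have "(r0 - G*N)*T <= M + 1 - g z0 + G*(\<rho> + norm z0)" using c c2 M[OF x] by (simp add: algebra_simps)
  hence "T <= (M + 1 - g z0 + G*(\<rho> + norm z0))/(r0 - G*N)" using G by (simp add: pos_le_divide_eq mult.commute)
  thus "T <= \<tau>" unfolding \<tau>_def by simp
 qed
qed

text \<open>The running cost is bounded on the ball of radius \<open>B + 1\<close>, because
  competitors may leave the ball of radius \<open>B\<close> which contains the given
  trajectories.\<close>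

definition uniform_constants :: "'a set => real => real => real => real => bool" where
 "uniform_constants K \<tau> B R dlt \<longleftrightarrow> 0 < \<tau> & 0 <= R & 0 < dlt &
   (\<forall>x\<in>K. \<forall>eps u y T. eps <= 1 & near_opt x eps u y T -->
    x \<notin> S & 0 < T & T <= \<tau> & y T \<in> frontier S & norm (y T) <= B & ball (y T) dlt \<subseteq> Nbd &
    (\<forall>s\<in>{0..\<tau> + 1}. norm (y s) <= B)) &
   (\<forall>x om. norm x <= B + 1 & om \<in> U --> r x om <= R)"

lemma uniform_constants_exist:
 assumes K: "compact K" "K \<inter> S = {}" and V: "continuous_on K V"
 shows "\<exists>\<tau> B R dlt. uniform_constants K \<tau> B R dlt"
proof -
 obtain \<tau> where \<tau>: "0 < \<tau>" "!!x eps u y T. x \<in> K ==> x \<notin> S ==> eps <= 1 ==> near_opt x eps u y T ==> T <= \<tau>"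
  using time_bound[OF K(1) V] by blast
 obtain \<rho> where \<rho>: "!!x. x \<in> K ==> norm x <= \<rho>"
  using compact_imp_bounded[OF K(1)] unfolding bounded_iff by blast
 define B where "B = \<bar>\<rho>\<bar> + N*(\<tau> + 1)"
 have "compact ((%(x, om). r x om) ` (cball 0 (B + 1) \<times> U))"
  by (intro compact_continuous_image continuous_on_subset[OF r_continuous] compact_Times U) auto
 from compact_imp_bounded[OF this]
 obtain R where R': "!!v. v \<in> (%(x, om). r x om) ` (cball 0 (B + 1) \<times> U) ==> norm v <= R"
  unfolding bounded_iff by blast
 have R: "\<bar>r x om\<bar> <= R" if "norm x <= B + 1" "om \<in> U" for x om
 proof -
  have "r x om \<in> (%(x, om). r x om) ` (cball 0 (B + 1) \<times> U)"
   by (rule image_eqI[of _ _ "(x, om)"]) (use that in auto)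
  from R'[OF this] show ?thesis by simp
 qed
 have "compact (frontier S \<inter> cball 0 B)" using closed_Int_compact by auto
 then obtain dlt where dlt: "0 < dlt" "(\<Union>x\<in>frontier S \<inter> cball 0 B. ball x dlt) \<subseteq> Nbd"
  using compact_subset_open_imp_ball_epsilon_subset[OF _ Nbd(1)] Nbd(2) by (metis inf.coboundedI1)
 have "uniform_constants K \<tau> B \<bar>R\<bar> dlt" unfolding uniform_constants_def
 proof (intro conjI ballI allI impI)
  fix x eps u y T assume x: "x \<in> K" and h: "eps <= 1 & near_opt x eps u y T"
  hence u: "control U u" "trajectory f x u y" and T: "hitting_time S y T" unfolding near_opt_def by auto
  show xS: "x \<notin> S" using K x by auto
  show T0: "0 < T" and fr: "y T \<in> frontier S" using hitting_frontier[OF u T xS] by auto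
  show T\<tau>: "T <= \<tau>" using \<tau>(2)[OF x xS] h by blast
  show b: "norm (y s) <= B" if "s \<in> {0..\<tau> + 1}" for s
  proof -
   have "norm (y s) <= norm (y 0) + norm (y s - y 0)" by (rule norm_triangle_sub)
   also have "norm (y s - y 0) <= N*(s - 0)" using that by (intro trajectory_lipschitz[OF u]) auto
   also have "... <= N*(\<tau> + 1)" using that constants by (intro mult_left_mono) auto
   also have "norm (y 0) <= \<bar>\<rho>\<bar>" using \<rho>[OF x] trajectory_primitive(1)[OF u] by simp
   finally show ?thesis unfolding B_def by simp
  qed
  show bT: "norm (y T) <= B" using b T0 T\<tau> by auto
  show "ball (y T) dlt \<subseteq> Nbd"  by (rule order_trans[OF UN_upper dlt(2)]) (use fr bT in auto)
 next
  fix x :: 'a and om assume "norm x <= B + 1 & om \<in> U"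
  thus "r x om <= \<bar>R\<bar>" using R[of x om] by simp
 qed (use \<tau> dlt in auto)
 thus ?thesis by blast
qed

end

section \<open>Growth of the value function\<close>

context exit_problem
begin

text \<open>This is \<open>H0\<close> at the reflected costate. A normal \<xi> to the closed
  complement points into the target, so \<open>hh z \<xi>\<close> is the largest speed with which
  the target can be entered at z; degenerate means that it is not positive.\<close>

definition hh :: "'a => 'a => real" where
 "hh x p = (SUP om\<in>U. p \<bullet> f x om)"

lemma hh_attained: obtains om where "om \<in> U" "hh x p = p \<bullet> f x om"
proof -
 have c: "continuous_on U (%om. p \<bullet> f x om)"
 proof -
  have "continuous_on U (Pair x)" "Pair x ` U \<subseteq> UNIV \<times> U" by (auto intro!: continuous_intros)
  from continuous_on_compose2[OF f_continuous this] show ?thesis by (intro continuous_intros) simp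
 qed
 obtain om where w: "om \<in> U" "!!om'. om' \<in> U ==> p \<bullet> f x om' <= p \<bullet> f x om"
  using continuous_attains_sup[OF U(1,2) c] by blast
 have "hh x p = p \<bullet> f x om" unfolding hh_def by (rule cSup_eq_maximum) (use w in auto)
 with w that show thesis by blast
qed

lemma hh_ge: assumes "om \<in> U" shows "p \<bullet> f x om <= hh x p" unfolding hh_def
proof (rule cSUP_upper[OF assms])
 have "p \<bullet> f x om <= norm p*N" if "om \<in> U" for om
 proof -
  have "p \<bullet> f x om <= norm p*norm (f x om)" using Cauchy_Schwarz_ineq2 abs_le_D1 by blast
  also have "... <= norm p*N" using f_bound[OF that] by (intro mult_left_mono) auto
  finally show ?thesis .
 qed
 thus "bdd_above ((%om. p \<bullet> f x om) ` U)" by (intro bdd_aboveI2) auto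
qed

lemma hh_lipschitz: "\<bar>hh x p - hh y q\<bar> <= N*norm (p - q) + L*norm q*norm (x - y)"
proof -
 have *: "p \<bullet> f x om - q \<bullet> f y om <= N*norm (p - q) + L*norm q*norm (x - y)"
    "q \<bullet> f y om - p \<bullet> f x om <= N*norm (p - q) + L*norm q*norm (x - y)" if w: "om \<in> U" for om
 proof -
  have "p \<bullet> f x om - q \<bullet> f y om = (p - q) \<bullet> f x om + q \<bullet> (f x om - f y om)" by (simp add: algebra_simps)
  moreover have "\<bar>(p - q) \<bullet> f x om\<bar> <= norm (p - q)*N"
   using order_trans[OF Cauchy_Schwarz_ineq2 mult_left_mono[OF f_bound[OF w] norm_ge_zero]] .
  moreover have "\<bar>q \<bullet> (f x om - f y om)\<bar> <= norm q*(L*norm (x - y))"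
   using order_trans[OF Cauchy_Schwarz_ineq2 mult_left_mono[OF f_lipschitz[OF w] norm_ge_zero]] .
  ultimately show "p \<bullet> f x om - q \<bullet> f y om <= N*norm (p - q) + L*norm q*norm (x - y)"
    "q \<bullet> f y om - p \<bullet> f x om <= N*norm (p - q) + L*norm q*norm (x - y)" by (auto simp: algebra_simps)
 qed
 obtain om1 where 1: "om1 \<in> U" "hh x p = p \<bullet> f x om1" by (rule hh_attained)
 obtain om2 where 2: "om2 \<in> U" "hh y q = q \<bullet> f y om2" by (rule hh_attained)
 have "hh x p - hh y q <= p \<bullet> f x om1 - q \<bullet> f y om1" using 1 hh_ge[OF 1(1), of q y] by simp
 moreover have "hh y q - hh x p <= q \<bullet> f y om2 - p \<bullet> f x om2" using 2 hh_ge[OF 2(1), of p x] by simp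
 ultimately show ?thesis using *(1)[OF 1(1)] *(2)[OF 2(1)] by linarith
qed

text \<open>The normal inequality read backwards: it can fail only inside the target. The
  variational competitors below are certified to arrive in this way.\<close>

lemma in_target_if:
 assumes "!!y. y \<in> closure (- S) ==> \<xi> \<bullet> (y - z) <= \<sigma>*(norm (y - z))^2"
  and "\<sigma>*(norm (x - z))^2 < \<xi> \<bullet> (x - z)"
 shows "x \<in> S"
proof (rule ccontr)
 assume "x \<notin> S"
 hence "x \<in> closure (- S)" using closure_subset[of "- S"] by auto
 with assms show False by fastforce
qed

text \<open>The inner ball at the end of a nearly optimal trajectory, pulled back by the flow of the
 frozen control, gives a half space in which \<open>V\<close> grows at most linearly.\<close>

lemma half_space_growth_approx:
 assumes K: "compact K" "K \<inter> S = {}" and V: "continuous_on K V"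
 shows "\<exists>C M dlt. 0 <= C & 0 <= M & 0 < dlt & (\<forall>x0\<in>K. \<forall>eps. 0 < eps & eps <= 1 --> (\<exists>\<zeta>. norm \<zeta> = 1 &
  (\<forall>x. x \<notin> S & norm (x - x0) < dlt & C*(norm (x - x0))^2 < \<zeta> \<bullet> (x - x0) --> V x <= V x0 + eps + M*norm (x - x0))))"
proof -
 obtain \<tau> B R dlt0 where uc: "uniform_constants K \<tau> B R dlt0" using uniform_constants_exist[OF assms] by blast
 hence \<tau>: "0 < \<tau>" "0 < dlt0" unfolding uniform_constants_def by auto
 define E where "E = exp (L*\<tau>)"
 have E: "1 <= E" using constants \<tau> by (simp add: E_def)
 \<comment> \<open>The bracket is the Taylor remainder of \<open>variation\<close> plus the
   curvature of the inner ball, both for displacements up to \<open>E * norm (x - x0)\<close>. The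
   outer factor \<open>E\<close> pays for normalizing \<open>p 0\<close>, whose norm is at least
   1/\<open>E\<close>.\<close>
 define C where "C = E*(E*L*E^2*\<tau> + 1/(2*\<rho>0)*E^2)"
 define M where "M = (L*\<tau> + G)*E"
 define dlt where "dlt = dlt0/E"
 show ?thesis
 proof (rule exI[of _ C], rule exI[of _ M], rule exI[of _ dlt], intro conjI ballI allI impI)
  show "0 <= C" "0 <= M" "0 < dlt" using E \<tau> constants G by (auto simp: C_def M_def dlt_def)
  fix x0 and eps :: real assume x0: "x0 \<in> K" and e: "0 < eps & eps <= 1"
  obtain u y T where no: "near_opt x0 eps u y T" using near_optimal[of eps x0] e unfolding near_opt_def by blast
  hence u: "control U u" "trajectory f x0 u y" and c: "cost u y T + g (y T) < V x0 + eps" unfolding near_opt_def by auto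
  have T: "x0 \<notin> S" "0 < T" "T <= \<tau>" "y T \<in> frontier S" "ball (y T) dlt0 \<subseteq> Nbd"
   using uc x0 e no unfolding uniform_constants_def by blast+
  obtain \<xi> where \<xi>: "norm \<xi> = 1"
   "!!z. z \<in> closure (- S) ==> \<xi> \<bullet> (z - y T) <= 1/(2*\<rho>0)*(norm (z - y T))^2"
   using inner_ball[OF T(4)] by blast
  obtain p where p: "p T = \<xi>" "primitive_on p (%s. - adj (Df (y s) (u s)) (p s)) T"
   "!!s. s \<in> {0..T} ==> norm (p s) <= norm \<xi>*exp (L*T)"
   "!!s. s \<in> {0..T} ==> norm \<xi> <= norm (p s)*exp (L*T)"
   using adjoint_exists[OF u, of T \<xi>] T(2) by (metis less_imp_le)
  have ET: "exp (L*T) <= E" "0 < exp (L*T)" using T constants unfolding E_def by auto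
  have pE: "norm (p s) <= E" if "s \<in> {0..T}" for s using p(3)[OF that] ET \<xi> by simp
  have p0: "1 <= norm (p 0)*E" using p(4)[of 0] T(2) \<xi>(1) mult_left_mono[OF ET(1), of "norm (p 0)"] by simp
  hence p0': "p 0 ~= 0" by auto
  define \<zeta> where "\<zeta> = p 0 /\<^sub>R norm (p 0)"
  show "\<exists>\<zeta>. norm \<zeta> = 1 & (\<forall>x. x \<notin> S & norm (x - x0) < dlt &
   C*(norm (x - x0))^2 < \<zeta> \<bullet> (x - x0) --> V x <= V x0 + eps + M*norm (x - x0))"
  proof (intro exI[of _ \<zeta>] conjI allI impI)
   show "norm \<zeta> = 1" using p0' by (simp add: \<zeta>_def)
   fix x assume x: "x \<notin> S & norm (x - x0) < dlt & C*(norm (x - x0))^2 < \<zeta> \<bullet> (x - x0)"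
   let ?w = "norm (x - x0)"
   obtain y' where y': "trajectory f x u y'" using trajectory_exists[OF u(1)] by blast
   note ab = order.refl order.refl less_imp_le[OF T(2)]
   have D: "norm (y' s - y s) <= E*?w" if "s \<in> {0..T}" for s
   proof -
    have "norm (y' s - y s) <= (?w + 2*N*(0 - 0))*exp (L*T)" by (rule trajectory_compare[OF u u(1) y' ab _ that]) simp
    also have "... <= ?w*E" using ET by (simp add: mult_left_mono)
    finally show ?thesis by (simp add: mult.commute)
   qed
   have "p 0 \<bullet> (x - x0) + integral {0..0} (%s. p s \<bullet> (f (y s) (u s) - f (y s) (u s)))
     - E*L*(E*?w)^2*T - 2*E*L*(E*?w)*(0 - 0) <= p T \<bullet> (y' T - y T)"
    by (rule variation[OF u u(1) y' ab _ p(2) pE D]) auto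
   hence var: "p 0 \<bullet> (x - x0) - E*L*(E*?w)^2*T <= \<xi> \<bullet> (y' T - y T)" using p(1) by simp
   have "E*L*(E*?w)^2*T <= E*L*(E*?w)^2*\<tau>" using T E constants by (intro mult_left_mono) auto
   moreover have "(E*L*E^2*\<tau> + 1/(2*\<rho>0)*E^2)*?w^2 < p 0 \<bullet> (x - x0)"
   proof -
    let ?c = "(E*L*E^2*\<tau> + 1/(2*\<rho>0)*E^2)*?w^2"
    have c0: "0 <= ?c" using E \<tau> constants by (intro mult_nonneg_nonneg add_nonneg_nonneg) auto
    have "?c <= norm (p 0)*E*?c" using mult_right_mono[OF p0 c0] by simp
    also have "... = norm (p 0)*(C*?w^2)" by (simp add: C_def algebra_simps)
    also have "... < norm (p 0)*(\<zeta> \<bullet> (x - x0))" using x p0' by (intro mult_strict_left_mono) auto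
    also have "... = p 0 \<bullet> (x - x0)" using p0' by (simp add: \<zeta>_def)
    finally show ?thesis .
   qed
   ultimately have "1/(2*\<rho>0)*(E*?w)^2 < \<xi> \<bullet> (y' T - y T)"
    using var by (simp add: power_mult_distrib algebra_simps)
   moreover have DT: "norm (y' T - y T) <= E*?w" using D[of T] T(2) by simp
   hence "1/(2*\<rho>0)*(norm (y' T - y T))^2 <= 1/(2*\<rho>0)*(E*?w)^2"
    using constants by (intro mult_left_mono power_mono) auto
   ultimately have "1/(2*\<rho>0)*(norm (y' T - y T))^2 < \<xi> \<bullet> (y' T - y T)" by linarith
   from in_target_if[OF \<xi>(2) this] have yS: "y' T \<in> S" .
   have "E*?w < dlt0" using x E by (simp add: dlt_def pos_less_divide_eq mult.commute)
   hence dN: "y' T \<in> Nbd" "y T \<in> Nbd"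
    using DT T(5) \<tau>(2) by (auto simp: dist_norm norm_minus_commute intro!: subsetD[OF T(5)])
   have "V x <= cost u y' T + g (y' T)" using x T(2) by (intro V_le_arrival[OF u(1) y' _ yS dN(1)]) auto
   moreover have "\<bar>cost u y' T - cost u y T\<bar> <= L*(E*?w)*T + 0*(0 - 0)"
    by (rule cost_compare[OF u u(1) y' ab _ D]) auto
   moreover have "L*(E*?w)*T <= L*(E*?w)*\<tau>" using T E constants by (intro mult_left_mono) auto
   moreover have "\<bar>g (y' T) - g (y T)\<bar> <= G*(E*?w)"
    using order_trans[OF g_lipschitz[OF dN(2,1)] mult_left_mono[OF DT G(1)]] .
   ultimately show "V x <= V x0 + eps + M*?w" using c unfolding M_def by (simp add: algebra_simps)
  qed
 qed
qed

text \<open>The direction \<zeta> found before depends on \<open>eps\<close>. A limit direction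
  exists by compactness of the sphere, and a strict inequality that holds for it holds for the late
  directions of the subsequence too.\<close>

lemma half_space_growth:
 assumes K: "compact K" "K \<inter> S = {}" and V: "continuous_on K V"
 shows "\<exists>C M dlt. 0 <= C & 0 <= M & 0 < dlt & (\<forall>x0\<in>K. \<exists>\<zeta>. norm \<zeta> = 1 &
  (\<forall>x. x \<notin> S & norm (x - x0) < dlt & C*(norm (x - x0))^2 < \<zeta> \<bullet> (x - x0) --> V x <= V x0 + M*norm (x - x0)))"
proof -
 obtain C M dlt where C: "0 <= C" "0 <= M" "0 < dlt" and
  *: "!!x0 eps. x0 \<in> K ==> 0 < eps ==> eps <= 1 ==> \<exists>\<zeta>. norm \<zeta> = 1 &
  (\<forall>x. x \<notin> S & norm (x - x0) < dlt & C*(norm (x - x0))^2 < \<zeta> \<bullet> (x - x0) --> V x <= V x0 + eps + M*norm (x - x0))"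
  using half_space_growth_approx[OF assms] by blast
 have "\<exists>\<zeta>. norm \<zeta> = 1 & (\<forall>x. x \<notin> S & norm (x - x0) < dlt &
   C*(norm (x - x0))^2 < \<zeta> \<bullet> (x - x0) --> V x <= V x0 + M*norm (x - x0))" if x0: "x0 \<in> K" for x0
 proof -
  have "\<exists>\<zeta>. norm \<zeta> = 1 & (\<forall>x. x \<notin> S & norm (x - x0) < dlt & C*(norm (x - x0))^2 < \<zeta> \<bullet> (x - x0)
   --> V x <= V x0 + inverse (real (Suc k)) + M*norm (x - x0))" for k
   using *[OF x0, of "inverse (real (Suc k))"] by (simp add: inverse_le_1_iff)
  then obtain Z where Z: "!!k. norm (Z k) = 1" "!!k x. x \<notin> S ==> norm (x - x0) < dlt ==>
   C*(norm (x - x0))^2 < Z k \<bullet> (x - x0) ==> V x <= V x0 + inverse (real (Suc k)) + M*norm (x - x0)" by metis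
  have "Z k \<in> sphere 0 1" for k using Z(1) by simp
  then obtain \<zeta> \<phi> where \<zeta>: "\<zeta> \<in> sphere 0 1" "strict_mono \<phi>" "(Z \<circ> \<phi>) \<longlonglongrightarrow> \<zeta>"
   using compact_sphere[of "0 :: 'a" 1] unfolding compact_def by metis
  show ?thesis
  proof (intro exI[of _ \<zeta>] conjI allI impI)
   show "norm \<zeta> = 1" using \<zeta>(1) by simp
   fix x assume x: "x \<notin> S & norm (x - x0) < dlt & C*(norm (x - x0))^2 < \<zeta> \<bullet> (x - x0)"
   have "(%k. Z (\<phi> k) \<bullet> (x - x0)) \<longlonglongrightarrow> \<zeta> \<bullet> (x - x0)"
    using \<zeta>(3) by (intro tendsto_intros) (simp add: o_def)
   hence "\<forall>\<^sub>F k in sequentially. C*(norm (x - x0))^2 < Z (\<phi> k) \<bullet> (x - x0)"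
    by (rule order_tendstoD) (use x in auto)
   hence "\<forall>\<^sub>F k in sequentially. V x <= V x0 + inverse (real (Suc (\<phi> k))) + M*norm (x - x0)"
    by eventually_elim (use Z(2) x in auto)
   moreover have "(%k. inverse (real (Suc (\<phi> k)))) \<longlonglongrightarrow> 0"
    using LIMSEQ_subseq_LIMSEQ[OF LIMSEQ_inverse_real_of_nat \<zeta>(2)] by (simp add: o_def)
   hence "(%k. V x0 + inverse (real (Suc (\<phi> k))) + M*norm (x - x0)) \<longlonglongrightarrow> V x0 + 0 + M*norm (x - x0)"
    by (intro tendsto_intros)
   ultimately have "V x <= V x0 + 0 + M*norm (x - x0)" by (intro tendsto_lowerbound[OF _ _ sequentially_bot])
   thus "V x <= V x0 + M*norm (x - x0)" by simp
  qed
 qed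
 with C show ?thesis by blast
qed

text \<open>If the end point of a nearly optimal trajectory admits an inward pointing velocity, nearby
 trajectories are steered into the target after a time proportional to the distance.\<close>

lemma steering:
 assumes K: "compact K" "K \<inter> S = {}" and V: "continuous_on K V" and \<kappa>: "0 < \<kappa>"
 shows "\<exists>dlt>0. \<exists>C. \<forall>x\<in>K. \<forall>x'\<in>K. \<forall>eps u y T \<xi>. norm (x' - x) < dlt & eps <= 1 & near_opt x eps u y T & norm \<xi> = 1 &
  (\<forall>z\<in>closure (- S). \<xi> \<bullet> (z - y T) <= 1/(2*\<rho>0)*(norm (z - y T))^2) & \<kappa> <= hh (y T) \<xi> -->
  V x' <= V x + eps + C*norm (x' - x)"
proof -
 obtain \<tau> B R dlt0 where uc: "uniform_constants K \<tau> B R dlt0" using uniform_constants_exist[OF assms(1-3)] by blast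
 hence \<tau>: "0 < \<tau>" "0 < dlt0" "0 <= R" unfolding uniform_constants_def by auto
 define E where "E = exp (L*\<tau>)"
 have E: "1 <= E" using constants \<tau> by (simp add: E_def)
 \<comment> \<open>Continuing for the time c \<eta> with the best velocity gains 4 \<eta> of depth;
   the initial displacement costs \<eta>, and the remaining 3 \<eta> outweigh all quadratic errors,
   which are collected in \<open>Q\<close>.\<close>
 define c where "c = 4/\<kappa>"
 have c0: "0 < c" using \<kappa> by (simp add: c_def)
 define A where "A = 1 + N*c"
 have A: "1 <= A" using constants c0 by (simp add: A_def)
 define Q where "Q = c*L*A + 1/(2*\<rho>0)*A^2"
 have Q: "0 < Q" using c0 A constants by (simp add: Q_def add_pos_pos)
 \<comment> \<open>In this order the bounds make the quadratic errors at most \<eta>, keep the new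
   end point in \<open>Nbd\<close>, keep the additional time below 1, and keep the trajectory within
   the radius \<open>B + 1\<close>.\<close>
 define dlt1 where "dlt1 = min (1/Q) (min (dlt0/A) (min (1/c) (1/A)))"
 have dlt1: "0 < dlt1" using Q A c0 \<tau> by (simp add: dlt1_def)
 define C where "C = (L*\<tau> + R*c + G*A)*E"
 show ?thesis
 proof (rule exI[of _ "dlt1/E"], rule conjI, use dlt1 E in simp, rule exI[of _ C], intro ballI allI impI)
  fix x x' eps u y T \<xi>
  assume x: "x \<in> K" "x' \<in> K" and h: "norm (x' - x) < dlt1/E & eps <= 1 & near_opt x eps u y T & norm \<xi> = 1 &
   (\<forall>z\<in>closure (- S). \<xi> \<bullet> (z - y T) <= 1/(2*\<rho>0)*(norm (z - y T))^2) & \<kappa> <= hh (y T) \<xi>"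
  hence u: "control U u" "trajectory f x u y" and co: "cost u y T + g (y T) < V x + eps" unfolding near_opt_def by auto
  have T: "0 < T" "T <= \<tau>" "y T \<in> frontier S" "norm (y T) <= B" "ball (y T) dlt0 \<subseteq> Nbd"
   using uc x h unfolding uniform_constants_def by blast+
  obtain om where w: "om \<in> U" "hh (y T) \<xi> = \<xi> \<bullet> f (y T) om" by (rule hh_attained)
  define \<eta> where "\<eta> = E*norm (x' - x)"
  have \<eta>: "0 <= \<eta>" "\<eta> < dlt1" using h E by (auto simp: \<eta>_def pos_less_divide_eq mult.commute)
  show "V x' <= V x + eps + C*norm (x' - x)"
  proof (cases "\<eta> = 0")
   case True
   hence "x' = x" using E by (simp add: \<eta>_def)
   \<comment> \<open>The starting points coincide, but the sign of \<open>eps\<close> is not among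
     the assumptions; it follows since a cost cannot lie below \<open>V x\<close>.\<close>
   moreover have "0 <= eps" using V_le_attained[OF u] co h unfolding near_opt_def by force
   ultimately show ?thesis by simp
  next
   case False
   hence \<eta>0: "0 < \<eta>" using \<eta> by simp
   define \<theta> where "\<theta> = c*\<eta>"
   have \<theta>: "0 < \<theta>" "\<theta> <= 1" using \<eta>0 c0 \<eta> by (auto simp: \<theta>_def dlt1_def field_simps)
   define u' where "u' = (%s. if s \<in> {T..T + \<theta>} then om else u s)"
   have u': "control U u'" unfolding u'_def by (rule control_splice[OF u(1) w(1)])
   obtain y' where y': "trajectory f x' u' y'" using trajectory_exists[OF u'] by blast
   \<comment> \<open>Up to time T the controls differ only at T itself, so the comparison uses the
     degenerate needle \<open>{T..T}\<close>.\<close>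
   have same: "u' s = u s" if "s \<in> {0..T}" "s \<notin> {T..T}" for s using that by (auto simp: u'_def)
   note ab = less_imp_le[OF T(1)] order.refl order.refl
   have ET: "exp (L*T) <= E" using T constants unfolding E_def by auto
   have D: "norm (y' s - y s) <= \<eta>" if "s \<in> {0..T}" for s
   proof -
    have "norm (y' s - y s) <= (norm (x' - x) + 2*N*(T - T))*exp (L*T)" by (rule trajectory_compare[OF u u' y' ab same that])
    also have "... <= norm (x' - x)*E" using ET by (simp add: mult_left_mono)
    finally show ?thesis by (simp add: \<eta>_def mult.commute)
   qed
   have DT: "norm (y' T - y T) <= \<eta>" using D[of T] T(1) by simp
   have "norm (y' (T + \<theta>) - y' T - \<theta> *\<^sub>R f (y T) om) <= \<theta>*L*(norm (y' T - y T) + N*\<theta>)"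
    by (rule trajectory_straight[OF u' y' _ _ w(1)]) (use T \<theta> in \<open>auto simp: u'_def\<close>)
   also have "... <= \<theta>*L*(\<eta> + N*\<theta>)" using DT \<theta> constants by (intro mult_left_mono) auto
   also have "... = c*L*A*\<eta>^2" by (simp add: \<theta>_def A_def power2_eq_square algebra_simps)
   finally have str: "norm (y' (T + \<theta>) - y' T - \<theta> *\<^sub>R f (y T) om) <= c*L*A*\<eta>^2" .
   let ?v = "y' (T + \<theta>) - y T"
   have "norm (y' (T + \<theta>) - y' T) <= N*(T + \<theta> - T)"
    by (rule trajectory_lipschitz[OF u' y']) (use T \<theta> in auto)
   hence "norm ?v <= \<eta> + N*\<theta>" using DT norm_triangle_ineq[of "y' (T + \<theta>) - y' T" "y' T - y T"] by simp
   hence vA: "norm ?v <= A*\<eta>" by (simp add: \<theta>_def A_def algebra_simps)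
   have cs: "\<bar>\<xi> \<bullet> v\<bar> <= norm v" for v using Cauchy_Schwarz_ineq2[of \<xi> v] h by simp
   have "\<xi> \<bullet> ?v = \<theta>*(\<xi> \<bullet> f (y T) om) + \<xi> \<bullet> (y' T - y T) + \<xi> \<bullet> (y' (T + \<theta>) - y' T - \<theta> *\<^sub>R f (y T) om)"
    by (simp add: algebra_simps)
   moreover have "\<theta>*\<kappa> <= \<theta>*(\<xi> \<bullet> f (y T) om)" using h w \<theta> by (intro mult_left_mono) auto
   moreover have "\<theta>*\<kappa> = 4*\<eta>" using \<kappa> by (simp add: \<theta>_def c_def)
   ultimately have lo: "3*\<eta> - c*L*A*\<eta>^2 <= \<xi> \<bullet> ?v"
    using cs[of "y' T - y T"] cs[of "y' (T + \<theta>) - y' T - \<theta> *\<^sub>R f (y T) om"] DT str by linarith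
   have "Q*\<eta> < 1" using \<eta>(2) Q by (simp add: dlt1_def field_simps)
   hence "Q*\<eta>^2 <= \<eta>" using \<eta>0 by (simp add: power2_eq_square mult_left_le_one_le flip: mult.assoc)
   moreover have "1/(2*\<rho>0)*(norm ?v)^2 <= 1/(2*\<rho>0)*(A*\<eta>)^2"
    using vA constants by (intro mult_left_mono power_mono) auto
   ultimately have "1/(2*\<rho>0)*(norm ?v)^2 < \<xi> \<bullet> ?v"
    using lo \<eta>0 by (simp add: Q_def power_mult_distrib algebra_simps)
   from in_target_if[OF _ this] h have yS: "y' (T + \<theta>) \<in> S" by blast
   have "A*\<eta> < dlt0" "A*\<eta> <= 1" using \<eta>(2) A by (auto simp: dlt1_def field_simps)
   hence dN: "y' (T + \<theta>) \<in> Nbd" "y T \<in> Nbd"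
    using vA T(5) \<tau>(2) by (auto simp: dist_norm norm_minus_commute intro!: subsetD[OF T(5)])
   have T\<theta>: "0 <= T + \<theta>" "T <= T + \<theta>" using T \<theta> by auto
   have "x' \<notin> S" using x K by auto
   have "V x' <= cost u' y' (T + \<theta>) + g (y' (T + \<theta>))"
    by (rule V_le_arrival[OF u' y' T\<theta>(1) yS dN(1) \<open>x' \<notin> S\<close>])
   moreover have "cost u' y' (T + \<theta>) = cost u' y' T + integral {T..T + \<theta>} (%s. r (y' s) (u' s))"
    by (rule cost_split[OF u' y' _ T\<theta>(2)]) (use T in auto)
   moreover have ile: "integral {T..T + \<theta>} (%s. r (y' s) (u' s)) <= integral {T..T + \<theta>} (%_. R)"
   proof (rule integral_le[OF cost_integrable[OF u' y']])
    fix s assume s: "s \<in> {T..T + \<theta>}"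
    have "norm (y' s) <= norm (y T) + norm (y' T - y T) + norm (y' s - y' T)"
     using norm_triangle_ineq[of "y T + (y' T - y T)" "y' s - y' T"] norm_triangle_ineq[of "y T" "y' T - y T"] by simp
    also have "norm (y' s - y' T) <= N*(s - T)" using s T by (intro trajectory_lipschitz[OF u' y']) auto
    also have "N*(s - T) <= N*\<theta>" using s constants by (intro mult_left_mono) auto
    finally have "norm (y' s) <= B + (\<eta> + N*\<theta>)" using DT T(4) by simp
    also have "\<eta> + N*\<theta> = A*\<eta>" by (simp add: \<theta>_def A_def algebra_simps)
    finally have "norm (y' s) <= B + 1" using \<open>A * \<eta> \<le> 1\<close> by simp
    thus "r (y' s) (u' s) <= R" using uc control_in[OF u', of s] s T unfolding uniform_constants_def by auto
   qed (use T in auto)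
   moreover have "\<bar>cost u' y' T - cost u y T\<bar> <= L*\<eta>*T"
   proof -
   have "\<bar>cost u' y' T - cost u y T\<bar> <= L*\<eta>*T + (2*R)*(T - T)"
   proof (rule cost_compare[OF u u' y' ab same D])
    fix s assume s: "s \<in> {T..T}"
    have "r (y T) om <= R" "r (y T) (u T) <= R" "r0 <= r (y T) om" "r0 <= r (y T) (u T)"
     using uc w control_in[OF u(1), of T] T r_ge unfolding uniform_constants_def by auto
    thus "\<bar>r (y s) (u' s) - r (y s) (u s)\<bar> <= 2*R" using s \<theta> constants by (auto simp: u'_def)
   qed
   thus ?thesis by simp
   qed
   moreover have "L*\<eta>*T <= L*\<eta>*\<tau>" using T \<eta> constants by (intro mult_left_mono) auto
   moreover have "\<bar>g (y' (T + \<theta>)) - g (y T)\<bar> <= G*(A*\<eta>)"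
    using order_trans[OF g_lipschitz[OF dN(2,1)] mult_left_mono[OF vA G(1)]] .
   moreover have "integral {T..T + \<theta>} (%_. R) = R*\<theta>" using \<theta> by simp
   moreover have "(L*\<tau> + R*c + G*A)*\<eta> = L*\<eta>*\<tau> + R*\<theta> + G*(A*\<eta>)"
    by (simp add: \<theta>_def algebra_simps)
   ultimately have "V x' <= V x + eps + (L*\<tau> + R*c + G*A)*\<eta>" using co by linarith
   thus ?thesis by (simp add: C_def \<eta>_def algebra_simps)
  qed
 qed
qed

end

section \<open>Limiting end points\<close>

lemma eventually_at_right_lessI:
 fixes \<Phi> :: "real => real"
 assumes "(\<Phi> \<longlongrightarrow> l) (at_right 0)" "l < c"
 shows "\<forall>\<^sub>F e in at_right 0. \<Phi> e < c" by (rule order_tendstoD(2)[OF assms])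

lemma at_right_witness:
 assumes "\<forall>\<^sub>F e in at_right (0::real). P e" "0 < e1"
 obtains e where "0 < e" "e < e1" "P e"
proof -
 have "\<forall>\<^sub>F e in at_right (0::real). P e & e \<in> {0<..<e1}"
  using assms by (intro eventually_conj eventually_at_right_real)
 then obtain e where "P e & e \<in> {0<..<e1}" using eventually_happens'[OF trivial_limit_at_right_real] by blast
 thus thesis by (intro that) auto
qed

text \<open>The scales of the needle variation: a needle of order 1/k^2, an earlier stop by s = c/k,
  and \<open>eps\<close> chosen last. Stopping early costs depth of order s^2, which the choice of c
  keeps below the gain of order 1/k^2. The saving b s is of order 1/k and beats the additional cost,
  which is of order 1/k^2.\<close>

lemma needle_scales:
 fixes \<eta> \<sigma> N L d C1 A b T dlt0 eps1 :: real
 assumes "0 < \<eta>" "0 <= \<sigma>" "0 <= N" "0 <= L" "0 < b" "0 < T" "0 < dlt0" "0 < eps1"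
 obtains k :: nat and s eps where "1 <= k" "0 < s" "0 < eps" "eps < eps1" "s <= T/4"
  "C1*(inverse (real k))^2 <= \<eta>/2"
  "\<sigma>*(N * s + d*(inverse (real k))^2 + eps)^2 + eps + s*L*(N * s + d*(inverse (real k))^2 + eps) < \<eta>*(inverse (real k))^2/2"
  "eps + A*(inverse (real k))^2 < b * s" "N * s + d*(inverse (real k))^2 < dlt0"
proof -
 define q where "q = \<sigma>*N^2 + L*N + 1"
 define c where "c = sqrt (\<eta>/(8*q))"
 have pos: "0 < q" unfolding q_def using assms by (simp add: add_nonneg_pos)
 have c0: "0 < c" using assms pos by (simp add: c_def)
 have "(\<sigma>*N^2 + L*N)*c^2 <= q*c^2" unfolding q_def by (intro mult_right_mono) auto
 also have "... = \<eta>/8" using pos assms by (simp add: c_def)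
 finally have cc: "(\<sigma>*N^2 + L*N)*c^2 < \<eta>/2" using assms by simp
 note i = tendsto_inverse_0_at_top[OF filterlim_real_sequentially]
 let ?i = "%k. inverse (real k)"
 have "(%k. C1*(?i k)^2) \<longlonglongrightarrow> C1*0^2" by (intro tendsto_intros i)
 hence 1: "\<forall>\<^sub>F k in sequentially. C1*(?i k)^2 < \<eta>/2" by (rule order_tendstoD) (use assms in auto)
 have "(%k. \<sigma>*(N*c + d*?i k)^2 + c*L*(N*c + d*?i k)) \<longlonglongrightarrow> \<sigma>*(N*c + d*0)^2 + c*L*(N*c + d*0)"
  by (intro tendsto_intros i)
 moreover have "\<sigma>*(N*c + d*0)^2 + c*L*(N*c + d*0) < \<eta>/2" using cc by (simp add: power2_eq_square algebra_simps)
 ultimately have 2: "\<forall>\<^sub>F k in sequentially. \<sigma>*(N*c + d*?i k)^2 + c*L*(N*c + d*?i k) < \<eta>/2"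
  by (rule order_tendstoD)
 have "(%k. A*?i k) \<longlonglongrightarrow> A*0" by (intro tendsto_intros i)
 hence 3: "\<forall>\<^sub>F k in sequentially. A*?i k < b*c" by (rule order_tendstoD) (use assms c0 in auto)
 have "(%k. c*?i k) \<longlonglongrightarrow> c*0" by (intro tendsto_intros i)
 hence 4: "\<forall>\<^sub>F k in sequentially. c*?i k < T/4" by (rule order_tendstoD) (use assms in auto)
 have "(%k. N*(c*?i k) + d*(?i k)^2) \<longlonglongrightarrow> N*(c*0) + d*0^2" by (intro tendsto_intros i)
 hence 5: "\<forall>\<^sub>F k in sequentially. N*(c*?i k) + d*(?i k)^2 < dlt0" by (rule order_tendstoD) (use assms in auto)
 have "\<exists>k\<ge>1. C1*(?i k)^2 < \<eta>/2 & \<sigma>*(N*c + d*?i k)^2 + c*L*(N*c + d*?i k) < \<eta>/2 &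
   A*?i k < b*c & c*?i k < T/4 & N*(c*?i k) + d*(?i k)^2 < dlt0"
  using eventually_happens'[OF sequentially_bot eventually_conj[OF eventually_ge_at_top[of 1] eventually_conj[OF 1
    eventually_conj[OF 2 eventually_conj[OF 3 eventually_conj[OF 4 5]]]]]] by blast
 then obtain k where k: "1 <= k" "C1*(?i k)^2 < \<eta>/2"
   "\<sigma>*(N*c + d*?i k)^2 + c*L*(N*c + d*?i k) < \<eta>/2"
   "A*?i k < b*c" "c*?i k < T/4" "N*(c*?i k) + d*(?i k)^2 < dlt0" by blast
 have k0: "0 < ?i k" using k(1) by simp
 define s where "s = c*?i k"
 define h where "h = (?i k)^2"
 have "(?i k)^2*(\<sigma>*(N*c + d*?i k)^2 + c*L*(N*c + d*?i k)) < (?i k)^2*(\<eta>/2)"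
  using k(3) k0 by (intro mult_strict_left_mono) auto
 hence b2: "\<sigma>*(N * s + d*h + 0)^2 + 0 + s*L*(N * s + d*h + 0) < \<eta>*h/2"
  by (simp add: s_def h_def power2_eq_square algebra_simps)
 have "?i k*(A*?i k) < ?i k*(b*c)" using k(4) k0 by (intro mult_strict_left_mono) auto
 hence b3: "0 + A*h < b * s" by (simp add: s_def h_def power2_eq_square algebra_simps)
 have "((%eps. \<sigma>*(N * s + d*h + eps)^2 + eps + s*L*(N * s + d*h + eps)) \<longlongrightarrow>
   \<sigma>*(N * s + d*h + 0)^2 + 0 + s*L*(N * s + d*h + 0)) (at_right 0)" by (intro tendsto_intros)
 note e1 = eventually_at_right_lessI[OF this b2]
 have "((%eps. eps + A*h) \<longlongrightarrow> 0 + A*h) (at_right 0)" by (intro tendsto_intros)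
 note e2 = eventually_at_right_lessI[OF this b3]
 obtain eps where e: "0 < eps" "eps < eps1"
  "\<sigma>*(N * s + d*h + eps)^2 + eps + s*L*(N * s + d*h + eps) < \<eta>*h/2 & eps + A*h < b * s"
  using at_right_witness[OF eventually_conj[OF e1 e2] assms(8)] by blast
 show thesis by (rule that[of k s eps]) (use k e c0 k0 in \<open>auto simp: s_def h_def\<close>)
qed

lemma integral_pigeonhole:
 fixes e :: "real => real"
 assumes e: "e integrable_on {0..T}" and T: "0 < T" and n: "1 <= (n :: nat)"
 obtains i where "i < n" "integral {0..T} e/n <= integral {T*real i/n..T*(real i + 1)/n} e"
proof -
 have s: "(\<Sum>i<m. integral {T*real i/n..T*(real i + 1)/n} e) = integral {0..T*real m/n} e" if "m <= n" for m using that
 proof (induction m)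
  case (Suc m)
  have "T*real (Suc m)/n <= T*1" using Suc.prems T n by (simp add: divide_le_eq)
  hence "e integrable_on {0..T*real (Suc m)/n}" by (intro integrable_on_subinterval[OF e]) auto
  hence "integral {0..T*real m/n} e + integral {T*real m/n..T*(real m + 1)/n} e = integral {0..T*(real m + 1)/n} e"
   using T n by (intro Henstock_Kurzweil_Integration.integral_combine) (auto simp: divide_right_mono add.commute)
  with Suc show ?case by (simp add: add.commute)
 qed simp
 show thesis
 proof (rule ccontr)
  assume neg: "\<not> thesis"
  have "(\<Sum>i<n. integral {T*real i/n..T*(real i + 1)/n} e) < (\<Sum>i<n. integral {0..T} e/n)"
   using that neg n by (intro sum_strict_mono) (auto simp: not_le[symmetric] lessThan_empty_iff)
  also have "... = integral {0..T} e" using n by simp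
  finally show False using s[of n] n by simp
 qed
qed

lemma primitive_on_inner_le:
 assumes y: "primitive_on y v T" and st: "0 <= s" "s <= t" "t <= T"
  and c: "!!r. r \<in> {s..t} ==> \<xi> \<bullet> v r <= c"
 shows "\<xi> \<bullet> (y t - y s) <= c*(t - s)"
proof -
 have h: "((%r. \<xi> \<bullet> v r) has_integral \<xi> \<bullet> (y t - y s)) {s..t}"
  using has_integral_linear[OF integrable_integral[OF primitive_on_diff_eq(2)[OF y st]] bounded_linear_inner_right[of \<xi>]]
  unfolding primitive_on_diff_eq(1)[OF y st] by (simp add: o_def)
 have "\<xi> \<bullet> (y t - y s) <= integral {s..t} (%_. c)" unfolding integral_unique[OF h, symmetric]
  by (rule integral_le[OF has_integral_integrable[OF h]]) (use c in auto)
 thus ?thesis using st by (simp add: mult.commute)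
qed

context exit_problem
begin

definition normal_at :: "'a => real => 'a => bool" where
 "normal_at z \<sigma> \<xi> \<longleftrightarrow> 0 <= \<sigma> & (\<forall>y\<in>closure (- S). \<xi> \<bullet> (y - z) <= \<sigma>*(norm (y - z))^2)"

text \<open>Stands in for an optimal trajectory from x that ends at z at time T: start, arrival
  time, end point and optimality gap are all approximate, with one common tolerance.\<close>

definition lim_end :: "'a => 'a => real => bool" where
 "lim_end x z T \<longleftrightarrow> (\<forall>eps>0. \<exists>x' u y T'. norm (x' - x) < eps & \<bar>T' - T\<bar> < eps & near_opt x' eps u y T' & norm (y T' - z) < eps)"

lemma near_opt_mono: "near_opt x eps u y T ==> eps <= eps' ==> near_opt x eps' u y T" unfolding near_opt_def by auto

lemma near_optD:
 assumes "near_opt x eps u y T"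
 shows "control U u" "trajectory f x u y" "hitting_time S y T" "cost u y T + g (y T) < V x + eps"
 using assms unfolding near_opt_def by auto

lemma uniform_constantsD:
 assumes "uniform_constants K \<tau> B R dlt" "x \<in> K" "near_opt x eps u y T" "eps <= 1"
 shows "0 < T" "T <= \<tau>" "ball (y T) dlt \<subseteq> Nbd" "norm (y T) <= B" "!!s. s \<in> {0..\<tau> + 1} ==> norm (y s) <= B"
 using assms unfolding uniform_constants_def by blast+

lemma compact_ball_outside:
 assumes "x \<notin> S" obtains e where "0 < e" "e <= 1" "cball x e \<inter> S = {}"
proof -
 have "open (- S)" "x \<in> - S" using S assms by auto
 then obtain e where "0 < e" "cball x e \<subseteq> - S" using open_contains_cball by blast
 thus thesis by (intro that[of "min e 1"]) auto
qed

text \<open>The point x is outside the target, z is on its frontier, and speeds are at most N; hence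
  T > 0. The approximating arrival times are eventually at least T/2, which is the uniform delay
  that the reachable boundary asks for.\<close>

lemma lim_end_facts:
 assumes x: "x \<notin> S" and le: "lim_end x z T"
 shows "0 < T" "z \<in> frontier S" "z \<in> reachable_boundary U f S"
proof -
 obtain e where e: "0 < e" "cball x e \<inter> S = {}" using compact_ball_outside[OF x] by blast
 have pt: "\<exists>x' u y T'. norm (x' - x) < eps & \<bar>T' - T\<bar> < eps & near_opt x' eps u y T' & norm (y T' - z) < eps
   & y T' \<in> frontier S & 0 < T' & norm (x - z) <= 2*eps + N*(T + eps)" if eps: "0 < eps" "eps < e" for eps
 proof -
  obtain x' u y T' where h: "norm (x' - x) < eps" "\<bar>T' - T\<bar> < eps" "near_opt x' eps u y T'" "norm (y T' - z) < eps"
   using le eps unfolding lim_end_def by blast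
  have "x' \<in> cball x e" using h(1) eps by (auto simp: dist_norm norm_minus_commute)
  hence x': "x' \<notin> S" using e by auto
  note n = near_optD[OF h(3)]
  note fr = hitting_frontier[OF n(1-3) x']
  have "norm (y T' - y 0) <= N*(T' - 0)" by (rule trajectory_lipschitz[OF n(1,2)]) (use fr in auto)
  also have "... <= N*(T + eps)" using h(2) constants by (intro mult_left_mono) auto
  finally have "norm (y T' - x') <= N*(T + eps)" using trajectory_primitive(1)[OF n(1,2)] by simp
  moreover have "norm (x - z) <= norm (x' - x) + norm (y T' - x') + norm (y T' - z)" by norm
  ultimately have "norm (x - z) <= 2*eps + N*(T + eps)" using h by linarith
  with h fr show ?thesis by blast
 qed
 have "z \<in> closure (frontier S)" unfolding closure_approachable
 proof (intro allI impI)
  fix eps :: real assume "0 < eps"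
  hence "0 < min eps (e/2)" "min eps (e/2) < e" using e by auto
  from pt[OF this] obtain y :: "real => 'a" and T' where "norm (y T' - z) < eps" "y T' \<in> frontier S" by force
  thus "\<exists>w\<in>frontier S. dist w z < eps" by (intro bexI[of _ "y T'"]) (auto simp: dist_norm)
 qed
 thus z: "z \<in> frontier S" by simp
 hence "z ~= x" using x S(1) frontier_subset_closed by blast
 show T0: "0 < T"
 proof (rule ccontr)
  assume "\<not> 0 < T"
  hence NT: "N*T <= 0" using constants by (simp add: mult_nonneg_nonpos)
  define eps where "eps = min (e/2) (norm (x - z)/(2*(2 + N)))"
  have eps: "0 < eps" "eps < e" "(2 + N)*eps <= norm (x - z)/2"
  proof -
   show "0 < eps" "eps < e" using e \<open>z \<noteq> x\<close> constants by (auto simp: eps_def)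
   have "(2 + N)*eps <= (2 + N)*(norm (x - z)/(2*(2 + N)))" using constants unfolding eps_def by (intro mult_left_mono) auto
   also have "... = norm (x - z)/2" using constants by (simp add: field_simps)
   finally show "(2 + N)*eps <= norm (x - z)/2" .
  qed
  have "norm (x - z) <= 2*eps + N*(T + eps)" using pt[OF eps(1,2)] by blast
  also have "... <= norm (x - z)/2" using eps(3) NT by (simp add: algebra_simps)
  finally show False using \<open>z \<noteq> x\<close> by simp
 qed
 define E where "E k = min (inverse (real (Suc k))) (min (T/2) (e/2))" for k
 have E: "0 < E k" "E k < e" "E k <= T/2" "E k <= inverse (real (Suc k))" for k using T0 e by (auto simp: E_def min_def)
 have "\<exists>w. norm (w - z) < E k & w \<in> frontier S &
   (\<exists>x0 u y T'. control U u & trajectory f x0 u y & hitting_time S y T' & T/2 <= T' & w = y T')" for k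
 proof -
  obtain x' u y T' where h: "\<bar>T' - T\<bar> < E k" "near_opt x' (E k) u y T'" "norm (y T' - z) < E k" "y T' \<in> frontier S"
   using pt[OF E(1,2)] by blast
  have "T/2 <= T'" using h(1) E(3)[of k] by linarith
  with h near_optD[OF h(2)] show ?thesis by blast
 qed
 then obtain X where X: "!!k. norm (X k - z) < E k" "!!k. X k \<in> frontier S"
  "!!k. \<exists>x0 u y T'. control U u & trajectory f x0 u y & hitting_time S y T' & T/2 <= T' & X k = y T'" by metis
 have "X \<longlonglongrightarrow> z"
 proof (rule metric_LIMSEQ_I, goal_cases)
  case (1 r)
  then obtain n0 where n0: "inverse (real (Suc n0)) < r" using reals_Archimedean by blast
  have "dist (X n) z < r" if "n0 <= n" for n
  proof -
   have "inverse (real (Suc n)) <= inverse (real (Suc n0))" using that by (simp add: le_imp_inverse_le)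
   thus ?thesis using X(1)[of n] E(4)[of n] n0 unfolding dist_norm by linarith
  qed
  thus ?case by blast
 qed
 thus "z \<in> reachable_boundary U f S"
  unfolding reachable_boundary_def using z X(2,3) T0 by (intro CollectI conjI exI[of _ "T/2"] exI[of _ X]) auto
qed

lemma inner_f_integrable:
 assumes u: "control U v" and y: "continuous_on {0..T} y" and p: "continuous_on {0..T} p"
 shows "(%s. p s \<bullet> f (y s) (v s)) integrable_on {0..T}"
proof -
 have "continuous_on UNIV (%(x :: 'a, y). x \<bullet> y)" unfolding case_prod_unfold by (intro continuous_intros)
 thus ?thesis using integrable_on_compose[of p 0 T "%s. f (y s) (v s)" "%x y. x \<bullet> y"]
   control_compose_integrable[OF f_continuous U(1) u y]
   integrable_continuous_real[OF p] compact_imp_bounded[OF compact_continuous_image[OF p]] by auto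
qed

lemma hh_continuous: "continuous_on A (%w. hh (fst w) (snd w))"
proof (rule continuous_at_imp_continuous_on, rule ballI)
 fix w :: "'a \<times> 'a"
 have "((%v. N*norm (snd v - snd w) + L*norm (snd w)*norm (fst v - fst w)) \<longlongrightarrow>
   N*norm (snd w - snd w) + L*norm (snd w)*norm (fst w - fst w)) (at w)" by (intro tendsto_intros)
 hence z: "((%v. N*norm (snd v - snd w) + L*norm (snd w)*norm (fst v - fst w)) \<longlongrightarrow> 0) (at w)" by simp
 have "((%v. hh (fst v) (snd v) - hh (fst w) (snd w)) \<longlongrightarrow> 0) (at w)"
 proof (rule Lim_null_comparison[OF _ z], intro always_eventually allI)
  fix v
  show "norm (hh (fst v) (snd v) - hh (fst w) (snd w)) <= N*norm (snd v - snd w) + L*norm (snd w)*norm (fst v - fst w)"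
   unfolding real_norm_def by (rule hh_lipschitz)
 qed
 thus "isCont (%w. hh (fst w) (snd w)) w" unfolding isCont_def by (rule LIM_zero_cancel)
qed

lemma hh_path_continuous:
 assumes "continuous_on {0..T} y" "continuous_on {0..T} p"
 shows "continuous_on {0..T} (%s. hh (y s) (p s))"
 using continuous_on_compose2[OF hh_continuous[of UNIV] continuous_on_Pair[OF assms]] by simp

text \<open>An approximate maximum principle without optimal trajectories: a needle variation on an
 interval of length \<open>T / k\<^sup>2\<close> gains depth of order \<open>k\<^sup>-\<^sup>2\<close> in the ball inside the target; as
 the normal is degenerate, one can stop a time of order \<open>1 / k\<close> earlier.\<close>

lemma approximate_maximum_principle:
 assumes x: "x \<notin> S" and V: "continuous_on UNIV V" and le: "lim_end x z T"
  and \<xi>: "norm \<xi> = 1" "normal_at z \<sigma> \<xi>" "hh z \<xi> <= 0" and \<eta>: "0 < \<eta>"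
 shows "\<exists>eps>0. \<forall>x' u y T' p. norm (x' - x) < eps & \<bar>T' - T\<bar> < eps & near_opt x' eps u y T' & norm (y T' - z) < eps &
  p T' = \<xi> & primitive_on p (%s. - adj (Df (y s) (u s)) (p s)) T' & (\<forall>s\<in>{0..T'}. norm (p s) <= exp (L*T')) -->
  integral {0..T'} (%s. hh (y s) (p s) - p s \<bullet> f (y s) (u s)) < \<eta>"
proof -
 have \<sigma>: "0 <= \<sigma>" and nb: "!!w. w \<in> closure (- S) ==> \<xi> \<bullet> (w - z) <= \<sigma>*(norm (w - z))^2"
  using \<xi>(2) unfolding normal_at_def by auto
 have T0: "0 < T" using lim_end_facts[OF x le] by blast
 obtain e where e: "0 < e" "e <= 1" "cball x e \<inter> S = {}" using compact_ball_outside[OF x] by blast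
 obtain \<tau> B R dlt0 where uc: "uniform_constants (cball x e) \<tau> B R dlt0"
  using uniform_constants_exist[OF compact_cball e(3) continuous_on_subset[OF V]] by blast
 hence \<tau>: "0 < \<tau>" "0 < dlt0" "0 <= R" unfolding uniform_constants_def by auto
 define E where "E = exp (L*\<tau>)"
 have E: "1 <= E" using constants \<tau> by (simp add: E_def)
 \<comment> \<open>With h = 1/k^2, the needle moves the trajectory by at most d h. Its depth loses
   at most C1 h^2, through freezing the control, the Taylor remainder and the displacement on the
   needle; its cost grows by at most A h.\<close>
 define d where "d = 2*N*\<tau>*E"
 define C1 where "C1 = 4*N*L*E*\<tau>^2 + E*L*d^2*\<tau> + 2*E*L*d*\<tau>"
 define A where "A = L*d*\<tau> + R*\<tau> + G*d"
 have d0: "0 <= d" using constants \<tau> E by (simp add: d_def)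
 have b0: "0 < r0 - G*N" using G by simp
 obtain k s eps where k: "1 <= k" and s: "0 < s" and eps: "0 < eps" "eps < min e (T/2)" and sT: "s <= T/4"
  and k1: "C1*(inverse (real k))^2 <= \<eta>/2"
  and k2: "\<sigma>*(N * s + d*(inverse (real k))^2 + eps)^2 + eps + s*L*(N * s + d*(inverse (real k))^2 + eps) < \<eta>*(inverse (real k))^2/2"
  and k3: "eps + A*(inverse (real k))^2 < (r0 - G*N) * s" and k4: "N * s + d*(inverse (real k))^2 < dlt0"
  by (rule needle_scales[of \<eta> \<sigma> N L "r0 - G*N" T dlt0 "min e (T/2)" C1 d A])
   (use \<eta> \<sigma> constants b0 T0 \<tau> e in auto)
 define h where "h = (inverse (real k))^2"
 define n where "n = k*k"
 have k': "1 <= real k" using k by simp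
 have n: "1 <= n" "1/real n = h" using k by (auto simp: n_def h_def power2_eq_square inverse_eq_divide)
 have h0: "0 < h" "h <= 1" using k' unfolding h_def by (auto intro!: power_le_one simp: inverse_le_1_iff)
 note k1 = k1[folded h_def] and k2 = k2[folded h_def] and k3 = k3[folded h_def] and k4 = k4[folded h_def]
 show ?thesis
 proof (rule exI[of _ eps], rule conjI, rule eps(1), intro allI impI, rule ccontr)
  fix x' u y T' p
  assume hyp: "norm (x' - x) < eps & \<bar>T' - T\<bar> < eps & near_opt x' eps u y T' & norm (y T' - z) < eps &
   p T' = \<xi> & primitive_on p (%s. - adj (Df (y s) (u s)) (p s)) T' & (\<forall>s\<in>{0..T'}. norm (p s) <= exp (L*T'))"
   and nle: "\<not> integral {0..T'} (%s. hh (y s) (p s) - p s \<bullet> f (y s) (u s)) < \<eta>"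
  let ?e = "%s. hh (y s) (p s) - p s \<bullet> f (y s) (u s)"
  have big: "\<eta> <= integral {0..T'} ?e" using nle by simp
  have no: "near_opt x' eps u y T'" and close: "norm (y T' - z) < eps" and pT: "p T' = \<xi>"
   and pp: "primitive_on p (%s. - adj (Df (y s) (u s)) (p s)) T'" using hyp by auto
  note u = near_optD(1,2)[OF no]
  have x'K: "x' \<in> cball x e" using hyp eps by (auto simp: dist_norm norm_minus_commute)
  hence x'S: "x' \<notin> S" using e by auto
  have T': "0 < T'" "T' <= \<tau>" "ball (y T') dlt0 \<subseteq> Nbd" "norm (y T') <= B" "!!s. s \<in> {0..\<tau> + 1} ==> norm (y s) <= B"
   using uniform_constantsD[OF uc x'K no] eps e by auto
  have sT': "s <= T'" using hyp eps sT by linarith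
  have pE: "norm (p r) <= E" if "r \<in> {0..T'}" for r
  proof -
   have "norm (p r) <= exp (L*T')" using hyp that by blast
   also have "... <= E" using T' constants by (simp add: E_def)
   finally show ?thesis .
  qed
  note cy = trajectory_continuous[OF u, of T'] and cp = primitive_on_continuous[OF pp]
  have ie: "?e integrable_on {0..T'}" by (intro hk_integrable_diff integrable_continuous_real hh_path_continuous cy cp
     inner_f_integrable[OF u(1)])
  \<comment> \<open>One of the \<open>k*k\<close> pieces carries at least the average of the gap.
    The needle is placed there, with the control that is optimal at the left end of the
    piece.\<close>
  obtain i where i: "i < n" "integral {0..T'} ?e/n <= integral {T'*real i/n..T'*(real i + 1)/n} ?e"
   using integral_pigeonhole[OF ie T'(1) n(1)] by blast
  define a where "a = T'*real i/n"
  define b where "b = T'*(real i + 1)/n"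
  define len where "len = b - a"
  have "len = T'*h" unfolding len_def a_def b_def n(2)[symmetric] by (simp add: algebra_simps add_divide_distrib)
  hence len: "0 <= len" "len <= \<tau>*h" using T' h0 by (auto simp: mult_right_mono)
  have "real i + 1 <= n" using i(1) by linarith
  hence "T'*(real i + 1)/n <= T'*n/n" using T' by (intro divide_right_mono mult_left_mono) auto
  hence ab: "0 <= a" "a <= b" "b <= T'" using T' n len(1) unfolding len_def by (auto simp: a_def b_def)
  have "\<eta>*h <= integral {0..T'} ?e*(1/n)" using big h0 n by (simp add: mult_right_mono)
  hence ebig: "\<eta>*h <= integral {a..b} ?e" using i(2) by (simp add: a_def b_def)
  obtain om where w: "om \<in> U" "hh (y a) (p a) = p a \<bullet> f (y a) om" by (rule hh_attained)
  define u' where "u' = (%s. if s \<in> {a..b} then om else u s)"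
  have u': "control U u'" unfolding u'_def by (rule control_splice[OF u(1) w(1)])
  obtain y' where y': "trajectory f x' u' y'" using trajectory_exists[OF u'] by blast
  have same: "u' r = u r" if "r \<in> {0..T'}" "r \<notin> {a..b}" for r using that by (auto simp: u'_def)
  define D where "D = d*h"
  have D0: "0 <= D" using d0 h0 by (simp add: D_def)
  have D: "norm (y' r - y r) <= D" if "r \<in> {0..T'}" for r
  proof -
   have "norm (y' r - y r) <= (norm (x' - x') + 2*N*(b - a))*exp (L*T')"
    by (rule trajectory_compare[OF u u' y' ab same that])
   also have "... <= (2*N*(\<tau>*h))*E"
    using len constants T' unfolding len_def E_def by (intro mult_mono) (auto intro!: mult_left_mono)
   finally show ?thesis by (simp add: D_def d_def algebra_simps)
  qed
  have pl: "norm (p r - p a) <= L*E*len" if r: "r \<in> {a..b}" for r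
  proof -
   have "norm (p r - p a) <= (L*E)*(r - a)"
   proof (rule primitive_on_lipschitz[OF pp])
    fix q assume q: "q \<in> {a..r}"
    have "norm (adj (Df (y q) (u q)) (p q)) <= norm (Df (y q) (u q))*norm (p q)" by (rule norm_adj_le)
    also have "... <= L*E" using q r ab constants by (intro mult_mono Df_norm control_in[OF u(1)] pE) auto
    finally show "norm (- adj (Df (y q) (u q)) (p q)) <= L*E" by simp
   qed (use r ab in auto)
   also have "... <= L*E*len" using r constants E by (intro mult_left_mono) (auto simp: len_def)
   finally show ?thesis .
  qed
  have yl: "norm (y r - y a) <= N*len" if r: "r \<in> {a..b}" for r
  proof -
   have "norm (y r - y a) <= N*(r - a)" by (rule trajectory_lipschitz[OF u]) (use r ab in auto)
   also have "... <= N*len" using r constants by (intro mult_left_mono) (auto simp: len_def)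
   finally show ?thesis .
  qed
  have pa: "norm (p a) <= E" using pE ab by auto
  \<comment> \<open>The control is frozen at time a; moving y and p along the needle changes the
    maximum and its frozen competitor by at most 2 N L E len each.\<close>
  have near: "hh (y r) (p r) - 4*N*L*E*len <= p r \<bullet> f (y r) om" if r: "r \<in> {a..b}" for r
  proof -
   have c1: "N*norm (p r - p a) <= N*(L*E*len)" using pl[OF r] constants by (intro mult_left_mono) auto
   have c2: "L*norm (p a)*norm (y r - y a) <= L*E*(N*len)" using pa yl[OF r] constants E len by (intro mult_mono) auto
   have h1: "hh (y r) (p r) <= hh (y a) (p a) + 2*N*L*E*len"
    using hh_lipschitz[of "y r" "p r" "y a" "p a"] c1 c2 by (simp add: algebra_simps)
   have c1': "norm (p r - p a)*N <= N*(L*E*len)" using c1 by (simp only: mult.commute)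
   have c2': "norm (p a)*(L*norm (y r - y a)) <= L*E*(N*len)" using c2 by (simp only: mult.commute mult.left_commute mult.assoc)
   have eq: "2*N*L*E*len = N*(L*E*len) + L*E*(N*len)" by simp
   have "\<bar>(p r - p a) \<bullet> f (y r) om\<bar> <= norm (p r - p a)*N"
    using order_trans[OF Cauchy_Schwarz_ineq2 mult_left_mono[OF f_bound[OF w(1)] norm_ge_zero]] .
   moreover have "\<bar>p a \<bullet> (f (y r) om - f (y a) om)\<bar> <= norm (p a)*(L*norm (y r - y a))"
    using order_trans[OF Cauchy_Schwarz_ineq2 mult_left_mono[OF f_lipschitz[OF w(1)] norm_ge_zero]] .
   moreover have "p r \<bullet> f (y r) om = p a \<bullet> f (y a) om + (p r - p a) \<bullet> f (y r) om + p a \<bullet> (f (y r) om - f (y a) om)"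
    by (simp add: algebra_simps)
   ultimately have "p a \<bullet> f (y a) om - 2*N*L*E*len <= p r \<bullet> f (y r) om" using c1' c2' eq by linarith
   thus ?thesis using h1 w(2) by simp
  qed
  have sub: "{a..b} \<subseteq> {0..T'}" using ab by auto
  have iab: "?e integrable_on {a..b}" by (rule integrable_on_subinterval[OF ie sub])
  have "integral {a..b} (%r. ?e r - 4*N*L*E*len) = integral {a..b} ?e - integral {a..b} (%_. 4*N*L*E*len)"
   by (rule hk_integral_diff[OF iab]) auto
  moreover have "integral {a..b} (%_. 4*N*L*E*len) = 4*N*L*E*len*len"
   unfolding integral_const_real len_def using ab by (simp add: mult.commute)
  ultimately have "integral {a..b} ?e - 4*N*L*E*len*len = integral {a..b} (%r. ?e r - 4*N*L*E*len)" by linarith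
  also have "... <= integral {a..b} (%r. p r \<bullet> (f (y r) (u' r) - f (y r) (u r)))"
  proof (rule integral_le)
   show "(%r. ?e r - 4*N*L*E*len) integrable_on {a..b}" by (intro hk_integrable_diff iab) auto
   have "(%r. p r \<bullet> f (y r) (u' r) - p r \<bullet> f (y r) (u r)) integrable_on {0..T'}"
    by (intro hk_integrable_diff inner_f_integrable u u' cy cp)
   thus "(%r. p r \<bullet> (f (y r) (u' r) - f (y r) (u r))) integrable_on {a..b}"
    unfolding inner_diff_right using sub by (rule integrable_on_subinterval)
   show "?e r - 4*N*L*E*len <= p r \<bullet> (f (y r) (u' r) - f (y r) (u r))" if "r \<in> {a..b}" for r
    using near[OF that] that by (simp add: u'_def inner_diff_right)
  qed
  finally have gain1: "\<eta>*h - 4*N*L*E*len*len <= integral {a..b} (%r. p r \<bullet> (f (y r) (u' r) - f (y r) (u r)))"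
   using ebig by linarith
  have var: "p 0 \<bullet> (x' - x') + integral {a..b} (%s. p s \<bullet> (f (y s) (u' s) - f (y s) (u s)))
   - E*L*D^2*T' - 2*E*L*D*(b - a) <= p T' \<bullet> (y' T' - y T')" by (rule variation[OF u u' y' ab same pp pE D])
  have "\<eta>*h - C1*h*h <= \<xi> \<bullet> (y' T' - y T')"
  proof -
   have "4*N*L*E*len*len <= 4*N*L*E*(\<tau>*h)*(\<tau>*h)"
    using len constants E \<tau> h0 by (intro mult_mono) (auto intro!: mult_left_mono)
   moreover have "E*L*D^2*T' <= E*L*D^2*\<tau>" using T' E constants by (intro mult_left_mono) auto
   moreover have "2*E*L*D*(b - a) <= 2*E*L*D*(\<tau>*h)"
    using len E constants D0 unfolding len_def by (intro mult_left_mono) auto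
   moreover have "C1*h*h = 4*N*L*E*(\<tau>*h)*(\<tau>*h) + E*L*D^2*\<tau> + 2*E*L*D*(\<tau>*h)"
    by (simp add: C1_def D_def power2_eq_square algebra_simps)
   ultimately show ?thesis using var gain1 pT by simp
  qed
  moreover have "C1*h*h <= \<eta>/2*h" using k1 h0 by (intro mult_right_mono) auto
  ultimately have gain: "\<eta>*h/2 <= \<xi> \<bullet> (y' T' - y T')" by simp
  let ?t = "T' - s"
  have t: "0 <= ?t" "?t <= T'" using sT' s by auto
  have cl: "norm (y' r - z) <= N * s + D + eps" if r: "r \<in> {?t..T'}" for r
  proof -
   have "norm (y' T' - y' r) <= N*(T' - r)" by (rule trajectory_lipschitz[OF u' y']) (use r t in auto)
   also have "... <= N * s" using r constants by (intro mult_left_mono) auto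
   finally have "norm (y' T' - y' r) <= N * s" .
   moreover have "norm (y' r - z) <= norm (y' T' - y' r) + norm (y' T' - y T') + norm (y T' - z)" by norm
   ultimately show ?thesis using D[of T'] T'(1) close by simp
  qed
  \<comment> \<open>Degeneracy enters here: as \<open>hh z \<xi> <= 0\<close>, near z every velocity
    has a \<xi>-component of the order of the distance, so the last time s contributes only order
    s^2 of depth and can be skipped.\<close>
  have "\<xi> \<bullet> (y' T' - y' ?t) <= L*(N * s + D + eps)*(T' - ?t)"
  proof (rule primitive_on_inner_le[OF trajectory_primitive(2)[OF u' y'] t order.refl])
   fix r assume r: "r \<in> {?t..T'}"
   have "\<xi> \<bullet> f (y' r) (u' r) <= hh (y' r) \<xi>" using r t by (intro hh_ge control_in[OF u']) auto
   also have "... <= hh z \<xi> + L*norm (y' r - z)" using hh_lipschitz[of "y' r" \<xi> z \<xi>] \<xi>(1) by simp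
   also have "... <= L*(N * s + D + eps)" using cl[OF r] \<xi>(3) constants by (smt (verit) mult_left_mono)
   finally show "\<xi> \<bullet> f (y' r) (u' r) <= L*(N * s + D + eps)" .
  qed
  hence b1: "\<xi> \<bullet> (y' T' - y' ?t) <= s*L*(N * s + D + eps)" by (simp add: mult.commute mult.left_commute)
  have "\<bar>\<xi> \<bullet> (y T' - z)\<bar> <= eps" using Cauchy_Schwarz_ineq2[of \<xi> "y T' - z"] \<xi>(1) close by simp
  moreover have "\<xi> \<bullet> (y' ?t - z) = \<xi> \<bullet> (y' T' - y T') + \<xi> \<bullet> (y T' - z) - \<xi> \<bullet> (y' T' - y' ?t)"
   by (simp add: algebra_simps)
  ultimately have "\<eta>*h/2 - eps - s*L*(N * s + D + eps) <= \<xi> \<bullet> (y' ?t - z)" using gain b1 by linarith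
  moreover have "\<sigma>*(norm (y' ?t - z))^2 <= \<sigma>*(N * s + D + eps)^2"
   using cl[of ?t] t \<sigma> by (intro mult_left_mono power_mono) auto
  ultimately have "\<sigma>*(norm (y' ?t - z))^2 < \<xi> \<bullet> (y' ?t - z)" using k2 unfolding D_def by linarith
  from in_target_if[OF nb this] have yS: "y' ?t \<in> S" .
  have "norm (y' ?t - y' T') <= N * s" using trajectory_lipschitz[OF u' y' t] by (simp add: norm_minus_commute)
  moreover have "norm (y' ?t - y T') <= norm (y' ?t - y' T') + norm (y' T' - y T')" by norm
  ultimately have yy: "norm (y' ?t - y T') <= N * s + D" using D[of T'] T'(1) by simp
  hence dN: "y' ?t \<in> Nbd" "y T' \<in> Nbd"
   using k4 T'(3) \<tau>(2) unfolding D_def by (auto simp: dist_norm norm_minus_commute intro!: subsetD[OF T'(3)])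
  have "V x' <= cost u' y' ?t + g (y' ?t)" by (rule V_le_arrival[OF u' y' t(1) yS dN(1) x'S])
  moreover have "cost u' y' ?t + r0*(T' - ?t) <= cost u' y' T'" by (rule cost_diff_ge[OF u' y' t])
  moreover have "\<bar>cost u' y' T' - cost u y T'\<bar> <= L*D*T' + R*(b - a)"
  proof (rule cost_compare[OF u u' y' ab same D])
   fix q assume q: "q \<in> {a..b}"
   hence q': "0 <= q" "norm (y q) <= B" using ab T' by auto
   hence "r (y q) om <= R" "r (y q) (u q) <= R" "r0 <= r (y q) om" "r0 <= r (y q) (u q)"
    using uc w(1) control_in[OF u(1) q'(1)] r_ge unfolding uniform_constants_def by auto
   thus "\<bar>r (y q) (u' q) - r (y q) (u q)\<bar> <= R" using q constants by (auto simp: u'_def)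
  qed
  moreover have "L*D*T' <= L*D*\<tau>" using T' D0 constants by (intro mult_left_mono) auto
  moreover have "R*(b - a) <= R*(\<tau>*h)" using len \<tau> unfolding len_def by (intro mult_left_mono) auto
  moreover have "\<bar>g (y' ?t) - g (y T')\<bar> <= G*(N * s + D)"
   using order_trans[OF g_lipschitz[OF dN(2,1)] mult_left_mono[OF yy G(1)]] .
  moreover have "A*h = L*D*\<tau> + R*(\<tau>*h) + G*D" by (simp add: A_def D_def algebra_simps)
  ultimately show False using k3 near_optD(4)[OF no] by (simp add: algebra_simps)
 qed
qed

end

lemma locally_lipschitz_on_compact:
 fixes h :: "'a::metric_space => 'b::metric_space"
 assumes l: "locally_lipschitz_on A h" and K: "compact K" "K \<subseteq> A"
 obtains C where "C-lipschitz_on K h"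
proof -
 have "local_lipschitz {0 :: real} K (%_. h)"
 proof (rule local_lipschitzI)
  fix t x assume x: "x \<in> K" and "t \<in> {0 :: real}"
  then obtain e C where e: "0 < e" "C-lipschitz_on (ball x e \<inter> A) h"
   using l K unfolding locally_lipschitz_on_def by blast
  have "C-lipschitz_on (cball x (e/2) \<inter> K) h" by (rule lipschitz_on_subset[OF e(2)]) (use e K in auto)
  thus "\<exists>u>0. \<exists>L. \<forall>t\<in>cball t u \<inter> {0}. L-lipschitz_on (cball x u \<inter> K) h"
   using e(1) by (intro exI[of _ "e/2"]) auto
 qed
 from local_lipschitz_compact_implies_lipschitz[OF this K(1)] that show thesis
  by (metis compact_sing continuous_on_const singletonI)
qed

text \<open>A gradient step of length t lowers \<phi> by at least t |D|^2/2, and the result must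
  still be nonnegative. The bound t \<le> 1/(2 \<Lambda>) makes the step a descent, and t \<le>
  \<rho>/(2 M) keeps it in the ball.\<close>

lemma nonneg_gradient_bound:
 fixes \<phi> :: "'c::euclidean_space => real"
 assumes d: "!!v. v \<in> ball w \<rho> ==> GDERIV \<phi> v :> D v" and pos: "!!v. v \<in> ball w \<rho> ==> 0 <= \<phi> v"
  and l: "!!v. v \<in> ball w \<rho> ==> norm (D v - D w) <= \<Lambda>*norm (v - w)"
  and c: "0 < \<rho>" "0 < \<Lambda>" "0 < M" "norm (D w) <= M"
 shows "(norm (D w))^2 <= (4*\<Lambda> + 4*M/\<rho>)*\<phi> w"
proof -
 define t where "t = min (1/(2*\<Lambda>)) (\<rho>/(2*M))"
 have t: "0 < t" "t*\<Lambda> <= 1/2" "t*M <= \<rho>/2" using c by (auto simp: t_def min_def field_simps)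
 have it: "1/t <= 2*\<Lambda> + 2*M/\<rho>" using c by (auto simp: t_def min_def)
 define v where "v = w - t *\<^sub>R D w"
 have nv: "norm (v - w) = t*norm (D w)" using t by (simp add: v_def)
 also have "... <= t*M" using c t by (intro mult_left_mono) auto
 finally have "norm (v - w) < \<rho>" using t c by linarith
 hence vb: "v \<in> ball w \<rho>" by (simp add: dist_norm norm_minus_commute)
 have "norm (\<phi> v - \<phi> w - (v - w) \<bullet> D w) <= norm (v - w)*(\<Lambda>*norm (v - w))"
 proof (rule differentiable_bound_linearization[where S = "closed_segment w v" and f' = "%z h. h \<bullet> D z"])
  show "w + s *\<^sub>R (v - w) \<in> closed_segment w v" if "s \<in> {0..1}" for s
   using that unfolding closed_segment_def by (auto intro!: exI[of _ s] simp: algebra_simps)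
  have cs: "closed_segment w v \<subseteq> ball w \<rho>" using vb c by (intro closed_segment_subset) auto
  fix z assume z: "z \<in> closed_segment w v"
  show "(\<phi> has_derivative (%h. h \<bullet> D z)) (at z within closed_segment w v)"
   using d[OF subsetD[OF cs z]] unfolding gderiv_def by (rule has_derivative_at_withinI)
  have "onorm ((%h. h \<bullet> D z) - (%h. h \<bullet> D w)) = onorm (%h. h \<bullet> (D z - D w))"
   by (simp add: fun_diff_def inner_diff_right)
  also have "... <= norm (D z - D w)" by (rule onorm_le) (metis Cauchy_Schwarz_ineq2 mult.commute real_norm_def)
  also have "... <= \<Lambda>*norm (z - w)" using z cs by (intro l) auto
  also have "... <= \<Lambda>*norm (v - w)" using segment_bound(1)[OF z] c by (intro mult_left_mono) auto
  finally show "onorm ((%h. h \<bullet> D z) - (%h. h \<bullet> D w)) <= \<Lambda>*norm (v - w)" .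
 qed simp
 hence "\<phi> v - \<phi> w - (v - w) \<bullet> D w <= \<Lambda>*(norm (v - w))^2"
  by (simp add: power2_eq_square algebra_simps abs_le_iff)
 also have "\<Lambda>*(norm (v - w))^2 = (t*\<Lambda>)*(t*(norm (D w))^2)"
  unfolding nv by (simp add: power2_eq_square algebra_simps)
 also have "... <= 1/2*(t*(norm (D w))^2)" using t by (intro mult_right_mono) auto
 finally have "\<phi> v <= \<phi> w - t*(norm (D w))^2/2" by (simp add: v_def power2_norm_eq_inner)
 hence "t*(norm (D w))^2 <= 2*\<phi> w" using pos[OF vb] by linarith
 hence "(norm (D w))^2 <= 2*\<phi> w*(1/t)" using t by (simp add: field_simps)
 also have "... <= 2*\<phi> w*(2*\<Lambda> + 2*M/\<rho>)" using pos[of w] c it by (intro mult_left_mono) auto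
 finally show ?thesis by (simp add: algebra_simps)
qed

context exit_problem
begin

lemma normal_avoid:
 assumes "normal_at z \<sigma> \<eta>" "w \<notin> S"
 shows "\<eta> \<bullet> (w - z) <= \<sigma>*(norm (w - z))^2"
 using assms closure_subset[of "- S"] unfolding normal_at_def by auto

text \<open>If all velocities near z had a \<eta>-component of at most about -\<kappa>, then a
  nearly optimal trajectory would be at depth about \<kappa> s a time s before its end, hence in the
  target before its hitting time.\<close>

lemma hh_nonneg_at_end:
 assumes x: "x \<notin> S" and le: "lim_end x z T" and \<eta>: "normal_at z \<sigma> \<eta>"
 shows "0 <= hh z \<eta>"
proof (rule ccontr)
 assume "\<not> 0 <= hh z \<eta>"
 define \<kappa> where "\<kappa> = - hh z \<eta>"
 have \<kappa>: "0 < \<kappa>" using \<open>\<not> 0 \<le> hh z \<eta>\<close> by (simp add: \<kappa>_def)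
 have T0: "0 < T" using lim_end_facts[OF x le] by blast
 have \<sigma>: "0 <= \<sigma>" using \<eta> unfolding normal_at_def by blast
 let ?M = "norm \<eta>"
 define c where "c = L*?M*N + \<sigma>*N^2 + 1"
 have c: "0 < c" using constants \<sigma> by (simp add: c_def add_nonneg_pos)
 define s where "s = min (T/2) (\<kappa>/(2*c))"
 have s: "0 < s" "s <= T/2" "s*c <= \<kappa>/2" using T0 \<kappa> c by (auto simp: s_def min_def field_simps)
 have "((%eps. ?M*eps + s*(L*?M*(eps + N * s)) + \<sigma>*(eps + N * s)^2) \<longlongrightarrow>
   ?M*0 + s*(L*?M*(0 + N * s)) + \<sigma>*(0 + N * s)^2) (at_right 0)" by (intro tendsto_intros)
 moreover have "?M*0 + s*(L*?M*(0 + N * s)) + \<sigma>*(0 + N * s)^2 < s*\<kappa>"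
 proof -
  have "?M*0 + s*(L*?M*(0 + N * s)) + \<sigma>*(0 + N * s)^2 = s*(s*(c - 1))"
   by (simp add: c_def power2_eq_square algebra_simps)
  also have "... < s*\<kappa>" using s \<kappa> by (intro mult_strict_left_mono) (auto simp: algebra_simps)
  finally show ?thesis .
 qed
 ultimately have "\<forall>\<^sub>F eps in at_right 0. ?M*eps + s*(L*?M*(eps + N * s)) + \<sigma>*(eps + N * s)^2 < s*\<kappa>"
  by (rule eventually_at_right_lessI)
 moreover have "0 < T/2" using T0 by simp
 ultimately obtain eps where eps: "0 < eps" "eps < T/2"
  "?M*eps + s*(L*?M*(eps + N * s)) + \<sigma>*(eps + N * s)^2 < s*\<kappa>" by (rule at_right_witness)
 obtain x' u y T' where h: "\<bar>T' - T\<bar> < eps" "near_opt x' eps u y T'" "norm (y T' - z) < eps"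
  using le eps(1) unfolding lim_end_def by blast
 note u = near_optD(1,2)[OF h(2)]
 let ?t = "T' - s"
 have t: "0 <= ?t" "?t < T'" "?t <= T'" using h(1) s eps by linarith+
 have "y ?t \<notin> S" using near_optD(3)[OF h(2)] t unfolding hitting_time_def by blast
 note av = normal_avoid[OF \<eta> this]
 have cl: "norm (y q - z) <= eps + N * s" if q: "q \<in> {?t..T'}" for q
 proof -
  have "norm (y T' - y q) <= N*(T' - q)" by (rule trajectory_lipschitz[OF u]) (use q t in auto)
  also have "... <= N * s" using q constants by (intro mult_left_mono) auto
  finally have "norm (y T' - y q) <= N * s" .
  moreover have "norm (y q - z) <= norm (y T' - y q) + norm (y T' - z)" by norm
  ultimately show ?thesis using h(3) by simp
 qed
 have "\<eta> \<bullet> (y T' - y ?t) <= (- \<kappa> + L*?M*(eps + N * s))*(T' - ?t)"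
 proof (rule primitive_on_inner_le[OF trajectory_primitive(2)[OF u] t(1,3) order.refl])
  fix q assume q: "q \<in> {?t..T'}"
  have "\<eta> \<bullet> f (y q) (u q) <= hh (y q) \<eta>" using q t by (intro hh_ge control_in[OF u(1)]) auto
  also have "... <= hh z \<eta> + L*?M*norm (y q - z)" using hh_lipschitz[of "y q" \<eta> z \<eta>] by simp
  also have "L*?M*norm (y q - z) <= L*?M*(eps + N * s)" using cl[OF q] constants by (intro mult_left_mono) auto
  finally show "\<eta> \<bullet> f (y q) (u q) <= - \<kappa> + L*?M*(eps + N * s)" by (simp add: \<kappa>_def)
 qed
 hence 1: "\<eta> \<bullet> (y T' - y ?t) <= - (s*\<kappa>) + s*(L*?M*(eps + N * s))" by (simp add: algebra_simps)
 have "\<bar>\<eta> \<bullet> (y T' - z)\<bar> <= ?M*eps"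
  using order_trans[OF Cauchy_Schwarz_ineq2 mult_left_mono[OF less_imp_le[OF h(3)] norm_ge_zero]] .
 moreover have "\<eta> \<bullet> (y ?t - z) = \<eta> \<bullet> (y T' - z) - \<eta> \<bullet> (y T' - y ?t)" by (simp add: algebra_simps)
 moreover have "\<sigma>*(norm (y ?t - z))^2 <= \<sigma>*(eps + N * s)^2"
  using cl[of ?t] t \<sigma> by (intro mult_left_mono power_mono) auto
 ultimately show False using av 1 eps(3) by linarith
qed

text \<open>If the limiting velocity were tangent or outward with respect to a nondegenerate normal
 \<open>\<eta>\<close>, then shortly before the end a detour of length \<open>o(s)\<close> would reach the ball with
 normal \<open>\<eta>\<close>, saving a time of order \<open>s\<close>.\<close>

lemma limiting_velocity_transversal:
 assumes x: "x \<notin> S" and V: "continuous_on UNIV V" and le: "lim_end x z T"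
  and \<xi>: "norm \<xi> = 1" "normal_at z \<sigma>1 \<xi>" and \<eta>: "normal_at z \<sigma>2 \<eta>" "0 < hh z \<eta>"
  and C: "0 <= C" and v: "!!om. om \<in> U ==> (norm (f z om - v))^2 <= C*(- (\<xi> \<bullet> f z om))"
 shows "0 < \<eta> \<bullet> v"
proof (rule ccontr)
 assume "\<not> 0 < \<eta> \<bullet> v"
 hence \<eta>v: "\<eta> \<bullet> v <= 0" by simp
 define \<kappa> where "\<kappa> = hh z \<eta>"
 have \<kappa>: "0 < \<kappa>" using \<eta> by (simp add: \<kappa>_def)
 have T0: "0 < T" using lim_end_facts[OF x le] by blast
 have \<sigma>: "0 <= \<sigma>1" "0 <= \<sigma>2" using \<xi> \<eta> unfolding normal_at_def by blast+
 obtain e where e: "0 < e" "e <= 1" "cball x e \<inter> S = {}" using compact_ball_outside[OF x] by blast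
 obtain \<tau> B R dlt0 where uc: "uniform_constants (cball x e) \<tau> B R dlt0"
  using uniform_constants_exist[OF compact_cball e(3) continuous_on_subset[OF V]] by blast
 hence \<tau>: "0 < \<tau>" "0 < dlt0" "0 <= R" unfolding uniform_constants_def by auto
 let ?M = "norm \<eta>"
 define b where "b = r0 - G*N"
 have b: "0 < b" using G by (simp add: b_def)
 \<comment> \<open>The detour lasts \<mu> s. With this \<mu> its running cost and its effect on
   \<open>g\<close> use up at most half of the saving b s from arriving earlier.\<close>
 define \<mu> where "\<mu> = min 1 (b/(2*(R + G*N + 1)))"
 have RG: "0 < R + G*N + 1" using \<tau> G constants by (simp add: add_nonneg_pos)
 have "(R + G*N + 1)*\<mu> <= (R + G*N + 1)*(b/(2*(R + G*N + 1)))"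
  unfolding \<mu>_def using RG by (intro mult_left_mono) auto
 also have "... = b/2"
 proof -
  have "q*(b/(2*q)) = b/2" if "0 < q" for q :: real using that by (simp add: field_simps)
  from this[OF RG] show ?thesis .
 qed
 finally have \<mu>: "0 < \<mu>" "\<mu> <= 1" "(R + G*N + 1)*\<mu> <= b/2" using b RG by (auto simp: \<mu>_def)
 define \<alpha> where "\<alpha> = \<mu>*\<kappa>/(4*(?M + 1))"
 have M1: "0 < ?M + 1" by (simp add: add_nonneg_pos)
 have \<alpha>: "0 < \<alpha>" "?M*\<alpha> <= \<mu>*\<kappa>/4"
 proof -
  show "0 < \<alpha>" using \<mu> \<kappa> M1 by (simp add: \<alpha>_def)
  have "?M*\<alpha> <= (?M + 1)*\<alpha>" using \<open>0 < \<alpha>\<close> by (intro mult_right_mono) auto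
  also have "... = \<mu>*\<kappa>/4"
  proof -
   have "q*(c/(4*q)) = c/4" if "0 < q" for c q :: real using that by (simp add: field_simps)
   from this[OF M1] show ?thesis unfolding \<alpha>_def .
  qed
  finally show "?M*\<alpha> <= \<mu>*\<kappa>/4" .
 qed
 \<comment> \<open>For every velocity, |f - v| \<le> \<alpha> + |f - v|^2/\<alpha>, and the square
   is at most C times the loss -\<xi> . f. Hence, with the penalty \<beta>, the direction \<eta> +
   \<beta> \<xi> meets each velocity at z in at most |\<eta>| \<alpha>.\<close>
 define \<beta> where "\<beta> = ?M*C/\<alpha>"
 have \<beta>: "0 <= \<beta>" using \<alpha> C by (simp add: \<beta>_def)
 \<comment> \<open>All errors of the detour. For \<open>eps = 0\<close> they are s |\<eta>| \<alpha>
   plus a term of order s^2, which is less than the gain \<mu> s \<kappa> once \<alpha> and then s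
   are small.\<close>
 let ?P = "%eps s. ?M*eps + s*(?M*\<alpha> + (\<beta> + ?M)*L*(eps + N * s)) + \<beta>*(eps + \<sigma>1*(eps + N * s)^2)
   + ?M*(\<mu> * s)*L*(eps + N * s + N*(\<mu> * s)) + \<sigma>2*(eps + N * s + N*(\<mu> * s))^2"
 define c where "c = (\<beta> + ?M)*L*N + \<beta>*\<sigma>1*N^2 + ?M*\<mu>*L*N*(1 + \<mu>) + \<sigma>2*N^2*(1 + \<mu>)^2"
 have P0: "?P 0 s = s*(?M*\<alpha> + s*c)" for s by (simp add: c_def power2_eq_square algebra_simps)
 have "((%s. s*c) \<longlongrightarrow> 0*c) (at_right 0)" by (intro tendsto_intros)
 hence s1: "\<forall>\<^sub>F s in at_right 0. s*c < \<mu>*\<kappa>/4" by (rule eventually_at_right_lessI) (use \<mu> \<kappa> in auto)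
 have "((%s. N*(s + \<mu> * s)) \<longlongrightarrow> N*(0 + \<mu>*0)) (at_right 0)" by (intro tendsto_intros)
 hence s2: "\<forall>\<^sub>F s in at_right 0. N*(s + \<mu> * s) < min dlt0 1" by (rule eventually_at_right_lessI) (use \<tau> in auto)
 have "0 < min (T/4) 1" using T0 by simp
 from at_right_witness[OF eventually_conj[OF s1 s2] this]
 obtain s where s: "0 < s" "s < min (T/4) 1" "s*c < \<mu>*\<kappa>/4 & N*(s + \<mu> * s) < min dlt0 1" by blast
 have "?P 0 s < (\<mu> * s)*\<kappa>"
 proof -
  have "?M*\<alpha> + s*c < \<mu>*\<kappa>" using \<alpha> s \<mu> \<kappa> mult_pos_pos[OF \<mu>(1) \<kappa>] by linarith
  hence "s*(?M*\<alpha> + s*c) < s*(\<mu>*\<kappa>)" using s by (intro mult_strict_left_mono) auto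
  thus ?thesis unfolding P0 by (simp add: algebra_simps)
 qed
 moreover have "((%eps. ?P eps s) \<longlongrightarrow> ?P 0 s) (at_right 0)" by (intro tendsto_intros)
 ultimately have e1: "\<forall>\<^sub>F eps in at_right 0. ?P eps s < (\<mu> * s)*\<kappa>" by (intro eventually_at_right_lessI)
 have "0 < min (min e (T/2)) (s*b/2)" using e T0 s b by simp
 from at_right_witness[OF e1 this]
 obtain eps where eps: "0 < eps" "eps < min (min e (T/2)) (s*b/2)" "?P eps s < (\<mu> * s)*\<kappa>" by blast
 obtain x' u y T' where h: "norm (x' - x) < eps" "\<bar>T' - T\<bar> < eps" "near_opt x' eps u y T'" "norm (y T' - z) < eps"
  using le eps(1) unfolding lim_end_def by blast
 note u = near_optD(1,2)[OF h(3)]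
 have x'K: "x' \<in> cball x e" using h eps by (auto simp: dist_norm norm_minus_commute)
 hence x'S: "x' \<notin> S" using e by auto
 have T': "0 < T'" "T' <= \<tau>" "ball (y T') dlt0 \<subseteq> Nbd" "norm (y T') <= B" "!!s. s \<in> {0..\<tau> + 1} ==> norm (y s) <= B"
  using uniform_constantsD[OF uc x'K h(3)] eps e by auto
 let ?t = "T' - s"
 have t: "0 <= ?t" "?t < T'" "?t <= T'" using h(2) s eps by (auto simp: abs_less_iff)
 have ytS: "y ?t \<notin> S" using near_optD(3)[OF h(3)] t unfolding hitting_time_def by blast
 have cl: "norm (y q - z) <= eps + N * s" if q: "q \<in> {?t..T'}" for q
 proof -
  have "norm (y T' - y q) <= N*(T' - q)" by (rule trajectory_lipschitz[OF u]) (use q t in auto)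
  also have "... <= N * s" using q constants by (intro mult_left_mono) auto
  finally have "norm (y T' - y q) <= N * s" .
  moreover have "norm (y q - z) <= norm (y T' - y q) + norm (y T' - z)" by norm
  ultimately show ?thesis using h(4) by simp
 qed
 have "(\<eta> + \<beta> *\<^sub>R \<xi>) \<bullet> (y T' - y ?t) <= (?M*\<alpha> + (\<beta> + ?M)*L*(eps + N * s))*(T' - ?t)"
 proof (rule primitive_on_inner_le[OF trajectory_primitive(2)[OF u] t(1,3) order.refl])
  fix q assume q: "q \<in> {?t..T'}"
  have uq: "u q \<in> U" using q t by (intro control_in[OF u(1)]) auto
  let ?g = "f z (u q)"
  have nf: "norm (f (y q) (u q) - ?g) <= L*(eps + N * s)"
   using order_trans[OF f_lipschitz[OF uq] mult_left_mono[OF cl[OF q]]] constants by simp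
  have "\<eta> \<bullet> ?g <= \<eta> \<bullet> (?g - v)" using \<eta>v by (simp add: inner_diff_right)
  also have "... <= ?M*norm (?g - v)" using Cauchy_Schwarz_ineq2[of \<eta> "?g - v"] by (simp add: abs_le_iff)
  finally have \<eta>g: "\<eta> \<bullet> ?g <= ?M*norm (?g - v)" .
  have "norm (?g - v) <= \<alpha> + (norm (?g - v))^2/\<alpha>"
  proof -
   have "0 <= (norm (?g - v) - \<alpha>)^2 + \<alpha>*norm (?g - v)" using \<alpha> by simp
   hence "\<alpha>*norm (?g - v) <= \<alpha>^2 + (norm (?g - v))^2" by (simp add: power2_eq_square algebra_simps)
   thus ?thesis using \<alpha> by (simp add: field_simps power2_eq_square)
  qed
  also have "(norm (?g - v))^2/\<alpha> <= C*(- (\<xi> \<bullet> ?g))/\<alpha>"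
   using v[OF uq] \<alpha> by (intro divide_right_mono) auto
  finally have "norm (?g - v) <= \<alpha> + C*(- (\<xi> \<bullet> ?g))/\<alpha>" by simp
  from mult_left_mono[OF this norm_ge_zero[of \<eta>]] \<eta>g
  have "\<eta> \<bullet> ?g <= ?M*(\<alpha> + C*(- (\<xi> \<bullet> ?g))/\<alpha>)" by linarith
  also have "... = ?M*\<alpha> + \<beta>*(- (\<xi> \<bullet> ?g))" by (simp add: \<beta>_def algebra_simps)
  finally have "\<eta> \<bullet> ?g <= ?M*\<alpha> + \<beta>*(- (\<xi> \<bullet> ?g))" .
  moreover have "(\<eta> + \<beta> *\<^sub>R \<xi>) \<bullet> f (y q) (u q) = \<eta> \<bullet> ?g + \<beta>*(\<xi> \<bullet> ?g) + (\<eta> + \<beta> *\<^sub>R \<xi>) \<bullet> (f (y q) (u q) - ?g)"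
   by (simp add: algebra_simps)
  moreover have "(\<eta> + \<beta> *\<^sub>R \<xi>) \<bullet> (f (y q) (u q) - ?g) <= (\<beta> + ?M)*(L*(eps + N * s))"
  proof -
   have "norm (\<eta> + \<beta> *\<^sub>R \<xi>) <= \<beta> + ?M" using norm_triangle_ineq[of \<eta> "\<beta> *\<^sub>R \<xi>"] \<xi>(1) \<beta> by simp
   hence "norm (\<eta> + \<beta> *\<^sub>R \<xi>)*norm (f (y q) (u q) - ?g) <= (\<beta> + ?M)*(L*(eps + N * s))"
    using nf \<beta> by (intro mult_mono) auto
   thus ?thesis using Cauchy_Schwarz_ineq2[of "\<eta> + \<beta> *\<^sub>R \<xi>" "f (y q) (u q) - ?g"] by linarith
  qed
  ultimately show "(\<eta> + \<beta> *\<^sub>R \<xi>) \<bullet> f (y q) (u q) <= ?M*\<alpha> + (\<beta> + ?M)*L*(eps + N * s)" by (simp add: mult.assoc)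
 qed
 hence 1: "\<eta> \<bullet> (y T' - y ?t) + \<beta>*(\<xi> \<bullet> (y T' - y ?t)) <= s*(?M*\<alpha> + (\<beta> + ?M)*L*(eps + N * s))"
  by (simp add: inner_add_left mult.commute)
 have clt: "norm (y ?t - z) <= eps + N * s" using cl[of ?t] s by auto
 \<comment> \<open>Before its hitting time the trajectory avoids the target, so the normal
   inequality for \<xi> holds at time T' - s. Hence the \<xi>-component drops by at most
   \<open>eps\<close> plus order s^2 afterwards, and the penalty \<beta> is harmless.\<close>
 have "\<xi> \<bullet> (y ?t - z) <= \<sigma>1*(eps + N * s)^2"
  using order_trans[OF normal_avoid[OF \<xi>(2) ytS] mult_left_mono[OF power_mono[OF clt norm_ge_zero] \<sigma>(1)]] .
 moreover have "\<bar>\<xi> \<bullet> (y T' - z)\<bar> <= eps" using Cauchy_Schwarz_ineq2[of \<xi> "y T' - z"] \<xi>(1) h(4) by simp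
 moreover have "\<xi> \<bullet> (y T' - y ?t) = \<xi> \<bullet> (y T' - z) - \<xi> \<bullet> (y ?t - z)" by (simp add: algebra_simps)
 ultimately have "- (eps + \<sigma>1*(eps + N * s)^2) <= \<xi> \<bullet> (y T' - y ?t)" by linarith
 hence "\<beta>*(- (eps + \<sigma>1*(eps + N * s)^2)) <= \<beta>*(\<xi> \<bullet> (y T' - y ?t))" using \<beta> by (rule mult_left_mono)
 hence 2: "\<eta> \<bullet> (y T' - y ?t) <= s*(?M*\<alpha> + (\<beta> + ?M)*L*(eps + N * s)) + \<beta>*(eps + \<sigma>1*(eps + N * s)^2)"
  using 1 by linarith
 have "\<bar>\<eta> \<bullet> (y T' - z)\<bar> <= ?M*eps"
  using order_trans[OF Cauchy_Schwarz_ineq2 mult_left_mono[OF less_imp_le[OF h(4)] norm_ge_zero]] .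
 moreover have "\<eta> \<bullet> (y ?t - z) = \<eta> \<bullet> (y T' - z) - \<eta> \<bullet> (y T' - y ?t)" by (simp add: algebra_simps)
 ultimately have 3: "- (?M*eps + s*(?M*\<alpha> + (\<beta> + ?M)*L*(eps + N * s)) + \<beta>*(eps + \<sigma>1*(eps + N * s)^2)) <= \<eta> \<bullet> (y ?t - z)"
  using 2 by linarith
 obtain om where w: "om \<in> U" "hh z \<eta> = \<eta> \<bullet> f z om" by (rule hh_attained)
 define \<theta> where "\<theta> = \<mu> * s"
 have \<theta>: "0 < \<theta>" "\<theta> <= s" using \<mu> s by (auto simp: \<theta>_def mult_left_le_one_le)
 define u' where "u' = (%r. if r \<in> {?t..T'} then om else u r)"
 have u': "control U u'" unfolding u'_def by (rule control_splice[OF u(1) w(1)])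
 obtain y' where y': "trajectory f x' u' y'" using trajectory_exists[OF u'] by blast
 have same: "u' r = u r" if "r \<in> {0..?t}" "r \<notin> {?t..?t}" for r using that by (auto simp: u'_def)
 have yeq: "y' r = y r" if "r \<in> {0..?t}" for r
  using trajectory_compare[OF u u' y' t(1) order.refl order.refl same that] by simp
 let ?t' = "?t + \<theta>"
 have t': "0 <= ?t'" "?t <= ?t'" "?t' <= T'" using t \<theta> by auto
 have "norm (y' ?t' - y' ?t - \<theta> *\<^sub>R f z om) <= \<theta>*L*(norm (y' ?t - z) + N*\<theta>)"
  by (rule trajectory_straight[OF u' y' t(1) _ w(1)]) (use \<theta> t' in \<open>auto simp: u'_def\<close>)
 also have "... <= \<theta>*L*(eps + N * s + N*\<theta>)"
  using clt yeq[of ?t] t \<theta> constants by (intro mult_left_mono) auto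
 finally have str: "norm (y' ?t' - y ?t - \<theta> *\<^sub>R f z om) <= \<theta>*L*(eps + N * s + N*\<theta>)" using yeq[of ?t] t by simp
 have "\<bar>\<eta> \<bullet> (y' ?t' - y ?t - \<theta> *\<^sub>R f z om)\<bar> <= ?M*(\<theta>*L*(eps + N * s + N*\<theta>))"
  using order_trans[OF Cauchy_Schwarz_ineq2 mult_left_mono[OF str norm_ge_zero]] .
 moreover have "\<eta> \<bullet> (y' ?t' - z) = \<eta> \<bullet> (y ?t - z) + \<theta>*\<kappa> + \<eta> \<bullet> (y' ?t' - y ?t - \<theta> *\<^sub>R f z om)"
  by (simp add: \<kappa>_def w(2) algebra_simps)
 ultimately have 4: "\<theta>*\<kappa> - ?M*(\<theta>*L*(eps + N * s + N*\<theta>)) + \<eta> \<bullet> (y ?t - z) <= \<eta> \<bullet> (y' ?t' - z)" by linarith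
 have d1: "norm (y' ?t' - y ?t) <= N*\<theta>" using trajectory_lipschitz[OF u' y' t(1) t'(2)] yeq[of ?t] t by simp
 have "norm (y' ?t' - z) <= norm (y' ?t' - y ?t) + norm (y ?t - z)" by norm
 hence "norm (y' ?t' - z) <= eps + N * s + N*\<theta>" using d1 clt by linarith
 hence "\<sigma>2*(norm (y' ?t' - z))^2 <= \<sigma>2*(eps + N * s + N*\<theta>)^2"
  using \<sigma> by (intro mult_left_mono power_mono) auto
 moreover have "?M*(\<theta>*L*(eps + N * s + N*\<theta>)) = ?M*\<theta>*L*(eps + N * s + N*\<theta>)" by simp
 ultimately have "\<sigma>2*(norm (y' ?t' - z))^2 < \<eta> \<bullet> (y' ?t' - z)" using 3 4 eps(3) unfolding \<theta>_def[symmetric] by linarith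
 hence yS: "y' ?t' \<in> S" using normal_avoid[OF \<eta>(1), of "y' ?t'"] by force
 have "norm (y T' - y ?t) <= N * s" using trajectory_lipschitz[OF u t(1,3)] by simp
 moreover have "norm (y' ?t' - y T') <= norm (y' ?t' - y ?t) + norm (y T' - y ?t)" by norm
 ultimately have yy: "norm (y' ?t' - y T') <= N*(s + \<theta>)" using d1 by (simp add: algebra_simps)
 also have "... < dlt0" using s(3) by (simp add: \<theta>_def)
 finally have dN: "y' ?t' \<in> Nbd" "y T' \<in> Nbd"
  using T'(3) \<tau>(2) by (auto simp: dist_norm norm_minus_commute intro!: subsetD[OF T'(3)])
 have "V x' <= cost u' y' ?t' + g (y' ?t')" by (rule V_le_arrival[OF u' y' t'(1) yS dN(1) x'S])
 moreover have "cost u' y' ?t' = cost u' y' ?t + integral {?t..?t'} (%q. r (y' q) (u' q))"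
  by (rule cost_split[OF u' y' t(1) t'(2)])
 moreover have "cost u' y' ?t = cost u y ?t" unfolding cost_def
  by (rule integral_spike[of "{?t}"]) (use yeq in \<open>auto simp: u'_def\<close>)
 moreover have "integral {?t..?t'} (%q. r (y' q) (u' q)) <= integral {?t..?t'} (%_. R)"
 proof (rule integral_le[OF cost_integrable[OF u' y' t(1)]])
  fix q assume q: "q \<in> {?t..?t'}"
  have "norm (y' q - y' ?t) <= N*(q - ?t)" using q t by (intro trajectory_lipschitz[OF u' y']) auto
  also have "N*(q - ?t) <= N*\<theta>" using q constants by (intro mult_left_mono) auto
  finally have "norm (y' q - y' ?t) <= N*\<theta>" .
  moreover have "norm (y' ?t) <= B" using T'(5)[of ?t] T' t yeq[of ?t] s by auto
  ultimately have "norm (y' q) <= B + N*\<theta>" using norm_triangle_ineq[of "y' ?t" "y' q - y' ?t"] by simp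
  moreover have "N*\<theta> <= N*(s + \<theta>)" "N*(s + \<theta>) < 1"
   using s constants by (auto simp: \<theta>_def intro!: mult_left_mono)
  ultimately have "norm (y' q) <= B + 1" by linarith
  thus "r (y' q) (u' q) <= R" using uc control_in[OF u', of q] q t unfolding uniform_constants_def by auto
 qed (use \<theta> in auto)
 moreover have "integral {?t..?t'} (%_. R) = R*\<theta>" using \<theta> by simp
 moreover have "cost u y ?t + r0*(T' - ?t) <= cost u y T'" by (rule cost_diff_ge[OF u t(1,3)])
 moreover have "\<bar>g (y' ?t') - g (y T')\<bar> <= G*(N*(s + \<theta>))"
  using order_trans[OF g_lipschitz[OF dN(2,1)] mult_left_mono[OF yy G(1)]] .
 moreover have "r0*(T' - ?t) = r0 * s" by simp
 ultimately have "r0 * s <= eps + R*\<theta> + G*(N*(s + \<theta>))" using near_optD(4)[OF h(3)] by linarith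
 hence "s*b <= eps + s*((R + G*N)*\<mu>)" by (simp add: b_def \<theta>_def algebra_simps)
 moreover have "s*((R + G*N)*\<mu>) <= s*(b/2)" using \<mu> s by (intro mult_left_mono) (auto simp: algebra_simps)
 ultimately show False using eps by simp
qed

end

section \<open>Hamiltonian arcs\<close>

lemma norm_Pair_le_add: "norm (a, b) <= norm a + norm b"
proof -
 have "(a, b) = (a, 0) + (0, b)" by simp
 thus ?thesis by (metis norm_Pair1 norm_Pair2 norm_triangle_ineq)
qed

lemma norm_fst_snd_le: "norm (fst w) <= norm w" "norm (snd w) <= norm w" by (cases w; simp add: norm_fst_le norm_snd_le)+

locale smooth_exit_problem = exit_problem U S Nbd f Df r g V N L r0 \<rho>0 G
 for U :: "'b::euclidean_space set" and S Nbd :: "'a::euclidean_space set"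
  and f :: "'a => 'b => 'a" and Df :: "'a => 'b => 'a \<Rightarrow>\<^sub>L 'a"
  and r :: "'a => 'b => real" and g V :: "'a => real" and N L r0 \<rho>0 G :: real +
 assumes V_continuous: "continuous_on UNIV V"
  and H0_C11: "C11_on (UNIV \<times> - {0}) (%(x, p). H0 U f x p)"
begin

lemma hh_gradient:
 obtains W where "!!w. snd w ~= 0 ==> GDERIV (%w. hh (fst w) (snd w)) w :> W w"
  "locally_lipschitz_on (UNIV \<times> - {0}) W"
proof -
 obtain D where D: "!!w. w \<in> UNIV \<times> - {0} ==> GDERIV (%(x, p). H0 U f x p) w :> D w"
  and l: "locally_lipschitz_on (UNIV \<times> - {0}) D" using H0_C11 unfolding C11_on_def by blast
 \<comment> \<open>\<open>hh\<close> is \<open>H0\<close> composed with the linear isometry J, so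
   its gradient is conjugated by J and keeps the local Lipschitz constants.\<close>
 define J where "J w = (fst w, - snd w)" for w :: "'a \<times> 'a"
 define W where "W w = J (D (J w))" for w
 have dJ: "dist (J v) (J w) = dist v w" for v w unfolding J_def dist_prod_def by (simp add: dist_norm norm_minus_commute)
 have H0_eq: "H0 U f x (- p) = hh x p" for x p by (simp add: H0_def hh_def)
 show thesis
 proof (rule that[of W])
  fix w :: "'a \<times> 'a" assume w: "snd w ~= 0"
  have j: "(J has_derivative J) (at w)" unfolding J_def[abs_def] by (auto intro!: derivative_eq_intros)
  have "J w \<in> UNIV \<times> - {0}" using w by (simp add: J_def)
  from D[OF this] have "((%(x, p). H0 U f x p) has_derivative (%h. h \<bullet> D (J w))) (at (J w))" unfolding gderiv_def .
  from has_derivative_compose[OF j this]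
  have "((%v. case J v of (x, p) => H0 U f x p) has_derivative (%h. J h \<bullet> D (J w))) (at w)" .
  moreover have "(%v. case J v of (x, p) => H0 U f x p) = (%w. hh (fst w) (snd w))" by (simp add: J_def H0_eq)
  moreover have "(%h. J h \<bullet> D (J w)) = (%h. h \<bullet> W w)" by (simp add: J_def W_def inner_prod_def fun_eq_iff)
  ultimately show "GDERIV (%w. hh (fst w) (snd w)) w :> W w" unfolding gderiv_def by (simp only:)
 next
  show "locally_lipschitz_on (UNIV \<times> - {0}) W" unfolding locally_lipschitz_on_def
  proof
   fix w :: "'a \<times> 'a" assume "w \<in> UNIV \<times> - {0}"
   hence "J w \<in> UNIV \<times> - {0}" by (auto simp: J_def)
   from bspec[OF l[unfolded locally_lipschitz_on_def] this]
   obtain e C where e: "0 < e" "C-lipschitz_on (ball (J w) e \<inter> (UNIV \<times> - {0})) D" by (elim exE conjE)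
   have "C-lipschitz_on (ball w e \<inter> (UNIV \<times> - {0})) W"
   proof (rule lipschitz_onI)
    fix v v' assume v: "v \<in> ball w e \<inter> (UNIV \<times> - {0})" "v' \<in> ball w e \<inter> (UNIV \<times> - {0})"
    hence "J v \<in> ball (J w) e \<inter> (UNIV \<times> - {0})" "J v' \<in> ball (J w) e \<inter> (UNIV \<times> - {0})"
     unfolding Int_iff mem_ball dJ by (auto simp: J_def)
    from lipschitz_onD[OF e(2) this] show "dist (W v) (W v') <= C*dist v v'" unfolding W_def dJ .
   qed (use lipschitz_on_nonneg[OF e(2)] in auto)
   with e(1) show "\<exists>e>0. \<exists>C. C-lipschitz_on (ball w e \<inter> (UNIV \<times> - {0})) W" by (intro exI conjI)
  qed
 qed
qed

definition phase_box :: "real => real => real => ('a \<times> 'a) set" where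
 "phase_box B a b = {w. norm (fst w) <= B & a <= norm (snd w) & norm (snd w) <= b}"

lemma compact_phase_box: "compact (phase_box B a b)"
proof (rule compact_eq_bounded_closed[THEN iffD2], rule conjI)
 have "phase_box B a b \<subseteq> cball 0 B \<times> cball 0 b" unfolding phase_box_def by auto
 thus "bounded (phase_box B a b)" using bounded_Times bounded_cball bounded_subset by metis
 show "closed (phase_box B a b)" unfolding phase_box_def by (intro closed_Collect_conj closed_Collect_le continuous_intros)
qed

text \<open>For \<open>W\<close> the gradient of \<open>hh\<close> and the pair with
  \<open>adj\<close> and \<open>f\<close> the gradient of p . f(x, om), this bounds their distance
  by the square root of the amount by which om fails to be a maximizer. The costates stay in an
  annulus, away from 0.\<close>

definition hamiltonian_bound :: "('a \<times> 'a => 'a \<times> 'a) => real => real => real => bool" where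
 "hamiltonian_bound W B a b \<longleftrightarrow> (\<exists>C \<Lambda>. 0 <= C & \<Lambda>-lipschitz_on (phase_box B a b) W &
  (\<forall>x p om. (x, p) \<in> phase_box B a b & om \<in> U -->
    (norm (W (x, p) - (adj (Df x om) p, f x om)))^2 <= C*(hh x p - p \<bullet> f x om)))"

text \<open>For a \<open>C\<^sup>1\<^sup>,\<^sup>1\<close> Hamiltonian, nearly maximizing controls move nearly along the
 Hamiltonian vector field.\<close>

lemma hamiltonian_field:
 obtains W where "!!B a b. 0 < a ==> hamiltonian_bound W B a b"
proof -
 obtain W where W: "!!w. snd w ~= 0 ==> GDERIV (%w. hh (fst w) (snd w)) w :> W w"
  "locally_lipschitz_on (UNIV \<times> - {0}) W" by (rule hh_gradient) blast
 have "hamiltonian_bound W B a b" if a: "0 < a" for B a b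
 proof -
  let ?K = "phase_box (B + 1) (a/2) (b + 1)"
  have KU: "?K \<subseteq> UNIV \<times> - {0}" using a by (auto simp: phase_box_def)
  obtain \<Lambda> where \<Lambda>: "\<Lambda>-lipschitz_on ?K W"
   by (rule locally_lipschitz_on_compact[OF W(2) compact_phase_box KU])
  have \<Lambda>0: "0 <= \<Lambda>" by (rule lipschitz_on_nonneg[OF \<Lambda>])
  have "bounded (W ` ?K)"
   using lipschitz_on_continuous_on[OF \<Lambda>] compact_phase_box compact_continuous_image compact_imp_bounded by blast
  then obtain M0 where M0: "!!w. w \<in> ?K ==> norm (W w) <= M0" unfolding bounded_iff by blast
  \<comment> \<open>Balls of this radius about points of the given box stay in the enlarged box
    \<open>?K\<close>, in particular away from the zero costate.\<close>
  define \<rho> where "\<rho> = min 1 (a/2)"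
  have \<rho>: "0 < \<rho>" using a by (simp add: \<rho>_def)
  define \<Lambda>' where "\<Lambda>' = \<Lambda> + (2*L + L*\<bar>b\<bar>)"
  have \<Lambda>': "0 < \<Lambda>'" using \<Lambda>0 constants by (simp add: \<Lambda>'_def add_nonneg_pos add_pos_nonneg)
  define M where "M = \<bar>M0\<bar> + L*\<bar>b\<bar> + N"
  have M: "0 < M" using constants by (simp add: M_def add_nonneg_pos)
  have sub: "phase_box B a b \<subseteq> ?K" using a by (auto simp: phase_box_def)
  have main: "(norm (W (x, p) - (adj (Df x om) p, f x om)))^2 <= (4*\<Lambda>' + 4*M/\<rho>)*(hh x p - p \<bullet> f x om)"
   if xp: "(x, p) \<in> phase_box B a b" and w: "om \<in> U" for x p om
  proof -
   \<comment> \<open>\<phi> is nonnegative and vanishes exactly where om is a maximizer;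
     \<open>D\<close> is its Lipschitz gradient, so \<open>nonneg_gradient_bound\<close> gives the
     square-root estimate.\<close>
   define \<phi> where "\<phi> v = hh (fst v) (snd v) - snd v \<bullet> f (fst v) om" for v
   define D where "D v = W v - (adj (Df (fst v) om) (snd v), f (fst v) om)" for v
   have nb: "norm p <= \<bar>b\<bar>" using xp by (auto simp: phase_box_def)
   have vb: "v \<in> ?K" "snd v ~= 0" if v: "v \<in> ball (x, p) \<rho>" for v
   proof -
    have d: "norm (fst v - x) < \<rho>" "norm (snd v - p) < \<rho>"
     using v dist_fst_le[of "(x, p)" v] dist_snd_le[of "(x, p)" v] by (auto simp: dist_norm norm_minus_commute)
    have "norm (fst v) <= norm x + norm (fst v - x)" by norm
    moreover have "norm (snd v) <= norm p + norm (snd v - p)" by norm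
    moreover have "norm p <= norm (snd v) + norm (snd v - p)" by norm
    moreover have "\<rho> <= 1" "\<rho> <= a/2" by (auto simp: \<rho>_def)
    ultimately show "v \<in> ?K" using d xp unfolding phase_box_def by auto
    thus "snd v ~= 0" using KU by (cases v) auto
   qed
   have "(norm (D (x, p)))^2 <= (4*\<Lambda>' + 4*M/\<rho>)*\<phi> (x, p)"
   proof (rule nonneg_gradient_bound[OF _ _ _ \<rho> \<Lambda>' M])
    fix v assume v: "v \<in> ball (x, p) \<rho>"
    have 1: "((%w. hh (fst w) (snd w)) has_derivative (%h. h \<bullet> W v)) (at v)"
     using W(1)[OF vb(2)[OF v]] unfolding gderiv_def .
    have 2: "((%w. f (fst w) om) has_derivative (%h. blinfun_apply (Df (fst v) om) (fst h))) (at v)"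
     by (rule has_derivative_compose[OF has_derivative_fst[OF has_derivative_ident] f_derivative[OF w]])
    have 3: "((%w. snd w \<bullet> f (fst w) om) has_derivative
      (%h. snd v \<bullet> blinfun_apply (Df (fst v) om) (fst h) + snd h \<bullet> f (fst v) om)) (at v)"
     by (rule has_derivative_inner[OF has_derivative_snd[OF has_derivative_ident] 2])
    have "(\<phi> has_derivative (%h. h \<bullet> W v - (snd v \<bullet> blinfun_apply (Df (fst v) om) (fst h) + snd h \<bullet> f (fst v) om))) (at v)"
     unfolding \<phi>_def[abs_def] by (rule has_derivative_diff[OF 1 3])
    moreover have "(%h. h \<bullet> W v - (snd v \<bullet> blinfun_apply (Df (fst v) om) (fst h) + snd h \<bullet> f (fst v) om)) = (%h. h \<bullet> D v)"
     by (auto simp: D_def inner_diff_right inner_prod_def adj_inner[symmetric] inner_commute)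
    ultimately show "GDERIV \<phi> v :> D v" unfolding gderiv_def by (simp only:)
    show "0 <= \<phi> v" unfolding \<phi>_def using hh_ge[OF w, of "snd v" "fst v"] by simp
    have xpK: "(x, p) \<in> ?K" using sub xp by blast
    have "norm (W v - W (x, p)) <= \<Lambda>*norm (v - (x, p))"
     using lipschitz_onD[OF \<Lambda> vb(1)[OF v] xpK] by (simp add: dist_norm)
    moreover have "norm ((adj (Df (fst v) om) (snd v), f (fst v) om) - (adj (Df x om) p, f x om)) <= (2*L + L*\<bar>b\<bar>)*norm (v - (x, p))"
    proof -
     let ?n = "norm (v - (x, p))"
     have dd: "norm (fst v - x) <= ?n" "norm (snd v - p) <= ?n"
      using norm_fst_snd_le[of "v - (x, p)"] by (simp_all add: fst_diff snd_diff)
     have eq: "adj (Df (fst v) om) (snd v) - adj (Df x om) p = adj (Df (fst v) om) (snd v - p) + adj (Df (fst v) om - Df x om) p"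
      by (simp add: adj_diff_right adj_diff_left)
     have "norm (adj (Df (fst v) om) (snd v) - adj (Df x om) p) <=
       norm (Df (fst v) om)*norm (snd v - p) + norm (Df (fst v) om - Df x om)*norm p"
      unfolding eq by (rule order_trans[OF norm_triangle_ineq add_mono[OF norm_adj_le norm_adj_le]])
     also have "... <= L*?n + (L*?n)*\<bar>b\<bar>"
     proof (intro add_mono mult_mono)
      show "norm (Df (fst v) om) <= L" by (rule Df_norm[OF w])
      show "norm (Df (fst v) om - Df x om) <= L*?n"
       using order_trans[OF Df_lipschitz[OF w] mult_left_mono[OF dd(1)]] constants by simp
     qed (use dd nb constants in auto)
     finally have 1: "norm (adj (Df (fst v) om) (snd v) - adj (Df x om) p) <= L*?n + (L*?n)*\<bar>b\<bar>" .
     have 2: "norm (f (fst v) om - f x om) <= L*?n"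
      using order_trans[OF f_lipschitz[OF w] mult_left_mono[OF dd(1)]] constants by simp
     show ?thesis using norm_Pair_le_add[of "adj (Df (fst v) om) (snd v) - adj (Df x om) p" "f (fst v) om - f x om"] 1 2
      by (simp add: algebra_simps)
    qed
    moreover have "norm (D v - D (x, p)) <= norm (W v - W (x, p)) + norm ((adj (Df (fst v) om) (snd v), f (fst v) om) - (adj (Df x om) p, f x om))"
    proof -
     have "D v - D (x, p) = (W v - W (x, p)) - ((adj (Df (fst v) om) (snd v), f (fst v) om) - (adj (Df x om) p, f x om))"
      by (simp add: D_def)
     thus ?thesis by (simp only: norm_triangle_ineq4)
    qed
    ultimately show "norm (D v - D (x, p)) <= \<Lambda>'*norm (v - (x, p))"
     unfolding \<Lambda>'_def distrib_right by linarith
   next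
    have "norm (adj (Df x om) p) <= L*\<bar>b\<bar>"
     using order_trans[OF norm_adj_le mult_mono[OF Df_norm[OF w] nb]] constants by simp
    moreover have "norm (W (x, p)) <= \<bar>M0\<bar>" using M0[OF subsetD[OF sub xp]] by simp
    ultimately show "norm (D (x, p)) <= M" using norm_triangle_ineq4[of "W (x, p)" "(adj (Df x om) p, f x om)"]
      norm_Pair_le_add[of "adj (Df x om) p" "f x om"] f_bound[OF w, of x] unfolding D_def M_def fst_conv snd_conv by linarith
   qed
   thus ?thesis by (simp add: D_def \<phi>_def)
  qed
  have "\<Lambda>-lipschitz_on (phase_box B a b) W" by (rule lipschitz_on_subset[OF \<Lambda> sub])
  moreover have "0 <= 4*\<Lambda>' + 4*M/\<rho>" using \<Lambda>' M \<rho> by simp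
  ultimately show ?thesis unfolding hamiltonian_bound_def using main by blast
 qed
 thus thesis by (rule that)
qed

text \<open>The data from which the backward Hamiltonian flow recovers x.\<close>

definition datum :: "'a => 'a => real => 'a => bool" where
 "datum x z T \<xi> \<longleftrightarrow> x \<notin> S & lim_end x z T & norm \<xi> = 1 & (\<exists>\<sigma>. normal_at z \<sigma> \<xi>) & hh z \<xi> <= 0"

definition extremal_arc :: "real => 'a => 'a => real => (real => 'b) => (real => 'a) => (real => 'a) => bool" where
 "extremal_arc dlt x \<xi> T u y p \<longleftrightarrow> control U u & trajectory f x u y & 0 < T & p T = \<xi> &
   primitive_on p (%s. - adj (Df (y s) (u s)) (p s)) T &
   (\<forall>s\<in>{0..T}. exp (- L*T) <= norm (p s) & norm (p s) <= exp (L*T)) &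
   integral {0..T} (%s. hh (y s) (p s) - p s \<bullet> f (y s) (u s)) <= dlt"

text \<open>The defect of the arc is asked to be of order dlt^2, since the deviation from the
  Hamiltonian flow is its square root.\<close>

lemma datum_approx:
 assumes d: "datum x z T \<xi>" and dlt: "0 < dlt"
 obtains x' T' u y p where "norm (x' - x) < dlt" "\<bar>T' - T\<bar> < dlt" "norm (y T' - z) < dlt" "extremal_arc (dlt^2) x' \<xi> T' u y p"
proof -
 obtain \<sigma> where h: "x \<notin> S" "lim_end x z T" "norm \<xi> = 1" "normal_at z \<sigma> \<xi>" "hh z \<xi> <= 0"
  using d unfolding datum_def by blast
 have "0 < dlt^2" using dlt by simp
 from approximate_maximum_principle[OF h(1) V_continuous h(2-5) this]
 obtain eps where eps: "0 < eps" "!!x' u y T' p. norm (x' - x) < eps & \<bar>T' - T\<bar> < eps & near_opt x' eps u y T' & norm (y T' - z) < eps &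
  p T' = \<xi> & primitive_on p (%s. - adj (Df (y s) (u s)) (p s)) T' & (\<forall>s\<in>{0..T'}. norm (p s) <= exp (L*T')) ==>
  integral {0..T'} (%s. hh (y s) (p s) - p s \<bullet> f (y s) (u s)) < dlt^2" by blast
 have T0: "0 < T" using lim_end_facts[OF h(1,2)] by blast
 define e where "e = min (min eps dlt) T"
 have e: "0 < e" "e <= eps" "e <= dlt" "e <= T" using eps(1) dlt T0 by (auto simp: e_def)
 obtain x' u y T' where c: "norm (x' - x) < e" "\<bar>T' - T\<bar> < e" "near_opt x' e u y T'" "norm (y T' - z) < e"
  using h(2) e(1) unfolding lim_end_def by blast
 note u = near_optD(1,2)[OF c(3)]
 have T': "0 < T'" using c(2) e(4) by linarith
 obtain p where p: "p T' = \<xi>" "primitive_on p (%s. - adj (Df (y s) (u s)) (p s)) T'"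
  "!!s. s \<in> {0..T'} ==> norm (p s) <= norm \<xi>*exp (L*T')"
  "!!s. s \<in> {0..T'} ==> norm \<xi> <= norm (p s)*exp (L*T')"
  by (rule adjoint_exists[OF u less_imp_le[OF T'], of \<xi>]) blast
 have up: "\<forall>s\<in>{0..T'}. norm (p s) <= exp (L*T')" using p(3) h(3) by simp
 have lo: "exp (- L*T') <= norm (p s)" if "s \<in> {0..T'}" for s
  using p(4)[OF that] h(3) by (simp add: exp_minus field_simps)
 have "integral {0..T'} (%s. hh (y s) (p s) - p s \<bullet> f (y s) (u s)) < dlt^2"
  by (rule eps(2)[of x' T' u y p]) (use c e near_opt_mono[OF c(3) e(2)] p(1,2) up in auto)
 hence "extremal_arc (dlt^2) x' \<xi> T' u y p" unfolding extremal_arc_def using u T' p(1,2) up lo by auto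
 thus thesis using that c e by force
qed

text \<open>Both arcs run backward from their ends and solve the Hamiltonian system up to an error
  of at most dlt + (C/dlt) times the defect. As the defect has integral at most dlt^2, the error has
  integral of order dlt, and Gronwall in phase space applies. The excess time T2 - T1 moves the
  longer arc by at most N times as much.\<close>

lemma extremal_arc_compare:
 obtains C where "0 <= C" "!!dlt x1 \<xi>1 T1 u1 y1 p1 x2 \<xi>2 T2 u2 y2 p2. 0 < dlt ==> dlt <= 1 ==>
  extremal_arc (dlt^2) x1 \<xi>1 T1 u1 y1 p1 ==> extremal_arc (dlt^2) x2 \<xi>2 T2 u2 y2 p2 ==> T1 <= T2 ==> T2 <= \<tau> ==>
  norm (y1 T1) <= B ==> norm (y2 T2) <= B ==>
  norm (x1 - x2) <= C*(norm (y1 T1 - y2 T2) + norm (\<xi>1 - \<xi>2) + \<bar>T1 - T2\<bar> + dlt)"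
proof -
 obtain W where W: "!!B a b. 0 < a ==> hamiltonian_bound W B a b" by (rule hamiltonian_field) blast
 let ?K = "phase_box (B + N*\<tau>) (exp (- L*\<tau>)) (exp (L*\<tau>))"
 obtain C \<Lambda> where C: "0 <= C" and \<Lambda>: "\<Lambda>-lipschitz_on ?K W"
  and gap: "!!x p om. (x, p) \<in> ?K ==> om \<in> U ==>
    (norm (W (x, p) - (adj (Df x om) p, f x om)))^2 <= C*(hh x p - p \<bullet> f x om)"
  using W[of "exp (- L*\<tau>)" "B + N*\<tau>" "exp (L*\<tau>)"] unfolding hamiltonian_bound_def by auto
 have \<Lambda>0: "0 <= \<Lambda>" by (rule lipschitz_on_nonneg[OF \<Lambda>])
 \<comment> \<open>The Hamiltonian field in reversed time: the position moves against the costate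
   gradient, the costate along the position gradient.\<close>
 define F where "F w = (- snd (W w), fst (W w))" for w
 have dF: "norm (F v - F w) = norm (W v - W w)" for v w
  unfolding F_def by (simp add: norm_prod_def norm_minus_commute fst_diff snd_diff add.commute)
 define E where "E = exp (\<Lambda>*\<bar>\<tau>\<bar>)"
 have E: "1 <= E" using \<Lambda>0 by (simp add: E_def)
 define C' where "C' = N + E*(1 + 2*\<bar>\<tau>\<bar> + 2*C)"
 have "norm (x1 - x2) <= C'*(norm (y1 T1 - y2 T2) + norm (\<xi>1 - \<xi>2) + \<bar>T1 - T2\<bar> + dlt)"
  if dlt: "0 < dlt" "dlt <= 1" and e1: "extremal_arc (dlt^2) x1 \<xi>1 T1 u1 y1 p1" and e2: "extremal_arc (dlt^2) x2 \<xi>2 T2 u2 y2 p2"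
   and T12: "T1 <= T2" "T2 <= \<tau>" and B: "norm (y1 T1) <= B" "norm (y2 T2) <= B"
  for dlt x1 \<xi>1 T1 u1 y1 p1 x2 \<xi>2 T2 u2 y2 p2
 proof -
  have arc: "primitive_on (%s. (y (T - s), p (T - s))) (%s. (- f (y (T - s)) (u (T - s)), adj (Df (y (T - s)) (u (T - s))) (p (T - s)))) T1 &
    (\<forall>s\<in>{0..T1}. (y (T - s), p (T - s)) \<in> ?K) &
    (%s. hh (y (T - s)) (p (T - s)) - p (T - s) \<bullet> f (y (T - s)) (u (T - s))) integrable_on {0..T1} &
    integral {0..T1} (%s. hh (y (T - s)) (p (T - s)) - p (T - s) \<bullet> f (y (T - s)) (u (T - s))) <= dlt^2 &
    (\<forall>s\<in>{0..T1}. norm ((- f (y (T - s)) (u (T - s)), adj (Df (y (T - s)) (u (T - s))) (p (T - s))) - F (y (T - s), p (T - s)))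
     <= dlt + C/dlt*(hh (y (T - s)) (p (T - s)) - p (T - s) \<bullet> f (y (T - s)) (u (T - s))))"
   if ea: "extremal_arc (dlt^2) x \<xi> T u y p" and T: "T1 <= T" "T <= \<tau>" and yB: "norm (y T) <= B" for x \<xi> T u y p
  proof -
   have u: "control U u" "trajectory f x u y" and T0: "0 < T"
    and pp: "primitive_on p (%s. - adj (Df (y s) (u s)) (p s)) T"
    and pb: "!!s. s \<in> {0..T} ==> exp (- L*T) <= norm (p s) & norm (p s) <= exp (L*T)"
    and ie: "integral {0..T} (%s. hh (y s) (p s) - p s \<bullet> f (y s) (u s)) <= dlt^2"
    using ea unfolding extremal_arc_def by auto
   let ?e = "%s. hh (y s) (p s) - p s \<bullet> f (y s) (u s)"
   note cy = trajectory_continuous[OF u, of T] and cp = primitive_on_continuous[OF pp]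
   have ii: "?e integrable_on {0..T}" by (intro hk_integrable_diff integrable_continuous_real hh_path_continuous cy cp
     inner_f_integrable[OF u(1)])
   have e0: "0 <= ?e s" if "s \<in> {0..T}" for s using hh_ge[OF control_in[OF u(1)], of s "p s" "y s"] that by simp
   have pr: "primitive_on (%s. (y (T - s), p (T - s))) (%s. (- f (y (T - s)) (u (T - s)), - (- adj (Df (y (T - s)) (u (T - s))) (p (T - s))))) T1"
    by (intro primitive_on_Pair primitive_on_reflect[OF trajectory_primitive(2)[OF u] T(1)] primitive_on_reflect[OF pp T(1)])
   have inK: "(y s, p s) \<in> ?K" if s: "s \<in> {0..T}" for s
   proof -
    have "norm (y T - y s) <= N*(T - s)" by (rule trajectory_lipschitz[OF u]) (use s in auto)
    also have "... <= N*\<tau>" using s T constants by (intro mult_left_mono) auto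
    finally have "norm (y T - y s) <= N*\<tau>" .
    moreover have "norm (y s) <= norm (y T) + norm (y T - y s)" by norm
    moreover have "exp (- L*\<tau>) <= exp (- L*T)" "exp (L*T) <= exp (L*\<tau>)" using T constants by auto
    ultimately have "norm (y s) <= B + N*\<tau>" "exp (- L*\<tau>) <= norm (p s)" "norm (p s) <= exp (L*\<tau>)"
     using yB pb[OF s] by linarith+
    thus ?thesis unfolding phase_box_def by simp
   qed
   have sub: "{T - T1..T - 0} \<subseteq> {0..T}" using T by auto
   note rf = integrable_on_reflect_interval[OF integrable_on_subinterval[OF ii sub]]
   have "integral {T - T1..T - 0} ?e <= integral {0..T} ?e"
    by (rule integral_subset_le[OF sub integrable_on_subinterval[OF ii sub] ii]) (use e0 in auto)
   hence le: "integral {0..T1} (%s. ?e (T - s)) <= dlt^2" using rf(2) ie by simp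
   have "norm ((- f (y (T - s)) (u (T - s)), adj (Df (y (T - s)) (u (T - s))) (p (T - s))) - F (y (T - s), p (T - s)))
     <= dlt + C/dlt*?e (T - s)" if s: "s \<in> {0..T1}" for s
   proof -
    let ?s = "T - s"
    have s': "?s \<in> {0..T}" using s T by auto
    let ?v = "W (y ?s, p ?s) - (adj (Df (y ?s) (u ?s)) (p ?s), f (y ?s) (u ?s))"
    have "(norm ?v)^2 <= C*?e ?s" by (rule gap[OF inK[OF s'] control_in[OF u(1)]]) (use s' in auto)
    moreover have "dlt*norm ?v <= dlt^2 + (norm ?v)^2"
    proof -
     have "0 <= (norm ?v - dlt)^2 + dlt*norm ?v" using dlt by simp
     thus ?thesis by (simp add: power2_eq_square algebra_simps)
    qed
    ultimately have "dlt*norm ?v <= dlt*(dlt + C/dlt*?e ?s)" using dlt by (simp add: power2_eq_square algebra_simps)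
    hence "norm ?v <= dlt + C/dlt*?e ?s" using dlt by simp
    moreover have "norm ((- f (y ?s) (u ?s), adj (Df (y ?s) (u ?s)) (p ?s)) - F (y ?s, p ?s)) = norm ?v"
     unfolding F_def by (simp add: norm_prod_def fst_diff snd_diff norm_minus_commute add.commute)
    ultimately show ?thesis by simp
   qed
   moreover have "(y (T - s), p (T - s)) \<in> ?K" if "s \<in> {0..T1}" for s by (rule inK) (use that T in auto)
   moreover have "(%s. ?e (T - s)) integrable_on {0..T1}" by (rule rf(1))
   moreover note pr[unfolded minus_minus] le
   ultimately show ?thesis by blast
  qed
  have T1: "0 < T1" using e1 unfolding extremal_arc_def by blast
  note a1 = arc[OF e1 order.refl order_trans[OF T12] B(1)] and a2 = arc[OF e2 T12 B(2)]
  define g1 where "g1 = (%s. hh (y1 (T1 - s)) (p1 (T1 - s)) - p1 (T1 - s) \<bullet> f (y1 (T1 - s)) (u1 (T1 - s)))"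
  define g2 where "g2 = (%s. hh (y2 (T2 - s)) (p2 (T2 - s)) - p2 (T2 - s) \<bullet> f (y2 (T2 - s)) (u2 (T2 - s)))"
  define Y1 where "Y1 = (%s. (y1 (T1 - s), p1 (T1 - s)))"
  define Y2 where "Y2 = (%s. (y2 (T2 - s), p2 (T2 - s)))"
  define V1 where "V1 = (%s. (- f (y1 (T1 - s)) (u1 (T1 - s)), adj (Df (y1 (T1 - s)) (u1 (T1 - s))) (p1 (T1 - s))))"
  define V2 where "V2 = (%s. (- f (y2 (T2 - s)) (u2 (T2 - s)), adj (Df (y2 (T2 - s)) (u2 (T2 - s))) (p2 (T2 - s))))"
  have g: "g1 integrable_on {0..T1}" "g2 integrable_on {0..T1}" "integral {0..T1} g1 <= dlt^2" "integral {0..T1} g2 <= dlt^2"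
   unfolding g1_def g2_def using a1 a2 by blast+
  have K12: "Y1 s \<in> ?K" "Y2 s \<in> ?K" if "s \<in> {0..T1}" for s unfolding Y1_def Y2_def using a1 a2 that by blast+
  have V12: "norm (V1 s - F (Y1 s)) <= dlt + C/dlt*g1 s" "norm (V2 s - F (Y2 s)) <= dlt + C/dlt*g2 s"
   if "s \<in> {0..T1}" for s unfolding Y1_def Y2_def V1_def V2_def g1_def g2_def using a1 a2 that by blast+
  have "primitive_on Y1 V1 T1" "primitive_on Y2 V2 T1" unfolding Y1_def Y2_def V1_def V2_def using a1 a2 by blast+
  hence pd: "primitive_on (%s. Y1 s - Y2 s) (%s. V1 s - V2 s) T1" by (rule primitive_on_diff)
  let ?e = "%s. 2*dlt + (C/dlt*g1 s + C/dlt*g2 s)"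
  note j = integrable_on_mult_right[OF g(1), of "C/dlt"] integrable_on_mult_right[OF g(2), of "C/dlt"]
  note ig = integrable_add[OF j]
  have ie: "?e integrable_on {0..T1}" by (rule integrable_add[OF integrable_const_ivl ig])
  have "integral {0..T1} ?e = integral {0..T1} (%_. 2*dlt) + (integral {0..T1} (%s. C/dlt*g1 s) + integral {0..T1} (%s. C/dlt*g2 s))"
   unfolding integral_add[OF integrable_const_ivl ig] integral_add[OF j] ..
  also have "... = 2*dlt*T1 + (C/dlt*integral {0..T1} g1 + C/dlt*integral {0..T1} g2)" using T1 by simp
  also have "C/dlt*integral {0..T1} g1 + C/dlt*integral {0..T1} g2 <= C/dlt*dlt^2 + C/dlt*dlt^2"
   using g C dlt by (intro add_mono mult_left_mono) auto
  also have "... = 2*C*dlt" using dlt by (simp add: power2_eq_square)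
  finally have inte: "integral {0..T1} ?e <= 2*dlt*T1 + 2*C*dlt" by simp
  have e0: "0 <= ?e s" if "s \<in> {0..T1}" for s
   using order_trans[OF norm_ge_zero V12(1)[OF that]] order_trans[OF norm_ge_zero V12(2)[OF that]] by linarith
  have "norm (Y1 T1 - Y2 T1) <= (norm (Y1 0 - Y2 0) + integral {0..T1} ?e)*exp (\<Lambda>*T1)"
  proof (rule primitive_on_gronwall[OF pd \<Lambda>0 _ ie e0])
   show "T1 \<in> {0..T1}" using T1 by simp
   fix s assume s: "s \<in> {0..T1}"
   have "norm (F (Y1 s) - F (Y2 s)) <= \<Lambda>*norm (Y1 s - Y2 s)"
    unfolding dF using lipschitz_onD[OF \<Lambda> K12(1)[OF s] K12(2)[OF s]] by (simp add: dist_norm)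
   moreover have "norm (V1 s - V2 s) <= norm (V1 s - F (Y1 s)) + norm (F (Y1 s) - F (Y2 s)) + norm (V2 s - F (Y2 s))" by norm
   ultimately show "norm (V1 s - V2 s) <= \<Lambda>*norm (Y1 s - Y2 s) + ?e s" using V12[OF s] by linarith
  qed
  also have "... <= (norm (Y1 0 - Y2 0) + integral {0..T1} ?e)*E"
  proof (rule mult_left_mono)
   have "\<Lambda>*T1 <= \<Lambda>*\<bar>\<tau>\<bar>" using \<Lambda>0 T12 T1 by (intro mult_left_mono) auto
   thus "exp (\<Lambda>*T1) <= E" unfolding E_def by simp
   have "0 <= integral {0..T1} ?e" by (rule integral_nonneg[OF ie e0])
   thus "0 <= norm (Y1 0 - Y2 0) + integral {0..T1} ?e" by simp
  qed
  finally have n1: "norm (Y1 T1 - Y2 T1) <= (norm (Y1 0 - Y2 0) + integral {0..T1} ?e)*E" .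
  have "p1 T1 = \<xi>1" "p2 T2 = \<xi>2" using e1 e2 unfolding extremal_arc_def by blast+
  hence "norm (Y1 0 - Y2 0) <= norm (y1 T1 - y2 T2) + norm (\<xi>1 - \<xi>2)"
   using norm_Pair_le_add[of "y1 T1 - y2 T2" "p1 T1 - p2 T2"] unfolding Y1_def Y2_def by simp
  moreover have "dlt*T1 <= dlt*\<bar>\<tau>\<bar>" using T12 T1 dlt by (intro mult_left_mono) auto
  hence "2*dlt*T1 + 2*C*dlt <= (2*\<bar>\<tau>\<bar> + 2*C)*dlt" by (simp add: algebra_simps)
  ultimately have "norm (Y1 0 - Y2 0) + integral {0..T1} ?e <= norm (y1 T1 - y2 T2) + norm (\<xi>1 - \<xi>2) + (2*\<bar>\<tau>\<bar> + 2*C)*dlt"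
   using inte by linarith
  from mult_right_mono[OF this, of E] E n1
  have "norm (Y1 T1 - Y2 T1) <= (norm (y1 T1 - y2 T2) + norm (\<xi>1 - \<xi>2) + (2*\<bar>\<tau>\<bar> + 2*C)*dlt)*E" by linarith
  moreover have "norm (y1 0 - y2 (T2 - T1)) <= norm (Y1 T1 - Y2 T1)"
   using norm_fst_snd_le(1)[of "Y1 T1 - Y2 T1"] unfolding Y1_def Y2_def by simp
  moreover have "norm (y2 (T2 - T1) - y2 0) <= N*(T2 - T1 - 0)"
   by (rule trajectory_lipschitz[of u2 x2]) (use e2 T12 in \<open>auto simp: extremal_arc_def\<close>)
  moreover have "norm (y1 0 - y2 0) <= norm (y1 0 - y2 (T2 - T1)) + norm (y2 (T2 - T1) - y2 0)" by norm
  moreover have "norm (x1 - x2) = norm (y1 0 - y2 0)"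
   using e1 e2 trajectory_primitive(1)[of u1 x1 y1] trajectory_primitive(1)[of u2 x2 y2] unfolding extremal_arc_def by simp
  moreover have "N*\<bar>T1 - T2\<bar> = N*(T2 - T1 - 0)" using T12 by simp
  ultimately have "norm (x1 - x2) <= (norm (y1 T1 - y2 T2) + norm (\<xi>1 - \<xi>2) + (2*\<bar>\<tau>\<bar> + 2*C)*dlt)*E + N*\<bar>T1 - T2\<bar>"
   by linarith
  also have "... <= C'*(norm (y1 T1 - y2 T2) + norm (\<xi>1 - \<xi>2) + \<bar>T1 - T2\<bar> + dlt)"
  proof -
   let ?a = "norm (y1 T1 - y2 T2) + norm (\<xi>1 - \<xi>2)"
   have C'1: "E <= C'" "(2*\<bar>\<tau>\<bar> + 2*C)*E <= C'" "N <= C'"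
   proof -
    have eq: "C' = N + E + (2*\<bar>\<tau>\<bar> + 2*C)*E" by (simp add: C'_def algebra_simps)
    have "0 <= (2*\<bar>\<tau>\<bar> + 2*C)*E" using E C by simp
    thus "E <= C'" "(2*\<bar>\<tau>\<bar> + 2*C)*E <= C'" "N <= C'" using eq E constants by linarith+
   qed
   have "?a*E <= ?a*C'" using C'1(1) by (intro mult_left_mono) auto
   moreover have "((2*\<bar>\<tau>\<bar> + 2*C)*E)*dlt <= C'*dlt" using C'1(2) dlt by (intro mult_right_mono) auto
   moreover have "N*\<bar>T1 - T2\<bar> <= C'*\<bar>T1 - T2\<bar>" using C'1(3) by (intro mult_right_mono) auto
   moreover have "(?a + (2*\<bar>\<tau>\<bar> + 2*C)*dlt)*E = ?a*E + ((2*\<bar>\<tau>\<bar> + 2*C)*E)*dlt" by (simp only: algebra_simps)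
   moreover have "C'*(?a + \<bar>T1 - T2\<bar> + dlt) = ?a*C' + C'*\<bar>T1 - T2\<bar> + C'*dlt" by (simp only: algebra_simps)
   ultimately show ?thesis by linarith
  qed
  finally show ?thesis .
 qed
 moreover have "0 <= C'" using E C constants by (simp add: C'_def)
 ultimately show thesis by (intro that[of C'])
qed

lemma datum_lipschitz:
 obtains C where "0 <= C" "!!x1 z1 T1 \<xi>1 x2 z2 T2 \<xi>2. datum x1 z1 T1 \<xi>1 ==> datum x2 z2 T2 \<xi>2 ==> T1 <= \<tau> ==> T2 <= \<tau> ==>
  norm z1 <= B ==> norm z2 <= B ==> norm (x1 - x2) <= C*(norm (z1 - z2) + norm (\<xi>1 - \<xi>2) + \<bar>T1 - T2\<bar>)"
proof -
 obtain C where C: "0 <= C" and cmp: "!!dlt x1 \<xi>1 T1 u1 y1 p1 x2 \<xi>2 T2 u2 y2 p2. 0 < dlt ==> dlt <= 1 ==>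
  extremal_arc (dlt^2) x1 \<xi>1 T1 u1 y1 p1 ==> extremal_arc (dlt^2) x2 \<xi>2 T2 u2 y2 p2 ==> T1 <= T2 ==> T2 <= \<tau> + 1 ==>
  norm (y1 T1) <= B + 1 ==> norm (y2 T2) <= B + 1 ==>
  norm (x1 - x2) <= C*(norm (y1 T1 - y2 T2) + norm (\<xi>1 - \<xi>2) + \<bar>T1 - T2\<bar> + dlt)"
  by (rule extremal_arc_compare[where \<tau> = "\<tau> + 1" and B = "B + 1"]) blast
 have "norm (x1 - x2) <= C*(norm (z1 - z2) + norm (\<xi>1 - \<xi>2) + \<bar>T1 - T2\<bar>)"
  if d: "datum x1 z1 T1 \<xi>1" "datum x2 z2 T2 \<xi>2" and b: "T1 <= \<tau>" "T2 <= \<tau>" "norm z1 <= B" "norm z2 <= B"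
  for x1 z1 T1 \<xi>1 x2 z2 T2 \<xi>2
 proof (rule field_le_epsilon)
  fix e :: real assume e: "0 < e"
  \<comment> \<open>The 5 counts two end points, two arrival times and \<open>dlt\<close> itself;
    the 2 counts the two starting points.\<close>
  define dlt where "dlt = min 1 (e/(5*C + 2))"
  have C5: "0 < 5*C + 2" using C by simp
  have dlt: "0 < dlt" "dlt <= 1" "(5*C + 2)*dlt <= e"
  proof -
   show "0 < dlt" "dlt <= 1" using e C5 by (auto simp: dlt_def)
   have "(5*C + 2)*dlt <= (5*C + 2)*(e/(5*C + 2))" unfolding dlt_def using C5 by (intro mult_left_mono) auto
   also have "... = e" using C5 by simp
   finally show "(5*C + 2)*dlt <= e" .
  qed
  obtain x1' T1' u1 y1 p1 where a1: "norm (x1' - x1) < dlt" "\<bar>T1' - T1\<bar> < dlt" "norm (y1 T1' - z1) < dlt" "extremal_arc (dlt^2) x1' \<xi>1 T1' u1 y1 p1"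
   by (rule datum_approx[OF d(1) dlt(1)])
  obtain x2' T2' u2 y2 p2 where a2: "norm (x2' - x2) < dlt" "\<bar>T2' - T2\<bar> < dlt" "norm (y2 T2' - z2) < dlt" "extremal_arc (dlt^2) x2' \<xi>2 T2' u2 y2 p2"
   by (rule datum_approx[OF d(2) dlt(1)])
  have yb: "norm (y1 T1') <= B + 1" "norm (y2 T2') <= B + 1"
  proof -
   have "norm (y1 T1') <= norm z1 + norm (y1 T1' - z1)" "norm (y2 T2') <= norm z2 + norm (y2 T2' - z2)" by norm+
   thus "norm (y1 T1') <= B + 1" "norm (y2 T2') <= B + 1" using a1 a2 b dlt by linarith+
  qed
  have tb: "T1' <= \<tau> + 1" "T2' <= \<tau> + 1" using a1 a2 b dlt by linarith+
  have "norm (x1' - x2') <= C*(norm (y1 T1' - y2 T2') + norm (\<xi>1 - \<xi>2) + \<bar>T1' - T2'\<bar> + dlt)"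
  proof (cases "T1' <= T2'")
   case True thus ?thesis by (intro cmp[OF dlt(1,2) a1(4) a2(4)] tb yb)
  next
   case False
   hence "norm (x2' - x1') <= C*(norm (y2 T2' - y1 T1') + norm (\<xi>2 - \<xi>1) + \<bar>T2' - T1'\<bar> + dlt)"
    by (intro cmp[OF dlt(1,2) a2(4) a1(4)] tb yb) auto
   thus ?thesis by (simp add: norm_minus_commute abs_minus_commute)
  qed
  also have "... <= C*(norm (z1 - z2) + norm (\<xi>1 - \<xi>2) + \<bar>T1 - T2\<bar> + 5*dlt)"
  proof (rule mult_left_mono[OF _ C])
   have "norm (y1 T1' - y2 T2') <= norm (y1 T1' - z1) + norm (z1 - z2) + norm (y2 T2' - z2)" by norm
   thus "norm (y1 T1' - y2 T2') + norm (\<xi>1 - \<xi>2) + \<bar>T1' - T2'\<bar> + dlt <= norm (z1 - z2) + norm (\<xi>1 - \<xi>2) + \<bar>T1 - T2\<bar> + 5*dlt"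
    using a1 a2 by linarith
  qed
  finally have "norm (x1' - x2') <= C*(norm (z1 - z2) + norm (\<xi>1 - \<xi>2) + \<bar>T1 - T2\<bar>) + 5*C*dlt"
   by (simp add: algebra_simps)
  moreover have "norm (x1 - x2) <= norm (x1' - x1) + norm (x1' - x2') + norm (x2' - x2)" by norm
  ultimately show "norm (x1 - x2) <= C*(norm (z1 - z2) + norm (\<xi>1 - \<xi>2) + \<bar>T1 - T2\<bar>) + e"
   using a1(1) a2(1) dlt(3) by (simp add: distrib_right)
 qed
 with C that show thesis by blast
qed

end

section \<open>Small sets\<close>

definition gauge_weight :: "(real => real) => nat => real => ennreal" where
 "gauge_weight w k r = (if r <= 0 then 0 else ennreal (w r*r ^ k))"

text \<open>\<open>X\<close> has measure zero for every gauge \<open>o(r\<^sup>k)\<close>. Sets of \<open>\<sigma>\<close>-finite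
 \<open>k\<close>-dimensional Minkowski content and \<open>k\<close>-dimensional Hausdorff null sets have this property,
 and it is stable under countable unions. Radii \<open>\<le> 0\<close> stand for unused balls.\<close>

definition small_set :: "nat => 'a::metric_space set => bool" where
 "small_set k X \<longleftrightarrow> (\<forall>w. (\<forall>r. 0 <= w r) & (w \<longlongrightarrow> 0) (at_right 0) -->
   (\<forall>dlt>0. \<exists>c r. (\<forall>i::nat. r i < dlt) & X \<subseteq> (\<Union>i. ball (c i) (r i)) & (\<Sum>i. gauge_weight w k (r i)) < ennreal dlt))"

lemma small_setD:
 assumes "small_set k X" "!!r. 0 <= w r" "(w \<longlongrightarrow> 0) (at_right 0)" "0 < dlt"
 shows "\<exists>c r. (\<forall>i::nat. r i < dlt) & X \<subseteq> (\<Union>i. ball (c i) (r i)) & (\<Sum>i. gauge_weight w k (r i)) < ennreal dlt"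
proof -
 have "(\<forall>r. 0 <= w r) & (w \<longlongrightarrow> 0) (at_right 0)" using assms(2,3) by simp
 from assms(1)[unfolded small_set_def, rule_format, OF this assms(4)] show ?thesis .
qed

lemma small_set_subset:
 assumes "small_set k X" "Y \<subseteq> X" shows "small_set k Y" unfolding small_set_def
proof (intro allI impI)
 fix w :: "real => real" and dlt :: real
 assume w: "(\<forall>r. 0 <= w r) & (w \<longlongrightarrow> 0) (at_right 0)" and dlt: "0 < dlt"
 from w have w1: "!!r. 0 <= w r" and w2: "(w \<longlongrightarrow> 0) (at_right 0)" by auto
 from small_setD[OF assms(1) w1 w2 dlt]
 obtain c r where cr: "\<forall>i::nat. r i < dlt" "X \<subseteq> (\<Union>i. ball (c i) (r i))" "(\<Sum>i. gauge_weight w k (r i)) < ennreal dlt"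
  by (elim exE conjE)
 have "Y \<subseteq> (\<Union>i. ball (c i) (r i))" using assms(2) cr(2) by (rule order_trans)
 thus "\<exists>c r. (\<forall>i::nat. r i < dlt) & Y \<subseteq> (\<Union>i. ball (c i) (r i)) & (\<Sum>i. gauge_weight w k (r i)) < ennreal dlt"
  using cr(1,3) by - (rule exI[of _ c], rule exI[of _ r], intro conjI; assumption)
qed

lemma small_set_empty [simp]: "small_set k {}"
 unfolding small_set_def by (auto intro!: exI[of _ "%_. 0"] simp: gauge_weight_def)

lemma suminf_geometric_ennreal:
 assumes "0 <= c" shows "(\<Sum>j::nat. ennreal (c*(1/2) ^ Suc j)) = ennreal c"
proof -
 have s: "(%j. c*(1/2) ^ Suc j) sums (c*1)" by (rule sums_mult[OF power_half_series])
 have "(\<Sum>j. ennreal (c*(1/2) ^ Suc j)) = ennreal (\<Sum>j. c*(1/2) ^ Suc j)"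
  by (rule suminf_ennreal2) (use assms s in \<open>auto simp: sums_iff\<close>)
 thus ?thesis using s by (simp add: sums_iff)
qed

lemma small_set_UN:
 fixes X :: "nat => 'a::metric_space set"
 assumes "!!j. small_set k (X j)" shows "small_set k (\<Union>j. X j)" unfolding small_set_def
proof (intro allI impI)
 fix w :: "real => real" and dlt :: real
 assume w: "(\<forall>r. 0 <= w r) & (w \<longlongrightarrow> 0) (at_right 0)" and dlt: "0 < dlt"
 have "\<exists>c r. (\<forall>i::nat. r i < (dlt/2)*(1/2) ^ Suc j) & X j \<subseteq> (\<Union>i. ball (c i) (r i)) &
   (\<Sum>i. gauge_weight w k (r i)) < ennreal ((dlt/2)*(1/2) ^ Suc j)" for j
 proof -
  have "0 < (dlt/2)*(1/2) ^ Suc j" using dlt by simp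
  from assms[of j, unfolded small_set_def, rule_format, OF w this] show ?thesis .
 qed
 then obtain c r where cr: "!!j i. r j (i::nat) < (dlt/2)*(1/2) ^ Suc j" "!!j. X j \<subseteq> (\<Union>i. ball (c j i) (r j i))"
  "!!j. (\<Sum>i. gauge_weight w k (r j i)) < ennreal ((dlt/2)*(1/2) ^ Suc j)" by metis
 let ?p = "%n. case_prod r (prod_decode n)"
 show "\<exists>c r. (\<forall>i::nat. r i < dlt) & (\<Union>j. X j) \<subseteq> (\<Union>i. ball (c i) (r i)) & (\<Sum>i. gauge_weight w k (r i)) < ennreal dlt"
 proof (rule exI[of _ "%n. case_prod c (prod_decode n)"], rule exI[of _ ?p], intro conjI allI)
  fix n
  obtain j i where "prod_decode n = (j, i)" by (cases "prod_decode n")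
  moreover have "(dlt/2)*(1/2) ^ Suc j <= (dlt/2)*1" using dlt by (intro mult_left_mono power_le_one) auto
  hence "r j i < dlt" using cr(1)[of j i] dlt by linarith
  ultimately show "?p n < dlt" by simp
 next
  show "(\<Union>j. X j) \<subseteq> (\<Union>n. ball (case_prod c (prod_decode n)) (?p n))"
  proof
   fix x assume "x \<in> (\<Union>j. X j)"
   then obtain j i where "x \<in> ball (c j i) (r j i)" using cr(2) by blast
   thus "x \<in> (\<Union>n. ball (case_prod c (prod_decode n)) (?p n))" by (intro UN_I[of "prod_encode (j, i)"]) auto
  qed
 next
  have "(\<Sum>n. gauge_weight w k (?p n)) = (\<Sum>n. (%(j, i). gauge_weight w k (r j i)) (prod_decode n))"
   by (simp add: case_prod_unfold)
  also have "... = (\<Sum>j. \<Sum>i. gauge_weight w k (r j i))" by (rule suminf_ennreal_2dimen) simp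
  also have "... <= (\<Sum>j. ennreal ((dlt/2)*(1/2) ^ Suc j))" using cr(3) by (intro suminf_le) (auto simp: less_imp_le)
  also have "... = ennreal (dlt/2)" using dlt by (intro suminf_geometric_ennreal) auto
  also have "... < ennreal dlt" using dlt by (simp add: ennreal_lessI)
  finally show "(\<Sum>n. gauge_weight w k (?p n)) < ennreal dlt" .
 qed
qed

lemma small_set_Un: "small_set k X ==> small_set k Y ==> small_set k (X \<union> Y)"
proof -
 assume "small_set k X" "small_set k Y"
 hence "small_set k (\<Union>j::nat. if j = 0 then X else Y)" by (intro small_set_UN) auto
 thus ?thesis by (rule small_set_subset) (auto intro: UN_I[of 0] UN_I[of 1])
qed

lemma small_set_countable_UN:
 assumes "countable I" "!!i. i \<in> I ==> small_set k (X i)" shows "small_set k (\<Union>i\<in>I. X i)"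
proof (cases "I = {}")
 case False
 have "small_set k (\<Union>j. X (from_nat_into I j))" using from_nat_into[OF False] assms by (intro small_set_UN) auto
 thus ?thesis by (rule small_set_subset) (use from_nat_into_surj[OF assms(1)] in force)
qed simp

text \<open>Localizing in the source and not in the image permits neighbourhoods of a whole triple
  (z, \<xi>, \<eta>) even though only (z, \<xi>) is kept. Lindelof makes the cover
  countable.\<close>

lemma small_set_local_image:
 fixes Y :: "'c::{metric_space, second_countable_topology} set" and \<pi> :: "'c => 'a::metric_space"
 assumes "!!t. t \<in> Y ==> \<exists>e>0. small_set k (\<pi> ` (Y \<inter> ball t e))"
 shows "small_set k (\<pi> ` Y)"
proof -
 obtain e where e: "!!t. t \<in> Y ==> 0 < e t & small_set k (\<pi> ` (Y \<inter> ball t (e t)))" using assms by metis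
 obtain F where F: "F \<subseteq> (%t. ball t (e t)) ` Y" "countable F" "\<Union>F = (\<Union>t\<in>Y. ball t (e t))"
  by (rule Lindelof[of "(%t. ball t (e t)) ` Y"]) auto
 have "small_set k (\<Union>b\<in>F. \<pi> ` (Y \<inter> b))" using F(1) e by (intro small_set_countable_UN[OF F(2)]) auto
 moreover have "Y \<subseteq> \<Union>F" unfolding F(3) using e by force
 hence "\<pi> ` Y \<subseteq> (\<Union>b\<in>F. \<pi> ` (Y \<inter> b))" by blast
 ultimately show ?thesis by (rule small_set_subset)
qed

text \<open>With balls of one radius h the weighted sum is w(h) times a bounded number, so it tends
  to 0 with h for every admissible gauge.\<close>

lemma small_setI_count:
 fixes X :: "'a::metric_space set"
 assumes h0: "0 < h0" and C: "0 <= C"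
  and cov: "!!h. 0 < h ==> h < h0 ==> \<exists>F. finite F & real (card F)*h ^ k <= C & X \<subseteq> (\<Union>c\<in>F. ball c h)"
 shows "small_set k X" unfolding small_set_def
proof (intro allI impI)
 fix w :: "real => real" and dlt :: real
 assume w: "(\<forall>r. 0 <= w r) & (w \<longlongrightarrow> 0) (at_right 0)" and dlt: "0 < dlt"
 have "\<forall>\<^sub>F h in at_right 0. w h < dlt/(C + 1)" by (rule order_tendstoD(2)) (use w dlt C in auto)
 moreover have "0 < min dlt h0" using dlt h0 by simp
 ultimately obtain h where h: "0 < h" "h < min dlt h0" "w h < dlt/(C + 1)" by (rule at_right_witness)
 obtain F where F: "finite F" "real (card F)*h ^ k <= C" "X \<subseteq> (\<Union>c\<in>F. ball c h)" using cov[of h] h by auto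
 obtain c where c: "bij_betw c {..<card F} F" using ex_bij_betw_nat_finite[OF F(1)] by (auto simp: lessThan_atLeast0)
 let ?r = "%i. if i < card F then h else 0"
 show "\<exists>c r. (\<forall>i::nat. r i < dlt) & X \<subseteq> (\<Union>i. ball (c i) (r i)) & (\<Sum>i. gauge_weight w k (r i)) < ennreal dlt"
 proof (rule exI[of _ c], rule exI[of _ ?r], intro conjI allI)
  show "?r i < dlt" for i using h dlt by simp
  show "X \<subseteq> (\<Union>i. ball (c i) (?r i))"
  proof
   fix x assume "x \<in> X"
   then obtain d where "d \<in> F" "x \<in> ball d h" using F(3) by blast
   hence "d \<in> c ` {..<card F}" using bij_betw_imp_surj_on[OF c] by simp
   then obtain i where "i < card F" "c i = d" by auto
   thus "x \<in> (\<Union>i. ball (c i) (?r i))" using \<open>x \<in> ball d h\<close> by (intro UN_I[of i]) auto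
  qed
  have "(\<Sum>i. gauge_weight w k (?r i)) = (\<Sum>i<card F. gauge_weight w k (?r i))"
   by (rule suminf_finite) (auto simp: gauge_weight_def)
  also have "... = (\<Sum>i<card F. ennreal (w h*h ^ k))" using h by (intro sum.cong) (auto simp: gauge_weight_def)
  also have "... = ennreal (real (card F)*(w h*h ^ k))" using w h by (simp add: ennreal_mult'' ennreal_of_nat_eq_real_of_nat)
  also have "... < ennreal dlt"
  proof (rule ennreal_lessI[OF dlt])
   have "real (card F)*(w h*h ^ k) = w h*(real (card F)*h ^ k)" by simp
   also have "... <= w h*C" using F(2) w by (intro mult_left_mono) auto
   also have "... <= w h*(C + 1)" using w by (intro mult_left_mono) auto
   also have "... < dlt" using h(3) C by (simp add: pos_less_divide_eq)
   finally show "real (card F)*(w h*h ^ k) < dlt" .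
  qed
  finally show "(\<Sum>i. gauge_weight w k (?r i)) < ennreal dlt" .
 qed
qed

text \<open>A grid of mesh h/A in coordinate space has at most a multiple of h^(-k) occupied cells,
  and one ball about a representative covers each of them. The 1 in A makes the radius strictly
  larger than the diameter of a cell.\<close>

lemma small_set_coordinates:
 fixes X :: "'a::metric_space set" and q :: "'a => nat => real"
 assumes b: "!!x i. x \<in> X ==> i < k ==> \<bar>q x i\<bar> <= B"
  and d: "!!x y. x \<in> X ==> y \<in> X ==> dist x y <= C*(\<Sum>i<k. \<bar>q x i - q y i\<bar>)"
 shows "small_set k X"
proof -
 define A where "A = \<bar>C\<bar>*real k + 1"
 have A: "1 <= A" by (simp add: A_def)
 define M where "M = 2*\<bar>B\<bar> + 3"
 show ?thesis
 proof (rule small_setI_count[of 1 "(M*A) ^ k"])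
  show "0 <= (M*A) ^ k" using A by (simp add: M_def)
  fix h :: real assume h: "0 < h" "h < 1"
  define \<eta> where "\<eta> = h/A"
  have \<eta>: "0 < \<eta>" "\<eta> <= 1" using h A by (auto simp: \<eta>_def divide_le_eq)
  define m where "m = \<lceil>\<bar>B\<bar>/\<eta>\<rceil>"
  have m0: "0 <= m" unfolding m_def using \<eta> by (simp add: order_less_le_trans[of "-1" 0])
  define cell where "cell x = restrict (%i. \<lfloor>q x i/\<eta>\<rfloor>) {..<k}" for x
  let ?P = "PiE {..<k} (%_. {- m..m})"
  have cP: "cell x \<in> ?P" if "x \<in> X" for x
  proof -
   have "\<lfloor>q x i/\<eta>\<rfloor> \<in> {- m..m}" if "i < k" for i
   proof -
    have "\<bar>q x i/\<eta>\<bar> <= \<bar>B\<bar>/\<eta>" using b[OF \<open>x \<in> X\<close> that] \<eta> by (simp add: divide_right_mono abs_divide)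
    also have "... <= of_int m" unfolding m_def by linarith
    finally have A: "\<bar>q x i/\<eta>\<bar> <= of_int m" .
    have "q x i/\<eta> <= of_int m" "- (q x i/\<eta>) <= of_int m" using abs_le_D1[OF A] abs_le_D2[OF A] by auto
    thus ?thesis unfolding atLeastAtMost_iff by (intro conjI; linarith)
   qed
   thus ?thesis unfolding cell_def by auto
  qed
  have fP: "finite ?P" by (intro finite_PiE) auto
  define pt where "pt v = (SOME x. x \<in> X & cell x = v)" for v
  have pt: "pt (cell x) \<in> X & cell (pt (cell x)) = cell x" if "x \<in> X" for x
   unfolding pt_def by (rule someI[of _ x]) (use that in auto)
  show "\<exists>F. finite F & real (card F)*h ^ k <= (M*A) ^ k & X \<subseteq> (\<Union>c\<in>F. ball c h)"
  proof (intro exI[of _ "pt ` cell ` X"] conjI)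
   have sub: "cell ` X \<subseteq> ?P" using cP by auto
   hence fc: "finite (cell ` X)" using fP finite_subset by blast
   thus "finite (pt ` cell ` X)" by simp
   have "card (pt ` cell ` X) <= card (cell ` X)" using fc by (rule card_image_le)
   also have "... <= card ?P" using sub fP by (intro card_mono)
   also have "card ?P = (nat (2*m + 1)) ^ k" by (simp add: card_PiE)
   finally have "real (card (pt ` cell ` X)) <= real (nat (2*m + 1)) ^ k" by (metis of_nat_le_iff of_nat_power)
   also have "real (nat (2*m + 1)) = 2 * of_int m + 1" using m0 by simp
   also have "(2 * of_int m + 1) ^ k <= (M/\<eta>) ^ k"
   proof (rule power_mono)
    have "of_int m <= \<bar>B\<bar>/\<eta> + 1" unfolding m_def by linarith
    moreover have "1 <= 1/\<eta>" using \<eta> by simp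
    moreover have "M/\<eta> = 2*(\<bar>B\<bar>/\<eta>) + 3*(1/\<eta>)" by (simp add: M_def add_divide_distrib)
    ultimately show "2 * of_int m + 1 <= M/\<eta>" by linarith
   qed (use m0 in auto)
   finally have "real (card (pt ` cell ` X))*h ^ k <= (M/\<eta>) ^ k*h ^ k" using h by (intro mult_right_mono) auto
   also have "... = (M*A) ^ k" using h A by (simp add: \<eta>_def power_mult_distrib[symmetric])
   finally show "real (card (pt ` cell ` X))*h ^ k <= (M*A) ^ k" .
   show "X \<subseteq> (\<Union>c\<in>pt ` cell ` X. ball c h)"
   proof
    fix x assume x: "x \<in> X"
    let ?y = "pt (cell x)"
    have y: "?y \<in> X" "cell ?y = cell x" using pt[OF x] by auto
    have "\<bar>q ?y i - q x i\<bar> <= \<eta>" if "i < k" for i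
    proof -
     have "\<lfloor>q ?y i/\<eta>\<rfloor> = \<lfloor>q x i/\<eta>\<rfloor>"
      using fun_cong[OF y(2), of i] that by (simp add: cell_def)
     hence "\<bar>q ?y i/\<eta> - q x i/\<eta>\<bar> <= 1" by linarith
     hence "\<bar>(q ?y i - q x i)/\<eta>\<bar> <= 1" by (simp add: diff_divide_distrib)
     thus ?thesis using \<eta> by (simp add: abs_divide)
    qed
    hence "(\<Sum>i<k. \<bar>q ?y i - q x i\<bar>) <= (\<Sum>i<k. \<eta>)" by (intro sum_mono) auto
    hence s: "(\<Sum>i<k. \<bar>q ?y i - q x i\<bar>) <= real k*\<eta>" by simp
    have "dist ?y x <= C*(\<Sum>i<k. \<bar>q ?y i - q x i\<bar>)" by (rule d[OF y(1) x])
    also have "... <= \<bar>C\<bar>*(\<Sum>i<k. \<bar>q ?y i - q x i\<bar>)" by (intro mult_right_mono sum_nonneg) auto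
    also have "... <= \<bar>C\<bar>*(real k*\<eta>)" using s by (intro mult_left_mono) auto
    also have "... < A*\<eta>" using \<eta> by (simp add: A_def algebra_simps)
    also have "... = h" using A by (simp add: \<eta>_def)
    finally show "x \<in> (\<Union>c\<in>pt ` cell ` X. ball c h)" using x by auto
   qed
  qed
 qed simp
qed

text \<open>Choosing one preimage for each point makes the parameters coordinates on the image;
  these are bounded after exhausting the parameter set.\<close>

lemma small_set_lipschitz_image_of_Rk:
 assumes "lipschitz_image_of_Rk k E" shows "small_set k E"
proof -
 obtain A :: "(nat => real) set" and h C where E: "E = h ` A"
  and l: "!!a b. a \<in> A ==> b \<in> A ==> dist (h a) (h b) <= C*L2_set (%i. a i - b i) {..<k}"
  using assms unfolding lipschitz_image_of_Rk_def by blast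
 let ?A = "%m::nat. {a \<in> A. \<forall>i<k. \<bar>a i\<bar> <= real m}"
 have "small_set k (h ` ?A m)" for m
 proof -
  define q where "q x = (SOME a. a \<in> ?A m & h a = x)" for x
  have q: "q x \<in> ?A m & h (q x) = x" if x: "x \<in> h ` ?A m" for x
  proof -
   obtain a0 where "a0 \<in> ?A m & h a0 = x" using x by blast
   thus ?thesis unfolding q_def by (rule someI[of "%a. a \<in> ?A m & h a = x"])
  qed
  show ?thesis
  proof (rule small_set_coordinates[of _ k q "real m" "\<bar>C\<bar>"])
   show "\<bar>q x i\<bar> <= real m" if "x \<in> h ` ?A m" "i < k" for x i using q[OF that(1)] that(2) by blast
   fix x y assume x: "x \<in> h ` ?A m" and y: "y \<in> h ` ?A m"
   have "dist x y <= C*L2_set (%i. q x i - q y i) {..<k}" using l[of "q x" "q y"] q[OF x] q[OF y] by simp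
   also have "... <= \<bar>C\<bar>*L2_set (%i. q x i - q y i) {..<k}" by (intro mult_right_mono L2_set_nonneg) auto
   also have "... <= \<bar>C\<bar>*(\<Sum>i<k. \<bar>q x i - q y i\<bar>)" by (intro mult_left_mono L2_set_le_sum_abs) auto
   finally show "dist x y <= \<bar>C\<bar>*(\<Sum>i<k. \<bar>q x i - q y i\<bar>)" .
  qed
 qed
 hence "small_set k (\<Union>m. h ` ?A m)" by (rule small_set_UN)
 moreover have "E \<subseteq> (\<Union>m. h ` ?A m)"
 proof
  fix x assume "x \<in> E"
  then obtain a where a: "a \<in> A" "x = h a" using E by blast
  obtain m :: nat where m: "(\<Sum>i<k. \<bar>a i\<bar>) <= real m" using real_arch_simple by blast
  have "\<bar>a i\<bar> <= real m" if "i < k" for i using member_le_sum[of i "{..<k}" "%i. \<bar>a i\<bar>"] that m by force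
  thus "x \<in> (\<Union>m. h ` ?A m)" using a by blast
 qed
 ultimately show ?thesis by (rule small_set_subset)
qed

lemma small_set_lipschitz_image:
 assumes X: "small_set k X" and h: "L-lipschitz_on X h" shows "small_set k (h ` X)" unfolding small_set_def
proof (intro allI impI)
 fix w :: "real => real" and dlt :: real
 assume w: "(\<forall>r. 0 <= w r) & (w \<longlongrightarrow> 0) (at_right 0)" and dlt: "0 < dlt"
 \<comment> \<open>The centre of a covering ball may lie outside X. A ball that meets X is recentred
   at a point of X with twice the radius, whence 2 L; the 1 is for open balls.\<close>
 define A where "A = 2*L + 1"
 have A: "1 <= A" using lipschitz_on_nonneg[OF h] by (simp add: A_def)
 let ?w = "%r. A ^ k*w (A*r)"
 have "filterlim (%r. A*r) (at_right 0) (at_right 0)" unfolding filterlim_at using A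
  by (auto intro!: tendsto_eq_intros simp: eventually_at_filter)
 hence "((%r. w (A*r)) \<longlongrightarrow> 0) (at_right 0)" using w by (auto intro: filterlim_compose)
 hence lim: "(?w \<longlongrightarrow> 0) (at_right 0)" using tendsto_mult_right_zero by blast
 have "0 < dlt/A" using dlt A by simp
 have w1: "0 <= A ^ k*w (A*r)" for r using w A by simp
 obtain c r where cr: "!!i::nat. r i < dlt/A" "X \<subseteq> (\<Union>i. ball (c i) (r i))" "(\<Sum>i. gauge_weight ?w k (r i)) < ennreal (dlt/A)"
  using small_setD[OF X w1 lim \<open>0 < dlt / A\<close>] by (elim exE conjE) auto
 define c' where "c' i = h (SOME x. x \<in> X & x \<in> ball (c i) (r i))" for i
 show "\<exists>c r. (\<forall>i::nat. r i < dlt) & h ` X \<subseteq> (\<Union>i. ball (c i) (r i)) & (\<Sum>i. gauge_weight w k (r i)) < ennreal dlt"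
 proof (rule exI[of _ c'], rule exI[of _ "%i. A*r i"], intro conjI allI)
  show "A*r i < dlt" for i using cr(1)[of i] A by (simp add: pos_less_divide_eq mult.commute)
  show "h ` X \<subseteq> (\<Union>i. ball (c' i) (A*r i))"
  proof (rule image_subsetI)
   fix x assume x: "x \<in> X"
   then obtain i where i: "x \<in> ball (c i) (r i)" using cr(2) by blast
   define x' where "x' = (SOME x. x \<in> X & x \<in> ball (c i) (r i))"
   have x': "x' \<in> X & x' \<in> ball (c i) (r i)" unfolding x'_def by (rule someI[of _ x]) (use x i in auto)
   have r0: "0 < r i" using i by (meson mem_ball zero_le_dist le_less_trans)
   have "dist x' x <= 2*r i" using x' i dist_triangle2[of x' x "c i"] by (auto simp: dist_commute)
   hence "dist (h x') (h x) <= L*(2*r i)"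
    using lipschitz_onD[OF h, of x' x] x x' mult_left_mono[OF _ lipschitz_on_nonneg[OF h]] order_trans by blast
   also have "... < A*r i" using r0 by (simp add: A_def algebra_simps)
   finally have "h x \<in> ball (c' i) (A*r i)" by (simp add: c'_def x'_def)
   thus "h x \<in> (\<Union>i. ball (c' i) (A*r i))" by (rule UN_I[OF UNIV_I])
  qed
  have "gauge_weight w k (A*r i) = gauge_weight ?w k (r i)" for i
   using A by (auto simp: gauge_weight_def power_mult_distrib mult_le_0_iff algebra_simps)
  hence "(\<Sum>i. gauge_weight w k (A*r i)) < ennreal (dlt/A)" using cr(3) by simp
  also have "... <= ennreal dlt" using dlt A by (intro ennreal_leI) (simp add: divide_le_eq mult_le_cancel_left1)
  finally show "(\<Sum>i. gauge_weight w k (A*r i)) < ennreal dlt" .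
 qed
qed

text \<open>A covering set of diameter q is put into a ball of radius q + t, as an open ball of
  radius q might miss points and is empty for a single point. The numbers t are so small that the
  k-th powers grow by a geometric sequence only.\<close>

lemma small_set_hausdorff_null:
 fixes X :: "'a::metric_space set"
 assumes "hausdorff_measure k X = 0" shows "small_set k X" unfolding small_set_def
proof (intro allI impI)
 fix w :: "real => real" and dlt :: real
 assume w: "(\<forall>r. 0 <= w r) & (w \<longlongrightarrow> 0) (at_right 0)" and dlt: "0 < dlt"
 have "\<forall>\<^sub>F h in at_right 0. w h < 1" by (rule order_tendstoD(2)) (use w in auto)
 then obtain b where b: "0 < b" "!!r. 0 < r ==> r < b ==> w r < 1" unfolding eventually_at_right_field by auto
 define d0 where "d0 = min b dlt"
 have d0: "0 < d0" using b dlt by (simp add: d0_def)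
 define V where "V = unit_ball_vol (real k)"
 have V: "0 < V" by (simp add: V_def)
 define eps where "eps = V/2 ^ k*(dlt/4)"
 have eps: "0 < eps" using V dlt by (simp add: eps_def)
 have "hausdorff_premeasure k (d0/2) X = 0"
  using assms d0 unfolding hausdorff_measure_def by (auto simp: SUP_eq_iff bot_ennreal dest!: SUP_bot_conv(1)[THEN iffD1, rotated])
 hence "hausdorff_premeasure k (d0/2) X < ennreal eps" using eps by simp
 then obtain C where C: "X \<subseteq> (\<Union>i::nat. C i)" "!!i. bounded (C i) & diameter (C i) <= d0/2"
  "(\<Sum>i. if C i = {} then 0 else ennreal (V*(diameter (C i)/2) ^ k)) < ennreal eps"
  unfolding hausdorff_premeasure_def INF_less_iff V_def by auto
 have "\<exists>t>0. t < d0/2 & (diameter (C i) + t) ^ k < diameter (C i) ^ k + (dlt/4)*(1/2) ^ Suc i" for i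
 proof -
  have "((%t. (diameter (C i) + t) ^ k) \<longlongrightarrow> (diameter (C i) + 0) ^ k) (at_right 0)" by (intro tendsto_intros)
  from eventually_at_right_lessI[OF this, of "diameter (C i) ^ k + (dlt/4)*(1/2) ^ Suc i"]
  have "\<forall>\<^sub>F t in at_right 0. (diameter (C i) + t) ^ k < diameter (C i) ^ k + (dlt/4)*(1/2) ^ Suc i" using dlt by simp
  moreover have "0 < d0/2" using d0 by simp
  ultimately show ?thesis by (rule at_right_witness) blast
 qed
 then obtain t where t: "!!i. 0 < t i" "!!i. t i < d0/2"
  "!!i. (diameter (C i) + t i) ^ k < diameter (C i) ^ k + (dlt/4)*(1/2) ^ Suc i" by metis
 define r where "r i = (if C i = {} then 0 else diameter (C i) + t i)" for i
 define c where "c i = (SOME x. x \<in> C i)" for i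
 have dn: "0 <= diameter (C i)" for i using C(2) by (intro diameter_ge_0) auto
 show "\<exists>c r. (\<forall>i::nat. r i < dlt) & X \<subseteq> (\<Union>i. ball (c i) (r i)) & (\<Sum>i. gauge_weight w k (r i)) < ennreal dlt"
 proof (rule exI[of _ c], rule exI[of _ r], intro conjI allI)
  have rd: "r i < d0" for i using C(2)[of i] t(2)[of i] d0 by (auto simp: r_def)
  show "r i < dlt" for i using rd[of i] by (simp add: d0_def)
  show "X \<subseteq> (\<Union>i. ball (c i) (r i))"
  proof
   fix x assume "x \<in> X"
   then obtain i where i: "x \<in> C i" using C(1) by blast
   hence "c i \<in> C i" unfolding c_def by (rule someI)
   hence "dist (c i) x <= diameter (C i)" using i C(2) by (intro diameter_bounded_bound) auto
   also have "... < r i" using i t(1)[of i] by (auto simp: r_def)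
   finally show "x \<in> (\<Union>i. ball (c i) (r i))" by auto
  qed
  let ?e = "%i. if C i = {} then 0 else ennreal (V*(diameter (C i)/2) ^ k)"
  have "gauge_weight w k (r i) <= ennreal (2 ^ k/V)*?e i + ennreal ((dlt/4)*(1/2) ^ Suc i)" for i
  proof (cases "C i = {}")
   case True thus ?thesis by (simp add: r_def gauge_weight_def)
  next
   case False
   have r0: "0 < r i" using False t(1)[of i] dn[of i] by (simp add: r_def)
   have "w (r i)*r i ^ k <= 1*r i ^ k" using b(2)[of "r i"] r0 rd[of i] by (intro mult_right_mono) (auto simp: d0_def)
   also have "... <= diameter (C i) ^ k + (dlt/4)*(1/2) ^ Suc i" using t(3)[of i] False by (simp add: r_def)
   also have "diameter (C i) ^ k = 2 ^ k/V*(V*(diameter (C i)/2) ^ k)" using V by (simp add: power_divide)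
   finally have "ennreal (w (r i)*r i ^ k) <= ennreal (2 ^ k/V*(V*(diameter (C i)/2) ^ k) + (dlt/4)*(1/2) ^ Suc i)"
    by (rule ennreal_leI)
   also have "... = ennreal (2 ^ k/V*(V*(diameter (C i)/2) ^ k)) + ennreal ((dlt/4)*(1/2) ^ Suc i)"
    using V dlt dn[of i] by (intro ennreal_plus mult_nonneg_nonneg zero_le_power divide_nonneg_pos) auto
   also have "ennreal (2 ^ k/V*(V*(diameter (C i)/2) ^ k)) = ennreal (2 ^ k/V)*ennreal (V*(diameter (C i)/2) ^ k)"
    using V dn[of i] by (intro ennreal_mult mult_nonneg_nonneg zero_le_power divide_nonneg_pos) auto
   finally show ?thesis using False r0 by (simp add: gauge_weight_def)
  qed
  hence "(\<Sum>i. gauge_weight w k (r i)) <= (\<Sum>i. ennreal (2 ^ k/V)*?e i + ennreal ((dlt/4)*(1/2) ^ Suc i))"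
   by (intro suminf_le) auto
  also have "... = (\<Sum>i. ennreal (2 ^ k/V)*?e i) + (\<Sum>i. ennreal ((dlt/4)*(1/2) ^ Suc i))"
   by (intro suminf_add[symmetric]) auto
  also have "(\<Sum>i. ennreal ((dlt/4)*(1/2) ^ Suc i)) = ennreal (dlt/4)" using dlt by (intro suminf_geometric_ennreal) auto
  also have "(\<Sum>i. ennreal (2 ^ k/V)*?e i) = ennreal (2 ^ k/V)*(\<Sum>i. ?e i)" by (rule ennreal_suminf_cmult)
  also have "ennreal (2 ^ k/V)*(\<Sum>i. ?e i) <= ennreal (2 ^ k/V)*ennreal eps" using C(3) by (intro mult_left_mono) auto
  also have "ennreal (2 ^ k/V)*ennreal eps = ennreal (dlt/4)"
   using V eps by (subst ennreal_mult[symmetric]) (auto simp: eps_def)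
  also have "ennreal (dlt/4) + ennreal (dlt/4) = ennreal (dlt/2)" using dlt by (subst ennreal_plus[symmetric]) auto
  also have "... < ennreal dlt" using dlt by (simp add: ennreal_lessI)
  finally show "(\<Sum>i. gauge_weight w k (r i)) < ennreal dlt" by simp
 qed
qed

lemma small_set_countably_rectifiable:
 assumes "countably_rectifiable k A" shows "small_set k A"
proof -
 obtain E :: "nat => 'a set" where E: "!!i. lipschitz_image_of_Rk k (E i)" "hausdorff_measure k (A - (\<Union>i. E i)) = 0"
  using assms unfolding countably_rectifiable_def by blast
 have "small_set k ((\<Union>i. E i) \<union> (A - (\<Union>i. E i)))"
  by (intro small_set_Un small_set_UN small_set_lipschitz_image_of_Rk small_set_hausdorff_null E)
 thus ?thesis by (rule small_set_subset) auto
qed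

text \<open>Adding an interval of parameters raises the dimension by one: a ball of radius r is
  combined with about \<tau>/r time slots of length r, and r^(k+1) times their number is of order
  r^k. \<open>P\<close> is a relation, so that several parameters may lead to the same
  point.\<close>

lemma small_set_parametrized:
 fixes X :: "'a::metric_space set" and A :: "'b::metric_space set"
 assumes A: "small_set k A" and \<tau>: "0 <= \<tau>" and C: "0 <= C"
  and P: "!!x. x \<in> X ==> \<exists>a\<in>A. \<exists>t\<in>{0..\<tau>}. P x a t"
  and l: "!!x a t x' a' t'. P x a t ==> P x' a' t' ==> a \<in> A ==> a' \<in> A ==> t \<in> {0..\<tau>} ==> t' \<in> {0..\<tau>} ==>
   dist x x' <= C*(dist a a' + \<bar>t - t'\<bar>)"
 shows "small_set (Suc k) X" unfolding small_set_def
proof (intro allI impI)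
 fix w :: "real => real" and dlt :: real
 assume w: "(\<forall>r. 0 <= w r) & (w \<longlongrightarrow> 0) (at_right 0)" and dlt: "0 < dlt"
 \<comment> \<open>Two parameters in the same ball and slot differ by at most 2 r and r; the 1 is
   for open balls.\<close>
 define D where "D = 3*C + 1"
 have D: "1 <= D" using C by (simp add: D_def)
 define M where "M = (\<tau> + 1)*D ^ Suc k"
 have M: "0 <= M" using \<tau> D by (simp add: M_def)
 let ?w = "%r. M*w (D*r)"
 have "filterlim (%r. D*r) (at_right 0) (at_right 0)"
  unfolding filterlim_at using D by (auto intro!: tendsto_eq_intros simp: eventually_at_filter)
 hence "((%r. w (D*r)) \<longlongrightarrow> 0) (at_right 0)" using w by (auto intro: filterlim_compose)
 hence lim: "(?w \<longlongrightarrow> 0) (at_right 0)" using tendsto_mult_right_zero by blast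
 have w1: "0 <= M*w (D*r)" for r using w M by simp
 define dlt' where "dlt' = min (dlt/D) 1"
 have dlt': "0 < dlt'" "dlt' <= 1" "dlt' <= dlt/D" using dlt D by (auto simp: dlt'_def)
 obtain c r where cr: "!!i::nat. r i < dlt'" "A \<subseteq> (\<Union>i. ball (c i) (r i))" "(\<Sum>i. gauge_weight ?w k (r i)) < ennreal dlt'"
  using small_setD[OF A w1 lim dlt'(1)] by (elim exE conjE) auto
 define n where "n i = nat \<lfloor>\<tau>/r i\<rfloor> + 1" for i
 define Q where "Q i m x \<longleftrightarrow> x \<in> X & (\<exists>a\<in>A \<inter> ball (c i) (r i). \<exists>t\<in>{0..\<tau>} \<inter> {real m*r i..(real m + 1)*r i}. P x a t)" for i m x
 define c' where "c' i m = (SOME x. Q i m x)" for i m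
 define r' where "r' i m = (if m < n i then D*r i else 0)" for i m
 have near: "dist (c' i m) x < D*r i" if Q: "Q i m x" for i m x
 proof -
  have "Q i m (c' i m)" unfolding c'_def using Q by (rule someI)
  then obtain a t where a: "a \<in> A" "a \<in> ball (c i) (r i)" "t \<in> {0..\<tau>}" "t \<in> {real m*r i..(real m + 1)*r i}" "P (c' i m) a t"
   unfolding Q_def by blast
  obtain a' t' where a': "a' \<in> A" "a' \<in> ball (c i) (r i)" "t' \<in> {0..\<tau>}" "t' \<in> {real m*r i..(real m + 1)*r i}" "P x a' t'"
   using Q unfolding Q_def by blast
  have r0: "0 < r i" using a(2) by (meson mem_ball zero_le_dist le_less_trans)
  have "dist a a' <= 2*r i" using a(2) a'(2) dist_triangle2[of a a' "c i"] by (auto simp: dist_commute)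
  moreover have "\<bar>t - t'\<bar> <= r i" using a(4) a'(4) by (auto simp: algebra_simps)
  ultimately have "C*(dist a a' + \<bar>t - t'\<bar>) <= C*(3*r i)" using C by (intro mult_left_mono) auto
  also have "... < D*r i" using r0 by (simp add: D_def algebra_simps)
  finally show ?thesis using l[OF a(5) a'(5) a(1) a'(1) a(3) a'(3)] by simp
 qed
 have "\<exists>c r. (\<forall>i::nat. r i < dlt) & X \<subseteq> (\<Union>i. ball (c i) (r i)) & (\<Sum>i. gauge_weight w (Suc k) (r i)) < ennreal dlt"
 proof (rule exI[of _ "%j. case_prod c' (prod_decode j)"], rule exI[of _ "%j. case_prod r' (prod_decode j)"], intro conjI allI)
  fix j
  obtain i m where "prod_decode j = (i, m)" by (cases "prod_decode j")
  moreover have "r i < dlt/D" using cr(1)[of i] dlt'(3) by linarith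
  hence "D*r i < dlt" using D by (simp add: pos_less_divide_eq mult.commute)
  ultimately show "case_prod r' (prod_decode j) < dlt" using dlt by (simp add: r'_def)
 next
  show "X \<subseteq> (\<Union>j. ball (case_prod c' (prod_decode j)) (case_prod r' (prod_decode j)))"
  proof
   fix x assume x: "x \<in> X"
   then obtain a t where a: "a \<in> A" "t \<in> {0..\<tau>}" "P x a t" using P by blast
   then obtain i where i: "a \<in> ball (c i) (r i)" using cr(2) by blast
   hence r0: "0 < r i" by (meson mem_ball zero_le_dist le_less_trans)
   define m where "m = nat \<lfloor>t/r i\<rfloor>"
   have t0: "0 <= t/r i" using a(2) r0 by simp
   have rm: "real m <= t/r i" "t/r i <= real m + 1" using t0 unfolding m_def by linarith+
   have "real m*r i <= t" "t <= (real m + 1)*r i" using rm r0 by (auto simp: pos_le_divide_eq pos_divide_le_eq)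
   hence Q: "Q i m x" unfolding Q_def using x a i by (intro conjI bexI[of _ a] bexI[of _ t]) auto
   have "t/r i <= \<tau>/r i" using a(2) r0 by (intro divide_right_mono) auto
   hence "m < n i" unfolding m_def n_def by (simp add: floor_mono nat_mono less_Suc_eq_le)
   hence "x \<in> ball (c' i m) (r' i m)" using near[OF Q] by (simp add: r'_def)
   thus "x \<in> (\<Union>j. ball (case_prod c' (prod_decode j)) (case_prod r' (prod_decode j)))"
    by (intro UN_I[of "prod_encode (i, m)"]) auto
  qed
 next
  have one: "(\<Sum>m. gauge_weight w (Suc k) (r' i m)) <= gauge_weight ?w k (r i)" for i
  proof (cases "r i <= 0")
   case True
   hence "D*r i <= 0" using D by (simp add: mult_le_0_iff)
   hence "gauge_weight w (Suc k) (r' i m) = 0" for m by (auto simp: r'_def gauge_weight_def)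
   thus ?thesis by simp
  next
   case False
   hence r0: "0 < r i" by simp
   have "(\<Sum>m. gauge_weight w (Suc k) (r' i m)) = (\<Sum>m<n i. gauge_weight w (Suc k) (r' i m))"
    by (rule suminf_finite) (auto simp: r'_def gauge_weight_def)
   also have "... = (\<Sum>m<n i. ennreal (w (D*r i)*(D*r i) ^ Suc k))"
    using r0 D by (intro sum.cong) (auto simp: r'_def gauge_weight_def mult_le_0_iff)
   also have "... = ennreal (real (n i)*(w (D*r i)*(D*r i) ^ Suc k))"
    using w r0 D by (simp add: ennreal_mult'' ennreal_of_nat_eq_real_of_nat del: power_Suc)
   also have "... <= ennreal (?w (r i)*r i ^ k)"
   proof (rule ennreal_leI)
    have "real (n i) <= \<tau>/r i + 1" unfolding n_def using \<tau> r0 by (simp add: of_nat_nat)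
    hence "real (n i)*r i <= (\<tau>/r i + 1)*r i" using r0 by (intro mult_right_mono) auto
    also have "... <= \<tau> + 1" using r0 cr(1)[of i] dlt'(2) by (simp add: distrib_right)
    finally have nr: "real (n i)*r i <= \<tau> + 1" .
    have "real (n i)*(w (D*r i)*(D*r i) ^ Suc k) = (real (n i)*r i)*(w (D*r i)*(D ^ Suc k*r i ^ k))"
     by (simp add: power_mult_distrib algebra_simps)
    also have "... <= (\<tau> + 1)*(w (D*r i)*(D ^ Suc k*r i ^ k))" using nr w D r0 by (intro mult_right_mono) auto
    also have "... = ?w (r i)*r i ^ k" by (simp add: M_def algebra_simps)
    finally show "real (n i)*(w (D*r i)*(D*r i) ^ Suc k) <= ?w (r i)*r i ^ k" .
   qed
   finally show ?thesis using r0 by (simp add: gauge_weight_def)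
  qed
  have "(\<Sum>j. gauge_weight w (Suc k) (case_prod r' (prod_decode j))) = (\<Sum>j. (%(i, m). gauge_weight w (Suc k) (r' i m)) (prod_decode j))"
   by (simp add: case_prod_unfold)
  also have "... = (\<Sum>i. \<Sum>m. gauge_weight w (Suc k) (r' i m))" by (rule suminf_ennreal_2dimen) simp
  also have "... <= (\<Sum>i. gauge_weight ?w k (r i))" using one by (intro suminf_le) auto
  also have "... < ennreal dlt'" by (rule cr(3))
  also have "... <= ennreal dlt"
   using dlt' D dlt by (intro ennreal_leI) (simp add: dlt'_def min_le_iff_disj divide_le_eq mult_le_cancel_left1)
  finally show "(\<Sum>j. gauge_weight w (Suc k) (case_prod r' (prod_decode j))) < ennreal dlt" .
 qed
 thus "\<exists>c r. (\<forall>i::nat. r i < dlt) & X \<subseteq> (\<Union>i. ball (c i) (r i)) & (\<Sum>i. gauge_weight w (Suc k) (r i)) < ennreal dlt" .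
qed

section \<open>Degenerate normals\<close>

text \<open>B is an orthonormal basis of the complement of the plane of \<xi> and a. The component
  along a is left out on purpose: it will be controlled by transversality and not by a
  coordinate.\<close>

lemma two_plane_coordinates:
 fixes \<xi> a :: "'a::euclidean_space"
 assumes "norm \<xi> = 1" "norm a = 1" "\<xi> \<bullet> a = 0"
 obtains B where "finite B" "card B + 2 = DIM('a)" "!!b. b \<in> B ==> norm b = 1"
  "!!v. norm (v - (a \<bullet> v) *\<^sub>R a) <= \<bar>\<xi> \<bullet> v\<bar> + (\<Sum>b\<in>B. \<bar>v \<bullet> b\<bar>)"
proof -
 let ?A = "{\<xi>, a}"
 have ne: "\<xi> ~= a" "\<xi> ~= 0" "a ~= 0" using assms by auto
 have po: "pairwise orthogonal ?A" using assms by (auto simp: pairwise_insert orthogonal_def inner_commute)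
 have ind: "independent ?A" by (rule pairwise_orthogonal_independent[OF po]) (use ne in auto)
 have dA: "dim (span ?A) = 2" using ind ne by (simp add: dim_span dim_eq_card_independent)
 let ?M = "{y \<in> UNIV. \<forall>x\<in>span ?A. orthogonal x y}"
 have dM: "dim ?M + 2 = DIM('a)" using dim_subspace_orthogonal_to_vectors[of "span ?A" UNIV] dA by simp
 have sM: "subspace ?M" by (auto simp: subspace_def orthogonal_clauses)
 obtain B where B: "B \<subseteq> ?M" "pairwise orthogonal B" "!!x. x \<in> B ==> norm x = 1" "independent B" "card B = dim ?M" "span B = ?M"
  by (rule orthonormal_basis_subspace[OF sM]) blast
 have fB: "finite B" using B(4) independent_bound by blast
 have perp: "\<xi> \<bullet> b = 0" "a \<bullet> b = 0" if "b \<in> ?M" for b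
  using that span_base[of \<xi> ?A] span_base[of a ?A] by (auto simp: orthogonal_def)
 have "norm (v - (a \<bullet> v) *\<^sub>R a) <= \<bar>\<xi> \<bullet> v\<bar> + (\<Sum>b\<in>B. \<bar>v \<bullet> b\<bar>)" for v
 proof -
  define z where "z = v - (\<xi> \<bullet> v) *\<^sub>R \<xi> - (a \<bullet> v) *\<^sub>R a"
  have za: "\<xi> \<bullet> z = 0" "a \<bullet> z = 0"
   using assms by (simp_all add: z_def inner_diff_right power2_norm_eq_inner[symmetric] inner_commute)
  have "z \<in> ?M"
  proof -
   have "orthogonal z x" if "x \<in> span ?A" for x
    by (rule orthogonal_to_span[OF that]) (use za in \<open>auto simp: orthogonal_def inner_commute\<close>)
   thus ?thesis by (simp add: orthogonal_commute)
  qed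
  hence "z \<in> span B" using B(6) by simp
  from orthonormal_basis_expand[OF B(2,3) this fB] have ze: "(\<Sum>b\<in>B. (z \<bullet> b) *\<^sub>R b) = z" .
  have zb: "z \<bullet> b = v \<bullet> b" if "b \<in> B" for b
   using perp[OF subsetD[OF B(1) that]] by (simp add: z_def inner_diff_left)
  have "norm z <= (\<Sum>b\<in>B. norm ((z \<bullet> b) *\<^sub>R b))" using norm_sum[of "%b. (z \<bullet> b) *\<^sub>R b" B] unfolding ze .
  also have "... = (\<Sum>b\<in>B. \<bar>v \<bullet> b\<bar>)" using B(3) zb by (intro sum.cong) auto
  finally have "norm z <= (\<Sum>b\<in>B. \<bar>v \<bullet> b\<bar>)" .
  moreover have "v - (a \<bullet> v) *\<^sub>R a = (\<xi> \<bullet> v) *\<^sub>R \<xi> + z" by (simp add: z_def)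
  hence "norm (v - (a \<bullet> v) *\<^sub>R a) <= norm ((\<xi> \<bullet> v) *\<^sub>R \<xi>) + norm z" by (simp only: norm_triangle_ineq)
  ultimately show ?thesis using assms(1) by simp
 qed
 with fB dM B(3,5) show thesis by (intro that[of B]) auto
qed

context smooth_exit_problem
begin

lemma normal_at_combine:
 assumes "normal_at z \<sigma>1 \<xi>" "normal_at z \<sigma>2 \<eta>" "0 <= a" "0 <= b"
 shows "normal_at z (a*\<sigma>1 + b*\<sigma>2) (a *\<^sub>R \<xi> + b *\<^sub>R \<eta>)" unfolding normal_at_def
proof (intro conjI ballI)
 show "0 <= a*\<sigma>1 + b*\<sigma>2" using assms unfolding normal_at_def by simp
 fix y assume y: "y \<in> closure (- S)"
 have "a*(\<xi> \<bullet> (y - z)) <= a*(\<sigma>1*(norm (y - z))^2)" "b*(\<eta> \<bullet> (y - z)) <= b*(\<sigma>2*(norm (y - z))^2)"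
  using assms y unfolding normal_at_def by (auto intro!: mult_left_mono)
 thus "(a *\<^sub>R \<xi> + b *\<^sub>R \<eta>) \<bullet> (y - z) <= (a*\<sigma>1 + b*\<sigma>2)*(norm (y - z))^2"
  by (simp add: inner_add_left algebra_simps)
qed

lemma normal_at_mono: "normal_at z \<sigma> \<xi> ==> \<sigma> <= \<sigma>' ==> normal_at z \<sigma>' \<xi>"
 unfolding normal_at_def by (meson mult_right_mono order_trans zero_le_power2)

text \<open>Adding the two normal inequalities gives (p2 - p1) . (z2 - z1) \<ge> -2 m |z2 - z1|^2.
  The shift by 4 m (z2 - z1) makes this strongly monotone, so that D controls the differences of
  points and of normals, as in Minty's parametrization of a monotone graph.\<close>

lemma normal_at_hypomonotone:
 assumes "normal_at z1 m p1" "normal_at z2 m p2" "z1 \<in> closure (- S)" "z2 \<in> closure (- S)" "0 < m"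
  and D: "D = p2 - p1 + (4*m) *\<^sub>R (z2 - z1)"
 shows "2*m*norm (z2 - z1) <= norm D" "norm (p2 - p1) <= 3*norm D"
proof -
 let ?z = "z2 - z1"
 have "p1 \<bullet> ?z <= m*(norm ?z)^2" "p2 \<bullet> (z1 - z2) <= m*(norm (z1 - z2))^2"
  using assms unfolding normal_at_def by auto
 hence "- (2*m*(norm ?z)^2) <= (p2 - p1) \<bullet> ?z" by (simp add: norm_minus_commute inner_diff_left inner_diff_right)
 hence "2*m*(norm ?z)^2 <= D \<bullet> ?z" by (simp add: D inner_add_left power2_norm_eq_inner)
 also have "... <= norm D*norm ?z" using Cauchy_Schwarz_ineq2[of D ?z] by linarith
 finally have "(2*m*norm ?z)*norm ?z <= norm D*norm ?z" by (simp add: power2_eq_square)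
 thus 1: "2*m*norm ?z <= norm D" using assms(5) by (cases "?z = 0") auto
 have "p2 - p1 = D - (4*m) *\<^sub>R ?z" by (simp add: D)
 hence "norm (p2 - p1) <= norm D + norm ((4*m) *\<^sub>R ?z)" by (simp only: norm_triangle_ineq4)
 also have "norm ((4*m) *\<^sub>R ?z) = 2*(2*m*norm ?z)" using assms(5) by simp
 finally show "norm (p2 - p1) <= 3*norm D" using 1 by linarith
qed

text \<open>\<eta> is the second normal, along which F leaves its degenerate value at least with
  rate \<kappa>. F is a parameter because it will be \<open>hh\<close> in one case and a linear
  functional of the normal in the other.\<close>

definition transversal_triples :: "('a => 'a => real) => real => real => ('a \<times> 'a \<times> 'a) set" where
 "transversal_triples F m \<kappa> = {(z, \<xi>, \<eta>). z \<in> closure (- S) & norm \<xi> = 1 & norm \<eta> <= 1 & normal_at z m \<xi> &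
   normal_at z m \<eta> & F z \<xi> <= 0 & (\<forall>s\<in>{0..1}. \<kappa> * s <= F z (\<xi> + s *\<^sub>R \<eta>))}"

text \<open>\<xi>1 + s \<eta>1 is a normal at z1 with F \<ge> \<kappa> s, while the multiple (1 + s
  \<alpha>) \<xi>2 is a normal at z2 with F \<le> 0. By hypomonotonicity both pairs depend on the
  parameter \<xi> + 8 m z in a Lipschitz way, so the parameters are at least a multiple of s apart.
  The constants double to 2 m because normals are added; \<alpha> leaves room for making the
  direction orthogonal to a given \<xi>.\<close>

lemma transversal_avoid:
 assumes hom: "!!z t p. 0 <= t ==> F z (t *\<^sub>R p) = t*F z p"
  and lip: "!!z z' p p'. norm p <= 2 ==> norm p' <= 2 ==> \<bar>F z p - F z' p'\<bar> <= \<Lambda>*(norm (z - z') + norm (p - p'))"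
  and pos: "0 < \<Lambda>" "0 < m"
  and t1: "(z1, \<xi>1, \<eta>1) \<in> transversal_triples F m \<kappa>" and t2: "(z2, \<xi>2, \<eta>2) \<in> transversal_triples F m \<kappa>"
  and \<alpha>: "\<bar>\<alpha>\<bar> <= 1" and s: "0 <= s" "s <= 1/2"
 shows "\<kappa> * s <= \<Lambda>*(3 + 1/(4*m))*norm ((\<xi>2 - \<xi>1) + (8*m) *\<^sub>R (z2 - z1) - s *\<^sub>R (\<eta>1 - \<alpha> *\<^sub>R \<xi>2))"
proof -
 have 1: "z1 \<in> closure (- S)" "norm \<xi>1 = 1" "norm \<eta>1 <= 1" "normal_at z1 m \<xi>1" "normal_at z1 m \<eta>1" "\<kappa> * s <= F z1 (\<xi>1 + s *\<^sub>R \<eta>1)"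
  using t1 s unfolding transversal_triples_def by auto
 have 2: "z2 \<in> closure (- S)" "norm \<xi>2 = 1" "normal_at z2 m \<xi>2" "F z2 \<xi>2 <= 0"
  using t2 unfolding transversal_triples_def by auto
 have "\<bar>s*\<alpha>\<bar> <= s*1" using \<alpha> s by (simp add: abs_mult mult_left_le)
 hence sa: "0 <= 1 + s*\<alpha>" "1 + s*\<alpha> <= 2" using s by linarith+
 let ?p1 = "1 *\<^sub>R \<xi>1 + s *\<^sub>R \<eta>1" and ?p2 = "(1 + s*\<alpha>) *\<^sub>R \<xi>2 + 0 *\<^sub>R \<xi>2"
 have n1: "normal_at z1 (2*m) ?p1"
  by (rule normal_at_mono[OF normal_at_combine[OF 1(4,5)]]) (use s pos in \<open>auto simp: mult_left_le_one_le\<close>)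
 have n2: "normal_at z2 (2*m) ?p2" by (rule normal_at_mono[OF normal_at_combine[OF 2(3,3)]]) (use sa pos in auto)
 let ?D = "(\<xi>2 - \<xi>1) + (8*m) *\<^sub>R (z2 - z1) - s *\<^sub>R (\<eta>1 - \<alpha> *\<^sub>R \<xi>2)"
 have D: "?D = ?p2 - ?p1 + (4*(2*m)) *\<^sub>R (z2 - z1)" by (simp add: algebra_simps)
 have m2: "0 < 2*m" using pos by simp
 note h = normal_at_hypomonotone[OF n1 n2 1(1) 2(1) m2 D]
 have "norm (z2 - z1) <= norm ?D/(4*m)" using h(1) pos by (simp add: field_simps)
 hence zz: "norm (z1 - z2) + norm (?p1 - ?p2) <= (3 + 1/(4*m))*norm ?D"
  using h(2) by (simp add: norm_minus_commute algebra_simps)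
 have "norm ?p1 <= 1 + s*1" using norm_triangle_ineq[of "1 *\<^sub>R \<xi>1" "s *\<^sub>R \<eta>1"] 1 s mult_left_mono[OF 1(3) s(1)] by simp
 hence np: "norm ?p1 <= 2" "norm ?p2 <= 2" using s sa 2 by auto
 have "F z2 ?p2 <= 0" using hom[OF sa(1), of z2 \<xi>2] 2(4) sa by (simp add: mult_nonneg_nonpos)
 hence "\<kappa> * s <= F z1 ?p1 - F z2 ?p2" using 1(6) by simp
 also have "... <= \<Lambda>*(norm (z1 - z2) + norm (?p1 - ?p2))" using lip[OF np, of z1 z2] by linarith
 also have "... <= \<Lambda>*((3 + 1/(4*m))*norm ?D)" using zz pos by (intro mult_left_mono) auto
 finally show ?thesis by (simp add: mult.assoc)
qed

text \<open>The parameter \<open>w = \<xi> + 8 m z\<close> determines \<open>(z, \<xi>)\<close> in a Lipschitz way, because normals are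
 hypomonotone. It moves almost orthogonally to \<open>\<xi>\<close> since \<open>\<bar>\<xi>\<bar> = 1\<close>, and it avoids a cone
 around \<open>\<eta>\<close> by transversality; so it is determined by \<open>d - 2\<close> coordinates.\<close>

lemma transversal_pairs_small:
 assumes hom: "!!z t p. 0 <= t ==> F z (t *\<^sub>R p) = t*F z p"
  and lip: "!!z z' p p'. norm p <= 2 ==> norm p' <= 2 ==> \<bar>F z p - F z' p'\<bar> <= \<Lambda>*(norm (z - z') + norm (p - p'))"
  and pos: "0 < \<Lambda>" "0 < m" "0 < \<kappa>"
 shows "small_set (DIM('a) - 2) ((%(z, \<xi>, \<eta>). (z, \<xi>)) ` transversal_triples F m \<kappa>)"
proof (rule small_set_local_image)
 fix t0 assume t0: "t0 \<in> transversal_triples F m \<kappa>"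
 obtain z0 \<xi>0 \<eta>0 where t0e: "t0 = (z0, \<xi>0, \<eta>0)" by (cases t0)
 have h0: "norm \<xi>0 = 1" "norm \<eta>0 <= 1" "F z0 \<xi>0 <= 0" "!!s. s \<in> {0..1} ==> \<kappa> * s <= F z0 (\<xi>0 + s *\<^sub>R \<eta>0)"
  using t0 unfolding t0e transversal_triples_def by auto
 define \<alpha> where "\<alpha> = \<xi>0 \<bullet> \<eta>0"
 have \<alpha>: "\<bar>\<alpha>\<bar> <= 1" using Cauchy_Schwarz_ineq2[of \<xi>0 \<eta>0] h0 by (simp add: \<alpha>_def)
 define e where "e = \<eta>0 - \<alpha> *\<^sub>R \<xi>0"
 have "e ~= 0"
 proof
  assume "e = 0"
  hence "\<xi>0 + (1/2) *\<^sub>R \<eta>0 = (1 + \<alpha>/2) *\<^sub>R \<xi>0" by (simp add: e_def algebra_simps)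
  moreover have "F z0 ((1 + \<alpha>/2) *\<^sub>R \<xi>0) <= 0" using hom[of "1 + \<alpha>/2" z0 \<xi>0] \<alpha> h0(3) by (simp add: mult_nonneg_nonpos)
  ultimately show False using h0(4)[of "1/2"] pos by simp
 qed
 define \<beta> where "\<beta> = norm e"
 have \<beta>: "0 < \<beta>" using \<open>e \<noteq> 0\<close> by (simp add: \<beta>_def)
 have xx: "\<xi>0 \<bullet> \<xi>0 = 1" using h0(1) by (simp add: power2_norm_eq_inner[symmetric])
 have "e \<bullet> e = \<eta>0 \<bullet> \<eta>0 - \<alpha>^2" using xx by (simp add: e_def \<alpha>_def inner_diff_left inner_diff_right inner_commute power2_eq_square)
 also have "... <= 1" using power_le_one[OF norm_ge_zero h0(2), of 2] zero_le_power2[of \<alpha>] unfolding power2_norm_eq_inner[symmetric] by linarith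
 finally have \<beta>1: "\<beta> <= 1" unfolding \<beta>_def by (simp add: norm_eq_sqrt_inner)
 define a where "a = e /\<^sub>R \<beta>"
 have a: "norm a = 1" "\<xi>0 \<bullet> a = 0" "\<beta> *\<^sub>R a = e"
  using \<beta> xx by (auto simp: a_def \<beta>_def e_def \<alpha>_def inner_diff_right)
 obtain B where B: "finite B" "card B + 2 = DIM('a)" "!!b. b \<in> B ==> norm b = 1"
  "!!v. norm (v - (a \<bullet> v) *\<^sub>R a) <= \<bar>\<xi>0 \<bullet> v\<bar> + (\<Sum>b\<in>B. \<bar>v \<bullet> b\<bar>)"
  by (rule two_plane_coordinates[OF h0(1) a(1,2)]) blast
 define c where "c = \<kappa>/(\<Lambda>*(3 + 1/(4*m)))"
 have L3: "0 < \<Lambda>*(3 + 1/(4*m))" using pos by (simp add: add_pos_pos)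
 have c: "0 < c" using pos L3 by (simp add: c_def)
 define H where "H = 1 + 2/c"
 have H: "1 <= H" using c by (simp add: H_def)
 define Cb where "Cb = 4*m + 5"
 have Cb: "0 < Cb" using pos by (simp add: Cb_def)
 \<comment> \<open>In this order: bounded coordinates; s \<le> 1/2 in the use of
   \<open>transversal_avoid\<close>; room for moving \<eta> and \<xi> away from \<eta>0 and \<xi>0;
   absorption of \<xi>0 . D into half of |D|.\<close>
 define eps where "eps = min (min 1 (\<beta>/(4*(1 + 8*m)))) (min (c/4) (1/(2*H*Cb)))"
 have eps: "0 < eps" "eps <= 1" "eps <= \<beta>/(4*(1 + 8*m))" "eps <= c/4" "eps <= 1/(2*H*Cb)"
 proof -
  show "eps <= c/4" unfolding eps_def by (intro min.coboundedI2 min.cobounded1)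
  show "eps <= \<beta>/(4*(1 + 8*m))" unfolding eps_def by (intro min.coboundedI1 min.cobounded2)
 qed (use \<beta> c H Cb pos in \<open>auto simp: eps_def\<close>)
 have eps2: "4*(1 + 8*m)*eps <= \<beta>" "2*H*Cb*eps <= 1" using eps(3,5) pos H Cb by (auto simp: field_simps)
 let ?Y = "transversal_triples F m \<kappa> \<inter> ball t0 eps"
 have near: "norm (z - z0) <= eps" "norm (\<xi> - \<xi>0) <= eps" "norm (\<eta> - \<eta>0) <= eps" if "(z, \<xi>, \<eta>) \<in> ball t0 eps" for z \<xi> \<eta>
  using that dist_fst_le[of t0 "(z, \<xi>, \<eta>)"] dist_snd_le[of t0 "(z, \<xi>, \<eta>)"]
   dist_fst_le[of "(\<xi>0, \<eta>0)" "(\<xi>, \<eta>)"] dist_snd_le[of "(\<xi>0, \<eta>0)" "(\<xi>, \<eta>)"]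
  by (auto simp: t0e dist_norm norm_minus_commute)
 define w where "w x = snd x + (8*m) *\<^sub>R fst x" for x :: "'a \<times> 'a"
 have main: "norm (z2 - z1) + norm (\<xi>2 - \<xi>1) <= (1/(4*m) + 3)*(2*H*(\<Sum>b\<in>B. \<bar>(w (z2, \<xi>2) - w (z1, \<xi>1)) \<bullet> b\<bar>))"
  if T1: "(z1, \<xi>1, \<eta>1) \<in> ?Y" and T2: "(z2, \<xi>2, \<eta>2) \<in> ?Y" for z1 \<xi>1 \<eta>1 z2 \<xi>2 \<eta>2
 proof -
  have t1: "(z1, \<xi>1, \<eta>1) \<in> transversal_triples F m \<kappa>" and t2: "(z2, \<xi>2, \<eta>2) \<in> transversal_triples F m \<kappa>"
   and b1: "(z1, \<xi>1, \<eta>1) \<in> ball t0 eps" and b2: "(z2, \<xi>2, \<eta>2) \<in> ball t0 eps" using T1 T2 by auto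
  note n1 = near[OF b1] and n2 = near[OF b2]
  define D where "D = (\<xi>2 - \<xi>1) + (8*m) *\<^sub>R (z2 - z1)"
  define P where "P = (\<Sum>b\<in>B. \<bar>D \<bullet> b\<bar>)"
  have P0: "0 <= P" unfolding P_def by (intro sum_nonneg) auto
  have wD: "w (z2, \<xi>2) - w (z1, \<xi>1) = D" by (simp add: w_def D_def algebra_simps)
  have N: "normal_at z1 m \<xi>1" "normal_at z2 m \<xi>2" "z1 \<in> closure (- S)" "z2 \<in> closure (- S)" "norm \<xi>1 = 1" "norm \<xi>2 = 1"
   using t1 t2 unfolding transversal_triples_def by auto
  have m2: "0 < 2*m" using pos by simp
  have De: "D = \<xi>2 - \<xi>1 + (4*(2*m)) *\<^sub>R (z2 - z1)" by (simp add: D_def)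
  have N2: "normal_at z1 (2*m) \<xi>1" "normal_at z2 (2*m) \<xi>2"
   using normal_at_mono[OF N(1), of "2*m"] normal_at_mono[OF N(2), of "2*m"] pos by auto
  note hm = normal_at_hypomonotone[OF N2 N(3,4) m2 De]
  have dz: "norm (z2 - z1) <= 2*eps" and dx: "norm (\<xi>2 - \<xi>1) <= 2*eps"
   using n1 n2 norm_triangle_ineq4[of "z2 - z0" "z1 - z0"] norm_triangle_ineq4[of "\<xi>2 - \<xi>0" "\<xi>1 - \<xi>0"] by simp_all
  have nD: "norm D <= 2*(1 + 8*m)*eps"
  proof -
   have "norm D <= norm (\<xi>2 - \<xi>1) + norm ((8*m) *\<^sub>R (z2 - z1))" unfolding D_def by (rule norm_triangle_ineq)
   also have "... <= 2*eps + 8*m*(2*eps)" using dx dz pos by (intro add_mono) auto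
   finally show ?thesis by (simp add: algebra_simps)
  qed
  \<comment> \<open>Both normals have norm one, so \<xi>2 - \<xi>1 is orthogonal to \<xi>1 + \<xi>2,
    which is close to 2 \<xi>0.\<close>
  have bx: "\<bar>\<xi>0 \<bullet> (\<xi>2 - \<xi>1)\<bar> <= eps*norm (\<xi>2 - \<xi>1)"
  proof -
   have "(\<xi>1 + \<xi>2) \<bullet> (\<xi>2 - \<xi>1) = 0" using N(5,6)
    by (simp add: inner_add_left inner_add_right inner_diff_left inner_diff_right inner_commute dot_square_norm)
   hence "\<xi>0 \<bullet> (\<xi>2 - \<xi>1) = (\<xi>0 - (1/2) *\<^sub>R (\<xi>1 + \<xi>2)) \<bullet> (\<xi>2 - \<xi>1)" by (simp add: inner_diff_left)
   moreover have "norm (\<xi>0 - (1/2) *\<^sub>R (\<xi>1 + \<xi>2)) <= eps"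
   proof -
    have "\<xi>0 - (1/2) *\<^sub>R (\<xi>1 + \<xi>2) = - ((1/2) *\<^sub>R (\<xi>1 - \<xi>0) + (1/2) *\<^sub>R (\<xi>2 - \<xi>0))" by (simp add: algebra_simps flip: scaleR_2)
    hence "norm (\<xi>0 - (1/2) *\<^sub>R (\<xi>1 + \<xi>2)) <= norm ((1/2) *\<^sub>R (\<xi>1 - \<xi>0)) + norm ((1/2) *\<^sub>R (\<xi>2 - \<xi>0))"
     by (simp only: norm_minus_cancel norm_triangle_ineq)
    thus ?thesis using n1(2) n2(2) by simp
   qed
   ultimately show ?thesis
    using Cauchy_Schwarz_ineq2[of "\<xi>0 - (1/2) *\<^sub>R (\<xi>1 + \<xi>2)" "\<xi>2 - \<xi>1"] mult_right_mono[of "norm (\<xi>0 - (1/2) *\<^sub>R (\<xi>1 + \<xi>2))" eps "norm (\<xi>2 - \<xi>1)"]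
    by simp
  qed
  \<comment> \<open>The normal inequalities at z1 and at z2 bound z2 - z1 in the direction \<xi>1
    and z1 - z2 in the direction \<xi>2 from above; both directions are close to \<xi>0, which gives
    a bound on both sides.\<close>
  have bz: "\<bar>\<xi>0 \<bullet> (z2 - z1)\<bar> <= (2*m + 1)*eps*norm (z2 - z1)"
  proof -
   let ?n = "norm (z2 - z1)"
   have "\<xi>1 \<bullet> (z2 - z1) <= m*?n^2" "\<xi>2 \<bullet> (z1 - z2) <= m*(norm (z1 - z2))^2"
    using N unfolding normal_at_def by auto
   moreover have "m*?n^2 <= 2*m*eps*?n"
   proof -
    have "m*?n*?n <= m*?n*(2*eps)" using dz pos by (intro mult_left_mono) auto
    thus ?thesis by (simp add: power2_eq_square algebra_simps)
   qed
   moreover have "norm (z1 - z2) = ?n" by (rule norm_minus_commute)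
   moreover have "\<bar>(\<xi>1 - \<xi>0) \<bullet> (z2 - z1)\<bar> <= eps*?n" "\<bar>(\<xi>2 - \<xi>0) \<bullet> (z1 - z2)\<bar> <= eps*?n"
    using order_trans[OF Cauchy_Schwarz_ineq2 mult_right_mono[OF n1(2) norm_ge_zero]]
     order_trans[OF Cauchy_Schwarz_ineq2 mult_right_mono[OF n2(2) norm_ge_zero], of "z1 - z2"]
    unfolding norm_minus_commute[of z1 z2] by blast+
   moreover have "\<xi>0 \<bullet> (z2 - z1) = \<xi>1 \<bullet> (z2 - z1) - (\<xi>1 - \<xi>0) \<bullet> (z2 - z1)" "- (\<xi>0 \<bullet> (z2 - z1)) = \<xi>2 \<bullet> (z1 - z2) - (\<xi>2 - \<xi>0) \<bullet> (z1 - z2)"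
    by (simp_all add: inner_diff_left inner_diff_right)
   moreover have "(2*m + 1)*eps*?n = 2*m*eps*?n + eps*?n" by (simp add: algebra_simps)
   ultimately show ?thesis by (simp only: abs_le_iff) linarith
  qed
  have b: "\<bar>\<xi>0 \<bullet> D\<bar> <= eps*Cb*norm D"
  proof -
   have "\<bar>\<xi>0 \<bullet> D\<bar> <= \<bar>\<xi>0 \<bullet> (\<xi>2 - \<xi>1)\<bar> + 8*m*\<bar>\<xi>0 \<bullet> (z2 - z1)\<bar>"
    using abs_triangle_ineq[of "\<xi>0 \<bullet> (\<xi>2 - \<xi>1)" "8*m*(\<xi>0 \<bullet> (z2 - z1))"] pos by (simp add: D_def inner_add_right abs_mult)
   also have "... <= eps*(3*norm D) + 8*m*((2*m + 1)*eps*norm (z2 - z1))"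
    using order_trans[OF bx mult_left_mono[OF hm(2)]] bz eps(1) pos by (intro add_mono mult_left_mono) auto
   also have "8*m*((2*m + 1)*eps*norm (z2 - z1)) = 2*(2*m + 1)*eps*(2*(2*m)*norm (z2 - z1))" by (simp add: algebra_simps)
   also have "... <= 2*(2*m + 1)*eps*norm D" using hm(1) eps(1) pos by (intro mult_left_mono) auto
   finally show ?thesis by (simp add: Cb_def algebra_simps)
  qed
  \<comment> \<open>If D' has a positive component along a, this component equals s e for some s,
    and \<open>transversal_avoid\<close> keeps D' a distance c s away from a point near s e. So the
    rest of D' is at least of order s.\<close>
  have one: "a \<bullet> D' <= 2/c*(\<bar>\<xi>0 \<bullet> D'\<bar> + (\<Sum>b\<in>B. \<bar>D' \<bullet> b\<bar>))"
   if av: "!!s. 0 <= s ==> s <= 1/2 ==> \<kappa> * s <= \<Lambda>*(3 + 1/(4*m))*norm (D' - s *\<^sub>R (\<eta> - \<alpha> *\<^sub>R \<xi>))"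
    and nn: "norm (\<eta> - \<eta>0) <= eps" "norm (\<xi> - \<xi>0) <= eps" and nD': "norm D' <= 2*(1 + 8*m)*eps" for D' \<eta> \<xi>
  proof (cases "a \<bullet> D' <= 0")
   case True
   have "0 <= 2/c*(\<bar>\<xi>0 \<bullet> D'\<bar> + (\<Sum>b\<in>B. \<bar>D' \<bullet> b\<bar>))"
    using c by (intro mult_nonneg_nonneg add_nonneg_nonneg sum_nonneg) auto
   with True show ?thesis by linarith
  next
   case False
   let ?Q = "\<bar>\<xi>0 \<bullet> D'\<bar> + (\<Sum>b\<in>B. \<bar>D' \<bullet> b\<bar>)"
   define s where "s = (a \<bullet> D')/\<beta>"
   have s0: "0 <= s" using False \<beta> by (simp add: s_def)
   have "a \<bullet> D' <= norm D'" using Cauchy_Schwarz_ineq2[of a D'] a(1) by simp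
   also have "... <= \<beta>*(1/2)" using nD' eps2(1) by (simp add: algebra_simps)
   finally have s1: "s <= 1/2" using \<beta> by (simp add: s_def field_simps)
   have se: "s *\<^sub>R e = (a \<bullet> D') *\<^sub>R a" using \<beta> by (simp add: s_def flip: a(3))
   have "D' - s *\<^sub>R (\<eta> - \<alpha> *\<^sub>R \<xi>) = (D' - (a \<bullet> D') *\<^sub>R a) - s *\<^sub>R ((\<eta> - \<eta>0) - \<alpha> *\<^sub>R (\<xi> - \<xi>0))"
    unfolding se[symmetric] by (simp add: e_def algebra_simps)
   hence "norm (D' - s *\<^sub>R (\<eta> - \<alpha> *\<^sub>R \<xi>)) <= norm (D' - (a \<bullet> D') *\<^sub>R a) + norm (s *\<^sub>R ((\<eta> - \<eta>0) - \<alpha> *\<^sub>R (\<xi> - \<xi>0)))"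
    by (simp only: norm_triangle_ineq4)
   moreover have "norm ((\<eta> - \<eta>0) - \<alpha> *\<^sub>R (\<xi> - \<xi>0)) <= eps + 1*eps"
   proof -
    have "norm ((\<eta> - \<eta>0) - \<alpha> *\<^sub>R (\<xi> - \<xi>0)) <= norm (\<eta> - \<eta>0) + \<bar>\<alpha>\<bar>*norm (\<xi> - \<xi>0)"
     using norm_triangle_ineq4[of "\<eta> - \<eta>0" "\<alpha> *\<^sub>R (\<xi> - \<xi>0)"] by simp
    also have "... <= eps + 1*eps" using nn \<alpha> by (intro add_mono mult_mono) auto
    finally show ?thesis .
   qed
   hence "norm (s *\<^sub>R ((\<eta> - \<eta>0) - \<alpha> *\<^sub>R (\<xi> - \<xi>0))) <= s*(eps + 1*eps)"
    using s0 by (simp add: mult_left_mono)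
   moreover have "s*(eps + 1*eps) <= s*(c/2)" using eps(4) s0 by (intro mult_left_mono) auto
   ultimately have "norm (D' - s *\<^sub>R (\<eta> - \<alpha> *\<^sub>R \<xi>)) <= ?Q + s*(c/2)" using B(4)[of D'] by linarith
   moreover have "c * s <= norm (D' - s *\<^sub>R (\<eta> - \<alpha> *\<^sub>R \<xi>))"
    using av[OF s0 s1] L3 by (simp add: c_def field_simps)
   ultimately have "c/2 * s <= ?Q" by (simp add: algebra_simps)
   hence "s <= 2/c*?Q" using c by (simp add: field_simps)
   moreover have "a \<bullet> D' = s*\<beta>" using \<beta> by (simp add: s_def)
   moreover have "s*\<beta> <= s*1" using \<beta>1 s0 by (intro mult_left_mono)
   ultimately show ?thesis by linarith
  qed
  have a1: "a \<bullet> D <= 2/c*(\<bar>\<xi>0 \<bullet> D\<bar> + P)" unfolding P_def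
  proof (rule one[OF _ n1(3) n2(2) nD])
   show "\<kappa> * s <= \<Lambda>*(3 + 1/(4*m))*norm (D - s *\<^sub>R (\<eta>1 - \<alpha> *\<^sub>R \<xi>2))" if "0 <= s" "s <= 1/2" for s
    unfolding D_def by (rule transversal_avoid[OF hom lip pos(1,2) t1 t2 \<alpha> that])
  qed
  \<comment> \<open>Exchanging the two triples reverses D and bounds its component along a from the
    other side.\<close>
  have a2: "a \<bullet> (- D) <= 2/c*(\<bar>\<xi>0 \<bullet> (- D)\<bar> + (\<Sum>b\<in>B. \<bar>(- D) \<bullet> b\<bar>))"
  proof (rule one[OF _ n2(3) n1(2)])
   have "- D = (\<xi>1 - \<xi>2) + (8*m) *\<^sub>R (z1 - z2)" by (simp add: D_def algebra_simps)
   thus "\<kappa> * s <= \<Lambda>*(3 + 1/(4*m))*norm (- D - s *\<^sub>R (\<eta>2 - \<alpha> *\<^sub>R \<xi>1))" if "0 <= s" "s <= 1/2" for s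
    using transversal_avoid[OF hom lip pos(1,2) t2 t1 \<alpha> that] by simp
  qed (use nD in simp)
  have aD: "\<bar>a \<bullet> D\<bar> <= 2/c*(\<bar>\<xi>0 \<bullet> D\<bar> + P)" using a1 a2 by (simp add: P_def abs_le_iff)
  have "D = (D - (a \<bullet> D) *\<^sub>R a) + (a \<bullet> D) *\<^sub>R a" by simp
  hence "norm D <= norm (D - (a \<bullet> D) *\<^sub>R a) + norm ((a \<bullet> D) *\<^sub>R a)" by (metis norm_triangle_ineq)
  hence "norm D <= (\<bar>\<xi>0 \<bullet> D\<bar> + P) + 2/c*(\<bar>\<xi>0 \<bullet> D\<bar> + P)"
   using B(4)[of D] aD a(1) unfolding P_def by simp
  also have "... = H*\<bar>\<xi>0 \<bullet> D\<bar> + H*P" by (simp add: H_def algebra_simps)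
  also have "H*\<bar>\<xi>0 \<bullet> D\<bar> <= H*(eps*Cb*norm D)" using b H by (intro mult_left_mono) auto
  also have "H*(eps*Cb*norm D) = (2*H*Cb*eps)*(norm D/2)" by simp
  also have "... <= 1*(norm D/2)" using eps2(2) by (intro mult_right_mono) auto
  finally have "norm D <= 2*H*P" by simp
  moreover have "norm (z2 - z1) <= norm D/(4*m)" using hm(1) pos by (simp add: field_simps)
  ultimately have "norm (z2 - z1) + norm (\<xi>2 - \<xi>1) <= (1/(4*m) + 3)*norm D" using hm(2) by (simp add: algebra_simps)
  also have "... <= (1/(4*m) + 3)*(2*H*P)" using \<open>norm D \<le> 2 * H * P\<close> pos by (intro mult_left_mono) auto
  finally show ?thesis unfolding wD P_def .
 qed
 let ?\<pi> = "%(z, \<xi>, \<eta>). (z, \<xi>)"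
 have cB: "card B = DIM('a) - 2" using B(2) by simp
 obtain b where b: "bij_betw b {..<card B} B" using ex_bij_betw_nat_finite[OF B(1)] by (auto simp: lessThan_atLeast0)
 show "\<exists>eps>0. small_set (DIM('a) - 2) (?\<pi> ` (transversal_triples F m \<kappa> \<inter> ball t0 eps))"
 proof (rule exI[of _ eps], rule conjI, rule eps(1), rule small_set_coordinates[of _ _ "%x i. w x \<bullet> b i"])
  fix x i assume "x \<in> ?\<pi> ` ?Y" and i: "i < DIM('a) - 2"
  then obtain z \<xi> \<eta> where x: "x = (z, \<xi>)" and y: "(z, \<xi>, \<eta>) \<in> ?Y" by auto
  have "norm \<xi> = 1" using y unfolding transversal_triples_def by auto
  moreover have "norm z <= norm z0 + norm (z - z0)" by norm
  hence "8*m*norm z <= 8*m*(norm z0 + 1)" using near(1)[of z \<xi> \<eta>] y eps(2) pos by (intro mult_left_mono) auto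
  moreover have "norm (w x) <= norm \<xi> + norm ((8*m) *\<^sub>R z)" unfolding w_def x fst_conv snd_conv by (rule norm_triangle_ineq)
  moreover have "norm ((8*m) *\<^sub>R z) = 8*m*norm z" using pos by simp
  ultimately have nw: "norm (w x) <= 1 + 8*m*(norm z0 + 1)" by linarith
  have "norm (b i) = 1" using B(3) b i cB by (auto simp: bij_betw_def)
  thus "\<bar>w x \<bullet> b i\<bar> <= 1 + 8*m*(norm z0 + 1)" using Cauchy_Schwarz_ineq2[of "w x" "b i"] nw by simp
 next
  fix x y assume "x \<in> ?\<pi> ` ?Y" "y \<in> ?\<pi> ` ?Y"
  then obtain z1 \<xi>1 \<eta>1 z2 \<xi>2 \<eta>2 where xy: "x = (z2, \<xi>2)" "y = (z1, \<xi>1)" "(z1, \<xi>1, \<eta>1) \<in> ?Y" "(z2, \<xi>2, \<eta>2) \<in> ?Y" by auto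
  have "dist x y <= norm (z2 - z1) + norm (\<xi>2 - \<xi>1)"
   unfolding dist_norm xy using norm_Pair_le_add[of "z2 - z1" "\<xi>2 - \<xi>1"] by simp
  also have "... <= (1/(4*m) + 3)*(2*H*(\<Sum>b\<in>B. \<bar>(w (z2, \<xi>2) - w (z1, \<xi>1)) \<bullet> b\<bar>))" by (rule main[OF xy(3,4)])
  also have "(\<Sum>b\<in>B. \<bar>(w (z2, \<xi>2) - w (z1, \<xi>1)) \<bullet> b\<bar>) = (\<Sum>i<card B. \<bar>(w (z2, \<xi>2) - w (z1, \<xi>1)) \<bullet> b i\<bar>)"
   by (rule sum.reindex_bij_betw[OF b, symmetric])
  finally show "dist x y <= ((1/(4*m) + 3)*2*H)*(\<Sum>i<DIM('a) - 2. \<bar>w x \<bullet> b i - w y \<bullet> b i\<bar>)"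
   unfolding cB xy inner_diff_left by (simp only: mult.assoc)
 qed
qed

end

section \<open>The singular set\<close>

lemma one_dimensional:
 fixes \<xi> v :: "'a::euclidean_space"
 assumes "DIM('a) = 1" "norm \<xi> = 1" shows "v = (v \<bullet> \<xi>) *\<^sub>R \<xi>"
proof -
 obtain b :: 'a where b: "Basis = {b}" using assms(1) by (auto simp: card_1_singleton_iff)
 have r: "x = (x \<bullet> b) *\<^sub>R b" for x :: 'a using euclidean_representation[of x] unfolding b by simp
 have i: "x \<bullet> y = (x \<bullet> b)*(y \<bullet> b)" for x y :: 'a using euclidean_inner[of x y] unfolding b by simp
 have "\<xi> \<bullet> \<xi> = 1" using assms(2) by (simp add: dot_square_norm)
 hence "(\<xi> \<bullet> b)*(\<xi> \<bullet> b) = 1" using i[of \<xi> \<xi>] by simp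
 moreover have "(v \<bullet> \<xi>) *\<^sub>R \<xi> = ((v \<bullet> b)*((\<xi> \<bullet> b)*(\<xi> \<bullet> b))) *\<^sub>R b"
  unfolding i[of v \<xi>] by (subst (2) r) simp
 ultimately show ?thesis using r[of v] by simp
qed

context smooth_exit_problem
begin

lemma hh_scale:
 assumes "0 <= t" shows "hh z (t *\<^sub>R p) = t*hh z p"
proof (rule antisym)
 obtain w where "w \<in> U" "hh z (t *\<^sub>R p) = (t *\<^sub>R p) \<bullet> f z w" by (rule hh_attained)
 thus "hh z (t *\<^sub>R p) <= t*hh z p" using mult_left_mono[OF hh_ge assms, of w p z] by simp
 obtain w where "w \<in> U" "hh z p = p \<bullet> f z w" by (rule hh_attained)
 thus "t*hh z p <= hh z (t *\<^sub>R p)" using hh_ge[of w "t *\<^sub>R p" z] by simp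
qed

lemma normal_at_scale: "normal_at z \<sigma> \<xi> ==> 0 <= t ==> normal_at z (t*\<sigma>) (t *\<^sub>R \<xi>)"
 using normal_at_combine[of z \<sigma> \<xi> \<sigma> \<xi> t 0] by simp

definition singular_set :: "'a set" where
 "singular_set = {x. x \<notin> S & (\<forall>e>0. \<forall>C. \<not> C-lipschitz_on (ball x e) V)}"

text \<open>\<open>steering\<close> read backwards: if the normals at the ends all had
  \<open>hh\<close> at least \<open>eps\<close>, the growth bound would hold for every pair of
  points near x0, with one constant. A pair that violates the bound is ordered such that V x < V x',
  and the optimality gap is at most half of the excess.\<close>

lemma nearly_degenerate_end:
 assumes x0: "x0 \<in> singular_set" and e: "0 < e" "cball x0 e \<inter> S = {}" and eps: "0 < eps" "eps <= 1"
 shows "\<exists>x u y T \<xi>. x \<in> cball x0 e & norm (x - x0) < eps & near_opt x eps u y T & norm \<xi> = 1 &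
  normal_at (y T) (1/(2*\<rho>0)) \<xi> & hh (y T) \<xi> < eps"
proof -
 have V: "continuous_on (cball x0 e) V" by (rule continuous_on_subset[OF V_continuous]) simp
 obtain dlt C where dlt: "0 < dlt" and st: "!!x x' eps' u y T \<xi>. x \<in> cball x0 e ==> x' \<in> cball x0 e ==>
  norm (x' - x) < dlt ==> eps' <= 1 ==> near_opt x eps' u y T ==> norm \<xi> = 1 ==>
  (\<forall>z\<in>closure (- S). \<xi> \<bullet> (z - y T) <= 1/(2*\<rho>0)*(norm (z - y T))^2) ==> eps <= hh (y T) \<xi> ==>
  V x' <= V x + eps' + C*norm (x' - x)" using steering[OF compact_cball e(2) V eps(1)] by (elim exE conjE) blast
 define e' where "e' = min e (min (dlt/2) eps)"
 have e': "0 < e'" "e' <= e" "e' <= dlt/2" "e' <= eps" using e dlt eps by (auto simp: e'_def)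
 have "\<not> \<bar>C\<bar>-lipschitz_on (ball x0 e') V" using x0 e'(1) unfolding singular_set_def by blast
 then obtain a b where ab: "a \<in> ball x0 e'" "b \<in> ball x0 e'" "\<bar>C\<bar>*dist a b < dist (V a) (V b)"
  unfolding lipschitz_on_def by (auto simp: not_le)
 have "\<exists>x x'. x \<in> ball x0 e' & x' \<in> ball x0 e' & \<bar>C\<bar>*norm (x' - x) < V x' - V x"
 proof (cases "V a <= V b")
  case True
  with ab show ?thesis by (intro exI[of _ a] exI[of _ b]) (auto simp: dist_norm norm_minus_commute)
 next
  case False
  with ab show ?thesis by (intro exI[of _ b] exI[of _ a]) (auto simp: dist_norm norm_minus_commute)
 qed
 then obtain x x' where x: "x \<in> ball x0 e'" "x' \<in> ball x0 e'" "\<bar>C\<bar>*norm (x' - x) < V x' - V x" by blast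
 define eps' where "eps' = min eps ((V x' - V x - \<bar>C\<bar>*norm (x' - x))/2)"
 have eps': "0 < eps'" "eps' <= eps" "eps' < V x' - V x - \<bar>C\<bar>*norm (x' - x)" using x eps by (auto simp: eps'_def min_def)
 have xK: "x \<in> cball x0 e" "x' \<in> cball x0 e" using x e' by auto
 have n: "norm (x' - x) < dlt" "norm (x - x0) < eps"
  using x e' dist_triangle_half_r[of x0 x' dlt x] by (auto simp: dist_norm norm_minus_commute)
 obtain u y T where u: "near_opt x eps' u y T" using near_optimal[OF eps'(1), of x] unfolding near_opt_def by blast
 have "x \<notin> S" using xK e(2) by auto
 from hitting_frontier(2)[OF near_optD(1-3)[OF u] this]
 obtain \<xi> where \<xi>: "norm \<xi> = 1" "\<forall>z\<in>closure (- S). \<xi> \<bullet> (z - y T) <= 1/(2*\<rho>0)*(norm (z - y T))^2"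
  using inner_ball by blast
 have "hh (y T) \<xi> < eps"
 proof (rule ccontr)
  assume "\<not> hh (y T) \<xi> < eps"
  hence "eps <= hh (y T) \<xi>" by simp
  from st[OF xK n(1) order_trans[OF eps'(2) eps(2)] u \<xi> this]
  have "V x' <= V x + eps' + C*norm (x' - x)" .
  moreover have "C*norm (x' - x) <= \<bar>C\<bar>*norm (x' - x)" by (intro mult_right_mono) auto
  ultimately show False using eps'(3) by linarith
 qed
 moreover have "normal_at (y T) (1/(2*\<rho>0)) \<xi>" unfolding normal_at_def using \<xi>(2) constants by simp
 ultimately show ?thesis using xK(1) n(2) near_opt_mono[OF u eps'(2)] \<xi>(1)
  by - (rule exI[of _ x], rule exI[of _ u], rule exI[of _ y], rule exI[of _ T], rule exI[of _ \<xi>], intro conjI; assumption)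
qed

text \<open>End points, normals and arrival times of the nearly degenerate ends stay in a compact
  set; the normal inequality and \<open>hh\<close> pass to the limit by continuity.\<close>

lemma singular_point_end:
 assumes x0: "x0 \<in> singular_set"
 shows "\<exists>z T \<xi>. lim_end x0 z T & norm \<xi> = 1 & normal_at z (1/(2*\<rho>0)) \<xi> & hh z \<xi> <= 0"
proof -
 have "x0 \<notin> S" using x0 unfolding singular_set_def by blast
 then obtain e where e: "0 < e" "e <= 1" "cball x0 e \<inter> S = {}" by (rule compact_ball_outside)
 obtain \<tau> B R dlt0 where uc: "uniform_constants (cball x0 e) \<tau> B R dlt0"
  using uniform_constants_exist[OF compact_cball e(3) continuous_on_subset[OF V_continuous]] by blast
 let ?r = "%k. 1/real (Suc k)"
 have "\<exists>x u y T \<xi>. x \<in> cball x0 e & norm (x - x0) < ?r k & near_opt x (?r k) u y T & norm \<xi> = 1 &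
  normal_at (y T) (1/(2*\<rho>0)) \<xi> & hh (y T) \<xi> < ?r k" for k by (rule nearly_degenerate_end[OF x0 e(1,3)]) auto
 then obtain x u y T \<xi> where h: "!!k::nat. x k \<in> cball x0 e" "!!k. norm (x k - x0) < ?r k" "!!k. near_opt (x k) (?r k) (u k) (y k) (T k)"
  "!!k. norm (\<xi> k) = 1" "!!k. normal_at (y k (T k)) (1/(2*\<rho>0)) (\<xi> k)" "!!k. hh (y k (T k)) (\<xi> k) < ?r k"
  by metis
 have r1: "?r k <= 1" for k by simp
 note ucD = uniform_constantsD[OF uc h(1) h(3) r1]
 let ?w = "%k. (y k (T k), \<xi> k, T k)"
 have "compact (cball (0::'a) B \<times> sphere (0::'a) 1 \<times> {0..\<tau>})" by (intro compact_Times) auto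
 moreover have "?w k \<in> cball 0 B \<times> sphere 0 1 \<times> {0..\<tau>}" for k
  using ucD(1,2,4)[of k] h(4)[of k] by auto
 ultimately obtain l \<phi> where l: "strict_mono (\<phi> :: nat => nat)" "(?w \<circ> \<phi>) \<longlonglongrightarrow> l"
  using seq_compactE[of "cball (0::'a) B \<times> sphere (0::'a) 1 \<times> {0..\<tau>}" ?w] unfolding compact_eq_seq_compact_metric by metis
 obtain z \<zeta> T0 where le: "l = (z, \<zeta>, T0)" by (cases l)
 have lz: "(%k. y (\<phi> k) (T (\<phi> k))) \<longlonglongrightarrow> z" and l\<xi>: "(%k. \<xi> (\<phi> k)) \<longlonglongrightarrow> \<zeta>" and lT: "(%k. T (\<phi> k)) \<longlonglongrightarrow> T0"
  using tendsto_fst[OF l(2)] tendsto_fst[OF tendsto_snd[OF l(2)]] tendsto_snd[OF tendsto_snd[OF l(2)]]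
  unfolding le by (simp_all add: o_def)
 have "?r \<longlonglongrightarrow> 0" using lim_1_over_n by (rule LIMSEQ_Suc)
 from LIMSEQ_subseq_LIMSEQ[OF this l(1)] have lr: "(%k. ?r (\<phi> k)) \<longlonglongrightarrow> 0" by (simp add: o_def)
 have "norm \<zeta> = 1" using LIMSEQ_unique[OF tendsto_norm[OF l\<xi>], of 1] by (simp add: h(4))
 moreover have "normal_at z (1/(2*\<rho>0)) \<zeta>" unfolding normal_at_def
 proof (intro conjI ballI)
  fix w assume w: "w \<in> closure (- S)"
  have "(%k. \<xi> (\<phi> k) \<bullet> (w - y (\<phi> k) (T (\<phi> k)))) \<longlonglongrightarrow> \<zeta> \<bullet> (w - z)"
   "(%k. 1/(2*\<rho>0)*(norm (w - y (\<phi> k) (T (\<phi> k))))^2) \<longlonglongrightarrow> 1/(2*\<rho>0)*(norm (w - z))^2"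
   by (intro tendsto_intros l\<xi> lz)+
  thus "\<zeta> \<bullet> (w - z) <= 1/(2*\<rho>0)*(norm (w - z))^2"
   by (rule LIMSEQ_le) (use h(5) w in \<open>auto simp: normal_at_def\<close>)
 qed (use constants in simp)
 moreover have "hh z \<zeta> <= 0"
 proof -
  have "isCont (%w. hh (fst w) (snd w)) (z, \<zeta>)"
   using hh_continuous[of UNIV] by (simp add: continuous_on_eq_continuous_at)
  from isCont_tendsto_compose[OF this tendsto_Pair[OF lz l\<xi>]]
  have "(%k. hh (y (\<phi> k) (T (\<phi> k))) (\<xi> (\<phi> k))) \<longlonglongrightarrow> hh z \<zeta>" by simp
  thus ?thesis by (rule LIMSEQ_le[OF _ lr]) (use h(6) in \<open>auto intro: less_imp_le\<close>)
 qed
 moreover have "lim_end x0 z T0" unfolding lim_end_def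
 proof (intro allI impI)
  fix eps :: real assume eps: "0 < eps"
  have "\<forall>\<^sub>F k in sequentially. ?r (\<phi> k) < eps & dist (T (\<phi> k)) T0 < eps & dist (y (\<phi> k) (T (\<phi> k))) z < eps"
   by (intro eventually_conj order_tendstoD(2)[OF lr eps] tendstoD[OF lT eps] tendstoD[OF lz eps])
  then obtain k where k: "?r (\<phi> k) < eps" "dist (T (\<phi> k)) T0 < eps" "dist (y (\<phi> k) (T (\<phi> k))) z < eps"
   using eventually_happens by (metis (no_types, lifting) sequentially_bot)
  have "norm (x (\<phi> k) - x0) < eps" using h(2)[of "\<phi> k"] k(1) by linarith
  moreover have "near_opt (x (\<phi> k)) eps (u (\<phi> k)) (y (\<phi> k)) (T (\<phi> k))"
   by (rule near_opt_mono[OF h(3)]) (use k in simp)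
  ultimately show "\<exists>x' u y T'. norm (x' - x0) < eps & \<bar>T' - T0\<bar> < eps & near_opt x' eps u y T' & norm (y T' - z) < eps"
   using k(2,3) unfolding dist_norm real_norm_def
   by - (rule exI[of _ "x (\<phi> k)"], rule exI[of _ "u (\<phi> k)"], rule exI[of _ "y (\<phi> k)"], rule exI[of _ "T (\<phi> k)"], intro conjI; assumption)
 qed
 ultimately show ?thesis by - (rule exI[of _ z], rule exI[of _ T0], rule exI[of _ \<zeta>], intro conjI; assumption)
qed

text \<open>The real constants are traded for m = j + 1 and \<kappa> = 1/(j + 1), and \<eta> is
  scaled to norm one. This leaves countably many classes of triples.\<close>

lemma transversal_triplesI:
 assumes z: "z \<in> closure (- S)" and \<xi>: "norm \<xi> = 1" "normal_at z \<sigma>1 \<xi>" "F z \<xi> <= 0" and \<eta>: "normal_at z \<sigma>2 \<eta>" "\<eta> ~= 0"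
  and \<beta>: "0 < \<beta>" "!!s. 0 <= s ==> s*\<beta> <= F z (\<xi> + s *\<^sub>R \<eta>)"
 shows "\<exists>j::nat. \<exists>\<eta>'. (z, \<xi>, \<eta>') \<in> transversal_triples F (real (Suc j)) (1/real (Suc j))"
proof -
 define t where "t = 1/norm \<eta>"
 have t: "0 < t" "norm (t *\<^sub>R \<eta>) = 1" using \<eta>(2) by (simp_all add: t_def)
 have "0 < t*\<beta>" using t \<beta> by simp
 obtain j :: nat where j: "max (1/(t*\<beta>)) (max \<sigma>1 (t*\<sigma>2)) < real j" using reals_Archimedean2 by blast
 have k: "1/real (Suc j) <= t*\<beta>"
 proof -
  have "1/(t*\<beta>) < real (Suc j)" using j by simp
  thus ?thesis using \<open>0 < t * \<beta>\<close> by (simp add: field_simps)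
 qed
 have "normal_at z (real (Suc j)) \<xi>" by (rule normal_at_mono[OF \<xi>(2)]) (use j in simp)
 moreover have "normal_at z (real (Suc j)) (t *\<^sub>R \<eta>)"
  by (rule normal_at_mono[OF normal_at_scale[OF \<eta>(1)]]) (use j t in auto)
 moreover have "1/real (Suc j) * s <= F z (\<xi> + s *\<^sub>R (t *\<^sub>R \<eta>))" if "0 <= s" for s
  using mult_right_mono[OF k that] \<beta>(2)[of "s*t"] that t by (simp add: mult_ac)
 ultimately have "(z, \<xi>, t *\<^sub>R \<eta>) \<in> transversal_triples F (real (Suc j)) (1/real (Suc j))"
  unfolding transversal_triples_def using z \<xi> t by auto
 thus ?thesis by blast
qed

text \<open>The cases are: a nondegenerate second normal; a normal cone of dimension at least two
  all of whose members are degenerate; a half line of normals.\<close>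

definition degenerate_pair :: "'a set => ('a => 'a) => 'a => 'a => bool" where
 "degenerate_pair D n z \<xi> \<longleftrightarrow> (\<exists>j::nat. \<exists>\<eta>. (z, \<xi>, \<eta>) \<in> transversal_triples hh (real (Suc j)) (1/real (Suc j))) \<or>
   (\<exists>e\<in>D. \<exists>j::nat. \<exists>\<eta>. (z, \<xi>, \<eta>) \<in> transversal_triples (%z p. e \<bullet> p) (real (Suc j)) (1/real (Suc j))) \<or>
   z \<in> {x \<in> reachable_boundary1 U f S. hh x (n x) = 0} & \<xi> = n z"

text \<open>If the velocity at \<open>z\<close> is not transversal to some normal, then every normal at \<open>z\<close> is
 degenerate. A normal cone of dimension at least two then contains a unit vector in the
 hyperplane orthogonal to an element of any given dense set.\<close>

lemma singular_point_datum:
 assumes x0: "x0 \<in> singular_set"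
  and n: "!!x. x \<in> reachable_boundary1 U f S ==> n x \<in> proximal_normals (closure (- S)) x & norm (n x) = 1"
  and D: "!!A. open A ==> A ~= {} ==> \<exists>e\<in>D. e \<in> A"
 shows "\<exists>z T \<xi>. datum x0 z T \<xi> &
  degenerate_pair D n z \<xi>"
proof -
 have x0S: "x0 \<notin> S" using x0 unfolding singular_set_def by blast
 obtain z T \<xi> where h: "lim_end x0 z T" "norm \<xi> = 1" "normal_at z (1/(2*\<rho>0)) \<xi>" "hh z \<xi> <= 0"
  using singular_point_end[OF x0] by (elim exE conjE)
 note lf = lim_end_facts[OF x0S h(1)]
 have zc: "z \<in> closure (- S)" using lf(2) by (simp add: frontier_closures)
 have dt: "datum x0 z T \<xi>'" if "norm \<xi>' = 1" "normal_at z \<sigma> \<xi>'" "hh z \<xi>' <= 0" for \<sigma> \<xi>'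
  unfolding datum_def using x0S h(1) that by (intro conjI exI[of _ \<sigma>])
 show ?thesis
 proof (cases "\<exists>\<sigma> \<eta>. normal_at z \<sigma> \<eta> & 0 < hh z \<eta>")
  case True
  then obtain \<sigma> \<eta> where \<eta>: "normal_at z \<sigma> \<eta>" "0 < hh z \<eta>" by (elim exE conjE)
  have e0: "\<eta> ~= 0" using \<eta>(2) hh_scale[of 0 z 0] by auto
  have hz: "hh z \<xi> = 0" using hh_nonneg_at_end[OF x0S h(1,3)] h(4) by linarith
  obtain W where W: "!!B a b. 0 < a ==> hamiltonian_bound W B a b" by (rule hamiltonian_field) blast
  have "(0::real) < 1" by simp
  from W[OF this, of "norm z" 1, unfolded hamiltonian_bound_def]
  obtain C \<Lambda> where C: "0 <= C" and "\<Lambda>-lipschitz_on (phase_box (norm z) 1 1) W" and "\<forall>x p om. (x, p) \<in> phase_box (norm z) 1 1 & om \<in> U -->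
     (norm (W (x, p) - (adj (Df x om) p, f x om)))^2 <= C*(hh x p - p \<bullet> f x om)" by (elim exE conjE)
  note C2 = this(3)[rule_format, OF conjI]
  have zp: "(z, \<xi>) \<in> phase_box (norm z) 1 1" unfolding phase_box_def using h(2) by simp
  \<comment> \<open>The velocity that the Hamiltonian field prescribes at (z, \<xi>). As
    \<open>hh z \<xi>\<close> is 0, the defect of a control om is its loss -\<xi> . f(z, om), so
    velocities of small loss are close to v.\<close>
  define v where "v = snd (W (z, \<xi>))"
  have gap: "(norm (f z om - v))^2 <= C*(- (\<xi> \<bullet> f z om))" if "om \<in> U" for om
  proof -
   have "norm (v - f z om) <= norm (W (z, \<xi>) - (adj (Df z om) \<xi>, f z om))"
    using norm_fst_snd_le(2)[of "W (z, \<xi>) - (adj (Df z om) \<xi>, f z om)"] by (simp add: v_def snd_diff)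
   from order_trans[OF power_mono[OF this norm_ge_zero, of 2] C2[OF zp that]] show ?thesis by (simp add: norm_minus_commute hz)
  qed
  have tv: "0 < \<eta> \<bullet> v" by (rule limiting_velocity_transversal[OF x0S V_continuous h(1-3) \<eta> C gap])
  obtain om where om: "om \<in> U" "hh z \<xi> = \<xi> \<bullet> f z om" by (rule hh_attained)
  \<comment> \<open>A maximizer has no loss, so its velocity is v itself. Testing \<open>hh\<close>
    with it gives growth at the rate \<eta> . v along \<xi> + s \<eta>.\<close>
  have fv: "f z om = v" using gap[OF om(1)] om(2) hz by simp
  have "s*(\<eta> \<bullet> v) <= hh z (\<xi> + s *\<^sub>R \<eta>)" for s
   using hh_ge[OF om(1), of "\<xi> + s *\<^sub>R \<eta>" z] om(2) hz fv by (simp add: inner_add_left)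
  hence "\<exists>j::nat. \<exists>\<eta>'. (z, \<xi>, \<eta>') \<in> transversal_triples hh (real (Suc j)) (1/real (Suc j))"
   by (intro transversal_triplesI[where F = hh, OF zc h(2,3,4) \<eta>(1) e0 tv])
  thus ?thesis using dt[OF h(2-4)] unfolding degenerate_pair_def by blast
 next
  case False
  hence all: "hh z \<eta> <= 0" if "normal_at z \<sigma> \<eta>" for \<sigma> \<eta> using that by (meson not_le)
  let ?P = "proximal_normals (closure (- S)) z"
  have P: "v \<in> ?P \<longleftrightarrow> (\<exists>\<sigma>. normal_at z \<sigma> v)" for v unfolding proximal_normals_def normal_at_def by auto
  show ?thesis
  proof (cases "dim ?P = 1")
   case True
   have z1: "z \<in> reachable_boundary1 U f S" unfolding reachable_boundary1_def using lf(3) True by simp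
   note nz = n[OF z1]
   obtain \<sigma> where \<sigma>: "normal_at z \<sigma> (n z)" using nz P by blast
   have "hh z (n z) = 0" using all[OF \<sigma>] hh_nonneg_at_end[OF x0S h(1) \<sigma>] by linarith
   moreover have "datum x0 z T (n z)" by (rule dt[OF _ \<sigma>]) (use nz all[OF \<sigma>] in auto)
   ultimately show ?thesis using z1 unfolding degenerate_pair_def by blast
  next
   case False
   have \<xi>P: "\<xi> \<in> ?P" using h(3) P by blast
   have "\<not> ?P \<subseteq> span {\<xi>}"
   proof
    assume s: "?P \<subseteq> span {\<xi>}"
    have i: "independent {\<xi>}" using h(2) by auto
    have "dim ?P <= 1" using dim_subset[OF s] dim_eq_card_independent[OF i] by (simp add: dim_span)
    moreover have "1 <= dim ?P" using dim_subset[of "{\<xi>}" ?P] \<xi>P dim_eq_card_independent[OF i] by simp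
    ultimately show False using False by simp
   qed
   then obtain \<eta> where \<eta>P: "\<eta> \<in> ?P" "\<eta> \<notin> span {\<xi>}" by blast
   obtain \<sigma> where \<eta>: "normal_at z \<sigma> \<eta>" using \<eta>P(1) P by blast
   have ns: "\<eta> ~= k *\<^sub>R \<xi>" for k using \<eta>P(2) by (auto simp: span_singleton)
   \<comment> \<open>Subtracting a small multiple of \<xi> from w gives a vector that is negative on
     \<xi> and positive on \<eta>. This is an open condition, so some e in the countable dense set
     satisfies it.\<close>
   define w where "w = \<eta> - (\<eta> \<bullet> \<xi>) *\<^sub>R \<xi>"
   have w0: "w ~= 0" using ns by (simp add: w_def)
   have xx: "\<xi> \<bullet> \<xi> = 1" using h(2) by (simp add: dot_square_norm)
   have wx: "w \<bullet> \<xi> = 0" using xx by (simp add: w_def inner_diff_left)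
   have "\<eta> = w + (\<eta> \<bullet> \<xi>) *\<^sub>R \<xi>" by (simp add: w_def)
   from arg_cong[OF this, of "%v. w \<bullet> v"] have "w \<bullet> \<eta> = w \<bullet> w" using wx by (simp add: inner_add_right)
   hence we: "0 < w \<bullet> \<eta>" using w0 by simp
   define c where "c = (w \<bullet> \<eta>)/(2*(1 + \<bar>\<xi> \<bullet> \<eta>\<bar>))"
   have c: "0 < c" using we by (simp add: c_def add_pos_nonneg)
   have "c*(\<xi> \<bullet> \<eta>) <= c*(1 + \<bar>\<xi> \<bullet> \<eta>\<bar>)" using c by (intro mult_left_mono) auto
   also have "... = (w \<bullet> \<eta>)/2" by (simp add: c_def field_simps add_nonneg_eq_0_iff)
   finally have "0 < (w - c *\<^sub>R \<xi>) \<bullet> \<eta>" using we by (simp add: inner_diff_left)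
   moreover have "(w - c *\<^sub>R \<xi>) \<bullet> \<xi> < 0" using wx xx c by (simp add: inner_diff_left)
   ultimately have "w - c *\<^sub>R \<xi> \<in> {e. e \<bullet> \<xi> < 0} \<inter> {e. 0 < e \<bullet> \<eta>}" by simp
   moreover have "open ({e. e \<bullet> \<xi> < 0} \<inter> {e. 0 < e \<bullet> \<eta>})"
    by (intro open_Int open_Collect_less continuous_intros)
   ultimately obtain e where e: "e \<in> D" "e \<bullet> \<xi> < 0" "0 < e \<bullet> \<eta>" using D by blast
   \<comment> \<open>The combination of \<xi> and \<eta> that e annihilates; both coefficients are
     positive by the choice of e, so it is again a normal.\<close>
   define \<zeta> where "\<zeta> = (e \<bullet> \<eta>) *\<^sub>R \<xi> + (- (e \<bullet> \<xi>)) *\<^sub>R \<eta>"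
   have \<zeta>n: "normal_at z ((e \<bullet> \<eta>)*(1/(2*\<rho>0)) + (- (e \<bullet> \<xi>))*\<sigma>) \<zeta>"
    unfolding \<zeta>_def by (rule normal_at_combine[OF h(3) \<eta>]) (use e in auto)
   have \<zeta>0: "\<zeta> ~= 0"
   proof
    assume "\<zeta> = 0"
    hence "(e \<bullet> \<xi>) *\<^sub>R \<eta> = (e \<bullet> \<eta>) *\<^sub>R \<xi>" by (simp add: \<zeta>_def)
    hence "(1/(e \<bullet> \<xi>)) *\<^sub>R (e \<bullet> \<xi>) *\<^sub>R \<eta> = (1/(e \<bullet> \<xi>)) *\<^sub>R (e \<bullet> \<eta>) *\<^sub>R \<xi>" by (rule arg_cong)
    hence "\<eta> = ((e \<bullet> \<eta>)/(e \<bullet> \<xi>)) *\<^sub>R \<xi>" using e(2) by simp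
    thus False using ns by blast
   qed
   have e\<zeta>: "e \<bullet> \<zeta> = 0" by (simp add: \<zeta>_def inner_add_right inner_diff_right)
   let ?\<xi> = "(1/norm \<zeta>) *\<^sub>R \<zeta>"
   have n1: "norm ?\<xi> = 1" using \<zeta>0 by simp
   have nn: "normal_at z (1/norm \<zeta>*((e \<bullet> \<eta>)*(1/(2*\<rho>0)) + (- (e \<bullet> \<xi>))*\<sigma>)) ?\<xi>"
    by (rule normal_at_scale[OF \<zeta>n]) simp
   have e0: "\<eta> ~= 0" using e by auto
   have "\<exists>j::nat. \<exists>\<eta>'. (z, ?\<xi>, \<eta>') \<in> transversal_triples (%z p. e \<bullet> p) (real (Suc j)) (1/real (Suc j))"
    by (rule transversal_triplesI[OF zc n1 nn _ \<eta> e0 e(3)]) (use e\<zeta> in \<open>auto simp: inner_add_right\<close>)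
   thus ?thesis using dt[OF n1 nn all[OF nn]] e(1) unfolding degenerate_pair_def by blast
  qed
 qed
qed

text \<open>\<open>E\<close> collects the pairs (z, \<xi>) that can occur and is small in dimension
  d - 2; \<open>datum_lipschitz\<close> parametrizes the singular points by \<open>E\<close> and the
  arrival time, which adds one dimension.\<close>

lemma singular_set_small_2:
 assumes dim: "2 <= DIM('a)"
  and n: "!!x. x \<in> reachable_boundary1 U f S ==> n x \<in> proximal_normals (closure (- S)) x & norm (n x) = 1"
  and Z: "Z = {x \<in> reachable_boundary1 U f S. hh x (n x) = 0}"
  and rect: "countably_rectifiable (DIM('a) - 2) Z" and lip: "locally_lipschitz_on Z n"
 shows "small_set (DIM('a) - 1) singular_set"
proof -
 obtain D :: "'a set" where D: "countable D" "!!A. open A ==> A ~= {} ==> \<exists>e\<in>D. e \<in> A"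
  by (rule countable_dense_setE) blast
 let ?\<pi> = "%(z :: 'a, \<xi> :: 'a, \<eta> :: 'a). (z, \<xi>)"
 let ?T = "%F j. ?\<pi> ` transversal_triples F (real (Suc j)) (1/real (Suc j))"
 define E where "E = (\<Union>j. ?T hh j) \<union> (\<Union>e\<in>D. \<Union>j. ?T (%z p. e \<bullet> p) j) \<union> (%z. (z, n z)) ` Z"
 have "small_set (DIM('a) - 2) E" unfolding E_def
 proof (intro small_set_Un small_set_UN small_set_countable_UN[OF D(1)])
  show "small_set (DIM('a) - 2) (?T hh j)" for j
  proof (rule transversal_pairs_small[where \<Lambda> = "N + 2*L"])
   fix z z' p p' :: 'a assume "norm p <= 2" "norm p' <= 2"
   have "\<bar>hh z p - hh z' p'\<bar> <= N*norm (p - p') + L*norm p'*norm (z - z')" by (rule hh_lipschitz)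
   also have "L*norm p'*norm (z - z') <= L*2*norm (z - z')"
    using constants \<open>norm p' \<le> 2\<close> by (intro mult_right_mono mult_left_mono) auto
   also have "N*norm (p - p') + L*2*norm (z - z') <= (N + 2*L)*(norm (z - z') + norm (p - p'))"
    using constants by (simp add: algebra_simps)
   finally show "\<bar>hh z p - hh z' p'\<bar> <= (N + 2*L)*(norm (z - z') + norm (p - p'))" by simp
  qed (use constants hh_scale in auto)
  show "small_set (DIM('a) - 2) (?T (%z p. e \<bullet> p) j)" for e :: 'a and j
  proof (rule transversal_pairs_small[where \<Lambda> = "norm e + 1"])
   fix z z' p p' :: 'a
   have "\<bar>e \<bullet> p - e \<bullet> p'\<bar> <= norm e*norm (p - p')" using Cauchy_Schwarz_ineq2[of e "p - p'"] by (simp add: inner_diff_right)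
   also have "... <= (norm e + 1)*(norm (z - z') + norm (p - p'))" by (intro mult_mono) auto
   finally show "\<bar>e \<bullet> p - e \<bullet> p'\<bar> <= (norm e + 1)*(norm (z - z') + norm (p - p'))" .
  qed (auto simp: add_nonneg_pos)
  show "small_set (DIM('a) - 2) ((%z. (z, n z)) ` Z)"
  proof (rule small_set_local_image)
   fix t assume "t \<in> Z"
   from bspec[OF lip[unfolded locally_lipschitz_on_def] this]
   obtain e C where e: "0 < e" and C: "C-lipschitz_on (ball t e \<inter> Z) n" by (elim exE conjE)
   have "(1 + C)-lipschitz_on (Z \<inter> ball t e) (%z. (z, n z))"
   proof (rule lipschitz_onI)
    fix x y assume "x \<in> Z \<inter> ball t e" "y \<in> Z \<inter> ball t e"
    hence "dist (n x) (n y) <= C*dist x y" using lipschitz_onD[OF C] by auto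
    moreover have "dist (x, n x) (y, n y) <= dist x y + dist (n x) (n y)"
     unfolding dist_norm using norm_Pair_le_add[of "x - y" "n x - n y"] by simp
    ultimately show "dist (x, n x) (y, n y) <= (1 + C)*dist x y" by (simp add: algebra_simps)
   qed (use lipschitz_on_nonneg[OF C] in auto)
   hence "small_set (DIM('a) - 2) ((%z. (z, n z)) ` (Z \<inter> ball t e))"
    by (intro small_set_lipschitz_image small_set_subset[OF small_set_countably_rectifiable[OF rect]]) auto
   thus "\<exists>e>0. small_set (DIM('a) - 2) ((%z. (z, n z)) ` (Z \<inter> ball t e))" using e by blast
  qed
 qed
 hence sE: "small_set (DIM('a) - 2) E" .
 \<comment> \<open>The Lipschitz constant of \<open>datum_lipschitz\<close> depends on bounds for z
   and T, so the singular points are exhausted by the bounds m.\<close>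
 let ?X = "%m::nat. {x. \<exists>a\<in>{a \<in> E. norm (fst a) <= real m}. \<exists>t\<in>{0..real m}. datum x (fst a) t (snd a)}"
 have "small_set (Suc (DIM('a) - 2)) (?X m)" for m
 proof -
  obtain C where C: "0 <= C" "!!x1 z1 T1 \<xi>1 x2 z2 T2 \<xi>2. datum x1 z1 T1 \<xi>1 ==> datum x2 z2 T2 \<xi>2 ==> T1 <= real m ==> T2 <= real m ==>
   norm z1 <= real m ==> norm z2 <= real m ==> norm (x1 - x2) <= C*(norm (z1 - z2) + norm (\<xi>1 - \<xi>2) + \<bar>T1 - T2\<bar>)"
   by (rule datum_lipschitz[of "real m" "real m"]) blast
  show ?thesis
  proof (rule small_set_parametrized[where A = "{a \<in> E. norm (fst a) <= real m}" and \<tau> = "real m" and C = "2*C" and P = "%x a t. datum x (fst a) t (snd a)"])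
   show "small_set (DIM('a) - 2) {a \<in> E. norm (fst a) <= real m}" by (rule small_set_subset[OF sE]) auto
   fix x a t x' a' t' assume d: "datum x (fst a) t (snd a)" "datum x' (fst a') t' (snd a')"
    and a: "a \<in> {a \<in> E. norm (fst a) <= real m}" "a' \<in> {a \<in> E. norm (fst a) <= real m}" and t: "t \<in> {0..real m}" "t' \<in> {0..real m}"
   have "norm (x - x') <= C*(norm (fst a - fst a') + norm (snd a - snd a') + \<bar>t - t'\<bar>)"
    by (rule C(2)[OF d]) (use a t in auto)
   also have "... <= C*(dist a a' + dist a a' + 2*\<bar>t - t'\<bar>)"
    using C(1) norm_fst_snd_le[of "a - a'"] by (intro mult_left_mono add_mono) (auto simp: dist_norm fst_diff snd_diff)
   finally show "dist x x' <= 2*C*(dist a a' + \<bar>t - t'\<bar>)" by (simp add: dist_norm algebra_simps)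
  qed (use C in auto)
 qed
 hence sU: "small_set (Suc (DIM('a) - 2)) (\<Union>m. ?X m)" by (rule small_set_UN)
 have dim': "Suc (DIM('a) - 2) = DIM('a) - 1" using dim by simp
 have "singular_set \<subseteq> (\<Union>m. ?X m)"
 proof
  fix x0 assume x0: "x0 \<in> singular_set"
  have "\<exists>z T \<xi>. datum x0 z T \<xi> &
  degenerate_pair D n z \<xi>" by (rule singular_point_datum[OF x0]; (rule n | rule D(2)); assumption)
  then obtain z T \<xi> where d: "datum x0 z T \<xi>" and c: "degenerate_pair D n z \<xi>" by (elim exE conjE)
  have \<pi>: "(z, \<xi>) \<in> ?T F j" if "(z, \<xi>, \<eta>) \<in> transversal_triples F (real (Suc j)) (1/real (Suc j))" for F j \<eta>
   using image_eqI[OF _ that, of "(z, \<xi>)" ?\<pi>] by simp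
  have "(z, \<xi>) \<in> E" unfolding E_def using c[unfolded degenerate_pair_def]
  proof (elim disjE exE bexE)
   fix j :: nat and \<eta> assume "(z, \<xi>, \<eta>) \<in> transversal_triples hh (real (Suc j)) (1/real (Suc j))"
   from \<pi>[OF this] show "(z, \<xi>) \<in> (\<Union>j. ?T hh j) \<union> (\<Union>e\<in>D. \<Union>j. ?T (%z p. e \<bullet> p) j) \<union> (%z. (z, n z)) ` Z"
    by (intro UnI1 UN_I[of j]) auto
  next
   fix e and j :: nat and \<eta> assume e: "e \<in> D" and "(z, \<xi>, \<eta>) \<in> transversal_triples (%z p. e \<bullet> p) (real (Suc j)) (1/real (Suc j))"
   from \<pi>[OF this(2)] show "(z, \<xi>) \<in> (\<Union>j. ?T hh j) \<union> (\<Union>e\<in>D. \<Union>j. ?T (%z p. e \<bullet> p) j) \<union> (%z. (z, n z)) ` Z"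
    by (intro UnI1 UnI2 UN_I[of e] UN_I[of j] e) auto
  next
   assume "z \<in> {x \<in> reachable_boundary1 U f S. hh x (n x) = 0} & \<xi> = n z"
   thus "(z, \<xi>) \<in> (\<Union>j. ?T hh j) \<union> (\<Union>e\<in>D. \<Union>j. ?T (%z p. e \<bullet> p) j) \<union> (%z. (z, n z)) ` Z"
    unfolding Z by (intro UnI2 image_eqI[of _ _ z]) auto
  qed
  obtain m :: nat where m: "max (norm z) T < real m" using reals_Archimedean2 by blast
  have "0 < T" using d lim_end_facts(1)[of x0 z T] unfolding datum_def by blast
  hence "x0 \<in> ?X m" using d m \<open>(z, \<xi>) \<in> E\<close> by (intro CollectI bexI[of _ "(z, \<xi>)"] bexI[of _ T]) auto
  thus "x0 \<in> (\<Union>m. ?X m)" by blast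
 qed
 from small_set_subset[OF sU this] show ?thesis unfolding dim' .
qed

text \<open>In dimension one a degenerate extremal is stationary: \<open>\<bar>p \<bullet> f\<bar> = \<bar>p\<bar> \<bar>f\<bar>\<close> and
 \<open>hh z\<close> vanishes on the half line spanned by \<open>\<xi>\<close>, which contains \<open>p\<close>.\<close>

lemma no_datum_1:
 assumes dim: "DIM('a) = 1" shows "\<not> datum x z T \<xi>"
proof
 assume d: "datum x z T \<xi>"
 obtain \<sigma> where h: "x \<notin> S" "lim_end x z T" "norm \<xi> = 1" "normal_at z \<sigma> \<xi>" "hh z \<xi> <= 0"
  using d unfolding datum_def by blast
 have hz: "hh z \<xi> = 0" using hh_nonneg_at_end[OF h(1,2,4)] h(5) by linarith
 define M where "M = exp (L*(T + 1))"
 have M: "1 <= M" using lim_end_facts(1)[OF h(1,2)] constants by (simp add: M_def)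
 \<comment> \<open>The right-hand side tends to 0 with \<open>dlt\<close>, which forces x = z; but z
   lies in the target and x does not.\<close>
 have est: "norm (x - z) <= dlt + (dlt + M*dlt)*M" if dlt: "0 < dlt" "dlt < 1" for dlt
 proof -
  obtain x' T' u y p where a: "norm (x' - x) < dlt" "\<bar>T' - T\<bar> < dlt" "norm (y T' - z) < dlt" "extremal_arc (dlt^2) x' \<xi> T' u y p"
   by (rule datum_approx[OF d dlt(1)])
  have u: "control U u" "trajectory f x' u y" and T0: "0 < T'" and pT: "p T' = \<xi>"
    and pp: "primitive_on p (%s. - adj (Df (y s) (u s)) (p s)) T'"
    and pb: "!!s. s \<in> {0..T'} ==> exp (- L*T') <= norm (p s)"
    and ie: "integral {0..T'} (%s. hh (y s) (p s) - p s \<bullet> f (y s) (u s)) <= dlt^2"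
    using a(4) unfolding extremal_arc_def by auto
  have TT: "exp (L*T') <= M" using a(2) dlt constants unfolding M_def by (auto intro!: mult_left_mono)
  let ?e = "%s. hh (y s) (p s) - p s \<bullet> f (y s) (u s)"
  note cy = trajectory_continuous[OF u, of T'] and cp = primitive_on_continuous[OF pp]
  have ii: "?e integrable_on {0..T'}" by (intro hk_integrable_diff integrable_continuous_real hh_path_continuous cy cp
     inner_f_integrable[OF u(1)])
  have e0: "0 <= ?e s" if "s \<in> {0..T'}" for s using hh_ge[OF control_in[OF u(1)], of s "p s" "y s"] that by simp
  have one: "v = (v \<bullet> \<xi>) *\<^sub>R \<xi>" for v by (rule one_dimensional[OF dim h(3)])
  have no: "norm v = \<bar>v \<bullet> \<xi>\<bar>" for v by (subst one) (use h(3) in simp)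
  \<comment> \<open>On the line p is a multiple of \<xi>; it equals \<xi> at the end and is bounded
    away from 0, so it cannot change its sign.\<close>
  have pos: "0 < p s \<bullet> \<xi>" if s: "s \<in> {0..T'}" for s
  proof (rule ccontr)
   assume "\<not> 0 < p s \<bullet> \<xi>"
   moreover have "0 <= p T' \<bullet> \<xi>" using pT by simp
   moreover have "continuous_on {s..T'} (%s. p s \<bullet> \<xi>)"
    by (intro continuous_intros continuous_on_subset[OF cp]) (use s in auto)
   ultimately obtain t where "s <= t" "t <= T'" "p t \<bullet> \<xi> = 0" using IVT'[of "%s. p s \<bullet> \<xi>" s 0 T'] s by auto
   hence "norm (p t) = 0" "t \<in> {0..T'}" using no[of "p t"] s by auto
   thus False using pb[of t] exp_gt_zero[of "- L*T'"] by linarith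
  qed
  let ?g = "%s. M*?e s"
  \<comment> \<open>As p is a positive multiple of \<xi>, \<open>hh\<close> vanishes at (z, p), and
    at y it is of the order of |y - z|. On the line |p . f| is |p| |f|, so the speed is bounded by
    the distance to z plus the defect, which is what Gronwall needs.\<close>
  have sp: "norm (f (y s) (u s)) <= L*norm (y s - z) + ?g s" if s: "s \<in> {0..T'}" for s
  proof -
   let ?q = "p s \<bullet> \<xi>" and ?f = "f (y s) (u s)"
   have q: "0 < ?q" by (rule pos[OF s])
   have nq: "norm (p s) = ?q" using no[of "p s"] q by simp
   have "hh z (p s) = 0" using hh_scale[of ?q z \<xi>] q hz one[of "p s"] by simp
   hence "\<bar>hh (y s) (p s)\<bar> <= L*?q*norm (y s - z)" using hh_lipschitz[of "y s" "p s" z "p s"] nq by simp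
   moreover have "p s \<bullet> ?f = ?q*(\<xi> \<bullet> ?f)" by (subst one) simp
   hence "?q*norm ?f = \<bar>p s \<bullet> ?f\<bar>" using q no[of ?f] by (simp add: abs_mult inner_commute)
   ultimately have "?q*norm ?f <= L*?q*norm (y s - z) + ?e s" using e0[OF s] by linarith
   moreover have "1 <= ?q*M"
   proof -
    have "exp (- L*T')*exp (L*T') <= ?q*M" using pb[OF s] nq TT q by (intro mult_mono) auto
    thus ?thesis by (simp add: exp_minus)
   qed
   hence "1*?e s <= (?q*M)*?e s" using e0[OF s] by (rule mult_right_mono)
   ultimately have "?q*norm ?f <= ?q*(L*norm (y s - z) + ?g s)" by (simp add: algebra_simps)
   thus ?thesis using q by simp
  qed
  have "primitive_on (%_. z) (%_. 0) T'" unfolding primitive_on_def by (auto simp: image_constant_conv)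
  from primitive_on_diff[OF trajectory_primitive(2)[OF u] this]
  have pr: "primitive_on (%s. y s - z) (%s. f (y s) (u s) - 0) T'" .
  have ig: "?g integrable_on {0..T'}" by (rule integrable_on_mult_right[OF ii])
  have "norm (y 0 - z) <= (norm (y T' - z) + integral {0..T'} ?g)*exp (L*(T' - 0))"
   by (rule primitive_on_gronwall_backward[OF pr _ _ ig]) (use constants T0 M e0 sp in auto)
  also have "... <= (dlt + M*dlt)*M"
  proof (rule mult_mono)
   have "dlt^2 <= dlt" using dlt by (simp add: power2_eq_square mult_left_le)
   hence "M*integral {0..T'} ?e <= M*dlt" using ie M by (intro mult_left_mono) auto
   thus "norm (y T' - z) + integral {0..T'} ?g <= dlt + M*dlt" using a(3) by simp
  qed (use TT dlt M in auto)
  finally have "norm (x' - z) <= (dlt + M*dlt)*M" unfolding trajectory_primitive(1)[OF u] .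
  moreover have "norm (x - z) <= norm (x' - x) + norm (x' - z)" by norm
  ultimately show ?thesis using a(1) by linarith
 qed
 have "((%dlt. dlt + (dlt + M*dlt)*M) \<longlongrightarrow> 0 + (0 + M*0)*M) (at_right 0)" by (intro tendsto_intros)
 moreover have "\<forall>\<^sub>F dlt in at_right 0. norm (x - z) <= dlt + (dlt + M*dlt)*M"
  unfolding eventually_at_right_field using est by (intro exI[of _ 1]) auto
 ultimately have "norm (x - z) <= 0 + (0 + M*0)*M" by (intro tendsto_lowerbound) auto
 hence "x = z" by simp
 moreover have "z \<in> S" using lim_end_facts(2)[OF h(1,2)] S by (simp add: frontier_def)
 ultimately show False using h(1) by simp
qed

text \<open>For d = 1 the truncated difference d - 2 is 0, and adding the arrival time would give 1
  and not d - 1 = 0. In that dimension there are no singular points at all.\<close>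

lemma singular_set_small:
 assumes n: "!!x. x \<in> reachable_boundary1 U f S ==> n x \<in> proximal_normals (closure (- S)) x & norm (n x) = 1"
  and Z: "Z = {x \<in> reachable_boundary1 U f S. hh x (n x) = 0}"
  and rect: "countably_rectifiable (DIM('a) - 2) Z" and lip: "locally_lipschitz_on Z n"
 shows "small_set (DIM('a) - 1) singular_set"
proof (cases "DIM('a) = 1")
 case True
 have "singular_set = {}"
 proof -
  have False if x: "x \<in> singular_set" for x
  proof -
   obtain z T \<xi> where "lim_end x z T" "norm \<xi> = 1" "normal_at z (1/(2*\<rho>0)) \<xi>" "hh z \<xi> <= 0"
    using singular_point_end[OF x] by (elim exE conjE)
   hence "datum x z T \<xi>" using x unfolding datum_def singular_set_def by blast
   thus False using no_datum_1[OF True] by blast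
  qed
  thus ?thesis by blast
 qed
 thus ?thesis by simp
next
 case False
 moreover have "0 < DIM('a)" by simp
 ultimately have "2 <= DIM('a)" by linarith
 thus ?thesis by (rule singular_set_small_2[OF _ n Z rect lip])
qed

end

section \<open>Difference quotients\<close>

lemma integral_translate:
 fixes g :: "'a::euclidean_space => real"
 assumes "g \<in> borel_measurable borel"
 shows "(LBINT x. g (c + x)) = (LBINT x. g x)"
proof -
 have "(\<integral>x. g x \<partial>distr lborel borel ((+) c)) = (LBINT x. g (c + x))"
  by (rule integral_distr) (use assms in auto)
 thus ?thesis by (simp add: lborel_distr_plus)
qed

lemma integrable_bounded_support:
 fixes g :: "'a::euclidean_space => real"
 assumes g: "g \<in> borel_measurable borel" and b: "!!x. \<bar>g x\<bar> <= A*indicator (cball z r) x"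
 shows "integrable lborel g" "\<bar>\<integral>x. g x \<partial>lborel\<bar> <= A*measure lborel (cball z r)"
proof -
 have i: "integrable lborel (%x. A*indicator (cball z r) x)"
  by (intro integrable_mult_right integrable_real_indicator) (use emeasure_bounded_finite[of "cball z r"] in auto)
 show 1: "integrable lborel g"
 proof (rule Bochner_Integration.integrable_bound[OF i])
  show "AE x in lborel. norm (g x) <= norm (A*indicator (cball z r) x)"
   using order_trans[OF b abs_ge_self] by (intro AE_I2) simp
 qed (use g in simp)
 have "\<bar>\<integral>x. g x \<partial>lborel\<bar> <= (LBINT x. \<bar>g x\<bar>)" by (rule integral_abs_bound)
 also have "... <= (LBINT x. A*indicator (cball z r) x)" by (rule integral_mono[OF integrable_abs[OF 1] i]) (use b in auto)
 finally show "\<bar>\<integral>x. g x \<partial>lborel\<bar> <= A*measure lborel (cball z r)" by simp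
qed

text \<open>Let \<open>P v\<close> be the set of points below which \<open>V\<close> decreases, up to a linear function, in
 a cone around \<open>v\<close>, and let \<open>W v\<close> be the largest function which decreases in the cone
 directions and is dominated by \<open>V\<close> (tilted) on \<open>P v\<close>. The values of \<open>V\<close> on a segment
 are enclosed by translates of the functions \<open>W v\<close>, whose \<open>L\<^sup>1\<close> moduli of continuity are
 linear by monotonicity.\<close>

lemma cone_monotone_difference_quotients:
 fixes V :: "'a::euclidean_space => real"
 assumes V: "continuous_on UNIV V" and R: "0 < R" and M: "0 <= M"
  and cone: "!!p. p \<in> cball z (2*R) ==> \<exists>\<zeta>. norm \<zeta> = 1 &
   (\<forall>x\<in>cball z (2*R). norm (x - p)/2 < \<zeta> \<bullet> (x - p) --> V x <= V p + M*norm (x - p))"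
 shows "\<exists>C. \<forall>h b. 0 < h & h < R & norm b <= 1 -->
  (LBINT x. indicator (ball z (R/2)) x*\<bar>V (x + h *\<^sub>R b) - V x\<bar>) <= C*h"
proof -
 define B where "B = cball z (2*R)"
 \<comment> \<open>If |v - \<zeta>| < 1/4, then the cone \<open>K v\<close> with constant 3/4 lies
   in the cone about \<zeta> with constant 1/2. So the finite net F serves all directions.\<close>
 obtain F :: "'a set" where F: "finite F" "F \<subseteq> sphere 0 1" "sphere 0 1 \<subseteq> (\<Union>v\<in>F. ball v (1/4))"
  using seq_compact_imp_totally_bounded[of "sphere (0::'a) 1"] compact_sphere[of "0::'a" 1]
  unfolding compact_eq_seq_compact_metric by (metis zero_less_divide_1_iff zero_less_numeral)
 have Fn: "norm v = 1" if "v \<in> F" for v using that F(2) by auto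
 have "compact (V ` B)" unfolding B_def by (intro compact_continuous_image continuous_on_subset[OF V]) auto
 then obtain A0 where A0: "!!x. x \<in> B ==> \<bar>V x\<bar> <= A0" using compact_imp_bounded bounded_iff by (metis imageI real_norm_def)
 \<comment> \<open>On \<open>K v\<close> one has |w| \<le> 2 v . w, so the tilt 2 M turns growth of
   at most M |w| into decrease.\<close>
 define u where "u v x = V x - 2*M*(v \<bullet> x)" for v x
 define A where "A = \<bar>A0\<bar> + 2*M*(norm z + 2*R)"
 have A0p: "0 <= A" using M R by (simp add: A_def)
 have uA: "\<bar>u v x\<bar> <= A" if "x \<in> B" "v \<in> F" for v x
 proof -
  have "norm x <= norm z + norm (x - z)" by norm
  hence "norm x <= norm z + 2*R" using that(1) by (simp add: B_def dist_norm norm_minus_commute)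
  hence "\<bar>v \<bullet> x\<bar> <= norm z + 2*R" using Cauchy_Schwarz_ineq2[of v x] Fn[OF that(2)] by simp
  hence "\<bar>2*M*(v \<bullet> x)\<bar> <= 2*M*(norm z + 2*R)" using M by (simp add: abs_mult mult_left_mono)
  thus ?thesis using A0[OF that(1)] by (simp add: u_def A_def)
 qed
 define K where "K v = {w. 3/4*norm w < v \<bullet> w}" for v :: 'a
 have Kadd: "w + w' \<in> K v" if "w \<in> K v" "w' \<in> K v" for w w' v
  using that norm_triangle_ineq[of w w'] by (simp add: K_def inner_add_right)
 have Kopen: "open {x. x - p \<in> K v}" for p v
  unfolding K_def mem_Collect_eq by (intro open_Collect_less continuous_intros)
 define P where "P v = {p \<in> B. \<forall>x\<in>B. x - p \<in> K v --> u v x <= u v p}" for v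
 \<comment> \<open>The element A, which bounds the tilted function on B, keeps the infimum defined
   where no p is admissible and preserves all the inequalities.\<close>
 define Q where "Q v x = insert A {u v p | p. p \<in> P v & x - p \<in> K v}" for v x
 define W where "W v x = Inf (Q v x)" for v x
 have Qlow: "- A <= y" if "y \<in> Q v x" "v \<in> F" for y v x
  using that uA[of _ v] A0p by (fastforce simp: Q_def P_def abs_le_iff)
 have Qbdd: "bdd_below (Q v x)" if "v \<in> F" for v x using Qlow[OF _ that] by (intro bdd_belowI) auto
 have Qne: "Q v x ~= {}" for v x by (simp add: Q_def)
 have WA: "\<bar>W v x\<bar> <= A" if "v \<in> F" for v x
 proof -
  have "- A <= W v x" unfolding W_def by (rule cInf_greatest[OF Qne Qlow[OF _ that]])
  moreover have "W v x <= A" unfolding W_def by (rule cInf_lower[OF _ Qbdd[OF that]]) (simp add: Q_def)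
  ultimately show ?thesis by simp
 qed
 have W1: "W v x <= u v p" if "p \<in> P v" "x - p \<in> K v" "v \<in> F" for v x p
  unfolding W_def by (rule cInf_lower[OF _ Qbdd[OF that(3)]]) (use that in \<open>auto simp: Q_def\<close>)
 have W2: "u v p <= W v x" if p: "p \<in> B" "p - x \<in> K v" "v \<in> F" for v x p unfolding W_def
 proof (rule cInf_greatest[OF Qne])
  fix y assume "y \<in> Q v x"
  then consider "y = A" | q where "y = u v q" "q \<in> P v" "x - q \<in> K v" by (auto simp: Q_def)
  thus "u v p <= y"
  proof cases
   case 1 thus ?thesis using uA[OF p(1,3)] by simp
  next
   case 2
   have "p - q \<in> K v" using Kadd[OF p(2) 2(3)] by simp
   thus ?thesis using 2 p(1) by (simp add: P_def)
  qed
 qed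
 have W3: "W v y <= W v x" if k: "y - x \<in> K v" "v \<in> F" for v x y unfolding W_def
 proof (rule cInf_superset_mono[OF Qne Qbdd[OF k(2)]])
  show "Q v x \<subseteq> Q v y"
  proof
   fix q assume "q \<in> Q v x"
   then consider "q = A" | p where "q = u v p" "p \<in> P v" "x - p \<in> K v" by (auto simp: Q_def)
   thus "q \<in> Q v y"
   proof cases
    case 2
    have "y - p \<in> K v" using Kadd[OF k(1) 2(3)] by simp
    with 2 show ?thesis by (auto simp: Q_def)
   qed (simp add: Q_def)
  qed
 qed
 have Wb: "W v \<in> borel_measurable borel" if v: "v \<in> F" for v
 proof (rule borel_measurable_iff_less[THEN iffD2], rule allI)
  fix a
  have "{x. W v x < a} = (if A < a then UNIV else {}) \<union> (\<Union>p\<in>{p \<in> P v. u v p < a}. {x. x - p \<in> K v})"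
   unfolding W_def cInf_less_iff[OF Qne Qbdd[OF v]] by (auto simp: Q_def)
  also have "open ..." by (intro open_Un open_UN ballI Kopen) auto
  finally show "{x \<in> space borel. W v x < a} \<in> sets borel" by simp
 qed
 have key: "\<bar>V (x + h *\<^sub>R b) - V x\<bar> <= (\<Sum>v\<in>F. W v (x - (8*h) *\<^sub>R v) - W v (x + (8*h) *\<^sub>R v) + 4*M*h)"
  if x: "x \<in> cball z R" and h: "0 < h" "h < R" and b: "norm b <= 1" for x h b
 proof -
  define lo where "lo v = W v (x + (8*h) *\<^sub>R v) + 2*M*(v \<bullet> x) - 2*M*h" for v
  define hi where "hi v = W v (x - (8*h) *\<^sub>R v) + 2*M*(v \<bullet> x) + 2*M*h" for v
  \<comment> \<open>A shift by 8 h along v dominates every displacement of length at most h: 3/4 (8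
    h + h) < 8 h - h.\<close>
  have cn: "(8*h) *\<^sub>R v + t *\<^sub>R w \<in> K v" if t: "0 <= t" "t <= h" and w: "norm w <= 1" and v: "v \<in> F" for t v w
  proof -
   have "v \<bullet> v = 1" using Fn[OF v] by (simp add: dot_square_norm)
   moreover have "\<bar>v \<bullet> w\<bar> <= 1" using Cauchy_Schwarz_ineq2[of v w] Fn[OF v] w by simp
   hence "t*\<bar>v \<bullet> w\<bar> <= h*1" using t by (intro mult_mono) auto
   hence "- h <= t*(v \<bullet> w)" using t abs_mult[of t "v \<bullet> w"] by (simp add: abs_le_iff)
   moreover have "norm ((8*h) *\<^sub>R v + t *\<^sub>R w) <= 8*h + h*1"
   proof (rule norm_triangle_le)
    have "t*norm w <= h*1" using t w by (intro mult_mono) auto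
    thus "norm ((8*h) *\<^sub>R v) + norm (t *\<^sub>R w) <= 8*h + h*1" using t h Fn[OF v] by simp
   qed
   ultimately show ?thesis using h by (simp add: K_def inner_add_right)
  qed
  have lohi: "lo v <= hi v" if v: "v \<in> F" for v
  proof -
   have "(x + (8*h) *\<^sub>R v) - (x - (8*h) *\<^sub>R v) \<in> K v"
    using Kadd[OF cn[of 0 0 v] cn[of 0 0 v]] v h by (simp add: algebra_simps)
   from W3[OF this v] have "W v (x + (8*h) *\<^sub>R v) <= W v (x - (8*h) *\<^sub>R v)" .
   moreover have "0 <= M*h" using M h by simp
   ultimately show ?thesis by (simp add: lo_def hi_def)
  qed
  define \<alpha> \<beta> where "\<alpha> = min (V x) (V (x + h *\<^sub>R b))" and "\<beta> = max (V x) (V (x + h *\<^sub>R b))"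
  \<comment> \<open>Each value c between the two ends is attained on the segment, and the direction
    adapted to that point puts c into the interval of some v. Different points may need different v,
    so the whole range is covered by the finitely many intervals and its length is at most the sum
    of theirs.\<close>
  have "{\<alpha>..\<beta>} \<subseteq> (\<Union>v\<in>F. {lo v..hi v})"
  proof
   fix c assume c: "c \<in> {\<alpha>..\<beta>}"
   have "connected ((%t. V (x + t *\<^sub>R b)) ` {0..h})"
    by (intro connected_continuous_image continuous_on_compose2[OF V] continuous_intros) auto
   moreover have "V x \<in> (%t. V (x + t *\<^sub>R b)) ` {0..h}" by (rule image_eqI[of _ _ 0]) (use h in auto)
   moreover have "V (x + h *\<^sub>R b) \<in> (%t. V (x + t *\<^sub>R b)) ` {0..h}" by (rule image_eqI[of _ _ h]) (use h in auto)
   ultimately have "c \<in> (%t. V (x + t *\<^sub>R b)) ` {0..h}"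
    using c connectedD_interval[of _ "\<alpha>" "\<beta>" c] by (auto simp: \<alpha>_def \<beta>_def min_def max_def split: if_splits)
   then obtain t where t: "0 <= t" "t <= h" "c = V (x + t *\<^sub>R b)" by auto
   define p where "p = x + t *\<^sub>R b"
   have tb: "norm (t *\<^sub>R b) <= h"
   proof -
    have "t*norm b <= h*1" using t b by (intro mult_mono) auto
    thus ?thesis using t by simp
   qed
   have "norm (p - z) <= norm (x - z) + norm (t *\<^sub>R b)"
    using norm_triangle_ineq[of "x - z" "t *\<^sub>R b"] by (simp add: p_def algebra_simps)
   moreover have "norm (x - z) <= R" using x by (simp add: dist_norm norm_minus_commute)
   ultimately have "norm (p - z) <= 2*R" using tb h by linarith
   hence pB: "p \<in> B" by (simp add: B_def dist_norm norm_minus_commute)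
   obtain \<zeta> where \<zeta>: "norm \<zeta> = 1" "!!y. y \<in> B ==> norm (y - p)/2 < \<zeta> \<bullet> (y - p) ==> V y <= V p + M*norm (y - p)"
    using cone[of p] pB unfolding B_def by blast
   have "\<zeta> \<in> sphere 0 1" using \<zeta>(1) by simp
   then obtain v where v: "v \<in> F" "norm (v - \<zeta>) < 1/4" using F(3) by (auto simp: dist_norm)
   have "p \<in> P v" unfolding P_def
   proof (intro CollectI conjI ballI impI pB)
    fix y assume y: "y \<in> B" "y - p \<in> K v"
    let ?w = "y - p"
    have "(v - \<zeta>) \<bullet> ?w <= norm (v - \<zeta>)*norm ?w" using Cauchy_Schwarz_ineq2[of "v - \<zeta>" ?w] by linarith
    also have "... <= 1/4*norm ?w" using v(2) by (intro mult_right_mono) auto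
    finally have "norm ?w/2 < \<zeta> \<bullet> ?w" using y(2) by (simp add: K_def inner_diff_left)
    from \<zeta>(2)[OF y(1) this] have "V y <= V p + M*norm ?w" .
    moreover have "M*norm ?w <= M*(2*(v \<bullet> ?w))"
     using y(2) M by (intro mult_left_mono) (auto simp: K_def, smt (verit) norm_ge_zero)
    ultimately show "u v y <= u v p" by (simp add: u_def inner_diff_right algebra_simps)
   qed
   moreover have "x + (8*h) *\<^sub>R v - p \<in> K v" using cn[OF t(1,2), of "- b" v] v b by (simp add: p_def)
   ultimately have 1: "W v (x + (8*h) *\<^sub>R v) <= u v p" using v(1) by (intro W1)
   have "p - (x - (8*h) *\<^sub>R v) \<in> K v" using cn[OF t(1,2) b v(1)] by (simp add: p_def add.commute)
   from W2[OF pB this v(1)] have 2: "u v p <= W v (x - (8*h) *\<^sub>R v)" .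
   have "\<bar>v \<bullet> (t *\<^sub>R b)\<bar> <= h" using Cauchy_Schwarz_ineq2[of v "t *\<^sub>R b"] Fn[OF v(1)] tb by simp
   hence "\<bar>2*M*(v \<bullet> (t *\<^sub>R b))\<bar> <= 2*M*h" using M by (simp add: abs_mult mult_left_mono del: inner_scaleR_right)
   moreover have "c = u v p + 2*M*(v \<bullet> x) + 2*M*(v \<bullet> (t *\<^sub>R b))"
    unfolding t(3) u_def p_def by (simp add: inner_add_right algebra_simps)
   ultimately have "c \<in> {lo v..hi v}" using 1 2 unfolding lo_def hi_def abs_le_iff by simp
   thus "c \<in> (\<Union>v\<in>F. {lo v..hi v})" using v(1) by blast
  qed
  hence "measure lborel {\<alpha>..\<beta>} <= measure lborel (\<Union>v\<in>F. {lo v..hi v})"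
   by (intro measure_mono_fmeasurable fmeasurable.finite_UN) (use F fmeasurable_cbox[where 'a = real] in auto)
  also have "... <= (\<Sum>v\<in>F. measure lborel {lo v..hi v})" by (intro measure_subadditive_finite) (use F lohi in auto)
  also have "... = (\<Sum>v\<in>F. hi v - lo v)" using lohi by (intro sum.cong) auto
  also have "measure lborel {\<alpha>..\<beta>} = \<bar>V (x + h *\<^sub>R b) - V x\<bar>" by (auto simp: \<alpha>_def \<beta>_def min_def max_def)
  also have "(\<Sum>v\<in>F. hi v - lo v) = (\<Sum>v\<in>F. W v (x - (8*h) *\<^sub>R v) - W v (x + (8*h) *\<^sub>R v) + 4*M*h)"
   by (intro sum.cong) (auto simp: hi_def lo_def)
  finally show ?thesis .
 qed
 \<comment> \<open>The right-hand side of \<open>key\<close> is linear in the functions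
   \<open>W v\<close>. Integrated against the Lipschitz bump \<phi>, the shifts move from the merely
   bounded \<open>W v\<close> to \<phi>, where they cost order h.\<close>
 define \<phi> where "\<phi> x = max 0 (1 - dist x z/R)" for x
 have \<phi>0: "0 <= \<phi> x" "\<phi> x <= 1" for x using R by (auto simp: \<phi>_def)
 have \<phi>s: "x \<in> cball z R" if "\<phi> x ~= 0" for x using that R by (auto simp: \<phi>_def max_def dist_commute field_simps split: if_splits)
 have \<phi>b: "\<phi> \<in> borel_measurable borel"
  by (rule borel_measurable_continuous_onI) (use R in \<open>auto simp: \<phi>_def[abs_def] intro!: continuous_intros\<close>)
 have \<phi>l: "\<bar>\<phi> x - \<phi> y\<bar> <= norm (x - y)/R" for x y
 proof -
  have "\<bar>\<phi> x - \<phi> y\<bar> <= \<bar>dist x z/R - dist y z/R\<bar>" unfolding \<phi>_def by linarith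
  also have "... = \<bar>dist x z - dist y z\<bar>/R" using R by (simp add: abs_divide flip: diff_divide_distrib)
  also have "... <= norm (x - y)/R" using R abs_dist_diff_le[of x z y] unfolding dist_norm[of x y, symmetric] dist_commute[of z y] by (intro divide_right_mono) auto
  finally show ?thesis .
 qed
 define vol where "vol = measure lborel (cball z (9*R))"
 define C where "C = 2*(\<Sum>v\<in>F. 16/R*A * vol + 4*M * vol)"
 have "(LBINT x. indicator (ball z (R/2)) x*\<bar>V (x + h *\<^sub>R b) - V x\<bar>) <= C*h"
  if h: "0 < h" "h < R" and b: "norm b <= 1" for h b
 proof -
  have R9: "x \<in> cball z (9*R)" if "x + y \<in> cball z R" "norm y <= 8*R" for x y
  proof -
   have "norm (x - z) <= norm (x + y - z) + norm y" by norm
   thus ?thesis using that by (simp add: dist_norm norm_minus_commute)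
  qed
  have ip: "integrable lborel (%x. \<phi> x*g x)" if "g \<in> borel_measurable borel" "!!x. \<bar>g x\<bar> <= A'" for g A'
  proof (rule integrable_bounded_support(1))
   show "\<bar>\<phi> x*g x\<bar> <= A'*indicator (cball z R) x" for x
   proof (cases "\<phi> x = 0")
    case True
    thus ?thesis using that(2)[of x] abs_ge_zero[of "g x"] by (auto simp: indicator_def intro: order_trans)
   next
    case False
    thus ?thesis using \<phi>s[OF False] \<phi>0[of x] mult_mono[of "\<phi> x" 1 "\<bar>g x\<bar>" A'] that(2)[of x] by (simp add: abs_mult)
   qed
  qed (use \<phi>b that in measurable)
  have each: "integrable lborel (%x. \<phi> x*(W v (x - (8*h) *\<^sub>R v) - W v (x + (8*h) *\<^sub>R v) + 4*M*h)) &
   (LBINT x. \<phi> x*(W v (x - (8*h) *\<^sub>R v) - W v (x + (8*h) *\<^sub>R v) + 4*M*h)) <= (16/R*A * vol + 4*M * vol)*h"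
   if v: "v \<in> F" for v
  proof -
   define a where "a = (8*h) *\<^sub>R v"
   have na: "norm a = 8*h" using Fn[OF v] h by (simp add: a_def)
   note [measurable] = Wb[OF v] \<phi>b
   have m1: "(%x. W v (x - a)) \<in> borel_measurable borel" "(%x. W v (x + a)) \<in> borel_measurable borel" by measurable
   note i = ip[OF m1(1) WA[OF v]] ip[OF m1(2) WA[OF v]] ip[of "%_. 4*M*h" "4*M*h"]
   have i3: "integrable lborel (%x. \<phi> x*(4*M*h))" by (rule i(3)) (use M h in auto)
   have i4: "integrable lborel (%x. W v x*\<phi> (x + y))" if "norm y <= 8*R" for y
   proof (rule integrable_bounded_support(1)[of _ A z "9*R"])
    show "\<bar>W v x*\<phi> (x + y)\<bar> <= A*indicator (cball z (9*R)) x" for x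
    proof (cases "\<phi> (x + y) = 0")
     case True thus ?thesis using A0p by (simp add: indicator_def)
    next
     case False
     thus ?thesis using R9[OF \<phi>s[OF False] that] \<phi>0[of "x + y"] mult_mono[OF WA[OF v, of x] _ A0p, of "\<phi> (x + y)" 1] by (simp add: abs_mult)
    qed
   qed measurable
   have t1: "(LBINT x. \<phi> x*W v (x - a)) = (LBINT x. W v x*\<phi> (x + a))"
    using integral_translate[of "%x. \<phi> x*W v (x - a)" a] by (simp add: add.commute mult.commute)
   have t2: "(LBINT x. \<phi> x*W v (x + a)) = (LBINT x. W v x*\<phi> (x - a))"
    using integral_translate[of "%x. \<phi> x*W v (x + a)" "- a"] by (simp add: mult.commute)
   have "(LBINT x. \<phi> x*(W v (x - a) - W v (x + a) + 4*M*h)) =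
     (LBINT x. \<phi> x*W v (x - a) - \<phi> x*W v (x + a) + \<phi> x*(4*M*h))"
    by (rule arg_cong[where f = "integral\<^sup>L lborel"]) (simp add: fun_eq_iff algebra_simps)
   also have "... = (LBINT x. \<phi> x*W v (x - a)) - (LBINT x. \<phi> x*W v (x + a)) + (LBINT x. \<phi> x*(4*M*h))"
    by (simp only: Bochner_Integration.integral_add[OF Bochner_Integration.integrable_diff[OF i(1,2)] i3] Bochner_Integration.integral_diff[OF i(1,2)])
   also have "(LBINT x. \<phi> x*W v (x - a)) - (LBINT x. \<phi> x*W v (x + a)) = (LBINT x. W v x*\<phi> (x + a) - W v x*\<phi> (x - a))"
    unfolding t1 t2 by (rule Bochner_Integration.integral_diff[symmetric]) (use i4[of a] i4[of "- a"] na h in auto)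
   also have "... <= A*(16*h/R)*measure lborel (cball z (9*R))"
   proof (rule order_trans[OF abs_ge_self integrable_bounded_support(2)])
    show "\<bar>W v x*\<phi> (x + a) - W v x*\<phi> (x - a)\<bar> <= A*(16*h/R)*indicator (cball z (9*R)) x" for x
    proof (cases "\<phi> (x + a) = 0 & \<phi> (x - a) = 0")
     case True thus ?thesis using A0p h R by (simp add: indicator_def)
    next
     case False
     hence "x \<in> cball z (9*R)" using R9[of x a] R9[of x "- a"] \<phi>s[of "x + a"] \<phi>s[of "x - a"] na h by auto
     moreover have "norm (x + a - (x - a)) = 16*h"
     proof -
      have "x + a - (x - a) = 2 *\<^sub>R a" by (simp add: scaleR_2)
      thus ?thesis using na by simp
     qed
     hence "\<bar>\<phi> (x + a) - \<phi> (x - a)\<bar> <= 16*h/R" using \<phi>l[of "x + a" "x - a"] by simp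
     hence "\<bar>W v x\<bar>*\<bar>\<phi> (x + a) - \<phi> (x - a)\<bar> <= A*(16*h/R)" using WA[OF v] A0p by (intro mult_mono) auto
     ultimately show ?thesis by (simp add: abs_mult right_diff_distrib[symmetric])
    qed
   qed measurable
   also have "(LBINT x. \<phi> x*(4*M*h)) <= (4*M*h)*measure lborel (cball z (9*R))"
   proof (rule order_trans[OF abs_ge_self integrable_bounded_support(2)])
    show "\<bar>\<phi> x*(4*M*h)\<bar> <= 4*M*h*indicator (cball z (9*R)) x" for x
    proof (cases "\<phi> x = 0")
     case True thus ?thesis using M h by (simp add: indicator_def)
    next
     case False
     have "\<phi> x*(4*M*h) <= 1*(4*M*h)" using \<phi>0 M h by (intro mult_right_mono) auto
     moreover have "0 <= \<phi> x*(4*M*h)" using \<phi>0[of x] M h by (intro mult_nonneg_nonneg) auto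
     moreover have "x \<in> cball z (9*R)" using R9[of x 0] \<phi>s[OF False] R by simp
     ultimately show ?thesis by simp
    qed
   qed measurable
   finally have "(LBINT x. \<phi> x*(W v (x - a) - W v (x + a) + 4*M*h)) <= A*(16*h/R) * vol + 4*M*h * vol"
    unfolding vol_def by simp
   also have "... = (16/R*A * vol + 4*M * vol)*h" by (simp add: algebra_simps)
   finally have le: "(LBINT x. \<phi> x*(W v (x - a) - W v (x + a) + 4*M*h)) <= (16/R*A * vol + 4*M * vol)*h" .
   have "integrable lborel (%x. \<phi> x*W v (x - a) - \<phi> x*W v (x + a) + \<phi> x*(4*M*h))"
    by (intro Bochner_Integration.integrable_add Bochner_Integration.integrable_diff i(1,2) i3)
   hence "integrable lborel (%x. \<phi> x*(W v (x - a) - W v (x + a) + 4*M*h))" by (simp add: algebra_simps)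
   with le show ?thesis unfolding a_def by blast
  qed
  let ?D = "%x. \<Sum>v\<in>F. \<phi> x*(W v (x - (8*h) *\<^sub>R v) - W v (x + (8*h) *\<^sub>R v) + 4*M*h)"
  have iD: "integrable lborel ?D" using each by (intro Bochner_Integration.integrable_sum) blast
  have ptw: "indicator (ball z (R/2)) x*\<bar>V (x + h *\<^sub>R b) - V x\<bar> <= 2*?D x" for x
  proof (cases "x \<in> cball z R")
   case True
   let ?q = "\<bar>V (x + h *\<^sub>R b) - V x\<bar>"
   have "indicator (ball z (R/2)) x <= 2*\<phi> x"
   proof (cases "x \<in> ball z (R/2)")
    case True
    hence "dist x z <= R/2" by (simp add: dist_commute)
    hence "dist x z/R <= 1/2" using R by (simp add: field_simps)
    hence "1/2 <= 1 - dist x z/R" by simp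
    hence "1/2 <= \<phi> x" unfolding \<phi>_def by (rule max.coboundedI2)
    hence "1 <= 2*\<phi> x" by simp
    thus ?thesis by (simp add: indicator_def)
   qed (use \<phi>0(1)[of x] in simp)
   from mult_right_mono[OF this, of ?q] have "indicator (ball z (R/2)) x*?q <= 2*(\<phi> x*?q)" by (simp only: mult.assoc)
   also have "... <= 2*(\<phi> x*(\<Sum>v\<in>F. W v (x - (8*h) *\<^sub>R v) - W v (x + (8*h) *\<^sub>R v) + 4*M*h))"
    using key[OF True h b] \<phi>0(1)[of x] by (intro mult_left_mono) auto
   finally show ?thesis by (simp add: sum_distrib_left)
  next
   case False
   hence "\<phi> x = 0" using \<phi>s by blast
   thus ?thesis using False R by (auto simp: indicator_def)
  qed
  have "(LBINT x. indicator (ball z (R/2)) x*\<bar>V (x + h *\<^sub>R b) - V x\<bar>) <= (LBINT x. 2*?D x)"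
  proof (rule Bochner_Integration.integral_mono_AE'; (intro AE_I2)?)
   show "integrable lborel (%x. 2*?D x)" by (intro integrable_mult_right iD)
   show "0 <= 2*?D x" for x by (rule order_trans[OF _ ptw]) simp
  qed (rule ptw)
  also have "... = 2*(\<Sum>v\<in>F. \<integral>x. \<phi> x*(W v (x - (8*h) *\<^sub>R v) - W v (x + (8*h) *\<^sub>R v) + 4*M*h) \<partial>lborel)"
   using each by (simp add: Bochner_Integration.integral_sum)
  also have "... <= 2*(\<Sum>v\<in>F. (16/R*A * vol + 4*M * vol)*h)" using each by (intro mult_left_mono sum_mono) auto
  finally show ?thesis by (simp add: C_def sum_distrib_right mult.assoc)
 qed
 thus ?thesis by blast
qed

section \<open>Almost everywhere convergence of convex combinations\<close>

lemma AE_summable_of_nn_integral: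
 fixes g :: "nat => 'a => real"
 assumes g: "!!n. g n \<in> borel_measurable M" and le: "!!n. (\<integral>\<^sup>+x. ennreal \<bar>g n x\<bar> \<partial>M) <= ennreal (C*(1/2) ^ n)" and C: "0 <= C"
 shows "AE x in M. summable (%n. \<bar>g n x\<bar>)"
proof -
 have s: "(%n. C*(1/2) ^ n) sums (C*(1/(1 - 1/2)))" by (intro sums_mult geometric_sums) simp
 have "(\<integral>\<^sup>+x. (\<Sum>n. ennreal \<bar>g n x\<bar>) \<partial>M) = (\<Sum>n. \<integral>\<^sup>+x. ennreal \<bar>g n x\<bar> \<partial>M)"
  by (rule nn_integral_suminf) (use g in measurable)
 also have "... <= (\<Sum>n. ennreal (C*(1/2) ^ n))" by (rule suminf_le[OF le]) auto
 also have "... = ennreal (\<Sum>n. C*(1/2) ^ n)" by (rule suminf_ennreal2) (use C s in \<open>auto simp: sums_iff\<close>)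
 also have "... < \<infinity>" by simp
 finally have "(\<integral>\<^sup>+x. (\<Sum>n. ennreal \<bar>g n x\<bar>) \<partial>M) ~= \<infinity>" by simp
 hence "AE x in M. (\<Sum>n. ennreal \<bar>g n x\<bar>) ~= \<infinity>" by (intro nn_integral_PInf_AE) (use g in measurable)
 thus ?thesis by eventually_elim (rule summable_suminf_not_top, auto)
qed

definition convex_weights :: "nat => nat => (nat => real) => bool" where
 "convex_weights n N c \<longleftrightarrow> (\<forall>k. 0 <= c k) & (\<forall>k. c k ~= 0 --> n <= k & k < N) & (\<Sum>k<N. c k) = 1"

lemma convex_weights_mono: "convex_weights n N c ==> m <= n ==> convex_weights m N c"
 unfolding convex_weights_def by (meson order_trans)

lemma convex_weights_extend:
 assumes "convex_weights n N c" "N <= N'" shows "(\<Sum>k<N'. c k*p k) = (\<Sum>k<N. c k*p k)"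
 by (rule sum.mono_neutral_right) (use assms in \<open>auto simp: convex_weights_def\<close>)

lemma convex_weights_midpoint:
 assumes "convex_weights n N c" "convex_weights n N' c'"
 shows "convex_weights n (max N N') (%k. (c k + c' k)/2)"
  "(\<Sum>k<max N N'. (c k + c' k)/2*p k) = ((\<Sum>k<N. c k*p k) + (\<Sum>k<N'. c' k*p k))/2"
proof -
 have *: "(\<Sum>k<max N N'. (c k + c' k)/2*p k) = ((\<Sum>k<N. c k*p k) + (\<Sum>k<N'. c' k*p k))/2" for p
  unfolding convex_weights_extend[OF assms(1) max.cobounded1[of N N'], where p = p, symmetric]
   convex_weights_extend[OF assms(2) max.cobounded2[of N' N], where p = p, symmetric]
  by (simp add: sum.distrib[symmetric] sum_divide_distrib algebra_simps add_divide_distrib)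
 thus "(\<Sum>k<max N N'. (c k + c' k)/2*p k) = ((\<Sum>k<N. c k*p k) + (\<Sum>k<N'. c' k*p k))/2" .
 have z: "c k ~= 0 \<or> c' k ~= 0" if "(c k + c' k)/2 ~= 0" for k using that by auto
 show "convex_weights n (max N N') (%k. (c k + c' k)/2)" unfolding convex_weights_def
 proof (intro conjI allI impI)
  show "0 <= (c k + c' k)/2" for k using assms by (simp add: convex_weights_def)
  show "n <= k" "k < max N N'" if "(c k + c' k)/2 ~= 0" for k using z[OF that] assms by (auto simp: convex_weights_def)
  show "(\<Sum>k<max N N'. (c k + c' k)/2) = 1" using *[of "%_. 1"] assms by (simp add: convex_weights_def)
 qed
qed

lemma convex_weights_bound:
 assumes c: "convex_weights n N c" and b: "!!k. n <= k ==> \<bar>p k\<bar> <= B" shows "\<bar>\<Sum>k<N. c k*p k\<bar> <= B"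
proof -
 have "\<bar>\<Sum>k<N. c k*p k\<bar> <= (\<Sum>k<N. c k*B)"
 proof (rule order_trans[OF sum_abs sum_mono])
  fix k
  show "\<bar>c k*p k\<bar> <= c k*B"
   using c b[of k] by (cases "c k = 0") (auto simp: convex_weights_def abs_mult intro!: mult_left_mono)
 qed
 also have "... = B" using c by (simp add: convex_weights_def flip: sum_distrib_right)
 finally show ?thesis .
qed

lemma convex_weights_tendsto:
 assumes c: "!!n. convex_weights n (N n) (c n)" and p: "p \<longlonglongrightarrow> (l::real)"
 shows "(%n. \<Sum>k<N n. c n k*p k) \<longlonglongrightarrow> l"
proof (rule LIMSEQ_I)
 fix e :: real assume e: "0 < e"
 obtain n0 where n0: "!!k. n0 <= k ==> norm (p k - l) < e/2" using LIMSEQ_D[OF p, of "e/2"] e by auto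
 have "norm ((\<Sum>k<N n. c n k*p k) - l) < e" if n: "n0 <= n" for n
 proof -
  have "\<bar>\<Sum>k<N n. c n k*(p k - l)\<bar> <= e/2"
  proof (rule convex_weights_bound[OF c])
   show "\<bar>p k - l\<bar> <= e/2" if "n <= k" for k using n0[of k] n that by simp
  qed
  moreover have "(\<Sum>k<N n. c n k*(p k - l)) = (\<Sum>k<N n. c n k*p k) - l*(\<Sum>k<N n. c n k)"
   by (simp add: right_diff_distrib sum_subtractf sum_distrib_left mult.commute)
  moreover have "(\<Sum>k<N n. c n k) = 1" using c[of n] by (simp add: convex_weights_def)
  ultimately show ?thesis using e by simp
 qed
 thus "\<exists>n0. \<forall>n\<ge>n0. norm ((\<Sum>k<N n. c n k*p k) - l) < e" by blast
qed

text \<open>Near-minimizers of the \<open>L\<^sup>2\<close> norm over the convex hulls of the tails form a Cauchy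
 sequence by the parallelogram identity.\<close>

lemma convex_combinations_converge_AE_bounded:
 fixes p :: "nat => 'a => real"
 assumes m: "finite_measure m" and p: "!!k. p k \<in> borel_measurable m" and b: "!!k x. x \<in> space m ==> \<bar>p k x\<bar> <= 1"
 shows "\<exists>c N. (\<forall>n. convex_weights n (N n) (c n)) & (AE x in m. convergent (%n. \<Sum>k<N n. c n k*p k x))"
proof -
 interpret finite_measure m by (rule m)
 define g where "g N c x = (\<Sum>k<N. c k*p k x)" for N and c :: "nat => real" and x
 have gm [measurable]: "g N c \<in> borel_measurable m" for N c unfolding g_def[abs_def] using p by measurable
 have gb: "\<bar>g N c x\<bar> <= 1" if "convex_weights n N c" "x \<in> space m" for n N c x
  unfolding g_def by (rule convex_weights_bound[OF that(1)]) (use b that in auto)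
 have gi: "integrable m (%x. (g N c x)^2)" if w: "convex_weights n N c" for n N c
 proof (rule integrable_const_bound[of _ 1])
  have "norm ((g N c x)^2) <= 1" if "x \<in> space m" for x using gb[OF w that] by (simp add: abs_square_le_1)
  thus "AE x in m. norm ((g N c x)^2) <= 1" by (intro AE_I2)
 qed measurable
 define E where "E N c = (\<integral>x. (g N c x)^2 \<partial>m)" for N c
 have E0: "0 <= E N c" for N c unfolding E_def by simp
 define \<mu> where "\<mu> = measure m (space m)"
 have E1: "E N c <= \<mu>" if w: "convex_weights n N c" for n N c
 proof -
  have "E N c <= (\<integral>x. 1 \<partial>m)" unfolding E_def
   by (rule integral_mono[OF gi[OF w]]) (use gb[OF w] in \<open>auto simp: abs_square_le_1\<close>)
  thus ?thesis by (simp add: \<mu>_def)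
 qed
 define X where "X n = {E N c | N c. convex_weights n N c}" for n
 define d where "d n = Inf (X n)" for n
 have Xb: "bdd_below (X n)" for n unfolding X_def by (rule bdd_belowI[of _ 0]) (use E0 in auto)
 have Xne: "X n ~= {}" for n
 proof -
  have "convex_weights n (Suc n) (%k. if k = n then 1 else 0)" by (auto simp: convex_weights_def)
  thus ?thesis unfolding X_def by blast
 qed
 have dle: "d n <= E N c" if "convex_weights n N c" for n N c
  unfolding d_def by (rule cInf_lower[OF _ Xb]) (use that in \<open>auto simp: X_def\<close>)
 have "d n <= \<mu>" for n
 proof -
  obtain N c where "convex_weights n N c" using Xne[of n] unfolding X_def by blast
  thus ?thesis using dle E1 by fastforce
 qed
 moreover have "incseq d"
 proof (rule incseq_SucI)
  fix n
  have "X (Suc n) \<subseteq> X n" unfolding X_def by (blast intro: convex_weights_mono[OF _ le_SucI[OF order.refl]])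
  thus "d n <= d (Suc n)" unfolding d_def by (rule cInf_superset_mono[OF Xne Xb])
 qed
 ultimately obtain D where D: "d \<longlonglongrightarrow> D" "!!n. d n <= D" using incseq_convergent[of d \<mu>] by blast
 have "\<exists>k. \<forall>j\<ge>k. D - (1/4) ^ n < d j" for n
 proof -
  have "D - (1/4) ^ n < D" by simp
  from order_tendstoD(1)[OF D(1) this] show ?thesis unfolding eventually_sequentially .
 qed
 then obtain k where k: "!!n j. k n <= j ==> D - (1/4) ^ n < d j" by metis
 \<comment> \<open>From \<open>l n\<close> on, the infimum over the tail is within 1/4^n of its
   limit. So midpoints of successive near-minimizers cannot be much smaller than their ends, and the
   squared L^2 distance is at most 8/4^n.\<close>
 define l where "l n = n + (\<Sum>i\<le>n. k i)" for n
 have l: "n <= l n" "k n <= l n" "l n <= l (Suc n)" for n using member_le_sum[of n "{..n}" k] by (auto simp: l_def)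
 have "\<exists>N c. convex_weights (l n) N c & E N c < d (l n) + (1/4) ^ n" for n
 proof -
  have "Inf (X (l n)) < d (l n) + (1/4) ^ n" by (simp add: d_def)
  from cInf_lessD[OF Xne this] show ?thesis unfolding X_def by blast
 qed
 then obtain N c where c: "!!n. convex_weights (l n) (N n) (c n)" "!!n. E (N n) (c n) < d (l n) + (1/4) ^ n" by metis
 let ?g = "%n. g (N n) (c n)"
 have sq: "integrable m (%x. (?g (Suc n) x - ?g n x)^2) & (\<integral>x. (?g (Suc n) x - ?g n x)^2 \<partial>m) <= 8*(1/4) ^ n" for n
 proof -
  note w1 = c(1)[of n] and w2 = convex_weights_mono[OF c(1)[of "Suc n"] l(3)[of n]]
  note mid = convex_weights_midpoint[OF w2 w1]
  let ?M = "max (N (Suc n)) (N n)" and ?c = "%k. (c (Suc n) k + c n k)/2"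
  have ge: "g ?M ?c x = (?g (Suc n) x + ?g n x)/2" for x unfolding g_def by (rule mid(2))
  have eq: "(?g (Suc n) x - ?g n x)^2 = 2*(?g (Suc n) x)^2 + 2*(?g n x)^2 - 4*(g ?M ?c x)^2" for x
   unfolding ge by (simp add: power2_eq_square field_simps)
  note i = gi[OF w2] gi[OF w1] gi[OF mid(1)]
  have "integrable m (%x. (?g (Suc n) x - ?g n x)^2)" unfolding eq using i by simp
  moreover have "(\<integral>x. (?g (Suc n) x - ?g n x)^2 \<partial>m) = 2*E (N (Suc n)) (c (Suc n)) + 2*E (N n) (c n) - 4*E ?M ?c"
   unfolding eq E_def using i by simp
  moreover have "d (l n) <= E ?M ?c" by (rule dle[OF mid(1)])
  moreover have "(1/4::real) ^ Suc n <= (1/4) ^ n" by simp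
  ultimately show ?thesis using c(2)[of n] c(2)[of "Suc n"] D(2)[of "l n"] D(2)[of "l (Suc n)"] k[OF l(2)[of n]] by simp
 qed
 have "AE x in m. summable (%n. \<bar>?g (Suc n) x - ?g n x\<bar>)"
 proof (rule AE_summable_of_nn_integral[where C = "\<mu> + 8"])
  fix n
  let ?a = "%x. ?g (Suc n) x - ?g n x"
  \<comment> \<open>The weights 1/2^n and 2^n turn the L^2 bound of order 1/4^n into a summable L^1
    bound.\<close>
  have amgm: "\<bar>?a x\<bar> <= (1/2) ^ n + 2 ^ n*(?a x)^2" for x
  proof -
   let ?h = "(1/2::real) ^ n"
   have "?h*2 ^ n = 1" by (simp flip: power_mult_distrib)
   moreover have "0 <= (\<bar>?a x\<bar> - ?h)^2 + ?h*\<bar>?a x\<bar>" by simp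
   hence "?h*\<bar>?a x\<bar> <= ?h*?h + (?a x)^2" by (simp add: power2_eq_square algebra_simps)
   ultimately have "?h*\<bar>?a x\<bar> <= ?h*(?h + 2 ^ n*(?a x)^2)" by (simp add: distrib_left mult.assoc[symmetric])
   thus ?thesis by simp
  qed
  have i: "integrable m (%x. (1/2) ^ n + 2 ^ n*(?a x)^2)" using sq[of n] by simp
  have "(\<integral>\<^sup>+x. ennreal \<bar>?a x\<bar> \<partial>m) <= (\<integral>\<^sup>+x. ennreal ((1/2) ^ n + 2 ^ n*(?a x)^2) \<partial>m)"
   by (intro nn_integral_mono ennreal_leI amgm)
  also have "... = ennreal (\<integral>x. (1/2) ^ n + 2 ^ n*(?a x)^2 \<partial>m)"
   by (rule nn_integral_eq_integral[OF i]) simp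
  also have "(\<integral>x. (1/2) ^ n + 2 ^ n*(?a x)^2 \<partial>m) = \<mu>*(1/2) ^ n + 2 ^ n*(\<integral>x. (?a x)^2 \<partial>m)"
   using sq[of n] by (simp add: \<mu>_def)
  also have "... <= \<mu>*(1/2) ^ n + 2 ^ n*(8*(1/4) ^ n)" using sq[of n] by (intro add_mono mult_left_mono order.refl) auto
  also have "2 ^ n*(8*(1/4) ^ n) = 8*(1/2::real) ^ n" by (simp flip: power_mult_distrib)
  finally show "(\<integral>\<^sup>+x. ennreal \<bar>?a x\<bar> \<partial>m) <= ennreal ((\<mu> + 8)*(1/2) ^ n)" by (simp add: distrib_right ennreal_leI)
 qed (auto simp: \<mu>_def)
 hence "AE x in m. convergent (%n. \<Sum>k<N n. c n k*p k x)"
 proof eventually_elim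
  fix x assume "summable (%n. \<bar>?g (Suc n) x - ?g n x\<bar>)"
  hence "convergent (%n. \<Sum>i<n. ?g (Suc i) x - ?g i x)" using summable_rabs_cancel summable_iff_convergent by blast
  hence "convergent (%n. ?g n x - ?g 0 x)" unfolding sum_lessThan_telescope[of "%i. ?g i x"] .
  from convergent_add[OF this convergent_const[of "?g 0 x"]] show "convergent (%n. \<Sum>k<N n. c n k*p k x)"
   by (simp add: g_def)
 qed
 moreover have "convex_weights n (N n) (c n)" for n by (rule convex_weights_mono[OF c(1) l(1)])
 ultimately show ?thesis by blast
qed

text \<open>A statement of Komlos type, reduced to bounded functions on a finite measure space. The
  density h is positive, so it makes the measure finite and keeps its null sets.\<close>

lemma convex_combinations_converge_AE:
 fixes q :: "nat => 'a => real"
 assumes M: "sigma_finite_measure M" and q: "!!k. q k \<in> borel_measurable M"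
 shows "\<exists>c N. (\<forall>n. convex_weights n (N n) (c n)) &
  (AE x in M. bounded (range (%k. q k x)) --> convergent (%n. \<Sum>k<N n. c n k*q k x))"
proof -
 interpret sigma_finite_measure M by (rule M)
 obtain h where h: "h \<in> borel_measurable M" "integral\<^sup>N M h ~= \<infinity>" "!!x. x \<in> space M ==> 0 < h x & h x < \<infinity>"
  using Ex_finite_integrable_function by blast
 define m where "m = density M h"
 have fm: "finite_measure m"
 proof (rule finite_measureI)
  have "emeasure m (space m) = (\<integral>\<^sup>+x. h x*indicator (space M) x \<partial>M)"
   unfolding m_def using h(1) by (simp add: emeasure_density)
  also have "... = integral\<^sup>N M h" by (intro nn_integral_cong) simp
  finally show "emeasure m (space m) ~= \<infinity>" using h(2) by simp
 qed
 note [measurable] = q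
 define s where "s x = (SUP k. ennreal \<bar>q k x\<bar>)" for x
 have sm [measurable]: "s \<in> borel_measurable M" unfolding s_def[abs_def] by measurable
 \<comment> \<open>The divisor does not depend on k, so it commutes with convex combinations; the
   value 0 is used where the sequence is unbounded.\<close>
 define p where "p k x = (if s x = top then 0 else q k x/(1 + enn2real (s x)))" for k x
 have pm: "p k \<in> borel_measurable M" for k unfolding p_def[abs_def] by measurable
 have pb: "\<bar>p k x\<bar> <= 1" for k x
 proof (cases "s x = top")
  case False
  have "ennreal \<bar>q k x\<bar> <= s x" unfolding s_def by (rule SUP_upper) simp
  hence "\<bar>q k x\<bar> <= enn2real (s x)" using False enn2real_mono[of "ennreal \<bar>q k x\<bar>" "s x"] by (simp add: top.not_eq_extremum)
  thus ?thesis using False by (simp add: p_def abs_divide)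
 qed (simp add: p_def)
 obtain c N where c: "!!n. convex_weights n (N n) (c n)" and cv: "AE x in m. convergent (%n. \<Sum>k<N n. c n k*p k x)"
  using convex_combinations_converge_AE_bounded[OF fm, of p] pm pb unfolding m_def by auto
 have "AE x in M. 0 < h x --> convergent (%n. \<Sum>k<N n. c n k*p k x)"
  using cv unfolding m_def by (simp add: AE_density[OF h(1)])
 hence "AE x in M. bounded (range (%k. q k x)) --> convergent (%n. \<Sum>k<N n. c n k*q k x)"
 proof (rule AE_mp, intro AE_I2 impI)
  fix x assume x: "x \<in> space M" and cx: "0 < h x --> convergent (%n. \<Sum>k<N n. c n k*p k x)"
   and bx: "bounded (range (%k. q k x))"
  obtain B where B: "!!k. \<bar>q k x\<bar> <= B" using bx unfolding bounded_iff by auto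
  have "s x <= ennreal B" unfolding s_def by (intro SUP_least ennreal_leI B)
  hence st: "s x ~= top" by (rule neq_top_trans[OF ennreal_neq_top])
  have sp: "1 + enn2real (s x) ~= 0" using enn2real_nonneg[of "s x"] by linarith
  have "(\<Sum>k<N n. c n k*q k x) = (1 + enn2real (s x))*(\<Sum>k<N n. c n k*p k x)" for n
   using st sp by (simp add: p_def sum_distrib_left)
  moreover have "convergent (%n. (1 + enn2real (s x))*(\<Sum>k<N n. c n k*p k x))"
   by (rule convergent_mult[OF convergent_const]) (use cx h(3)[OF x] in auto)
  ultimately show "convergent (%n. \<Sum>k<N n. c n k*q k x)" by simp
 qed
 with c show ?thesis by blast
qed

section \<open>Weak derivatives\<close>

lemma continuous_bounded_cball:
 fixes g :: "'a::euclidean_space => real"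
 assumes g: "continuous_on UNIV g"
 obtains A where "0 <= A" "!!x. x \<in> cball z B ==> \<bar>g x\<bar> <= A"
proof -
 have "compact (g ` cball z B)" by (intro compact_continuous_image continuous_on_subset[OF g]) auto
 from compact_imp_bounded[OF this] obtain A where "\<forall>x\<in>cball z B. \<bar>g x\<bar> <= A" unfolding bounded_iff by auto
 thus thesis using that[of "\<bar>A\<bar>"] by force
qed

lemma integrable_continuous_support:
 fixes g :: "'a::euclidean_space => real"
 assumes g: "continuous_on UNIV g" and s: "!!x. g x ~= 0 ==> norm x <= B"
 shows "integrable lborel g"
proof -
 obtain A where A: "0 <= A" "!!x. x \<in> cball 0 B ==> \<bar>g x\<bar> <= A" by (rule continuous_bounded_cball[OF g, of 0 B]) blast
 have "\<bar>g x\<bar> <= A*indicator (cball 0 B) x" for x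
  using A(1) A(2)[of x] s[of x] by (cases "g x = 0") (auto simp: indicator_def)
 thus ?thesis by (rule integrable_bounded_support(1)[OF borel_measurable_continuous_onI[OF g]])
qed

text \<open>All that the measure theoretic half of the argument retains of the control
  problem.\<close>

locale small_singular_set =
 fixes V :: "'a::euclidean_space => real" and \<Omega> :: "'a set"
 assumes V: "continuous_on UNIV V" and \<Omega>: "open \<Omega>"
  and difference_quotients: "!!z. z \<in> \<Omega> ==> \<exists>R>0. \<exists>C. \<forall>h b. 0 < h & h < R & norm b <= 1 -->
   (LBINT x. indicator (ball z (R/2)) x*\<bar>V (x + h *\<^sub>R b) - V x\<bar>) <= C*h"
  and small: "small_set (DIM('a) - 1) {x \<in> \<Omega>. \<forall>e>0. \<forall>C. \<not> C-lipschitz_on (ball x e) V}"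
begin

definition regular :: "'a set" where
 "regular = {x \<in> \<Omega>. \<exists>e>0. \<exists>C. C-lipschitz_on (ball x e) V}"

definition step :: "nat => real" where "step k = 1/real (Suc k)"

definition diff_quotient :: "'a => nat => 'a => real" where
 "diff_quotient b k x = real (Suc k)*(V (x + step k *\<^sub>R b) - V x)"

text \<open>The quotient of V shifted onto the test function by discrete integration by parts. In
  this form it can be estimated by the oscillation of V alone.\<close>

definition dual_quotient :: "'a => nat => ('a => real) => real" where
 "dual_quotient b k \<psi> = (LBINT x. V x*(real (Suc k)*(\<psi> (x - step k *\<^sub>R b) - \<psi> x)))"

lemma step: "0 < step k" "step k <= 1" "real (Suc k) * step k = 1" "step \<longlonglongrightarrow> 0"
proof -
 show "step \<longlonglongrightarrow> 0" unfolding step_def[abs_def] by (rule LIMSEQ_Suc[OF lim_1_over_n])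
qed (auto simp: step_def)

lemma V_compose: "continuous_on UNIV g ==> continuous_on UNIV (%x. V (g x))" by (rule continuous_on_compose2[OF V]) auto

lemma V_measurable [measurable]: "V \<in> borel_measurable borel" by (rule borel_measurable_continuous_onI[OF V])

lemma quotient_continuous: "continuous_on UNIV (diff_quotient b k)"
 unfolding diff_quotient_def[abs_def] by (intro continuous_intros V_compose)

lemma quotient_measurable [measurable]: "diff_quotient b k \<in> borel_measurable borel"
 by (rule borel_measurable_continuous_onI[OF quotient_continuous])

lemma shift_support:
 assumes "norm b <= 1" "norm (x - step k *\<^sub>R b) <= B" shows "norm x <= B + 1"
proof -
 have "norm (step k *\<^sub>R b) <= 1*1" using step(1,2)[of k] assms(1) by (simp add: mult_le_one)
 thus ?thesis using norm_triangle_sub[of x "step k *\<^sub>R b"] assms(2) by linarith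
qed

lemma dual_quotient_eq:
 assumes \<psi>: "continuous_on UNIV \<psi>" "!!x. \<psi> x ~= 0 ==> norm x <= B" and b: "norm b <= 1"
 shows "dual_quotient b k \<psi> = (LBINT x. \<psi> x*diff_quotient b k x)"
proof -
 have c: "continuous_on UNIV (%x. \<psi> (x - step k *\<^sub>R b))"
  by (rule continuous_on_compose2[OF \<psi>(1)]) (auto intro!: continuous_intros)
 let ?g = "%x. V x*(real (Suc k)*\<psi> (x - step k *\<^sub>R b))"
 have g: "continuous_on UNIV ?g" by (intro continuous_intros V c)
 have s: "norm x <= B + 1" if "\<psi> (x - step k *\<^sub>R b) ~= 0" for x by (rule shift_support[OF b \<psi>(2)[OF that]])
 have i1: "integrable lborel ?g" by (rule integrable_continuous_support[OF g]) (use s in auto)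
 have i2: "integrable lborel (%x. V x*(real (Suc k)*\<psi> x))"
  by (rule integrable_continuous_support[where B = B]) (use \<psi> in \<open>auto intro!: continuous_intros V\<close>)
 have i3: "integrable lborel (%x. V (x + step k *\<^sub>R b)*(real (Suc k)*\<psi> x))"
  by (rule integrable_continuous_support[where B = B]) (use \<psi> in \<open>auto intro!: continuous_intros V_compose\<close>)
 have "(LBINT x. ?g x) = (LBINT x. ?g (step k *\<^sub>R b + x))"
  by (rule integral_translate[symmetric]) (rule borel_measurable_continuous_onI[OF g])
 also have "... = (LBINT x. V (x + step k *\<^sub>R b)*(real (Suc k)*\<psi> x))" by (simp add: add.commute)
 finally have e: "(LBINT x. ?g x) = (LBINT x. V (x + step k *\<^sub>R b)*(real (Suc k)*\<psi> x))" .
 have "dual_quotient b k \<psi> = (LBINT x. ?g x - V x*(real (Suc k)*\<psi> x))"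
  unfolding dual_quotient_def by (rule arg_cong[where f = "integral\<^sup>L lborel"]) (simp only: fun_eq_iff right_diff_distrib simp_thms)
 also have "... = (LBINT x. ?g x) - (LBINT x. V x*(real (Suc k)*\<psi> x))"
  by (rule Bochner_Integration.integral_diff[OF i1 i2])
 also have "... = (LBINT x. V (x + step k *\<^sub>R b)*(real (Suc k)*\<psi> x) - V x*(real (Suc k)*\<psi> x))"
  unfolding e by (rule Bochner_Integration.integral_diff[OF i3 i2, symmetric])
 also have "... = (LBINT x. \<psi> x*diff_quotient b k x)"
  by (rule arg_cong[where f = "integral\<^sup>L lborel"]) (simp add: diff_quotient_def fun_eq_iff algebra_simps)
 finally show ?thesis .
qed

lemma dual_quotient_add:
 assumes "continuous_on UNIV \<psi>" "!!x. \<psi> x ~= 0 ==> norm x <= B" "continuous_on UNIV \<psi>'" "!!x. \<psi>' x ~= 0 ==> norm x <= B"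
  and b: "norm b <= 1"
 shows "dual_quotient b k (%x. \<psi> x + \<psi>' x) = dual_quotient b k \<psi> + dual_quotient b k \<psi>'"
proof -
 have i: "integrable lborel (%x. \<psi> x*diff_quotient b k x)"
  if "continuous_on UNIV \<psi>" "!!x. \<psi> x ~= 0 ==> norm x <= B" for \<psi>
  by (rule integrable_continuous_support[where B = B]) (use that in \<open>auto intro!: continuous_intros quotient_continuous\<close>)
 have c: "continuous_on UNIV (%x. \<psi> x + \<psi>' x)" using assms by (intro continuous_intros)
 have s: "norm x <= B" if "\<psi> x + \<psi>' x ~= 0" for x using that assms(2,4)[of x] by force
 have "dual_quotient b k (%x. \<psi> x + \<psi>' x) = (LBINT x. (\<psi> x + \<psi>' x)*diff_quotient b k x)"
  by (rule dual_quotient_eq[OF c s b])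
 also have "... = (LBINT x. \<psi> x*diff_quotient b k x) + (LBINT x. \<psi>' x*diff_quotient b k x)"
  unfolding distrib_right by (rule Bochner_Integration.integral_add; rule i; fact)
 also have "(LBINT x. \<psi> x*diff_quotient b k x) = dual_quotient b k \<psi>" by (rule dual_quotient_eq[symmetric]; fact)
 also have "(LBINT x. \<psi>' x*diff_quotient b k x) = dual_quotient b k \<psi>'" by (rule dual_quotient_eq[symmetric]; fact)
 finally show ?thesis .
qed

text \<open>The quotient of \<psi> has integral zero, so V may be replaced by V - V c, which is at
  most w on the enlarged ball. This is how the modulus of continuity enters.\<close>

lemma dual_quotient_bound:
 assumes \<psi>: "!!x y. \<bar>\<psi> x - \<psi> y\<bar> <= \<Lambda>*norm (x - y)" "!!x. \<psi> x ~= 0 ==> x \<in> ball c (2*r)"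
  and b: "norm b <= 1" and k: "step k <= r" and w: "!!x. x \<in> cball c (3*r) ==> \<bar>V x - V c\<bar> <= w" and \<Lambda>: "0 <= \<Lambda>"
 shows "\<bar>dual_quotient b k \<psi>\<bar> <= w*\<Lambda>*measure lborel (cball c (3*r))"
proof -
 have r: "0 < r" using step(1)[of k] k by linarith
 have w0: "0 <= w" using w[of c] r by simp
 have "(norm \<Lambda>)-lipschitz_on UNIV \<psi>" by (rule lipschitz_onI) (use \<psi>(1) \<Lambda> in \<open>auto simp: dist_norm\<close>)
 hence c: "continuous_on UNIV \<psi>" by (rule lipschitz_on_continuous_on)
 have c': "continuous_on UNIV (%x. \<psi> (x - step k *\<^sub>R b))" by (rule continuous_on_compose2[OF c]) (auto intro!: continuous_intros)
 have sb: "norm (step k *\<^sub>R b) <= step k" using step(1)[of k] b by (simp add: mult_left_le)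
 let ?g = "%x. real (Suc k)*(\<psi> (x - step k *\<^sub>R b) - \<psi> x)"
 have gc: "continuous_on UNIV ?g" by (intro continuous_intros c c')
 have gb: "\<bar>?g x\<bar> <= \<Lambda>" for x
 proof -
  have "\<bar>\<psi> (x - step k *\<^sub>R b) - \<psi> x\<bar> <= \<Lambda>*norm (step k *\<^sub>R b)" using \<psi>(1)[of "x - step k *\<^sub>R b" x] by simp
  also have "... <= \<Lambda> * step k" using sb \<Lambda> by (rule mult_left_mono)
  finally have "real (Suc k)*\<bar>\<psi> (x - step k *\<^sub>R b) - \<psi> x\<bar> <= real (Suc k)*(\<Lambda> * step k)" by (rule mult_left_mono) simp
  also have "... = \<Lambda>*(real (Suc k) * step k)" by simp
  finally show ?thesis unfolding step(3) abs_mult by simp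
 qed
 have gs: "x \<in> cball c (3*r)" if "?g x ~= 0" for x
 proof -
  have "\<psi> (x - step k *\<^sub>R b) ~= 0 \<or> \<psi> x ~= 0" using that by auto
  hence "dist c (x - step k *\<^sub>R b) < 2*r \<or> dist c x < 2*r" using \<psi>(2) by auto
  hence "norm (x - step k *\<^sub>R b - c) < 2*r \<or> norm (x - c) < 2*r" unfolding dist_norm norm_minus_commute[of c] .
  moreover have "norm (x - c) <= norm (x - step k *\<^sub>R b - c) + norm (step k *\<^sub>R b)"
   using norm_triangle_ineq[of "x - step k *\<^sub>R b - c" "step k *\<^sub>R b"] by (simp add: algebra_simps)
  ultimately have "norm (x - c) <= 3*r" using sb k r by linarith
  thus ?thesis by (simp add: dist_norm norm_minus_commute)
 qed
 have gs': "norm x <= norm c + 3*r" if "?g x ~= 0" for x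
  using gs[OF that] norm_triangle_sub[of x c] by (auto simp: dist_norm norm_minus_commute)
 have ig: "integrable lborel ?g" by (rule integrable_continuous_support[OF gc gs'])
 have iVg: "integrable lborel (%x. V x*?g x)"
  by (rule integrable_continuous_support[where B = "norm c + 3*r"]) (use gs' continuous_on_mult[OF V gc] in auto)
 have s0: "norm x <= norm c + 2*r" if "\<psi> x ~= 0" for x
  using \<psi>(2)[OF that] norm_triangle_sub[of x c] by (auto simp: dist_norm norm_minus_commute)
 have "norm x <= norm c + 2*r + 1" if "\<psi> (x - step k *\<^sub>R b) ~= 0" for x by (rule shift_support[OF b s0[OF that]])
 hence "integrable lborel (%x. \<psi> (x - step k *\<^sub>R b))" by (rule integrable_continuous_support[OF c'])
 moreover have "integrable lborel \<psi>" by (rule integrable_continuous_support[OF c s0])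
 moreover have "(LBINT x. \<psi> (x - step k *\<^sub>R b)) = (LBINT x. \<psi> x)"
  using integral_translate[of \<psi> "- (step k *\<^sub>R b)"] borel_measurable_continuous_onI[OF c] by simp
 ultimately have g0: "(LBINT x. ?g x) = 0" by simp
 have "dual_quotient b k \<psi> = (LBINT x. V x*?g x) - V c*(LBINT x. ?g x)" unfolding g0 dual_quotient_def by simp
 also have "... = (LBINT x. V x*?g x - V c*?g x)"
  unfolding integral_mult_right_zero[symmetric] by (rule Bochner_Integration.integral_diff[OF iVg integrable_mult_right[OF ig], symmetric])
 also have "... = (LBINT x. (V x - V c)*?g x)" by (simp only: left_diff_distrib)
 finally have e: "dual_quotient b k \<psi> = (LBINT x. (V x - V c)*?g x)" .
 show ?thesis unfolding e
 proof (rule integrable_bounded_support(2))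
  show "(%x. (V x - V c)*?g x) \<in> borel_measurable borel"
   by (rule borel_measurable_continuous_onI) (intro continuous_on_mult continuous_on_diff V gc continuous_on_const)
  show "\<bar>(V x - V c)*?g x\<bar> <= w*\<Lambda>*indicator (cball c (3*r)) x" for x
  proof (cases "?g x = 0")
   case True
   thus ?thesis using w0 \<Lambda> by (simp only: mult_zero_right abs_zero) simp
  next
   case False
   have "\<bar>V x - V c\<bar>*\<bar>?g x\<bar> <= w*\<Lambda>" by (rule mult_mono[OF w[OF gs[OF False]] gb w0]) simp
   thus ?thesis using gs[OF False] by (simp only: abs_mult indicator_simps mult_1_right)
  qed
 qed
qed

lemma open_regular: "open regular" unfolding open_contains_ball
proof
 fix x assume "x \<in> regular"
 then obtain e C where x: "x \<in> \<Omega>" and e: "0 < e" "C-lipschitz_on (ball x e) V" unfolding regular_def by auto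
 obtain e' where e': "0 < e'" "ball x e' \<subseteq> \<Omega>" using \<Omega> x open_contains_ball by blast
 have "y \<in> regular" if "y \<in> ball x (min e' (e/2))" for y
 proof -
  have "ball y (e/2) \<subseteq> ball x e"
  proof
   fix w assume "w \<in> ball y (e/2)"
   thus "w \<in> ball x e" using that dist_triangle[of x w y] by auto
  qed
  hence "C-lipschitz_on (ball y (e/2)) V" by (rule lipschitz_on_subset[OF e(2)])
  moreover have "y \<in> \<Omega>" using e'(2) that by auto
  ultimately show ?thesis unfolding regular_def using e(1)
   by (intro CollectI conjI) (assumption, rule exI[of _ "e/2"], rule conjI, simp, rule exI[of _ C])
 qed
 thus "\<exists>e>0. ball x e \<subseteq> regular" using e(1) e'(1) by (intro exI[of _ "min e' (e/2)"]) auto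
qed

lemma ball_measurable [measurable]: "ball (z :: 'a) \<rho> \<in> sets borel" by simp

text \<open>K is covered by finitely many balls of half the radius on which V is Lipschitz. Once the
  step is below these halves, both points of the quotient lie in one Lipschitz ball.\<close>

lemma quotient_bounded_on_compact:
 assumes K: "compact K" "K \<subseteq> regular" and b: "norm b <= 1"
 shows "\<exists>C k0. \<forall>k\<ge>k0. \<forall>x\<in>K. \<bar>diff_quotient b k x\<bar> <= C"
proof -
 have "\<forall>x\<in>K. \<exists>e C. 0 < e & C-lipschitz_on (ball x e) V" using K(2) unfolding regular_def by blast
 then obtain e C where e: "!!x. x \<in> K ==> 0 < e x & (C x)-lipschitz_on (ball x (e x)) V" by metis
 have cov: "K \<subseteq> (\<Union>x\<in>K. ball x (e x/2))" using e by force
 obtain D where D: "D \<subseteq> K" "finite D" "K \<subseteq> (\<Union>x\<in>D. ball x (e x/2))"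
  by (rule compactE_image[OF K(1) _ cov]) auto
 have "\<forall>\<^sub>F k in sequentially. \<forall>x\<in>D. step k < e x/2"
  using D e by (intro eventually_ball_finite ballI order_tendstoD(2)[OF step(4)]) force+
 then obtain k0 where k0: "!!k x. k0 <= k ==> x \<in> D ==> step k < e x/2" unfolding eventually_sequentially by blast
 have "\<bar>diff_quotient b k y\<bar> <= (\<Sum>x\<in>D. C x)" if k: "k0 <= k" and y: "y \<in> K" for k y
 proof -
  obtain x where x: "x \<in> D" "y \<in> ball x (e x/2)" using D(3) y by blast
  note ex = e[OF subsetD[OF D(1) x(1)]]
  let ?y = "y + step k *\<^sub>R b"
  have d: "dist ?y y <= step k" using step(1)[of k] b by (simp add: dist_norm mult_left_le)
  have yy: "?y \<in> ball x (e x)" "y \<in> ball x (e x)"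
   using x(2) d k0[OF k x(1)] ex dist_triangle[of x ?y y] by (auto simp: dist_commute)
  have C0: "0 <= C z" if "z \<in> D" for z using lipschitz_on_nonneg e[OF subsetD[OF D(1) that]] by blast
  have "\<bar>V ?y - V y\<bar> <= C x*dist ?y y" using lipschitz_onD[OF conjunct2[OF ex] yy] by (simp add: dist_real_def)
  also have "... <= C x * step k" using d C0[OF x(1)] by (rule mult_left_mono)
  finally have "real (Suc k)*\<bar>V ?y - V y\<bar> <= real (Suc k)*(C x * step k)" by (rule mult_left_mono) simp
  also have "... = C x*(real (Suc k) * step k)" by simp
  finally have "\<bar>diff_quotient b k y\<bar> <= C x" unfolding step(3) diff_quotient_def abs_mult by simp
  also have "C x <= (\<Sum>x\<in>D. C x)" by (rule member_le_sum[OF x(1)]) (use C0 D in auto)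
  finally show ?thesis .
 qed
 thus ?thesis by blast
qed

lemma quotient_bounded_range:
 assumes "x \<in> regular" "norm b <= 1" shows "bounded (range (%k. diff_quotient b k x))"
proof -
 obtain C k0 where C: "!!k. k0 <= k ==> \<bar>diff_quotient b k x\<bar> <= C"
  using quotient_bounded_on_compact[of "{x}" b] assms by auto
 have "Bseq (%k. diff_quotient b k x)" by (rule BfunI[of _ C]) (use C in \<open>auto simp: eventually_sequentially\<close>)
 thus ?thesis by (simp add: Bseq_eq_bounded)
qed

lemma quotient_integral_ball:
 assumes "z \<in> \<Omega>" "norm b <= 1"
 shows "\<exists>\<rho>>0. \<exists>C k0. \<forall>k\<ge>k0. integrable lborel (%x. indicator (ball z \<rho>) x*\<bar>diff_quotient b k x\<bar>) &
  (LBINT x. indicator (ball z \<rho>) x*\<bar>diff_quotient b k x\<bar>) <= C"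
proof -
 obtain R C where R: "0 < R" and C: "!!h. 0 < h ==> h < R ==>
   (LBINT x. indicator (ball z (R/2)) x*\<bar>V (x + h *\<^sub>R b) - V x\<bar>) <= C*h"
  using difference_quotients[OF assms(1)] assms(2) by metis
 obtain k0 where k0: "!!k. k0 <= k ==> step k < R"
  using order_tendstoD(2)[OF step(4) R] unfolding eventually_sequentially by blast
 have "integrable lborel (%x. indicator (ball z (R/2)) x*\<bar>diff_quotient b k x\<bar>)" for k
 proof -
  obtain A where A0: "0 <= A" and A: "!!x. x \<in> cball z (R/2) ==> \<bar>diff_quotient b k x\<bar> <= A"
   by (rule continuous_bounded_cball[OF quotient_continuous, of z "R/2" b k]) blast
  show ?thesis
  proof (rule integrable_bounded_support(1)[of _ A z "R/2"])
   show "\<bar>indicator (ball z (R/2)) x*\<bar>diff_quotient b k x\<bar>\<bar> <= A*indicator (cball z (R/2)) x" for x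
    using A[of x] A0 by (auto simp: indicator_def)
  qed measurable
 qed
 moreover have "(LBINT x. indicator (ball z (R/2)) x*\<bar>diff_quotient b k x\<bar>) <= C" if "k0 <= k" for k
 proof -
  let ?I = "\<integral>x. indicator (ball z (R/2)) x*\<bar>V (x + step k *\<^sub>R b) - V x\<bar> \<partial>lborel"
  have "(LBINT x. indicator (ball z (R/2)) x*\<bar>diff_quotient b k x\<bar>) = (LBINT x. real (Suc k)*(indicator (ball z (R/2)) x*\<bar>V (x + step k *\<^sub>R b) - V x\<bar>))"
   by (rule arg_cong[where f = "integral\<^sup>L lborel"]) (simp add: diff_quotient_def abs_mult fun_eq_iff)
  also have "... = real (Suc k)*?I" by (rule integral_mult_right_zero)
  also have "... <= real (Suc k)*(C * step k)" using C[OF step(1) k0[OF that]] by (intro mult_left_mono) auto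
  also have "... = C*(real (Suc k) * step k)" by simp
  finally show ?thesis unfolding step(3) by simp
 qed
 ultimately show ?thesis using R by (intro exI[of _ "R/2"] conjI exI[of _ C] exI[of _ k0]) auto
qed

definition local_density :: "('a => real) => bool" where
 "local_density G \<longleftrightarrow> G \<in> borel_measurable borel & (\<forall>x. x \<notin> \<Omega> --> G x = 0) &
  (\<forall>K. compact K & K \<subseteq> \<Omega> --> integrable lborel (%x. indicator K x*G x))"

text \<open>On the regular set the quotients are bounded at each point, so convex combinations
  converge almost everywhere there. Fatou's lemma and the L^1 bounds on balls, which include
  singular points, make the limit locally integrable in all of \<Omega>. The limit formula itself is
  claimed only for \<psi> supported in the regular set, where the convergence is dominated.\<close>

lemma weak_derivative_exists:
 assumes b: "norm b <= 1"
 shows "\<exists>G c N. local_density G & (\<forall>n. convex_weights n (N n) (c n)) &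
  (\<forall>\<psi> K. continuous_on UNIV \<psi> & compact K & K \<subseteq> regular & (\<forall>x. x \<notin> K --> \<psi> x = 0) -->
   (%n. \<Sum>k<N n. c n k*dual_quotient b k \<psi>) \<longlonglongrightarrow> (LBINT x. \<psi> x*G x))"
proof -
 obtain c N where w: "!!n. convex_weights n (N n) (c n)"
  and cv0: "AE x in lborel. bounded (range (%k. diff_quotient b k x)) --> convergent (%n. \<Sum>k<N n. c n k*diff_quotient b k x)"
  using convex_combinations_converge_AE[OF sigma_finite_lborel, of "diff_quotient b"] by auto
 define Q where "Q n x = (\<Sum>k<N n. c n k*diff_quotient b k x)" for n x
 have Qm [measurable]: "Q n \<in> borel_measurable borel" for n unfolding Q_def[abs_def] by measurable
 \<comment> \<open>Nothing is known about convergence off the regular set; there the density is set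
   to 0.\<close>
 define G where "G x = indicator regular x*lim (%n. Q n x)" for x
 have rm [measurable]: "regular \<in> sets borel" using open_regular by simp
 have Gm [measurable]: "G \<in> borel_measurable borel" unfolding G_def[abs_def] by measurable
 have cv: "AE x in lborel. x \<in> regular --> (%n. Q n x) \<longlonglongrightarrow> G x"
  using cv0 by eventually_elim (use quotient_bounded_range[OF _ b] in \<open>auto simp: G_def Q_def convergent_LIMSEQ_iff\<close>)
 have G0: "G x = 0" if "x \<notin> regular" for x using that by (simp add: G_def)
 have ball: "\<exists>\<rho>>0. integrable lborel (%x. indicator (ball z \<rho>) x*G x)" if z: "z \<in> \<Omega>" for z
 proof -
  obtain \<rho> C k0 where \<rho>: "0 < \<rho>" and C: "!!k. k0 <= k ==> integrable lborel (%x. indicator (ball z \<rho>) x*\<bar>diff_quotient b k x\<bar>) &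
   (LBINT x. indicator (ball z \<rho>) x*\<bar>diff_quotient b k x\<bar>) <= C" using quotient_integral_ball[OF z b] by blast
  let ?I = "indicator (ball z \<rho>) :: 'a => real"
  have QC: "(\<integral>\<^sup>+x. ennreal (?I x*\<bar>Q n x\<bar>) \<partial>lborel) <= ennreal C" if n: "k0 <= n" for n
  proof -
   have i: "integrable lborel (%x. c n k*(?I x*\<bar>diff_quotient b k x\<bar>))" for k
   proof (cases "c n k = 0")
    case False
    hence "k0 <= k" using w[of n] n by (auto simp: convex_weights_def)
    with C show ?thesis by (intro integrable_mult_right) blast
   qed simp
   have "(\<integral>\<^sup>+x. ennreal (?I x*\<bar>Q n x\<bar>) \<partial>lborel) <= (\<integral>\<^sup>+x. ennreal (\<Sum>k<N n. c n k*(?I x*\<bar>diff_quotient b k x\<bar>)) \<partial>lborel)"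
   proof (intro nn_integral_mono ennreal_leI)
    fix x
    have "\<bar>Q n x\<bar> <= (\<Sum>k<N n. c n k*\<bar>diff_quotient b k x\<bar>)"
     unfolding Q_def by (rule order_trans[OF sum_abs]) (use w[of n] in \<open>auto simp: abs_mult convex_weights_def intro!: sum_mono\<close>)
    hence "?I x*\<bar>Q n x\<bar> <= ?I x*(\<Sum>k<N n. c n k*\<bar>diff_quotient b k x\<bar>)" by (rule mult_left_mono) simp
    thus "?I x*\<bar>Q n x\<bar> <= (\<Sum>k<N n. c n k*(?I x*\<bar>diff_quotient b k x\<bar>))" by (simp add: sum_distrib_left mult_ac)
   qed
   also have "... = ennreal (LBINT x. (\<Sum>k<N n. c n k*(?I x*\<bar>diff_quotient b k x\<bar>)))"
    by (rule nn_integral_eq_integral) (use i w[of n] in \<open>auto intro!: Bochner_Integration.integrable_sum sum_nonneg mult_nonneg_nonneg simp: convex_weights_def\<close>)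
   also have "(LBINT x. (\<Sum>k<N n. c n k*(?I x*\<bar>diff_quotient b k x\<bar>))) = (\<Sum>k<N n. c n k*(LBINT x. ?I x*\<bar>diff_quotient b k x\<bar>))"
    unfolding Bochner_Integration.integral_sum[OF i] by (intro sum.cong refl integral_mult_right_zero)
   also have "... <= C"
   proof (rule order_trans[OF abs_ge_self convex_weights_bound[OF w]])
    fix k assume "n <= k"
    have "0 <= (LBINT x. ?I x*\<bar>diff_quotient b k x\<bar>)" by (rule Bochner_Integration.integral_nonneg) simp
    thus "\<bar>\<integral>x. ?I x*\<bar>diff_quotient b k x\<bar> \<partial>lborel\<bar> <= C" using C[of k] n \<open>n \<le> k\<close> by simp
   qed
   finally show ?thesis by (simp add: ennreal_leI)
  qed
  have "(\<integral>\<^sup>+x. ennreal (?I x*\<bar>G x\<bar>) \<partial>lborel) <= (\<integral>\<^sup>+x. liminf (%n. ennreal (?I x*\<bar>Q n x\<bar>)) \<partial>lborel)"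
  proof (rule nn_integral_mono_AE)
   show "AE x in lborel. ennreal (?I x*\<bar>G x\<bar>) <= liminf (%n. ennreal (?I x*\<bar>Q n x\<bar>))" using cv
   proof eventually_elim
    case (elim x)
    show ?case
    proof (cases "x \<in> regular")
     case True
     with elim have "(%n. ennreal (?I x*\<bar>Q n x\<bar>)) \<longlonglongrightarrow> ennreal (?I x*\<bar>G x\<bar>)"
      by (intro tendsto_ennrealI tendsto_mult tendsto_const tendsto_rabs) auto
     from lim_imp_Liminf[OF _ this] show ?thesis by simp
    qed (simp add: G0)
   qed
  qed
  also have "... <= liminf (%n. \<integral>\<^sup>+x. ennreal (?I x*\<bar>Q n x\<bar>) \<partial>lborel)" by (rule nn_integral_liminf) measurable
  also have "... <= ennreal C" by (rule Liminf_le) (use QC in \<open>auto simp: eventually_sequentially\<close>)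
  finally have "(\<integral>\<^sup>+x. ennreal (norm (?I x*G x)) \<partial>lborel) < \<infinity>"
   by (auto simp: abs_mult le_less_trans)
  thus ?thesis using \<rho> by (intro exI[of _ \<rho>] conjI integrableI_bounded) measurable
 qed
 have loc: "integrable lborel (%x. indicator K x*G x)" if K: "compact K" "K \<subseteq> \<Omega>" for K
 proof -
  obtain \<rho> where \<rho>: "!!z. z \<in> \<Omega> ==> 0 < \<rho> z & integrable lborel (%x. indicator (ball z (\<rho> z)) x*G x)" using ball by metis
  have cov: "K \<subseteq> (\<Union>z\<in>K. ball z (\<rho> z))" using \<rho> K(2) by force
  obtain D where D: "D \<subseteq> K" "finite D" "K \<subseteq> (\<Union>z\<in>D. ball z (\<rho> z))" by (rule compactE_image[OF K(1) _ cov]) auto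
  have Km [measurable]: "K \<in> sets borel" using K(1) by (simp add: borel_compact)
  have i: "integrable lborel (%x. \<Sum>z\<in>D. \<bar>indicator (ball z (\<rho> z)) x*G x\<bar>)"
   by (intro Bochner_Integration.integrable_sum integrable_abs) (use \<rho> D K in auto)
  show ?thesis
  proof (rule Bochner_Integration.integrable_bound[OF i])
   have "\<bar>indicator K x*G x\<bar> <= (\<Sum>z\<in>D. \<bar>indicator (ball z (\<rho> z)) x*G x\<bar>)" for x
   proof (cases "x \<in> K")
    case True
    then obtain z where z: "z \<in> D" "x \<in> ball z (\<rho> z)" using D(3) by blast
    have "\<bar>indicator K x*G x\<bar> = \<bar>indicator (ball z (\<rho> z)) x*G x\<bar>" using True z(2) by simp
    also have "... <= (\<Sum>z\<in>D. \<bar>indicator (ball z (\<rho> z)) x*G x\<bar>)"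
     by (rule member_le_sum[OF z(1)]) (use D in auto)
    finally show ?thesis .
   qed (simp add: sum_nonneg)
   thus "AE x in lborel. norm (indicator K x*G x) <= norm (\<Sum>z\<in>D. \<bar>indicator (ball z (\<rho> z)) x*G x\<bar>)"
    by (intro AE_I2) (simp add: order_trans[OF _ abs_ge_self])
  qed measurable
 qed
 have lim: "(%n. \<Sum>k<N n. c n k*dual_quotient b k \<psi>) \<longlonglongrightarrow> (LBINT x. \<psi> x*G x)"
  if \<psi>: "continuous_on UNIV \<psi>" and K: "compact K" "K \<subseteq> regular" and s: "!!x. x \<notin> K ==> \<psi> x = 0" for \<psi> K
 proof -
  obtain B where B: "!!x. x \<in> K ==> norm x <= B" using compact_imp_bounded[OF K(1)] unfolding bounded_iff by blast
  have sB: "norm x <= B" if "\<psi> x ~= 0" for x using s B that by blast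
  obtain C k0 where C: "!!k x. k0 <= k ==> x \<in> K ==> \<bar>diff_quotient b k x\<bar> <= C"
   using quotient_bounded_on_compact[OF K b] by blast
  have ik: "integrable lborel (%x. c n k*(\<psi> x*diff_quotient b k x))" for n k
   by (rule integrable_continuous_support[where B = B]) (use \<psi> sB in \<open>auto intro!: continuous_intros quotient_continuous\<close>)
  have dq: "dual_quotient b k \<psi> = (LBINT x. \<psi> x*diff_quotient b k x)" for k by (rule dual_quotient_eq[OF \<psi> sB b])
  have e: "(\<Sum>k<N n. c n k*dual_quotient b k \<psi>) = (LBINT x. \<psi> x*Q n x)" for n
  proof -
   have "(\<Sum>k<N n. c n k*dual_quotient b k \<psi>) = (\<Sum>k<N n. \<integral>x. c n k*(\<psi> x*diff_quotient b k x) \<partial>lborel)"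
    by (intro sum.cong refl) (simp only: integral_mult_right_zero dq)
   also have "... = (LBINT x. (\<Sum>k<N n. c n k*(\<psi> x*diff_quotient b k x)))"
    by (rule Bochner_Integration.integral_sum[OF ik, symmetric])
   also have "... = (LBINT x. \<psi> x*Q n x)"
    by (rule arg_cong[where f = "integral\<^sup>L lborel"]) (simp add: Q_def fun_eq_iff sum_distrib_left mult_ac)
   finally show ?thesis .
  qed
  have \<psi>m [measurable]: "\<psi> \<in> borel_measurable borel" by (rule borel_measurable_continuous_onI[OF \<psi>])
  have "(%n. \<integral>x. \<psi> x*Q (n + k0) x \<partial>lborel) \<longlonglongrightarrow> (LBINT x. \<psi> x*G x)"
  proof (rule integral_dominated_convergence[where w = "%x. \<bar>C\<bar>*\<bar>\<psi> x\<bar>"])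
   show "integrable lborel (%x. \<bar>C\<bar>*\<bar>\<psi> x\<bar>)"
    by (intro integrable_mult_right integrable_abs integrable_continuous_support[OF \<psi> sB])
   show "AE x in lborel. (%n. \<psi> x*Q (n + k0) x) \<longlonglongrightarrow> \<psi> x*G x" using cv
   proof eventually_elim
    case (elim x)
    show ?case
    proof (cases "x \<in> regular")
     case True
     with elim have "(%n. Q (n + k0) x) \<longlonglongrightarrow> G x" by (intro LIMSEQ_ignore_initial_segment) auto
     thus ?thesis by (intro tendsto_mult tendsto_const)
    next
     case False
     hence "\<psi> x = 0" using s K(2) by blast
     thus ?thesis by simp
    qed
   qed
   fix n
   have "\<bar>\<psi> x*Q (n + k0) x\<bar> <= \<bar>C\<bar>*\<bar>\<psi> x\<bar>" for x
   proof (cases "x \<in> K")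
    case True
    have "\<bar>Q (n + k0) x\<bar> <= C" unfolding Q_def by (rule convex_weights_bound[OF w]) (use C True in auto)
    hence "\<bar>Q (n + k0) x\<bar> <= \<bar>C\<bar>" by simp
    thus ?thesis unfolding abs_mult mult.commute[of "\<bar>C\<bar>"] by (rule mult_left_mono) simp
   qed (simp add: s)
   thus "AE x in lborel. norm (\<psi> x*Q (n + k0) x) <= \<bar>C\<bar>*\<bar>\<psi> x\<bar>" by (intro AE_I2) simp
  qed measurable
  thus ?thesis unfolding e by (rule LIMSEQ_offset)
 qed
 have "G x = 0" if "x \<notin> \<Omega>" for x using G0[of x] that by (auto simp: regular_def)
 with Gm loc have "local_density G" unfolding local_density_def by blast
 with w lim show ?thesis
  by - (rule exI[of _ G], rule exI[of _ c], rule exI[of _ N], intro conjI allI impI; (elim conjE)?; blast)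
qed

end

section \<open>Cutoffs around the singular set and integration by parts\<close>

context small_singular_set
begin

lemma modulus_of_continuity:
 "\<exists>om. (\<forall>\<rho>. 0 <= om \<rho>) & (om \<longlongrightarrow> 0) (at_right 0) &
  (\<forall>x y \<rho>. norm x <= B & norm y <= B & norm (x - y) <= \<rho> --> \<bar>V x - V y\<bar> <= om \<rho>)"
proof -
 obtain A where A: "0 <= A" "!!x. x \<in> cball 0 B ==> \<bar>V x\<bar> <= A" by (rule continuous_bounded_cball[OF V, of 0 B]) blast
 \<comment> \<open>The 0 makes the supremum meaningful and nonnegative when no pair of points
   qualifies, as for negative \<rho>.\<close>
 define D where "D \<rho> = insert 0 {\<bar>V x - V y\<bar> | x y. norm x <= B & norm y <= B & norm (x - y) <= \<rho>}" for \<rho>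
 define om where "om \<rho> = Sup (D \<rho>)" for \<rho>
 have Db: "bdd_above (D \<rho>)" for \<rho>
 proof (rule bdd_aboveI[of _ "2*A"])
  fix t assume "t \<in> D \<rho>"
  thus "t <= 2*A"
  proof (unfold D_def, elim insertE CollectE exE conjE)
   fix x y assume "t = \<bar>V x - V y\<bar>" "norm x <= B" "norm y <= B"
   thus ?thesis using A(2)[of x] A(2)[of y] by simp
  qed (use A in simp)
 qed
 have "0 <= om \<rho>" for \<rho> unfolding om_def by (rule cSup_upper[OF _ Db]) (simp add: D_def)
 moreover have "\<bar>V x - V y\<bar> <= om \<rho>" if "norm x <= B" "norm y <= B" "norm (x - y) <= \<rho>" for x y \<rho>
  unfolding om_def by (rule cSup_upper[OF _ Db]) (use that in \<open>auto simp: D_def\<close>)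
 moreover have "(om \<longlongrightarrow> 0) (at_right 0)"
 proof (rule tendstoI)
  fix e :: real assume e: "0 < e"
  have "uniformly_continuous_on (cball 0 B) V" by (rule compact_uniformly_continuous[OF continuous_on_subset[OF V]]) auto
  then obtain d where d: "0 < d" "!!x y. x \<in> cball 0 B ==> y \<in> cball 0 B ==> dist y x < d ==> dist (V y) (V x) < e/2"
   using e unfolding uniformly_continuous_on_def by (meson half_gt_zero)
  have "om \<rho> <= e/2" if "\<rho> < d" for \<rho> unfolding om_def
  proof (rule cSup_least)
   fix t assume "t \<in> D \<rho>"
   thus "t <= e/2"
   proof (unfold D_def, elim insertE CollectE exE conjE)
    fix x y assume "t = \<bar>V x - V y\<bar>" "norm x <= B" "norm y <= B" "norm (x - y) <= \<rho>"
    thus ?thesis using d(2)[of y x] that by (simp add: dist_norm)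
   qed (use e in simp)
  qed (simp add: D_def)
  hence "dist (om \<rho>) 0 < e" if "\<rho> < d" for \<rho> using \<open>\<And>\<rho>. 0 \<le> om \<rho>\<close> that e by (force simp: dist_real_def)
  thus "\<forall>\<^sub>F \<rho> in at_right 0. dist (om \<rho>) 0 < e" unfolding eventually_at_right_field using d(1) by blast
 qed
 ultimately show ?thesis by (intro exI[of _ om]) blast
qed

text \<open>The Lipschitz clause is stated for every lower bound \<rho> of the radii, because the
  induction needs it with the radius of the next ball, which is not larger than the previous
  ones.\<close>

definition balls_cutoff :: "('a => real) => 'a => (real => real) => real => real => (nat => 'a) => (nat => real) => nat set => ('a => real) => bool" where
 "balls_cutoff \<phi> b om A \<Lambda> c r I \<theta> \<longleftrightarrow> (\<forall>x. 0 <= \<theta> x & \<theta> x <= 1) & (\<forall>i\<in>I. \<forall>x\<in>ball (c i) (r i). \<theta> x = 1) &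
  (\<forall>x. \<theta> x ~= 0 --> (\<exists>i\<in>I. x \<in> ball (c i) (2*r i))) &
  (\<forall>\<rho>. 0 < \<rho> & (\<forall>i\<in>I. \<rho> <= r i) --> (\<forall>x y. \<bar>\<theta> x - \<theta> y\<bar> <= 1/\<rho>*norm (x - y))) & continuous_on UNIV \<theta> &
  (\<forall>k. (\<forall>i\<in>I. step k <= r i) -->
   \<bar>dual_quotient b k (%x. \<phi> x*\<theta> x)\<bar> <= (\<Sum>i\<in>I. om (3*r i)*(2*A/r i + \<Lambda>)*measure lborel (cball (c i) (3*r i))))"

text \<open>The cutoff is a maximum of bump functions. Adding the balls in the order of decreasing
 radius, each increment is supported in the new ball and its Lipschitz constant is controlled by the new radius.\<close>

lemma cutoff_of_balls:
 fixes c :: "nat => 'a"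
 assumes I: "finite I" and r: "\<forall>i\<in>I. 0 < r i & r i <= 1"
  and \<phi>: "!!x. \<bar>\<phi> x\<bar> <= A" "!!x y. \<bar>\<phi> x - \<phi> y\<bar> <= \<Lambda>*norm (x - y)" "!!x. \<phi> x ~= 0 ==> norm x <= B"
  and \<phi>c: "continuous_on UNIV \<phi>" and \<Lambda>: "0 <= \<Lambda>" and b: "norm b <= 1"
  and om: "!!\<rho>. 0 <= om \<rho>" "!!x y \<rho>. norm x <= B + 5 ==> norm y <= B + 5 ==> norm (x - y) <= \<rho> ==> \<bar>V x - V y\<bar> <= om \<rho>"
 shows "\<exists>\<theta>. balls_cutoff \<phi> b om A \<Lambda> c r I \<theta>" using I r
proof (induction I rule: finite_ranking_induct[where f = "%i. - r i"])
 case empty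
 show ?case by (rule exI[of _ "%_. 0"]) (simp add: balls_cutoff_def dual_quotient_def)
next
 case (insert i I)
 show ?case
 proof (cases "i \<in> I")
  case True
  thus ?thesis using insert.IH insert.prems by (simp add: insert_absorb)
 next
  case iI: False
 have ri: "0 < r i" "r i <= 1" using insert.prems by auto
 have ler: "r i <= r j" if "j \<in> I" for j using insert.hyps(2)[OF that] by simp
 have "\<forall>j\<in>I. 0 < r j & r j <= 1" using insert.prems by simp
 from insert.IH[OF this] obtain \<theta> where bc: "balls_cutoff \<phi> b om A \<Lambda> c r I \<theta>" by (elim exE)
 note bc = bc[unfolded balls_cutoff_def]
 have \<theta>: "0 <= \<theta> x" "\<theta> x <= 1" "j \<in> I ==> x \<in> ball (c j) (r j) ==> \<theta> x = 1"
  "\<theta> x ~= 0 ==> \<exists>j\<in>I. x \<in> ball (c j) (2*r j)" for j x using bc by blast+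
 have \<theta>c: "continuous_on UNIV \<theta>" using bc by blast
 have \<theta>l: "\<bar>\<theta> x - \<theta> y\<bar> <= 1/\<rho>*norm (x - y)" if "0 < \<rho>" "!!j. j \<in> I ==> \<rho> <= r j" for \<rho> x y
  using bc that by blast
 define \<kappa> where "\<kappa> x = max 0 (min 1 (2 - dist x (c i)/r i))" for x
 have \<kappa>01: "0 <= \<kappa> x" "\<kappa> x <= 1" for x by (auto simp: \<kappa>_def)
 have \<kappa>c: "continuous_on UNIV \<kappa>" unfolding \<kappa>_def[abs_def] using ri by (intro continuous_intros) auto
 have \<kappa>l: "\<bar>\<kappa> x - \<kappa> y\<bar> <= 1/r i*norm (x - y)" for x y
 proof -
  have "\<bar>\<kappa> x - \<kappa> y\<bar> <= \<bar>dist x (c i)/r i - dist y (c i)/r i\<bar>"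
  proof -
   have "\<bar>max 0 (min 1 (2 - s)) - max 0 (min 1 (2 - t))\<bar> <= \<bar>s - t\<bar>" for s t :: real by (smt (verit))
   thus ?thesis unfolding \<kappa>_def .
  qed
  also have "... = \<bar>dist x (c i) - dist y (c i)\<bar>/r i" using ri by (simp add: abs_divide flip: diff_divide_distrib)
  also have "... <= norm (x - y)/r i"
   using ri abs_dist_diff_le[of x "c i" y] unfolding dist_norm[of x y, symmetric] dist_commute[of "c i" y] by (intro divide_right_mono) auto
  finally show ?thesis by simp
 qed
 have \<kappa>1: "\<kappa> x = 1" if "x \<in> ball (c i) (r i)" for x
 proof -
  have "dist x (c i)/r i <= 1" using that ri by (simp add: dist_commute)
  thus ?thesis unfolding \<kappa>_def by simp
 qed
 have \<kappa>s: "x \<in> ball (c i) (2*r i)" if "\<kappa> x ~= 0" for x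
 proof (rule ccontr)
  assume "x \<notin> ball (c i) (2*r i)"
  hence "2 <= dist x (c i)/r i" using ri by (simp add: dist_commute field_simps)
  thus False using that unfolding \<kappa>_def by simp
 qed
 define \<theta>' where "\<theta>' x = max (\<theta> x) (\<kappa> x)" for x
 define \<eta> where "\<eta> x = \<theta>' x - \<theta> x" for x
 have \<eta>: "0 <= \<eta> x" "\<eta> x <= 1" "\<eta> x ~= 0 ==> \<kappa> x ~= 0" for x
  using \<theta>(1,2)[of x] \<kappa>01[of x] by (auto simp: \<eta>_def \<theta>'_def max_def split: if_splits)
 have \<theta>'c: "continuous_on UNIV \<theta>'" unfolding \<theta>'_def[abs_def] by (intro continuous_intros \<theta>c \<kappa>c)
 have \<eta>c: "continuous_on UNIV \<eta>" unfolding \<eta>_def[abs_def] by (intro continuous_intros \<theta>c \<theta>'c)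
 have maxl: "\<bar>\<theta>' x - \<theta>' y\<bar> <= t" if "\<bar>\<theta> x - \<theta> y\<bar> <= t" "\<bar>\<kappa> x - \<kappa> y\<bar> <= t" for x y t
  using that unfolding \<theta>'_def by (smt (verit))
 have \<theta>'l: "\<bar>\<theta>' x - \<theta>' y\<bar> <= 1/\<rho>*norm (x - y)" if \<rho>: "0 < \<rho>" "!!j. j \<in> insert i I ==> \<rho> <= r j" for \<rho> x y
 proof (rule maxl)
  show "\<bar>\<theta> x - \<theta> y\<bar> <= 1/\<rho>*norm (x - y)" by (rule \<theta>l) (use \<rho> in auto)
  have "1/r i*norm (x - y) <= 1/\<rho>*norm (x - y)" using \<rho> ri by (intro mult_right_mono divide_left_mono) auto
  thus "\<bar>\<kappa> x - \<kappa> y\<bar> <= 1/\<rho>*norm (x - y)" using \<kappa>l[of x y] by linarith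
 qed
 have A0: "0 <= A" using \<phi>(1)[of 0] by linarith
 let ?E = "%i. om (3*r i)*(2*A/r i + \<Lambda>)*measure lborel (cball (c i) (3*r i))"
 let ?\<psi> = "%x. \<phi> x*\<eta> x"
 have \<psi>l: "\<bar>?\<psi> x - ?\<psi> y\<bar> <= (2*A/r i + \<Lambda>)*norm (x - y)" for x y
 proof -
  have e1: "\<bar>\<theta>' x - \<theta>' y\<bar> <= 1/r i*norm (x - y)" by (rule \<theta>'l) (use ri ler in auto)
  have e2: "\<bar>\<theta> x - \<theta> y\<bar> <= 1/r i*norm (x - y)" by (rule \<theta>l) (use ri ler in auto)
  have "\<bar>\<eta> x - \<eta> y\<bar> <= \<bar>\<theta>' x - \<theta>' y\<bar> + \<bar>\<theta> x - \<theta> y\<bar>" unfolding \<eta>_def by linarith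
  hence e: "\<bar>\<eta> x - \<eta> y\<bar> <= 2/r i*norm (x - y)" using e1 e2 by simp
  have "?\<psi> x - ?\<psi> y = \<phi> x*(\<eta> x - \<eta> y) + (\<phi> x - \<phi> y)*\<eta> y" by (simp add: algebra_simps)
  hence "\<bar>?\<psi> x - ?\<psi> y\<bar> <= \<bar>\<phi> x\<bar>*\<bar>\<eta> x - \<eta> y\<bar> + \<bar>\<phi> x - \<phi> y\<bar>*\<bar>\<eta> y\<bar>"
   using abs_triangle_ineq[of "\<phi> x*(\<eta> x - \<eta> y)" "(\<phi> x - \<phi> y)*\<eta> y"] by (simp add: abs_mult)
  also have "... <= A*(2/r i*norm (x - y)) + (\<Lambda>*norm (x - y))*1"
   using \<phi>(1)[of x] \<phi>(2)[of x y] e \<eta>(1,2)[of y] A0 \<Lambda> by (intro add_mono mult_mono) auto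
  finally show ?thesis by (simp add: algebra_simps)
 qed
 have \<psi>s: "x \<in> ball (c i) (2*r i)" if "?\<psi> x ~= 0" for x using \<kappa>s \<eta>(3) that by auto
 have dE: "\<bar>dual_quotient b k ?\<psi>\<bar> <= ?E i" if k: "step k <= r i" for k
 proof (cases "\<exists>x. ?\<psi> x ~= 0")
  case True
  then obtain x0 where x0: "?\<psi> x0 ~= 0" by blast
  have "norm (c i - x0) <= 2" using \<psi>s[OF x0] ri by (auto simp: dist_norm)
  moreover have "norm x0 <= B" using \<phi>(3) x0 by auto
  ultimately have ci: "norm (c i) <= B + 2" using norm_triangle_sub[of "c i" x0] by linarith
  show ?thesis
  proof (rule dual_quotient_bound[OF \<psi>l \<psi>s b k])
   show "\<bar>V x - V (c i)\<bar> <= om (3*r i)" if "x \<in> cball (c i) (3*r i)" for x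
   proof (rule om(2))
    show "norm (x - c i) <= 3*r i" using that by (simp add: dist_norm norm_minus_commute)
    thus "norm x <= B + 5" using ci ri norm_triangle_sub[of x "c i"] by linarith
   qed (use ci in simp)
  qed (use A0 \<Lambda> ri in auto)
 next
  case False
  hence "?\<psi> = (%_. 0)" by auto
  thus ?thesis using om(1) A0 \<Lambda> ri by (simp add: dual_quotient_def)
 qed
 have "\<bar>dual_quotient b k (%x. \<phi> x*\<theta>' x)\<bar> <= (\<Sum>j\<in>insert i I. ?E j)" if k: "!!j. j \<in> insert i I ==> step k <= r j" for k
 proof -
  have sp: "(%x. \<phi> x*\<theta>' x) = (%x. \<phi> x*\<theta> x + ?\<psi> x)" by (simp add: \<eta>_def fun_eq_iff algebra_simps)
  have "dual_quotient b k (%x. \<phi> x*\<theta>' x) = dual_quotient b k (%x. \<phi> x*\<theta> x) + dual_quotient b k ?\<psi>"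
   unfolding sp by (rule dual_quotient_add[where B = B]) (use \<phi>(3) b in \<open>auto intro!: continuous_on_mult \<phi>c \<theta>c \<eta>c\<close>)
  moreover have "\<bar>dual_quotient b k (%x. \<phi> x*\<theta> x)\<bar> <= (\<Sum>j\<in>I. ?E j)" using bc k by auto
  moreover have "\<bar>dual_quotient b k ?\<psi>\<bar> <= ?E i" by (rule dE) (use k in auto)
  ultimately show ?thesis using insert.hyps(1) iI by simp
 qed
 moreover have "0 <= \<theta>' x & \<theta>' x <= 1" for x using \<theta>(1,2)[of x] \<kappa>01[of x] by (auto simp: \<theta>'_def)
 moreover have "\<theta>' x = 1" if "j \<in> insert i I" "x \<in> ball (c j) (r j)" for j x
  using that \<theta>(2)[of x] \<theta>(3)[of j x] \<kappa>1[of x] \<kappa>01(2)[of x] by (auto simp: \<theta>'_def)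
 moreover have "\<exists>j\<in>insert i I. x \<in> ball (c j) (2*r j)" if "\<theta>' x ~= 0" for x
  using that \<theta>(4)[of x] \<kappa>s[of x] by (auto simp: \<theta>'_def max_def split: if_splits)
 ultimately show ?thesis using \<theta>'l \<theta>'c unfolding balls_cutoff_def
  by - (rule exI[of _ \<theta>'], intro conjI allI ballI impI; (elim conjE)?; blast)
 qed
qed

lemma test_function_facts:
 fixes \<phi> :: "'a => real"
 assumes "test_function \<Omega> \<phi>"
 obtains A \<Lambda> B K where "compact K" "K \<subseteq> \<Omega>" "!!x. x \<notin> K ==> \<phi> x = 0" "!!x. x \<in> K ==> norm x <= B" "continuous_on UNIV \<phi>"
  "!!x. \<bar>\<phi> x\<bar> <= A" "0 <= \<Lambda>" "!!x y. \<bar>\<phi> x - \<phi> y\<bar> <= \<Lambda>*norm (x - y)"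
  "!!x. (\<phi> has_derivative frechet_derivative \<phi> (at x)) (at x)" "!!x b. x \<notin> K ==> frechet_derivative \<phi> (at x) b = 0"
  "!!b. b \<in> Basis ==> continuous_on UNIV (%x. frechet_derivative \<phi> (at x) b)"
proof -
 define K where "K = closure {x. \<phi> x ~= 0}"
 have K: "compact K" "K \<subseteq> \<Omega>" and "times_cont_differentiable (Suc 0) \<phi>"
  using assms unfolding test_function_def K_def by blast+
 hence d: "\<phi> differentiable_on UNIV" and pc: "!!b. b \<in> Basis ==> continuous_on UNIV (%x. frechet_derivative \<phi> (at x) b)" by auto
 have hd: "(\<phi> has_derivative frechet_derivative \<phi> (at x)) (at x)" for x
  using d by (simp add: differentiable_on_def frechet_derivative_works)
 have cont: "continuous_on UNIV \<phi>" by (rule differentiable_imp_continuous_on[OF d])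
 have z: "\<phi> x = 0" if "x \<notin> K" for x using that closure_subset[of "{x. \<phi> x ~= 0}"] unfolding K_def by auto
 obtain B where B: "!!x. x \<in> K ==> norm x <= B" using compact_imp_bounded[OF K(1)] unfolding bounded_iff by blast
 have glob: "\<exists>A\<ge>0. \<forall>x. \<bar>g x\<bar> <= A" if gc: "continuous_on UNIV g" and gz: "!!x. x \<notin> K ==> g x = 0" for g :: "'a => real"
 proof -
  obtain A where A: "0 <= A" "!!x. x \<in> cball 0 B ==> \<bar>g x\<bar> <= A" by (rule continuous_bounded_cball[OF gc, of 0 B]) blast
  have "\<bar>g x\<bar> <= A" for x using A(1) A(2)[of x] B[of x] gz[of x] by (cases "x \<in> K") auto
  with A(1) show ?thesis by blast
 qed
 obtain A where A: "!!x. \<bar>\<phi> x\<bar> <= A" using glob[OF cont z] by blast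
 have dz: "frechet_derivative \<phi> (at x) b = 0" if "x \<notin> K" for x b
 proof -
  have "open (- K)" using K(1) by (simp add: compact_imp_closed open_Compl)
  hence "(\<phi> has_derivative (%_. 0)) (at x)"
   by (rule has_derivative_transform_within_open[OF has_derivative_const[of 0]]) (use that z in auto)
  from frechet_derivative_at[OF this] show ?thesis by metis
 qed
 have "\<exists>M. \<forall>b\<in>Basis. 0 <= M b & (\<forall>x. \<bar>frechet_derivative \<phi> (at x) b\<bar> <= M b)"
  using glob[OF pc dz] by (intro bchoice) blast
 then obtain M where M: "!!b. b \<in> Basis ==> 0 <= M b" "!!b x. b \<in> Basis ==> \<bar>frechet_derivative \<phi> (at x) b\<bar> <= M b" by blast
 define \<Lambda> where "\<Lambda> = (\<Sum>b\<in>Basis. M b)"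
 have \<Lambda>0: "0 <= \<Lambda>" unfolding \<Lambda>_def by (rule sum_nonneg) (rule M(1))
 have on: "onorm (frechet_derivative \<phi> (at x)) <= \<Lambda>" for x
 proof (rule onorm_bound[OF \<Lambda>0])
  fix v
  have lin: "linear (frechet_derivative \<phi> (at x))" using hd by (rule has_derivative_linear)
  have "frechet_derivative \<phi> (at x) v = frechet_derivative \<phi> (at x) (\<Sum>b\<in>Basis. (v \<bullet> b) *\<^sub>R b)" by (simp add: euclidean_representation)
  also have "... = (\<Sum>b\<in>Basis. (v \<bullet> b)*frechet_derivative \<phi> (at x) b)"
   by (simp add: linear_sum[OF lin] linear_cmul[OF lin])
  also have "norm ... <= (\<Sum>b\<in>Basis. M b*norm v)"
  proof (rule order_trans[OF norm_sum sum_mono])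
   fix b :: 'a assume b: "b \<in> Basis"
   have "\<bar>v \<bullet> b\<bar>*\<bar>frechet_derivative \<phi> (at x) b\<bar> <= norm v * M b"
    using Basis_le_norm[OF b, of v] M(2)[OF b, of x] by (intro mult_mono) auto
   thus "norm ((v \<bullet> b)*frechet_derivative \<phi> (at x) b) <= M b*norm v" by (simp add: abs_mult mult.commute)
  qed
  finally show "norm (frechet_derivative \<phi> (at x) v) <= \<Lambda>*norm v" by (simp add: \<Lambda>_def sum_distrib_right)
 qed
 have lip: "\<bar>\<phi> x - \<phi> y\<bar> <= \<Lambda>*norm (x - y)" for x y
  using differentiable_bound[of UNIV \<phi> "%x. frechet_derivative \<phi> (at x)" \<Lambda> x y] hd on by simp
 show thesis by (rule that[of K B A \<Lambda>]; (fact K z B cont A \<Lambda>0 lip hd dz pc))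
qed

lemma dual_quotient_test_function:
 assumes \<phi>: "test_function \<Omega> \<phi>" and b: "norm b <= 1"
 shows "(%k. dual_quotient b k \<phi>) \<longlonglongrightarrow> - (LBINT x. V x*frechet_derivative \<phi> (at x) b)"
proof -
 obtain A \<Lambda> B K where K: "compact K" "K \<subseteq> \<Omega>" "!!x. x \<notin> K ==> \<phi> x = 0" "!!x. x \<in> K ==> norm x <= B" and c: "continuous_on UNIV \<phi>"
  and "!!x. \<bar>\<phi> x\<bar> <= A" and \<Lambda>: "0 <= \<Lambda>" "!!x y. \<bar>\<phi> x - \<phi> y\<bar> <= \<Lambda>*norm (x - y)"
  and hd: "!!x. (\<phi> has_derivative frechet_derivative \<phi> (at x)) (at x)"
  by (rule test_function_facts[OF \<phi>]) blast
 let ?D = "%x. frechet_derivative \<phi> (at x) b" and ?q = "%k x. real (Suc k)*(\<phi> (x - step k *\<^sub>R b) - \<phi> x)"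
 have c': "continuous_on UNIV (%x. \<phi> (x - step k *\<^sub>R b))" for k
  by (rule continuous_on_compose2[OF c]) (auto intro!: continuous_intros)
 have lim: "(%k. ?q k x) \<longlonglongrightarrow> - ?D x" for x
 proof -
  have "((%h. \<phi> (x + h *\<^sub>R (- b))) has_derivative (%h. frechet_derivative \<phi> (at x) (h *\<^sub>R (- b)))) (at (0::real))"
   by (rule has_derivative_compose[of "%h. x + h *\<^sub>R (- b)"]) (use hd[of x] in \<open>auto intro!: derivative_eq_intros\<close>)
  moreover have "(%h. frechet_derivative \<phi> (at x) (h *\<^sub>R (- b))) = (*) (- ?D x)"
  proof
   fix h
   have "frechet_derivative \<phi> (at x) ((- h) *\<^sub>R b) = (- h) *\<^sub>R ?D x" by (rule linear_cmul[OF has_derivative_linear[OF hd]])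
   thus "frechet_derivative \<phi> (at x) (h *\<^sub>R (- b)) = - ?D x*h" by simp
  qed
  ultimately have "DERIV (%h. \<phi> (x + h *\<^sub>R (- b))) 0 :> - ?D x" unfolding has_field_derivative_def by simp
  hence "((%h. (\<phi> (x + h *\<^sub>R (- b)) - \<phi> x)/h) \<longlongrightarrow> - ?D x) (at 0)" unfolding DERIV_def by simp
  moreover have "filterlim step (at 0) sequentially"
   unfolding filterlim_at using step(1,4) by (auto simp: less_imp_neq[symmetric])
  ultimately have "(%k. (\<phi> (x + step k *\<^sub>R (- b)) - \<phi> x)/step k) \<longlonglongrightarrow> - ?D x" by (rule filterlim_compose)
  moreover have "(\<phi> (x + step k *\<^sub>R (- b)) - \<phi> x)/step k = ?q k x" for k by (simp add: step_def mult.commute)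
  ultimately show ?thesis by simp
 qed
 obtain M where M: "0 <= M" "!!x. x \<in> cball 0 (B + 1) ==> \<bar>V x\<bar> <= M" by (rule continuous_bounded_cball[OF V, of 0 "B + 1"]) blast
 have qs: "x \<in> cball 0 (B + 1)" if "?q k x ~= 0" for k x
 proof -
  have "x - step k *\<^sub>R b \<in> K \<or> x \<in> K" using that K(3) by force
  thus ?thesis using K(4)[of x] shift_support[OF b K(4)[of "x - step k *\<^sub>R b"]] by auto
 qed
 have qb: "\<bar>?q k x\<bar> <= \<Lambda>" for k x
 proof -
  have "\<bar>\<phi> (x - step k *\<^sub>R b) - \<phi> x\<bar> <= \<Lambda>*norm (step k *\<^sub>R b)" using \<Lambda>(2)[of "x - step k *\<^sub>R b" x] by simp
  also have "... <= \<Lambda> * step k" using step(1)[of k] b \<Lambda>(1) by (intro mult_left_mono) (auto simp: mult_left_le)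
  finally have "real (Suc k)*\<bar>\<phi> (x - step k *\<^sub>R b) - \<phi> x\<bar> <= real (Suc k)*(\<Lambda> * step k)" by (rule mult_left_mono) simp
  also have "... = \<Lambda>*(real (Suc k) * step k)" by simp
  finally show ?thesis unfolding step(3) abs_mult by simp
 qed
 have qm: "(%x. V x*?q k x) \<in> borel_measurable borel" for k
  by (intro borel_measurable_continuous_onI continuous_on_mult V continuous_on_diff c c' continuous_on_const)
 have "(%k. \<integral>x. V x*?q k x \<partial>lborel) \<longlonglongrightarrow> (LBINT x. V x * - ?D x)"
 proof (rule integral_dominated_convergence[where w = "%x. M*\<Lambda>*indicator (cball (0 :: 'a) (B + 1)) x"])
  have cb: "(%x. M*\<Lambda>*indicator (cball (0 :: 'a) (B + 1)) x) \<in> borel_measurable borel"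
   by (intro borel_measurable_times borel_measurable_const borel_measurable_indicator) simp
  show "(%x. V x * - ?D x) \<in> borel_measurable lborel"
  proof (rule borel_measurable_LIMSEQ_real)
   show "(%k. V x*?q k x) \<longlonglongrightarrow> V x * - ?D x" for x by (intro tendsto_mult tendsto_const lim)
   show "(%x. V x*?q k x) \<in> borel_measurable lborel" for k using qm[of k] by simp
  qed
  show "integrable lborel (%x. M*\<Lambda>*indicator (cball (0 :: 'a) (B + 1)) x)"
   by (rule integrable_bounded_support(1)[of _ "M*\<Lambda>" 0 "B + 1"]) (use M \<Lambda> cb in auto)
  show "AE x in lborel. (%k. V x*?q k x) \<longlonglongrightarrow> V x * - ?D x" by (intro AE_I2 tendsto_mult tendsto_const lim)
  fix k
  have "\<bar>V x*?q k x\<bar> <= M*\<Lambda>*indicator (cball 0 (B + 1)) x" for x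
  proof (cases "?q k x = 0")
   case True
   thus ?thesis using M \<Lambda> by (simp only: mult_zero_right abs_zero) simp
  next
   case False
   have "\<bar>V x\<bar>*\<bar>?q k x\<bar> <= M*\<Lambda>" by (rule mult_mono[OF M(2)[OF qs[OF False]] qb M(1)]) simp
   thus ?thesis using qs[OF False] by (simp only: abs_mult indicator_simps mult_1_right)
  qed
  thus "AE x in lborel. norm (V x*?q k x) <= M*\<Lambda>*indicator (cball 0 (B + 1)) x" by (intro AE_I2) simp
 qed (use qm in simp)
 thus ?thesis unfolding dual_quotient_def by simp
qed

end

context small_singular_set
begin

definition singular_cutoff :: "('a => real) => 'a => real => ('a => real) => 'a set => bool" where
 "singular_cutoff \<phi> b eps \<theta> K' \<longleftrightarrow> continuous_on UNIV \<theta> & (\<forall>x. 0 <= \<theta> x & \<theta> x <= 1) &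
  compact K' & K' \<subseteq> regular & (\<forall>x. x \<notin> K' --> \<phi> x*(1 - \<theta> x) = 0) &
  (\<integral>\<^sup>+x. ennreal (\<theta> x) \<partial>lborel) <= ennreal (eps) &
  (\<exists>k0. \<forall>k\<ge>k0. \<bar>dual_quotient b k (%x. \<phi> x*\<theta> x)\<bar> <= eps)"

text \<open>The singular part of the support of \<phi> is compact, so finitely many balls of a cover
  with small gauge sum suffice. Their radii then have a positive minimum, and for all later k the
  step is below it.\<close>

lemma cutoff_singular_set:
 assumes \<phi>t: "test_function \<Omega> \<phi>" and b: "norm b <= 1"
 shows "\<exists>C\<ge>0. \<forall>dlt. 0 < dlt & dlt <= 1 --> (\<exists>\<theta> K'. singular_cutoff \<phi> b (C*dlt) \<theta> K')"
proof -
 obtain A \<Lambda> B K where K: "compact K" "K \<subseteq> \<Omega>" "!!x. x \<notin> K ==> \<phi> x = 0" "!!x. x \<in> K ==> norm x <= B" and c: "continuous_on UNIV \<phi>"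
  and A: "!!x. \<bar>\<phi> x\<bar> <= A" and \<Lambda>: "0 <= \<Lambda>" "!!x y. \<bar>\<phi> x - \<phi> y\<bar> <= \<Lambda>*norm (x - y)"
  by (rule test_function_facts[OF \<phi>t]) blast
 have A0: "0 <= A" using A[of 0] by linarith
 obtain om where om: "!!\<rho>. 0 <= om \<rho>" "(om \<longlongrightarrow> 0) (at_right 0)"
  "!!x y \<rho>. norm x <= B + 5 ==> norm y <= B + 5 ==> norm (x - y) <= \<rho> ==> \<bar>V x - V y\<bar> <= om \<rho>"
  using modulus_of_continuity[of "B + 5"] by (elim exE conjE) blast
 define m where "m = DIM('a) - 1"
 have m: "DIM('a) = Suc m" by (simp add: m_def)
 define u where "u = unit_ball_vol (real DIM('a))"
 have u0: "0 <= u" by (simp add: u_def)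
 have vol: "measure lborel (cball (x :: 'a) \<rho>) = u*\<rho> ^ Suc m" if "0 <= \<rho>" for x \<rho>
  using content_cball[OF that, of x] unfolding u_def m .
 define C1 where "C1 = (2*A + \<Lambda>)*u*3 ^ Suc m"
 define C where "C = C1 + u*2 ^ Suc m"
 have C0: "0 <= C1" "0 <= u*2 ^ Suc m" using A0 \<Lambda> u0 by (simp_all add: C1_def)
 \<comment> \<open>The gauge has two tasks: \<open>om (3*\<rho>)\<close> controls the change of the
   dual quotients, and \<rho>, times \<rho>^(d-1), controls the volume of the balls.\<close>
 define w where "w \<rho> = om (3*\<rho>) + \<bar>\<rho>\<bar>" for \<rho>
 have w0: "0 <= w \<rho>" for \<rho> using om(1)[of "3*\<rho>"] by (simp add: w_def)
 have wl: "(w \<longlongrightarrow> 0) (at_right 0)"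
 proof -
  have "filterlim (%\<rho>. 3*\<rho>) (at_right 0) (at_right (0::real))"
   unfolding filterlim_at by (auto intro!: tendsto_eq_intros simp: eventually_at_filter)
  from filterlim_compose[OF om(2) this] have "((%\<rho>. om (3*\<rho>)) \<longlongrightarrow> 0) (at_right 0)" .
  moreover have "((%\<rho>. \<bar>\<rho>\<bar>) \<longlongrightarrow> 0) (at_right (0::real))" by (auto intro!: tendsto_eq_intros)
  ultimately have "((%\<rho>. om (3*\<rho>) + \<bar>\<rho>\<bar>) \<longlongrightarrow> 0 + 0) (at_right 0)" by (rule tendsto_add)
  thus ?thesis by (simp add: w_def[abs_def])
 qed
 have "\<exists>\<theta> K'. singular_cutoff \<phi> b (C*dlt) \<theta> K'" if dlt: "0 < dlt" "dlt <= 1" for dlt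
 proof -
  obtain z r where r: "!!i::nat. r i < dlt"
   and cov: "{x \<in> \<Omega>. \<forall>e>0. \<forall>C. \<not> C-lipschitz_on (ball x e) V} \<subseteq> (\<Union>i. ball (z i) (r i))"
   and sum: "(\<Sum>i. gauge_weight w m (r i)) < ennreal dlt"
   using small_setD[OF small w0 wl dlt(1)] unfolding m_def[symmetric] by (elim exE conjE) blast
  have kc: "compact (K - regular)" by (rule compact_diff[OF K(1) open_regular])
  have kcov: "K - regular \<subseteq> (\<Union>i. ball (z i) (r i))" using cov K(2) by (auto simp: regular_def)
  obtain I' where I': "finite I'" "K - regular \<subseteq> (\<Union>i\<in>I'. ball (z i) (r i))"
   by (rule compactE_image[OF kc _ kcov]) auto
  define I where "I = {i \<in> I'. 0 < r i}"
  have I: "finite I" "K - regular \<subseteq> (\<Union>i\<in>I. ball (z i) (r i))"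
  proof -
   have "i \<in> I" if "i \<in> I'" "x \<in> ball (z i) (r i)" for i x
    using that zero_le_dist[of "z i" x] by (auto simp: I_def simp del: zero_le_dist)
   thus "K - regular \<subseteq> (\<Union>i\<in>I. ball (z i) (r i))" using I'(2) by blast
  qed (use I' in \<open>simp add: I_def\<close>)
  have rI: "\<forall>i\<in>I. 0 < r i & r i <= 1" using less_imp_le[OF less_le_trans[OF r dlt(2)]] by (simp add: I_def)
  have sI: "(\<Sum>i\<in>I. w (r i)*r i ^ m) <= dlt"
  proof -
   have "ennreal (\<Sum>i\<in>I. w (r i)*r i ^ m) = (\<Sum>i\<in>I. gauge_weight w m (r i))"
    using rI w0 by (subst sum_ennreal[symmetric]) (auto simp: gauge_weight_def intro!: sum.cong)
   also have "... <= (\<Sum>i. gauge_weight w m (r i))" by (rule sum_le_suminf) (use I in auto)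
   finally have "ennreal (\<Sum>i\<in>I. w (r i)*r i ^ m) <= ennreal dlt" using sum by (simp add: order.strict_implies_order order.strict_trans1)
   thus ?thesis using dlt by simp
  qed
  have s1: "(\<Sum>i\<in>I. om (3*r i)*r i ^ m) <= dlt" "(\<Sum>i\<in>I. r i ^ Suc m) <= dlt"
  proof -
   have "(\<Sum>i\<in>I. om (3*r i)*r i ^ m) <= (\<Sum>i\<in>I. w (r i)*r i ^ m)" "(\<Sum>i\<in>I. r i ^ Suc m) <= (\<Sum>i\<in>I. w (r i)*r i ^ m)"
    using rI om(1) by (auto intro!: sum_mono mult_right_mono simp: w_def)
   thus "(\<Sum>i\<in>I. om (3*r i)*r i ^ m) <= dlt" "(\<Sum>i\<in>I. r i ^ Suc m) <= dlt" using sI by linarith+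
  qed
  have \<phi>s: "norm x <= B" if "\<phi> x ~= 0" for x using K(3,4) that by blast
  have "\<exists>\<theta>. balls_cutoff \<phi> b om A \<Lambda> z r I \<theta>"
   by (rule cutoff_of_balls[OF I(1) rI A \<Lambda>(2) \<phi>s c \<Lambda>(1) b om(1,3)])
  then obtain \<theta> where bc: "balls_cutoff \<phi> b om A \<Lambda> z r I \<theta>" by (elim exE)
  note bc = bc[unfolded balls_cutoff_def]
  hence \<theta>: "\<forall>x. 0 <= \<theta> x & \<theta> x <= 1" "\<forall>i\<in>I. \<forall>x\<in>ball (z i) (r i). \<theta> x = 1"
   "\<forall>x. \<theta> x ~= 0 --> (\<exists>i\<in>I. x \<in> ball (z i) (2*r i))" "continuous_on UNIV \<theta>" by blast+
  let ?K' = "K - (\<Union>i\<in>I. ball (z i) (r i))"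
  have K': "compact ?K'" "?K' \<subseteq> regular" using I(2) by (auto intro!: compact_diff[OF K(1)])
  have K'0: "\<phi> x*(1 - \<theta> x) = 0" if "x \<notin> ?K'" for x using that K(3)[of x] \<theta>(2) by auto
  have "(\<Sum>i\<in>I. om (3*r i)*(2*A/r i + \<Lambda>)*measure lborel (cball (z i) (3*r i))) <= (\<Sum>i\<in>I. C1*(om (3*r i)*r i ^ m))"
  proof (rule sum_mono)
   fix i assume i: "i \<in> I"
   hence ri: "0 < r i" "r i <= 1" using rI by auto
   \<comment> \<open>The Lipschitz constant of the bump is of order 1/r and the volume of order r^d,
     which leaves r^(d-1).\<close>
   have "(2*A/r i + \<Lambda>)*measure lborel (cball (z i) (3*r i)) = (2*A + \<Lambda>*r i)*u*3 ^ Suc m*r i ^ m"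
    using ri by (subst vol) (auto simp: field_simps power_mult_distrib)
   also have "... <= (2*A + \<Lambda>*1)*u*3 ^ Suc m*r i ^ m"
    using ri u0 \<Lambda>(1) by (intro mult_right_mono add_left_mono mult_left_mono) auto
   finally have "(2*A/r i + \<Lambda>)*measure lborel (cball (z i) (3*r i)) <= C1*r i ^ m" by (simp add: C1_def)
   from mult_left_mono[OF this om(1)[of "3*r i"]]
   show "om (3*r i)*(2*A/r i + \<Lambda>)*measure lborel (cball (z i) (3*r i)) <= C1*(om (3*r i)*r i ^ m)"
    by (simp only: mult_ac)
  qed
  also have "... = C1*(\<Sum>i\<in>I. om (3*r i)*r i ^ m)" by (simp add: sum_distrib_left)
  also have "... <= C1*dlt" using s1(1) C0 by (intro mult_left_mono) auto
  also have "... <= C*dlt" using C0 dlt by (intro mult_right_mono) (auto simp: C_def)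
  finally have E: "(\<Sum>i\<in>I. om (3*r i)*(2*A/r i + \<Lambda>)*measure lborel (cball (z i) (3*r i))) <= C*dlt" .
  have "\<forall>\<^sub>F k in sequentially. \<forall>i\<in>I. step k < r i"
   using I rI by (intro eventually_ball_finite ballI order_tendstoD(2)[OF step(4)]) auto
  then obtain k0 where k0: "!!k i. k0 <= k ==> i \<in> I ==> step k < r i" unfolding eventually_sequentially by blast
  have dq: "\<bar>dual_quotient b k (%x. \<phi> x*\<theta> x)\<bar> <= C*dlt" if "k0 <= k" for k
  proof (rule order_trans[OF _ E], rule bc[THEN conjunct2, THEN conjunct2, THEN conjunct2, THEN conjunct2, THEN conjunct2, rule_format])
   show "step k <= r i" if "i \<in> I" for i using k0[OF \<open>k0 \<le> k\<close> that] by simp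
  qed
  have "(\<integral>\<^sup>+x. ennreal (\<theta> x) \<partial>lborel) <= (\<integral>\<^sup>+x. (\<Sum>i\<in>I. indicator (cball (z i) (2*r i)) x) \<partial>lborel)"
  proof (rule nn_integral_mono)
   fix x
   show "ennreal (\<theta> x) <= (\<Sum>i\<in>I. indicator (cball (z i) (2*r i)) x)"
   proof (cases "\<theta> x = 0")
    case False
    then obtain i where i: "i \<in> I" "x \<in> ball (z i) (2*r i)" using \<theta>(3) by blast
    have "ennreal (\<theta> x) <= 1" using \<theta>(1) by simp
    also have "1 = (indicator (cball (z i) (2*r i)) x :: ennreal)" using i(2) by simp
    also have "... <= (\<Sum>i\<in>I. indicator (cball (z i) (2*r i)) x)" by (rule member_le_sum[OF i(1)]) (use I in auto)
    finally show ?thesis .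
   qed simp
  qed
  also have "... = (\<Sum>i\<in>I. \<integral>\<^sup>+x. indicator (cball (z i) (2*r i)) x \<partial>lborel)"
   by (rule nn_integral_sum) (rule borel_measurable_indicator, simp)
  also have "... = (\<Sum>i\<in>I. emeasure lborel (cball (z i) (2*r i)))" by (intro sum.cong refl nn_integral_indicator) simp
  also have "... = (\<Sum>i\<in>I. ennreal (u*2 ^ Suc m*r i ^ Suc m))"
  proof (rule sum.cong[OF refl])
   fix i assume "i \<in> I"
   hence "0 <= 2*r i" using rI by auto
   from vol[OF this, of "z i"] show "emeasure lborel (cball (z i) (2*r i)) = ennreal (u*2 ^ Suc m*r i ^ Suc m)"
    using emeasure_bounded_finite[of "cball (z i) (2*r i)"]
    by (simp add: emeasure_eq_ennreal_measure less_top[symmetric] power_mult_distrib mult_ac)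
  qed
  also have "... = ennreal (u*2 ^ Suc m*(\<Sum>i\<in>I. r i ^ Suc m))"
   using rI u0 by (subst sum_ennreal) (auto simp: sum_distrib_left intro!: mult_nonneg_nonneg)
  also have "... <= ennreal (C*dlt)"
  proof (rule ennreal_leI)
   have "u*2 ^ Suc m*(\<Sum>i\<in>I. r i ^ Suc m) <= u*2 ^ Suc m*dlt" using s1(2) C0 by (intro mult_left_mono) auto
   also have "... <= C*dlt" using C0 dlt by (intro mult_right_mono) (auto simp: C_def)
   finally show "u*2 ^ Suc m*(\<Sum>i\<in>I. r i ^ Suc m) <= C*dlt" .
  qed
  finally have "(\<integral>\<^sup>+x. ennreal (\<theta> x) \<partial>lborel) <= ennreal (C*dlt)" .
  thus ?thesis unfolding singular_cutoff_def using \<theta>(1,4) K' K'0 dq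
   by - (rule exI[of _ \<theta>], rule exI[of _ ?K'], intro conjI; blast)
 qed
 thus ?thesis using C0 by (intro exI[of _ C] conjI allI impI) (auto simp: C_def)
qed

text \<open>\<phi> is split into \<phi> \<theta> and \<phi> (1 - \<theta>). The second part is
  supported in the regular set, where the limit formula holds; the first contributes at most C/2^j.
  As the integrals of the cutoffs are summable, the cutoffs tend to 0 almost everywhere and the
  second part exhausts \<phi>.\<close>

lemma weak_derivative:
 assumes b: "norm b <= 1"
 shows "\<exists>G. local_density G &
  (\<forall>\<phi>. test_function \<Omega> \<phi> --> (LBINT x. V x*frechet_derivative \<phi> (at x) b) = - (LBINT x. \<phi> x*G x))"
proof -
 obtain G c N where ld: "local_density G" and w: "\<forall>n. convex_weights n (N n) (c n)"
  and lim: "\<forall>\<psi> K. continuous_on UNIV \<psi> & compact K & K \<subseteq> regular & (\<forall>x. x \<notin> K --> \<psi> x = 0) -->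
   (%n. \<Sum>k<N n. c n k*dual_quotient b k \<psi>) \<longlonglongrightarrow> (LBINT x. \<psi> x*G x)"
  using weak_derivative_exists[OF b] by (elim exE conjE)
 have Gm [measurable]: "G \<in> borel_measurable borel"
  and loc: "\<forall>K. compact K & K \<subseteq> \<Omega> --> integrable lborel (%x. indicator K x*G x)"
  using ld unfolding local_density_def by blast+
 have "(LBINT x. V x*frechet_derivative \<phi> (at x) b) = - (LBINT x. \<phi> x*G x)" if \<phi>t: "test_function \<Omega> \<phi>" for \<phi>
 proof -
  obtain A \<Lambda> B K where K: "compact K" "K \<subseteq> \<Omega>" "!!x. x \<notin> K ==> \<phi> x = 0" "!!x. x \<in> K ==> norm x <= B" and \<phi>c: "continuous_on UNIV \<phi>"
   and A: "!!x. \<bar>\<phi> x\<bar> <= A" by (rule test_function_facts[OF \<phi>t]) blast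
  define L where "L = - (LBINT x. V x*frechet_derivative \<phi> (at x) b)"
  obtain C where C: "0 <= C" and cut: "!!dlt. 0 < dlt & dlt <= 1 ==> \<exists>\<theta> K'. singular_cutoff \<phi> b (C*dlt) \<theta> K'"
   using cutoff_singular_set[OF \<phi>t b] by (elim exE conjE) blast
  have "\<forall>j::nat. \<exists>\<theta> K'. singular_cutoff \<phi> b (C*(1/2) ^ j) \<theta> K'" by (rule allI, rule cut) (simp add: power_le_one)
  from choice[OF this] obtain \<theta> where "\<forall>j. \<exists>K'. singular_cutoff \<phi> b (C*(1/2) ^ j) (\<theta> j) K'" by (elim exE)
  from choice[OF this] obtain K' where h: "\<forall>j. singular_cutoff \<phi> b (C*(1/2) ^ j) (\<theta> j) (K' j)" by (elim exE)
  have \<theta>: "!!j. continuous_on UNIV (\<theta> j)" "!!j x. 0 <= \<theta> j x & \<theta> j x <= 1"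
   and K': "!!j. compact (K' j)" "!!j. K' j \<subseteq> regular" "!!j x. x \<notin> K' j ==> \<phi> x*(1 - \<theta> j x) = 0"
   and \<theta>i: "!!j::nat. (\<integral>\<^sup>+x. ennreal (\<theta> j x) \<partial>lborel) <= ennreal (C*(1/2) ^ j)"
   and dq: "!!j. \<exists>k0. \<forall>k\<ge>k0. \<bar>dual_quotient b k (%x. \<phi> x*\<theta> j x)\<bar> <= C*(1/2) ^ j"
   using h unfolding singular_cutoff_def by blast+
  have \<phi>s: "norm x <= B" if "\<phi> x ~= 0" for x using K(3,4) that by blast
  have tot: "(%n. \<Sum>k<N n. c n k*dual_quotient b k \<phi>) \<longlonglongrightarrow> L"
   unfolding L_def by (rule convex_weights_tendsto[OF w[rule_format] dual_quotient_test_function[OF \<phi>t b]])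
  have est: "\<bar>L - (LBINT x. (\<phi> x*(1 - \<theta> j x))*G x)\<bar> <= C*(1/2) ^ j" for j
  proof -
   let ?\<psi> = "%x. \<phi> x*(1 - \<theta> j x)"
   have \<psi>c: "continuous_on UNIV ?\<psi>" by (intro continuous_intros \<phi>c \<theta>)
   have "(%n. \<Sum>k<N n. c n k*dual_quotient b k ?\<psi>) \<longlonglongrightarrow> (LBINT x. ?\<psi> x*G x)"
    by (rule lim[rule_format, where K = "K' j"]) (use \<psi>c K' in blast)
   from tendsto_rabs[OF tendsto_diff[OF tot this]]
   have l: "(%n. \<bar>(\<Sum>k<N n. c n k*dual_quotient b k \<phi>) - (\<Sum>k<N n. c n k*dual_quotient b k ?\<psi>)\<bar>)
    \<longlonglongrightarrow> \<bar>L - (LBINT x. ?\<psi> x*G x)\<bar>" .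
   obtain k0 where k0: "!!k. k0 <= k ==> \<bar>dual_quotient b k (%x. \<phi> x*\<theta> j x)\<bar> <= C*(1/2) ^ j" using dq[of j] by blast
   have sp: "dual_quotient b k \<phi> - dual_quotient b k ?\<psi> = dual_quotient b k (%x. \<phi> x*\<theta> j x)" for k
   proof -
    have "dual_quotient b k (%x. \<phi> x*\<theta> j x + ?\<psi> x) = dual_quotient b k (%x. \<phi> x*\<theta> j x) + dual_quotient b k ?\<psi>"
     by (rule dual_quotient_add[where B = B]) (use \<phi>s b \<psi>c in \<open>auto intro!: continuous_on_mult \<phi>c \<theta>\<close>)
    moreover have "(%x. \<phi> x*\<theta> j x + ?\<psi> x) = \<phi>" by (simp add: fun_eq_iff algebra_simps)
    ultimately show ?thesis by simp
   qed
   have "\<bar>(\<Sum>k<N n. c n k*dual_quotient b k \<phi>) - (\<Sum>k<N n. c n k*dual_quotient b k ?\<psi>)\<bar> <= C*(1/2) ^ j" if n: "k0 <= n" for n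
   proof -
    have "(\<Sum>k<N n. c n k*dual_quotient b k \<phi>) - (\<Sum>k<N n. c n k*dual_quotient b k ?\<psi>) =
      (\<Sum>k<N n. c n k*dual_quotient b k (%x. \<phi> x*\<theta> j x))"
     unfolding sum_subtractf[symmetric] right_diff_distrib[symmetric] sp ..
    moreover have "\<bar>\<Sum>k<N n. c n k*dual_quotient b k (%x. \<phi> x*\<theta> j x)\<bar> <= C*(1/2) ^ j"
     by (rule convex_weights_bound[OF w[rule_format]]) (use k0 n in auto)
    ultimately show ?thesis by simp
   qed
   thus ?thesis by (intro LIMSEQ_le_const2[OF l]) blast
  qed
  have \<theta>m [measurable]: "\<theta> j \<in> borel_measurable borel" for j by (rule borel_measurable_continuous_onI[OF \<theta>(1)])
  have \<phi>m [measurable]: "\<phi> \<in> borel_measurable borel" by (rule borel_measurable_continuous_onI[OF \<phi>c])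
  have "AE x in lborel. summable (%j. \<bar>\<theta> j x\<bar>)"
   by (rule AE_summable_of_nn_integral[OF _ _ C]) (use \<theta>(2) \<theta>i in \<open>auto simp: abs_of_nonneg\<close>)
  hence \<theta>0: "AE x in lborel. (%j. \<theta> j x) \<longlonglongrightarrow> 0"
   by eventually_elim (use summable_LIMSEQ_zero tendsto_rabs_zero_iff in blast)
  have i\<phi>: "integrable lborel (%x. A*\<bar>indicator K x*G x\<bar>)"
   using loc K by (intro integrable_mult_right integrable_abs) blast
  have bd: "\<bar>\<phi> x*G x\<bar> <= A*\<bar>indicator K x*G x\<bar>" for x
   using mult_right_mono[OF A[of x] abs_ge_zero[of "G x"]] K(3)[of x] by (cases "x \<in> K") (auto simp: abs_mult)
  have "(%j. \<integral>x. (\<phi> x*(1 - \<theta> j x))*G x \<partial>lborel) \<longlonglongrightarrow> (LBINT x. \<phi> x*G x)"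
  proof (rule integral_dominated_convergence[OF _ _ i\<phi>])
   show "AE x in lborel. (%j. \<phi> x*(1 - \<theta> j x)*G x) \<longlonglongrightarrow> \<phi> x*G x" using \<theta>0
   proof eventually_elim
    case (elim x)
    have "(%j. \<phi> x*(1 - \<theta> j x)*G x) \<longlonglongrightarrow> \<phi> x*(1 - 0)*G x" by (intro tendsto_intros elim)
    thus ?case by simp
   qed
   fix j
   have "\<bar>\<phi> x*(1 - \<theta> j x)*G x\<bar> <= A*\<bar>indicator K x*G x\<bar>" for x
   proof -
    have "\<bar>1 - \<theta> j x\<bar> <= 1" using \<theta>(2)[of j x] by auto
    hence "\<bar>1 - \<theta> j x\<bar>*\<bar>\<phi> x*G x\<bar> <= 1*\<bar>\<phi> x*G x\<bar>" by (rule mult_right_mono) simp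
    thus ?thesis using bd[of x] by (simp add: abs_mult mult_ac)
   qed
   thus "AE x in lborel. norm (\<phi> x*(1 - \<theta> j x)*G x) <= A*\<bar>indicator K x*G x\<bar>" by (intro AE_I2) simp
  qed measurable
  from tendsto_rabs[OF tendsto_diff[OF tendsto_const[of L] this]]
  have l1: "(%j. \<bar>L - (LBINT x. (\<phi> x*(1 - \<theta> j x))*G x)\<bar>) \<longlonglongrightarrow> \<bar>L - (LBINT x. \<phi> x*G x)\<bar>" .
  have l2: "(%j. C*(1/2) ^ j) \<longlonglongrightarrow> C*0" by (intro tendsto_mult tendsto_const LIMSEQ_power_zero) simp
  have "\<bar>L - (LBINT x. \<phi> x*G x)\<bar> <= C*0" by (rule LIMSEQ_le[OF l1 l2]) (use est in blast)
  thus ?thesis by (simp add: L_def)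
 qed
 with ld show ?thesis by blast
qed

text \<open>The weak partial derivatives form a locally integrable field g, and the density |g| is
  the total variation. Its singular part is the zero measure, so the approximate continuity set,
  which is all of \<Omega> by continuity of V, is null for it.\<close>

lemma V_SBV_loc: "V \<in> SBV_loc \<Omega>"
proof -
 have "\<forall>b\<in>Basis. \<exists>G. local_density G &
  (\<forall>\<phi>. test_function \<Omega> \<phi> --> (LBINT x. V x*frechet_derivative \<phi> (at x) b) = - (LBINT x. \<phi> x*G x))"
  using weak_derivative by simp
 from bchoice[OF this] obtain G where h: "\<forall>b\<in>Basis. local_density (G b) &
  (\<forall>\<phi>. test_function \<Omega> \<phi> --> (LBINT x. V x*frechet_derivative \<phi> (at x) b) = - (LBINT x. \<phi> x*G b x))"
  by (elim exE)
 have Gm: "!!b. b \<in> Basis ==> G b \<in> borel_measurable borel" and G0: "!!b x. b \<in> Basis ==> x \<notin> \<Omega> ==> G b x = 0"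
  and loc: "!!b K. b \<in> Basis ==> compact K ==> K \<subseteq> \<Omega> ==> integrable lborel (%x. indicator K x*G b x)"
  and parts: "!!b \<phi>. b \<in> Basis ==> test_function \<Omega> \<phi> ==>
   (LBINT x. V x*frechet_derivative \<phi> (at x) b) = - (LBINT x. \<phi> x*G b x)"
  using h unfolding local_density_def by blast+
 define g :: "'a => 'a" where "g x = (\<Sum>b\<in>Basis. G b x *\<^sub>R b)" for x
 have gb: "g x \<bullet> b = G b x" if "b \<in> Basis" for x b using that by (simp add: g_def inner_sum_left_Basis)
 have gm [measurable]: "g \<in> borel_measurable borel"
  unfolding g_def[abs_def] by (intro borel_measurable_sum borel_measurable_scaleR Gm) auto
 have ngm [measurable]: "(%x. norm (g x)) \<in> borel_measurable borel" by measurable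
 have engm: "(%x. ennreal (norm (g x))) \<in> borel_measurable borel" by measurable
 obtain e0 :: 'a where e0: "e0 \<in> Basis" using nonempty_Basis by blast
 \<comment> \<open>Where g vanishes, any unit vector will do; e0 keeps the norm equal to 1
   everywhere.\<close>
 define \<sigma> where "\<sigma> x = (if g x = 0 then e0 else g x /\<^sub>R norm (g x))" for x
 have \<sigma>n: "norm (\<sigma> x) = 1" for x using e0 by (simp add: \<sigma>_def)
 have \<sigma>g: "norm (g x)*(\<sigma> x \<bullet> b) = g x \<bullet> b" for x b by (simp add: \<sigma>_def)
 have \<sigma>m [measurable]: "\<sigma> \<in> borel_measurable borel" unfolding \<sigma>_def[abs_def] by measurable
 let ?R = "restrict_space lborel \<Omega>"
 have O: "\<Omega> \<inter> space lborel \<in> sets lborel" using \<Omega> by simp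
 have sR: "sets ?R = sets (restrict_space borel \<Omega>)" by (rule sets_restrict_space_cong) simp
 have mR: "h \<in> borel_measurable ?R" if "h \<in> borel_measurable borel" for h :: "'a => 'b::topological_space"
  using that by (intro measurable_restrict_space1) simp
 define \<mu> where "\<mu> = density ?R (%x. ennreal (norm (g x)))"
 have s\<mu>: "sets \<mu> = sets ?R" by (simp add: \<mu>_def)
 define \<nu> where "\<nu> = density ?R (%x. 0)"
 have s\<nu>: "sets \<nu> = sets ?R" by (simp add: \<nu>_def)
 have \<nu>0: "emeasure \<nu> B = 0" if "B \<in> sets ?R" for B using that by (simp add: \<nu>_def emeasure_density)
 have fin: "emeasure \<mu> K < \<infinity>" if K: "compact K" "K \<subseteq> \<Omega>" for K
 proof -
  have Kb: "K \<in> sets borel" using K(1) by (simp add: borel_compact)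
  have KR: "K \<in> sets ?R" using Kb K(2) O by (auto simp: sets_restrict_space_iff)
  have "emeasure \<mu> K = (\<integral>\<^sup>+x. ennreal (norm (g x))*indicator K x \<partial>?R)"
   unfolding \<mu>_def by (rule emeasure_density[OF mR[OF engm] KR])
  also have "... = (\<integral>\<^sup>+x. ennreal (norm (g x))*indicator K x*indicator \<Omega> x \<partial>lborel)"
   by (rule nn_integral_restrict_space[OF O])
  also have "... <= (\<integral>\<^sup>+x. ennreal (\<Sum>b\<in>Basis. \<bar>indicator K x*G b x\<bar>) \<partial>lborel)"
  proof (rule nn_integral_mono)
   fix x
   have "norm (g x) <= (\<Sum>b\<in>Basis. \<bar>G b x\<bar>)"
    unfolding g_def by (rule order_trans[OF norm_sum]) (simp add: sum_mono)
   hence "indicator K x*norm (g x) <= indicator K x*(\<Sum>b\<in>Basis. \<bar>G b x\<bar>)" by (rule mult_left_mono) simp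
   also have "... = (\<Sum>b\<in>Basis. \<bar>indicator K x*G b x\<bar>)" by (simp add: sum_distrib_left abs_mult)
   finally have "ennreal (indicator K x*norm (g x)) <= ennreal (\<Sum>b\<in>Basis. \<bar>indicator K x*G b x\<bar>)" by (rule ennreal_leI)
   thus "ennreal (norm (g x))*indicator K x*indicator \<Omega> x <= ennreal (\<Sum>b\<in>Basis. \<bar>indicator K x*G b x\<bar>)"
    using K(2) by (cases "x \<in> K") auto
  qed
  also have "... = ennreal (LBINT x. (\<Sum>b\<in>Basis. \<bar>indicator K x*G b x\<bar>))"
   by (rule nn_integral_eq_integral) (auto intro!: Bochner_Integration.integrable_sum integrable_abs loc K sum_nonneg)
  also have "... < \<infinity>" by simp
  finally show ?thesis .
 qed
 have dd: "distributional_derivative \<Omega> V \<mu> \<sigma>" unfolding distributional_derivative_def radon_measure_on_def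
 proof (intro conjI allI impI)
  show "sets \<mu> = sets (restrict_space borel \<Omega>)" using s\<mu> sR by simp
  show "emeasure \<mu> K < \<infinity>" if "compact K & K \<subseteq> \<Omega>" for K using fin that by blast
  show "\<sigma> \<in> borel_measurable \<mu>" using mR[OF \<sigma>m] unfolding \<mu>_def by simp
  show "AE x in \<mu>. norm (\<sigma> x) = 1" by (simp add: \<sigma>n)
  fix \<phi> :: "'a => real" and b :: 'a assume "test_function \<Omega> \<phi> & b \<in> Basis"
  hence \<phi>t: "test_function \<Omega> \<phi>" and b: "b \<in> Basis" by auto
  obtain A \<Lambda> B K where K: "compact K" "K \<subseteq> \<Omega>" "!!x. x \<notin> K ==> \<phi> x = 0" and \<phi>c: "continuous_on UNIV \<phi>"
   and dz: "!!x b. x \<notin> K ==> frechet_derivative \<phi> (at x) b = 0"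
   and dc: "!!b. b \<in> Basis ==> continuous_on UNIV (%x. frechet_derivative \<phi> (at x) b)"
   by (rule test_function_facts[OF \<phi>t]) blast
  have \<phi>m: "\<phi> \<in> borel_measurable borel" by (rule borel_measurable_continuous_onI[OF \<phi>c])
  have m: "(%x. V x*frechet_derivative \<phi> (at x) b) \<in> borel_measurable lborel"
   using borel_measurable_continuous_onI[OF continuous_on_mult[OF V dc[OF b]]] by simp
  have "(LINT x:\<Omega>|lebesgue. V x*frechet_derivative \<phi> (at x) b) = (\<integral>x. V x*frechet_derivative \<phi> (at x) b \<partial>lebesgue)"
   unfolding set_lebesgue_integral_def
   by (rule Bochner_Integration.integral_cong) (use dz K(2) in \<open>auto simp: indicator_def\<close>)
  also have "... = (LBINT x. V x*frechet_derivative \<phi> (at x) b)" by (rule integral_completion[OF m])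
  also have "... = - (LBINT x. \<phi> x*G b x)" by (rule parts[OF b \<phi>t])
  also have "(LBINT x. \<phi> x*G b x) = (LBINT x. indicator \<Omega> x *\<^sub>R (norm (g x) *\<^sub>R (\<phi> x*(\<sigma> x \<bullet> b))))"
  proof (rule Bochner_Integration.integral_cong[OF refl])
   fix x
   have "norm (g x)*(\<phi> x*(\<sigma> x \<bullet> b)) = \<phi> x*G b x" using \<sigma>g[of x b] gb[OF b, of x] by (simp add: mult.left_commute)
   thus "\<phi> x*G b x = indicator \<Omega> x *\<^sub>R (norm (g x) *\<^sub>R (\<phi> x*(\<sigma> x \<bullet> b)))"
    using G0[OF b, of x] by (cases "x \<in> \<Omega>") auto
  qed
  also have "... = (\<integral>x. norm (g x) *\<^sub>R (\<phi> x*(\<sigma> x \<bullet> b)) \<partial>?R)" by (rule integral_restrict_space[OF O, symmetric])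
  also have "... = (\<integral>x. \<phi> x*(\<sigma> x \<bullet> b) \<partial>\<mu>)" unfolding \<mu>_def
   by (rule integral_density[symmetric]) (auto intro!: mR borel_measurable_times borel_measurable_inner ngm \<sigma>m \<phi>m)
  finally show "(LINT x:\<Omega>|lebesgue. V x*frechet_derivative \<phi> (at x) b) = - (\<integral>x. \<phi> x*(\<sigma> x \<bullet> b) \<partial>\<mu>)" .
 qed
 have vi: "V absolutely_integrable_on K" if "compact K" for K
 proof -
  have i: "integrable lborel (%x. indicator K x *\<^sub>R V x)" by (rule borel_integrable_compact[OF that continuous_on_subset[OF V]]) simp
  have "integrable lebesgue (%x. indicator K x *\<^sub>R V x)"
   using integrable_completion[of "%x. indicator K x *\<^sub>R V x" lborel] i borel_measurable_integrable[OF i] by blast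
  thus ?thesis by (simp add: set_integrable_def)
 qed
 have ld: "lebesgue_decomposition \<Omega> \<mu> \<mu> \<nu>" unfolding lebesgue_decomposition_def
 proof (intro conjI ballI bexI[of _ "{}"])
  show "absolutely_continuous ?R \<mu>" unfolding \<mu>_def by (rule absolutely_continuousI_density[OF mR[OF engm]])
  show "emeasure \<nu> (\<Omega> - {}) = 0" by (rule \<nu>0) (use \<Omega> in \<open>simp add: sets_restrict_space_iff[OF O]\<close>)
 qed (use s\<mu> s\<nu> \<nu>0 in auto)
 have ac: "approx_continuity_set \<Omega> V = \<Omega>"
 proof -
  have "((%\<rho>. (LINT y:ball x \<rho>|lebesgue. \<bar>V y - V x\<bar>)/measure lebesgue (ball x \<rho>)) \<longlongrightarrow> 0) (at_right 0)" for x
  proof (rule tendstoI)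
   fix e :: real assume e: "0 < e"
   have "isCont V x" using V by (simp add: continuous_on_eq_continuous_at)
   then obtain d where d: "0 < d" "!!y. dist y x < d ==> dist (V y) (V x) < e/2"
    using e unfolding continuous_at_eps_delta by (meson half_gt_zero)
   have "dist ((LINT y:ball x \<rho>|lebesgue. \<bar>V y - V x\<bar>)/measure lebesgue (ball x \<rho>)) 0 < e" if \<rho>: "0 < \<rho>" "\<rho> < d" for \<rho>
   proof -
    have mp: "0 < measure lebesgue (ball x \<rho>)" using content_ball_pos[OF \<rho>(1), of x] by (simp add: measure_completion)
    have bi: "integrable lebesgue (%y. indicator (ball x \<rho>) y *\<^sub>R (e/2))"
     using lmeasurable_ball[of x \<rho>] by (intro integrable_scaleR_left integrable_real_indicator) (auto simp: fmeasurable_def)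
    have "(LINT y:ball x \<rho>|lebesgue. \<bar>V y - V x\<bar>) <= (\<integral>y. indicator (ball x \<rho>) y *\<^sub>R (e/2) \<partial>lebesgue)"
     unfolding set_lebesgue_integral_def
    proof (rule Bochner_Integration.integral_mono_AE'[OF bi]; intro AE_I2)
     fix y
     show "indicator (ball x \<rho>) y *\<^sub>R \<bar>V y - V x\<bar> <= indicator (ball x \<rho>) y *\<^sub>R (e/2)"
      using d(2)[of y] \<rho> by (auto simp: indicator_def dist_commute[of y x] dist_real_def)
     show "0 <= indicator (ball x \<rho>) y *\<^sub>R (e/2)" using e by simp
    qed
    also have "... = e/2*measure lebesgue (ball x \<rho>)" by simp
    finally have "(LINT y:ball x \<rho>|lebesgue. \<bar>V y - V x\<bar>)/measure lebesgue (ball x \<rho>) <= e/2"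
     unfolding pos_divide_le_eq[OF mp] .
    moreover have "0 <= (LINT y:ball x \<rho>|lebesgue. \<bar>V y - V x\<bar>)"
     unfolding set_lebesgue_integral_def by (rule Bochner_Integration.integral_nonneg) simp
    hence "0 <= (LINT y:ball x \<rho>|lebesgue. \<bar>V y - V x\<bar>)/measure lebesgue (ball x \<rho>)" using mp by (intro divide_nonneg_pos)
    moreover have "e/2 < e" using e by simp
    ultimately show ?thesis unfolding dist_real_def diff_zero by (simp only: abs_of_nonneg le_less_trans)
   qed
   thus "\<forall>\<^sub>F \<rho> in at_right 0. dist ((LINT y:ball x \<rho>|lebesgue. \<bar>V y - V x\<bar>)/measure lebesgue (ball x \<rho>)) 0 < e"
    unfolding eventually_at_right_field using d(1) by blast
  qed
  thus ?thesis unfolding approx_continuity_set_def by blast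
 qed
 have "\<Omega> \<in> null_sets \<nu>"
 proof (rule null_setsI)
  have "\<Omega> \<in> sets ?R" using \<Omega> by (simp add: sets_restrict_space_iff[OF O])
  thus "\<Omega> \<in> sets \<nu>" "emeasure \<nu> \<Omega> = 0" using s\<nu> \<nu>0 by auto
 qed
 hence n: "approx_continuity_set \<Omega> V \<in> null_sets \<nu>" unfolding ac .
 have BV: "V \<in> BV_loc \<Omega>" unfolding BV_loc_def using vi dd by blast
 show ?thesis unfolding SBV_loc_def mem_Collect_eq
  by (rule conjI[OF BV], rule exI[of _ \<mu>], rule exI[of _ \<sigma>], rule exI[of _ \<mu>], rule exI[of _ \<nu>], intro conjI) (rule dd ld n)+
qed

end

context smooth_exit_problem
begin

text \<open>The two halves meet: \<open>singular_set_small\<close> gives the size of the singular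
  set, and \<open>half_space_growth\<close> gives the cones for the difference quotients.\<close>

lemma value_function_SBV_loc:
 assumes n: "!!x. x \<in> reachable_boundary1 U f S ==> n x \<in> proximal_normals (closure (- S)) x & norm (n x) = 1"
  and Z: "Z = {x \<in> reachable_boundary1 U f S. hh x (n x) = 0}"
  and rect: "countably_rectifiable (DIM('a) - 2) Z" and lip: "locally_lipschitz_on Z n"
 shows "V \<in> SBV_loc (- S)"
proof -
 interpret small_singular_set V "- S"
 proof
  show "continuous_on UNIV V" by (rule V_continuous)
  show "open (- S)" using S by (simp add: open_Compl)
  have "singular_set = {x \<in> - S. \<forall>e>0. \<forall>C. \<not> C-lipschitz_on (ball x e) V}" by (simp add: singular_set_def)
  with singular_set_small[OF n Z rect lip]
  show "small_set (DIM('a) - 1) {x \<in> - S. \<forall>e>0. \<forall>C. \<not> C-lipschitz_on (ball x e) V}" by simp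
 next
  fix z assume "z \<in> - S"
  then obtain e where e: "0 < e" "e <= 1" "cball z e \<inter> S = {}" using compact_ball_outside[of z] by blast
  obtain C M dlt where C: "0 <= C" "0 <= M" "0 < dlt" and hs: "\<forall>x0\<in>cball z e. \<exists>\<zeta>. norm \<zeta> = 1 &
   (\<forall>x. x \<notin> S & norm (x - x0) < dlt & C*(norm (x - x0))^2 < \<zeta> \<bullet> (x - x0) --> V x <= V x0 + M*norm (x - x0))"
   using half_space_growth[OF compact_cball e(3) continuous_on_subset[OF V_continuous]] by auto
  \<comment> \<open>Points of \<open>cball z (2*R)\<close> are at most 4 R apart. As C times 4 R is
    at most 1/2, the quadratic error of the half space growth is below half the distance there,
    which leaves a cone.\<close>
  define R where "R = min (e/2) (min (dlt/8) (1/(8*(C + 1))))"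
  have R: "0 < R" "2*R <= e" "4*R < dlt" "R <= 1/(8*(C + 1))" using e C by (auto simp: R_def min_def)
  have "C*(4*R) <= (C + 1)*(4*(1/(8*(C + 1))))" using C R by (intro mult_mono) auto
  also have "... = 1/2" using C by (simp add: field_simps)
  finally have CR: "C*(4*R) <= 1/2" .
  have "\<exists>\<zeta>. norm \<zeta> = 1 & (\<forall>x\<in>cball z (2*R). norm (x - p)/2 < \<zeta> \<bullet> (x - p) --> V x <= V p + M*norm (x - p))"
   if p: "p \<in> cball z (2*R)" for p
  proof -
   have "p \<in> cball z e" using p R by auto
   then obtain \<zeta> where \<zeta>: "norm \<zeta> = 1" and hz: "!!x. x \<notin> S ==> norm (x - p) < dlt ==> C*(norm (x - p))^2 < \<zeta> \<bullet> (x - p) ==> V x <= V p + M*norm (x - p)"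
    using hs by blast
   have "V x <= V p + M*norm (x - p)" if x: "x \<in> cball z (2*R)" "norm (x - p)/2 < \<zeta> \<bullet> (x - p)" for x
   proof (rule hz)
    have "x \<in> cball z e" using x(1) R(2) by auto
    thus "x \<notin> S" using e(3) by blast
    have xp: "norm (x - p) <= 4*R" using x(1) p dist_triangle3[of x p z] by (auto simp: dist_norm)
    thus "norm (x - p) < dlt" using R by linarith
    have "C*(norm (x - p))^2 <= C*(4*R)*norm (x - p)"
     using C(1) mult_right_mono[OF xp norm_ge_zero] unfolding power2_eq_square mult.assoc[of C] by (intro mult_left_mono)
    also have "... <= 1/2*norm (x - p)" using CR by (intro mult_right_mono) auto
    finally show "C*(norm (x - p))^2 < \<zeta> \<bullet> (x - p)" using x(2) by simp
   qed
   with \<zeta> show ?thesis by blast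
  qed
  from cone_monotone_difference_quotients[OF V_continuous R(1) C(2) this]
  show "\<exists>R>0. \<exists>C. \<forall>h b. 0 < h & h < R & norm b <= 1 -->
   (LBINT x. indicator (ball z (R/2)) x*\<bar>V (x + h *\<^sub>R b) - V x\<bar>) <= C*h" using R(1) by blast
 qed
 show ?thesis by (rule V_SBV_loc)
qed

end

theorem corollary5p3:
  fixes U :: "(real ^ 'm) set"
    and S Nbd :: "(real ^ 'd) set"
    and f :: "real ^ 'd \<Rightarrow> real ^ 'm \<Rightarrow> real ^ 'd"
    and Df :: "real ^ 'd \<Rightarrow> real ^ 'm \<Rightarrow> (real ^ 'd) \<Rightarrow>\<^sub>L (real ^ 'd)"
    and r :: "real ^ 'd \<Rightarrow> real ^ 'm \<Rightarrow> real"
    and Dr :: "real ^ 'd \<Rightarrow> real ^ 'm \<Rightarrow> real ^ 'd"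
    and g V :: "real ^ 'd \<Rightarrow> real"
    and n :: "real ^ 'd \<Rightarrow> real ^ 'd"
    and N L r0 \<rho>0 G :: real
  assumes U: "compact U" "U \<noteq> {}"
    and S: "closed S" "S \<noteq> {}"
    and constants: "N > 0" "L > 0" "r0 > 0" "\<rho>0 > 0"
    and convexity: "\<And>x. convex {(v, l). \<exists>\<omega>\<in>U. v = f x \<omega> \<and> l \<ge> r x \<omega>}"
    and dynamics:
      "continuous_on (UNIV \<times> U) (\<lambda>(x, \<omega>). f x \<omega>)"
      "\<And>x \<omega>. \<omega> \<in> U \<Longrightarrow> norm (f x \<omega>) < N"
      "\<And>x \<omega>. \<omega> \<in> U \<Longrightarrow> ((\<lambda>y. f y \<omega>) has_derivative blinfun_apply (Df x \<omega>)) (at x)"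
      "continuous_on (UNIV \<times> U) (\<lambda>(x, \<omega>). Df x \<omega>)"
      "\<And>x y \<omega>. \<omega> \<in> U \<Longrightarrow> norm (f y \<omega> - f x \<omega>) \<le> L * norm (y - x)"
      "\<And>x y \<omega>. \<omega> \<in> U \<Longrightarrow> norm (Df y \<omega> - Df x \<omega>) \<le> L * norm (y - x)"
    and running_cost:
      "continuous_on (UNIV \<times> U) (\<lambda>(x, \<omega>). r x \<omega>)"
      "\<And>x \<omega>. \<omega> \<in> U \<Longrightarrow> GDERIV (\<lambda>y. r y \<omega>) x :> Dr x \<omega>"
      "continuous_on (UNIV \<times> U) (\<lambda>(x, \<omega>). Dr x \<omega>)"
      "\<And>x y \<omega>. \<omega> \<in> U \<Longrightarrow>
         \<bar>r y \<omega> - r x \<omega>\<bar> + norm (Dr y \<omega> - Dr x \<omega>) \<le> L * norm (y - x)"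
      "\<And>x \<omega>. \<omega> \<in> U \<Longrightarrow> r x \<omega> \<ge> r0"
    and terminal_cost:
      "open Nbd" "frontier S \<subseteq> Nbd" "0 \<le> G" "G < r0 / N"
      "\<And>x y. x \<in> Nbd \<Longrightarrow> y \<in> Nbd \<Longrightarrow> \<bar>g y - g x\<bar> \<le> G * norm (y - x)"
    and inner_ball:
      "\<And>x. x \<in> frontier S \<Longrightarrow>
         \<exists>\<xi>\<in>proximal_normals (closure (- S)) x. norm \<xi> = 1 \<and>
           (\<forall>y\<in>closure (- S). \<xi> \<bullet> (y - x) \<le> 1 / (2 * \<rho>0) * (norm (y - x))\<^sup>2)"
    and semiconcave: "locally_semiconcave g"
    and V_value: "\<And>x. value_function U f r g S x = ereal (V x)"
    and V_continuous: "continuous_on UNIV V"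
    and H0_C11: "C11_on (UNIV \<times> - {0}) (\<lambda>(x, p). H0 U f x p)"
    and normal:
      "\<And>x. x \<in> reachable_boundary1 U f S \<Longrightarrow>
         n x \<in> proximal_normals (closure (- S)) x \<and> norm (n x) = 1"
    and rectifiable:
      "countably_rectifiable (CARD('d) - 2)
         {x \<in> reachable_boundary1 U f S. (SUP \<omega>\<in>U. n x \<bullet> f x \<omega>) = 0}"
    and normal_lipschitz:
      "locally_lipschitz_on {x \<in> reachable_boundary1 U f S. (SUP \<omega>\<in>U. n x \<bullet> f x \<omega>) = 0} n"
  shows "V \<in> SBV_loc (- S)"
proof -
  interpret smooth_exit_problem U S Nbd f Df r g V N L r0 \<rho>0 G
  proof
    show "norm (f x \<omega>) \<le> N" if "\<omega> \<in> U" for x \<omega> using dynamics(2)[OF that, of x] by simp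
    show "\<bar>r y \<omega> - r x \<omega>\<bar> \<le> L * norm (y - x)" if "\<omega> \<in> U" for x y \<omega>
      using running_cost(4)[OF that, of y x] norm_ge_zero[of "Dr y \<omega> - Dr x \<omega>"] by linarith
    show "G * N < r0" using terminal_cost(4) constants(1) by (simp add: pos_less_divide_eq)
    show "\<exists>\<xi>. norm \<xi> = 1 \<and> (\<forall>y\<in>closure (- S). \<xi> \<bullet> (y - x) \<le> 1 / (2 * \<rho>0) * (norm (y - x))\<^sup>2)" if "x \<in> frontier S" for x
      using inner_ball[OF that] by blast
  qed (fact U S constants dynamics running_cost terminal_cost V_value V_continuous H0_C11)+
  show ?thesis
  proof (rule value_function_SBV_loc)
    show "countably_rectifiable (DIM(real ^ 'd) - 2) {x \<in> reachable_boundary1 U f S. (SUP \<omega>\<in>U. n x \<bullet> f x \<omega>) = 0}"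
      using rectifiable by simp
  qed (fact normal normal_lipschitz | simp add: hh_def)+
qed

end
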